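(* Let $0<s<1$, let $\Omega:S^1\to\mathbb{R}$ be smooth, strictly positive, with $\Omega(\theta+\pi)=\Omega(\theta)$, and let $W(\mathbf{x})=|\mathbf{x}|^{-s}\Omega(\theta)+|\mathbf{x}|^2$ on $\mathbb{R}^2$ with associated energy $E$. Let $\tilde\Omega$ be the angular part of the Fourier transform of $|\mathbf{x}|^{-s}\Omega(\theta)$ (defined in the context), and assume $\tilde\Omega\ge 0$. Then exactly one of the following holds (up to translation): \begin{itemize} \item[1.] There exists a unique tuple $(a,b,\eta)\in(0,\infty)^2\times[0,\pi/2)$ such that $\rho_{a,b,\eta}$ is the unique minimizer of $E$. \item[2.] There exists a unique pair $(b,\eta)\in(0,\infty)\times[0,\pi)$ such that $\rho_{0,b,\eta}$ is the unique minimizer of $E$. \end{itemize} If $\tilde\Omega\ge c$ for some constant $c>0$, then item 1 must happen.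
   Context: $S^1=[-\pi,\pi)$ is the set of angles (mod $2\pi$); $\theta$ is the angle of $\mathbf{x}\in\mathbb{R}^2\setminus\{0\}$, i.e. $\mathbf{x}/|\mathbf{x}|=(\cos\theta,\sin\theta)$. The energy is $E[\rho]=\frac12\int_{\mathbb{R}^2}\int_{\mathbb{R}^2}W(\mathbf{x}-\mathbf{y})\rho(\mathbf{y})\,\mathrm{d}\mathbf{y}\,\rho(\mathbf{x})\,\mathrm{d}\mathbf{x}$ for probability measures $\rho$ on $\mathbb{R}^2$; minimizers are global minimizers among probability measures. The Fourier transform is $\mathcal{F}[f](\xi)=\int_{\mathbb{R}^2}f(\mathbf{x})e^{-2\pi i\mathbf{x}\cdot\xi}\,\mathrm{d}\mathbf{x}$ (extended to tempered distributions). Writing $\xi=|\xi|(\cos\varphi,\sin\varphi)$, $\tilde\Omega$ is defined by $\mathcal{F}[|\mathbf{x}|^{-s}\Omega(\theta)](\xi)=|\xi|^{-2+s}\tilde\Omega(\varphi)$; explicitly, $$\tilde\Omega(\varphi)=\tau_{2-s}\int_{-\pi}^{\pi}|\cos(\varphi-\theta)|^{-2+s}\Big(\Omega(\theta)-\Omega(\varphi+\tfrac{\pi}{2})\Big)\mathrm{d}\theta+c_s\,\Omega(\varphi+\tfrac{\pi}{2}),$$ with $\tau_r=(2\pi)^{-r}\Gamma(r)\cos\frac{r\pi}{2}$ and $c_s=\pi^{s-1}\frac{\Gamma((2-s)/2)}{\Gamma(s/2)}$. Let $\rho_2(\mathbf{x})=C_2(R_2^2-|\mathbf{x}|^2)_+^{s/2}$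 with $R_2=\Big(\frac{8\sin\frac{s\pi}{2}}{s^2(2+s)\pi}\Big)^{-\frac{1}{s+2}}$, $C_2=\frac{4\sin\frac{s\pi}{2}}{s^2\pi^2}$ (a probability density). With $\mathcal{R}_\theta=\begin{pmatrix}\cos\theta&-\sin\theta\\ \sin\theta&\cos\theta\end{pmatrix}$, for $a,b>0$, $\eta\in\mathbb{R}$ set $$\rho_{a,b}(\mathbf{x})=\frac{1}{ab}\rho_2\Big(\frac{x_1}{a},\frac{x_2}{b}\Big),\qquad \rho_{a,b,\eta}(\mathbf{x})=\rho_{a,b}(\mathcal{R}_{-\eta}\mathbf{x}),$$ and let $\rho_{0,b}$, $\rho_{0,b,\eta}$ be the weak limits of $\rho_{a,b}$, $\rho_{a,b,\eta}$ as $a\to0^+$.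
   Formalization: In item 1 the tuple is normalized by η = 0 when a = b: for a radial minimizer (e.g. Ω constant) ρ_{a,a,η} does not depend on η, so no tuple (a,b,η) is unique as printed and neither item would hold. *)

theory Defs
  imports "HOL-Probability.Probability"
begin

text \<open>A function on the circle is a \<open>2\<pi>\<close>-periodic function of a real variable. Such functions do
  not distinguish the representatives \<open>[-\<pi>,\<pi>)\<close> of the circle from \<open>(-\<pi>,\<pi>]\<close>, the range of
  \<^const>\<open>Arg\<close>.\<close>

definition polar_angle :: "real^2 \<Rightarrow> real" where
  "polar_angle x = Arg (Complex (x $ 1) (x $ 2))"

definition smooth :: "(real \<Rightarrow> real) \<Rightarrow> bool" where
  "smooth f \<longleftrightarrow> (\<forall>n x. ((deriv ^^ n) f) differentiable (at x))"

definition homogeneous_kernel :: "real \<Rightarrow> (real \<Rightarrow> real) \<Rightarrow> real^2 \<Rightarrow> real" where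
  "homogeneous_kernel r \<Omega> x = norm x powr r * \<Omega> (polar_angle x)"


section \<open>Fourier transform\<close>

definition partial_deriv :: "2 \<Rightarrow> (real^2 \<Rightarrow> complex) \<Rightarrow> real^2 \<Rightarrow> complex" where
  "partial_deriv i f x = vector_derivative (\<lambda>t. f (x + t *\<^sub>R axis i 1)) (at 0)"

text \<open>The list \<open>is\<close> runs through all iterated partial derivatives. Requiring each of them to be
  Frechet differentiable is smoothness.\<close>

definition schwartz :: "(real^2 \<Rightarrow> complex) \<Rightarrow> bool" where
  "schwartz f \<longleftrightarrow>
     (\<forall>is. (\<forall>x. foldr partial_deriv is f differentiable (at x)) \<and>
           (\<forall>k::nat. \<exists>C. \<forall>x. norm x ^ k * norm (foldr partial_deriv is f x) \<le> C))"

definition fourier :: "(real^2 \<Rightarrow> complex) \<Rightarrow> real^2 \<Rightarrow> complex" where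
  "fourier f \<xi> = (LINT x|lborel. f x * exp (- 2 * of_real pi * \<i> * of_real (x \<bullet> \<xi>)))"

text \<open>\<open>\<F>[T] = S\<close> in the sense of tempered distributions, i.e. \<open>\<langle>T, \<F>[\<psi>]\<rangle> = \<langle>S, \<psi>\<rangle>\<close> for every
  Schwartz function \<open>\<psi>\<close>. This is meant for functions \<open>T\<close>, \<open>S\<close> that are integrable against all
  Schwartz functions.\<close>

definition has_tempered_fourier :: "(real^2 \<Rightarrow> real) \<Rightarrow> (real^2 \<Rightarrow> real) \<Rightarrow> bool" where
  "has_tempered_fourier T S \<longleftrightarrow>
     (\<forall>\<psi>. schwartz \<psi> \<longrightarrow>
        (LINT x|lborel. of_real (T x) * fourier \<psi> x) = (LINT \<xi>|lborel. of_real (S \<xi>) * \<psi> \<xi>))"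

text \<open>\<open>\<Omega>t\<close> is the angular part of the Fourier transform of \<open>|x|\<^sup>-\<^sup>s \<Omega>(\<theta>)\<close>. Both sides are
  locally integrable of homogeneity larger than \<open>-2\<close> when \<open>0 < s < 2\<close>. The distributional identity
  determines \<open>\<Omega>t\<close> only almost everywhere; continuity makes it unique.\<close>

definition angular_fourier :: "real \<Rightarrow> (real \<Rightarrow> real) \<Rightarrow> (real \<Rightarrow> real) \<Rightarrow> bool" where
  "angular_fourier s \<Omega> \<Omega>t \<longleftrightarrow>
     continuous_on UNIV \<Omega>t \<and> (\<forall>\<phi>. \<Omega>t (\<phi> + 2 * pi) = \<Omega>t \<phi>) \<and>
     has_tempered_fourier (homogeneous_kernel (- s) \<Omega>) (homogeneous_kernel (- 2 + s) \<Omega>t)"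


section \<open>Energy and minimizers\<close>

text \<open>The potential is \<open>+\<infinity>\<close> at the origin, so measures with atoms have infinite energy. (In HOL,
  \<open>0 powr (- s) = 0\<close>.)\<close>

definition potential :: "real \<Rightarrow> (real \<Rightarrow> real) \<Rightarrow> real^2 \<Rightarrow> ennreal" where
  "potential s \<Omega> x =
     (if x = 0 then \<infinity> else ennreal (homogeneous_kernel (- s) \<Omega> x + (norm x)\<^sup>2))"

definition energy :: "(real^2 \<Rightarrow> ennreal) \<Rightarrow> (real^2) measure \<Rightarrow> ennreal" where
  "energy W \<mu> = (\<integral>\<^sup>+ x. (\<integral>\<^sup>+ y. W (x - y) \<partial>\<mu>) \<partial>\<mu>) / 2"

definition prob_measures :: "(real^2) measure set" where
  "prob_measures = {\<mu>. prob_space \<mu> \<and> sets \<mu> = sets borel}"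

definition minimizer :: "((real^2) measure \<Rightarrow> ennreal) \<Rightarrow> (real^2) measure \<Rightarrow> bool" where
  "minimizer E \<mu> \<longleftrightarrow> \<mu> \<in> prob_measures \<and> (\<forall>\<nu>\<in>prob_measures. E \<mu> \<le> E \<nu>)"

text \<open>The energy is translation invariant, so uniqueness is uniqueness up to translation.\<close>

definition unique_minimizer :: "((real^2) measure \<Rightarrow> ennreal) \<Rightarrow> (real^2) measure \<Rightarrow> bool" where
  "unique_minimizer E \<mu> \<longleftrightarrow>
     minimizer E \<mu> \<and> (\<forall>\<nu>. minimizer E \<nu> \<longrightarrow> (\<exists>v. \<nu> = distr \<mu> borel (\<lambda>x. x + v)))"


section \<open>The candidate minimizers\<close>

definition R2 :: "real \<Rightarrow> real" where
  "R2 s = (8 * sin (s * pi / 2) / (s\<^sup>2 * (2 + s) * pi)) powr (- 1 / (s + 2))"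

definition C2 :: "real \<Rightarrow> real" where
  "C2 s = 4 * sin (s * pi / 2) / (s\<^sup>2 * pi\<^sup>2)"

definition rho2 :: "real \<Rightarrow> real^2 \<Rightarrow> real" where
  "rho2 s x = C2 s * max 0 ((R2 s)\<^sup>2 - (norm x)\<^sup>2) powr (s / 2)"

definition rotation :: "real \<Rightarrow> real^2^2" where
  "rotation \<theta> = vector [vector [cos \<theta>, - sin \<theta>], vector [sin \<theta>, cos \<theta>]]"

definition rho_ab :: "real \<Rightarrow> real \<Rightarrow> real \<Rightarrow> real^2 \<Rightarrow> real" where
  "rho_ab s a b x = 1 / (a * b) * rho2 s (vector [x $ 1 / a, x $ 2 / b])"

text \<open>For \<open>a = b\<close> the density is rotation invariant, so it does not determine \<open>\<eta>\<close>; statements about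
  uniqueness of \<open>(a, b, \<eta>)\<close> have to fix a value of \<open>\<eta>\<close> (here \<open>0\<close>) in that case.\<close>

definition ellipse_measure :: "real \<Rightarrow> real \<Rightarrow> real \<Rightarrow> real \<Rightarrow> (real^2) measure" where
  "ellipse_measure s a b \<eta> = density lborel (\<lambda>x. ennreal (rho_ab s a b (rotation (- \<eta>) *v x)))"

definition weak_limit ::
    "(real \<Rightarrow> (real^2) measure) \<Rightarrow> (real^2) measure \<Rightarrow> real filter \<Rightarrow> bool" where
  "weak_limit \<rho> \<mu> F \<longleftrightarrow>
     (\<forall>f :: real^2 \<Rightarrow> real. continuous_on UNIV f \<and> bounded (range f) \<longrightarrow>
        ((\<lambda>a. LINT x|\<rho> a. f x) \<longlongrightarrow> (LINT x|\<mu>. f x)) F)"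

text \<open>The weak limit as \<open>a \<rightarrow> 0+\<close> exists, and it is unique because a finite Borel measure is
  determined by the integrals of the bounded continuous functions.\<close>

definition segment_measure :: "real \<Rightarrow> real \<Rightarrow> real \<Rightarrow> (real^2) measure" where
  "segment_measure s b \<eta> =
     (THE \<mu>. \<mu> \<in> prob_measures \<and> weak_limit (\<lambda>a. ellipse_measure s a b \<eta>) \<mu> (at_right 0))"

end

theory Submission
  imports Defs
begin

text \<open>The kernel \<open>|x|\<^sup>-\<^sup>s \<Omega>(\<theta>)\<close> has a nonnegative Fourier transform, homogeneous of degree \<open>-2 + s\<close>.
  Cutting the frequency plane into lines through the origin, and using that \<open>|u|\<^sup>s\<^sup>-\<^sup>1\<close> is up to a
  positive factor the Fourier transform of \<open>|t|\<^sup>-\<^sup>s\<close> on the line, the kernel becomes a positive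
  superposition of one-dimensional Riesz kernels: \<open>|x|\<^sup>-\<^sup>s \<Omega>(\<theta>) = \<integral> w(v) |x\<^sub>1 + v x\<^sub>2|\<^sup>-\<^sup>s dv\<close> with
  \<open>w \<ge> 0\<close> built from \<open>\<Omega>t\<close> (\<open>kernel_eq_slope_mixture\<close>). So the energy of a measure is an average
  over \<open>v\<close> of the Riesz energies of its one-dimensional projections, plus a confinement term
  which for a centred measure is its second moment.

  On the line, among all laws with a given second moment, the Riesz energy is minimal exactly for
  the dilates of the density \<open>(1 - y\<^sup>2)\<^sup>(\<^sup>1\<^sup>+\<^sup>s\<^sup>)\<^sup>/\<^sup>2\<close> (\<open>riesz_energy_ge_second_moment\<close>). The reason is
  that the potential of this density is a quadratic polynomial on its support and lies at or
  above that polynomial elsewhere (\<open>profile_potential_quadratic\<close>), while the Riesz kernel is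
  positive definite (\<open>riesz_polarization\<close>). Hence the energy of a centred measure with second
  moment matrix \<open>M\<close> is at least a function \<open>reduced_energy M\<close>, and equality forces almost every
  projection charged by \<open>w\<close> to be such a dilate. The density \<open>\<rho>\<^sub>2\<close> is the rotation invariant one
  whose projections have this form, so its linear images, the ellipses and in the limit the
  segments, attain equality for every \<open>M \<noteq> 0\<close>.

  The problem is now finite dimensional. The reduced energy has exactly one minimizer \<open>M\<close> among
  the positive semidefinite matrices (\<open>exists_reduced_minimizer\<close>, \<open>reduced_minimizer_unique\<close>):
  existence is compactness and Fatou's lemma, uniqueness is strict convexity of \<open>x\<^sup>-\<^sup>s\<^sup>/\<^sup>2\<close>. It is
  not zero because the reduced energy of the zero matrix is infinite. If a measure has minimal
  energy, then after centring its projections agree with those of the ellipse or segment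
  belonging to \<open>M\<close> for infinitely many directions, and this determines a compactly supported
  measure (\<open>measure_eq_of_projections\<close>). Therefore an ellipse or segment is the unique minimizer
  up to translation if and only if its second moment matrix is \<open>M\<close>
  (\<open>unique_minimizer_iff_shape\<close>). The first alternative is \<open>det M \<noteq> 0\<close>, the second is
  \<open>det M = 0\<close>, and the parameters are recovered from the spectral decomposition of \<open>M\<close>.

  If \<open>\<Omega>t \<ge> c > 0\<close>, then \<open>w(v)\<close> is bounded below by a multiple of \<open>(1 + v\<^sup>2)\<^sup>(\<^sup>s\<^sup>-\<^sup>2\<^sup>)\<^sup>/\<^sup>2\<close>, and a singular
  \<open>M\<close> cannot be minimal: passing to \<open>M + \<epsilon> I\<close> costs \<open>2\<epsilon>\<close> of confinement but gains a multiple of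
  \<open>\<epsilon>\<^sup>(\<^sup>1\<^sup>-\<^sup>s\<^sup>)\<^sup>/\<^sup>2\<close> of interaction energy from the directions near the degenerate one
  (\<open>nondegenerate_of_lower_bound\<close>).\<close>

section \<open>Riesz kernel and Riesz energy on the line\<close>

text \<open>An inverse of an extended real, so that the value at \<open>0\<close> is \<open>\<infinity>\<close>; the real power \<open>0 powr (- s)\<close>
  is \<open>0\<close>.\<close>

definition riesz :: "real \<Rightarrow> real \<Rightarrow> ennreal" where
  "riesz s t = inverse (ennreal (\<bar>t\<bar> powr s))"

lemma riesz_nonzero: "t \<noteq> 0 \<Longrightarrow> riesz s t = ennreal (\<bar>t\<bar> powr (- s))"
  by (simp add: riesz_def inverse_ennreal powr_minus)

lemma riesz_0 [simp]: "riesz s 0 = \<infinity>"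
  by (simp add: riesz_def)

lemma riesz_minus [simp]: "riesz s (- t) = riesz s t"
  by (simp add: riesz_def)

lemma measurable_riesz [measurable]:
  assumes [measurable]: "f \<in> borel_measurable M"
  shows "(\<lambda>x. riesz s (f x)) \<in> borel_measurable M"
  unfolding riesz_def by measurable

lemma riesz_scale: "c > 0 \<Longrightarrow> riesz s (c * t) = ennreal (c powr (- s)) * riesz s t"
  by (cases "t = 0") (auto simp: riesz_nonzero abs_mult powr_mult ennreal_mult ennreal_mult_top)

lemma nn_integral_powr_tail:
  fixes a c :: real
  assumes "a > 0" "c > 0"
  shows "(\<integral>\<^sup>+x. ennreal (x powr (- a - 1)) * indicator {c..} x \<partial>lborel) = ennreal (c powr (- a) / a)"
proof -
  have "(\<integral>\<^sup>+x. ennreal (x powr (- a - 1)) * indicator {c..} x \<partial>lborel)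
      = ennreal (0 - (- (c powr (- a) / a)))"
  proof (rule nn_integral_FTC_atLeast)
    fix x assume "c \<le> x"
    show "((\<lambda>x. - (x powr (- a) / a)) has_real_derivative x powr (- a - 1)) (at x)"
      using \<open>c \<le> x\<close> assms by (auto intro!: derivative_eq_intros simp: field_simps)
  next
    have "((\<lambda>x. x powr (- a)) \<longlongrightarrow> 0) at_top"
      using assms(1) by (intro tendsto_neg_powr filterlim_ident) auto
    then have "((\<lambda>x. - (x powr (- a) / a)) \<longlongrightarrow> - (0 / a)) at_top"
      by (intro tendsto_intros) (use assms in auto)
    then show "((\<lambda>x. - (x powr (- a) / a)) \<longlongrightarrow> 0) at_top" by simp
  qed (use assms in auto)
  then show ?thesis by simp
qed

lemma nn_integral_powr_tail_0:
  fixes a :: real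
  assumes "a > 0"
  shows "(\<integral>\<^sup>+x. ennreal (x powr (- a - 1)) * indicator {0..} x \<partial>lborel) = \<infinity>"
proof -
  let ?I = "\<integral>\<^sup>+x. ennreal (x powr (- a - 1)) * indicator {0..} x \<partial>lborel"
  have *: "ennreal (c powr (- a) / a) \<le> ?I" if "c > 0" for c
    unfolding nn_integral_powr_tail[OF assms that, symmetric]
    by (intro nn_integral_mono) (use that in \<open>auto simp: indicator_def\<close>)
  show ?thesis
  proof (rule ccontr)
    assume "?I \<noteq> \<infinity>"
    then obtain K where K: "?I = ennreal K" "K \<ge> 0"
      by (cases ?I) (auto simp: top_unique)
    define c where "c = (a * (K + 1)) powr (- 1 / a)"
    have "c > 0" unfolding c_def using assms K by (auto)
    have "c powr (- a) = a * (K + 1)"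
      unfolding c_def using assms K by (simp add: powr_powr)
    with *[OF \<open>c > 0\<close>] K assms show False by (simp)
  qed
qed

lemma nn_integral_lborel_reflect:
  fixes f :: "real \<Rightarrow> ennreal"
  assumes [measurable]: "f \<in> borel_measurable borel"
  shows "(\<integral>\<^sup>+x. f (- x) \<partial>lborel) = (\<integral>\<^sup>+x. f x \<partial>lborel)"
  by (subst nn_integral_real_affine[where c = "- 1" and t = 0 and f = f]) auto

lemma nn_integral_lborel_shift:
  fixes f :: "real \<Rightarrow> ennreal"
  assumes [measurable]: "f \<in> borel_measurable borel"
  shows "(\<integral>\<^sup>+x. f (t + x) \<partial>lborel) = (\<integral>\<^sup>+x. f x \<partial>lborel)"
  by (subst nn_integral_real_affine[where c = 1 and t = t and f = f]) auto

text \<open>The intervals containing both \<open>x\<close> and \<open>y\<close> are those with left end at most the minimum and right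
  end at least the maximum, and integrating \<open>(q - p)\<^sup>-\<^sup>s\<^sup>-\<^sup>2\<close> over these ends gives back a power of
  the distance. The kernel is thus a positive mixture of products \<open>1\<^sub>I(x) 1\<^sub>I(y)\<close>, which shows
  that it is positive definite without any Fourier analysis.\<close>

lemma riesz_eq_interval_integral:
  fixes s x y :: real
  assumes "s > 0"
  shows "riesz s (x - y) = (\<integral>\<^sup>+p. \<integral>\<^sup>+q. ennreal (s * (s + 1) * (q - p) powr (- s - 2)) *
           (indicator {p..q} x * indicator {p..q} y) \<partial>lborel \<partial>lborel)"
proof -
  define m M where "m = min x y" and "M = max x y"
  have "m \<le> M" by (auto simp: m_def M_def)
  have inner: "(\<integral>\<^sup>+q. ennreal (s * (s + 1) * (q - p) powr (- s - 2)) *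
           (indicator {p..q} x * indicator {p..q} y) \<partial>lborel)
     = ennreal (s * (M - p) powr (- s - 1)) * indicator {..m} p" if "p \<noteq> M" for p
  proof (cases "p \<le> m")
    case True
    then have "p < M" using that \<open>m \<le> M\<close> by auto
    have "(\<integral>\<^sup>+q. ennreal (s * (s + 1) * (q - p) powr (- s - 2)) *
           (indicator {p..q} x * indicator {p..q} y) \<partial>lborel)
        = (\<integral>\<^sup>+q. ennreal (s * (s + 1)) * (ennreal ((q - p) powr (- (s + 1) - 1)) * indicator {M..} q) \<partial>lborel)"
      using True assms by (intro nn_integral_cong)
        (auto simp: indicator_def m_def M_def ennreal_mult'[symmetric] diff_diff_eq)
    also have "\<dots> = ennreal (s * (s + 1)) * (\<integral>\<^sup>+q. (ennreal ((q - p) powr (- (s + 1) - 1)) * indicator {M..} q) \<partial>lborel)"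
      by (rule nn_integral_cmult) measurable
    also have "(\<integral>\<^sup>+q. (ennreal ((q - p) powr (- (s + 1) - 1)) * indicator {M..} q) \<partial>lborel)
        = (\<integral>\<^sup>+q. (ennreal (((p + q) - p) powr (- (s + 1) - 1)) * indicator {M..} (p + q)) \<partial>lborel)"
      by (rule nn_integral_lborel_shift[symmetric]) measurable
    also have "\<dots> = (\<integral>\<^sup>+q. (ennreal (q powr (- (s + 1) - 1)) * indicator {M-p..} q) \<partial>lborel)"
      by (intro nn_integral_cong) (auto simp: indicator_def)
    also have "\<dots> = ennreal ((M - p) powr (- (s + 1)) / (s + 1))"
      using assms \<open>p < M\<close> by (intro nn_integral_powr_tail) auto
    finally show ?thesis
      using True assms by (simp add: ennreal_mult'[symmetric] diff_diff_eq)
  next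
    case False
    then have "(\<integral>\<^sup>+q. ennreal (s * (s + 1) * (q - p) powr (- s - 2)) *
           (indicator {p..q} x * indicator {p..q} y) \<partial>lborel) = (\<integral>\<^sup>+q. 0 \<partial>(lborel::real measure))"
      by (intro nn_integral_cong) (auto simp: indicator_def m_def)
    with False show ?thesis by simp
  qed
  have "(\<integral>\<^sup>+p. \<integral>\<^sup>+q. ennreal (s * (s + 1) * (q - p) powr (- s - 2)) *
           (indicator {p..q} x * indicator {p..q} y) \<partial>lborel \<partial>lborel)
      = (\<integral>\<^sup>+p. ennreal (s * (M - p) powr (- s - 1)) * indicator {..m} p \<partial>lborel)"
  proof (rule nn_integral_cong_AE)
    have "AE p in lborel. p \<noteq> M" by (rule AE_lborel_singleton)
    then show "AE p in lborel. (\<integral>\<^sup>+q. ennreal (s * (s + 1) * (q - p) powr (- s - 2)) *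
           (indicator {p..q} x * indicator {p..q} y) \<partial>lborel)
     = ennreal (s * (M - p) powr (- s - 1)) * indicator {..m} p"
      by eventually_elim (rule inner)
  qed
  also have "\<dots> = (\<integral>\<^sup>+p. ennreal s * (ennreal ((M - p) powr (- s - 1)) * indicator {..m} p) \<partial>lborel)"
    using assms by (intro nn_integral_cong) (auto simp: ennreal_mult' mult.assoc)
  also have "\<dots> = ennreal s * (\<integral>\<^sup>+p. (ennreal ((M - p) powr (- s - 1)) * indicator {..m} p) \<partial>lborel)"
    by (rule nn_integral_cmult) measurable
  also have "(\<integral>\<^sup>+p. (ennreal ((M - p) powr (- s - 1)) * indicator {..m} p) \<partial>lborel)
     = (\<integral>\<^sup>+p. (ennreal ((M - - p) powr (- s - 1)) * indicator {..m} (- p)) \<partial>lborel)"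
    by (rule nn_integral_lborel_reflect[symmetric]) measurable
  also have "\<dots> = (\<integral>\<^sup>+p. (ennreal ((M - - (- M + p)) powr (- s - 1)) * indicator {..m} (- (- M + p))) \<partial>lborel)"
    by (rule nn_integral_lborel_shift[symmetric]) measurable
  also have "\<dots> = (\<integral>\<^sup>+p. (ennreal (p powr (- s - 1)) * indicator {M-m..} p) \<partial>lborel)"
    by (intro nn_integral_cong) (auto simp: indicator_def)
  also have "ennreal s * \<dots> = riesz s (x - y)"
  proof (cases "m = M")
    case True
    then have "x = y" by (auto simp: m_def M_def min_def max_def split: if_splits)
    with True show ?thesis
      using assms by (simp add: nn_integral_powr_tail_0 ennreal_mult_top)
  next
    case False
    then have "x \<noteq> y" by (auto simp: m_def M_def)
    moreover have "M - m = \<bar>x - y\<bar>" by (auto simp: m_def M_def)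
    ultimately show ?thesis
      using assms by (simp add: nn_integral_powr_tail riesz_nonzero ennreal_mult'[symmetric])
  qed
  finally show ?thesis ..
qed

definition riesz_mutual :: "real \<Rightarrow> real measure \<Rightarrow> real measure \<Rightarrow> ennreal" where
  "riesz_mutual s \<mu> \<nu> = (\<integral>\<^sup>+x. \<integral>\<^sup>+y. riesz s (x - y) \<partial>\<nu> \<partial>\<mu>)"

abbreviation riesz_energy :: "real \<Rightarrow> real measure \<Rightarrow> ennreal" where
  "riesz_energy s \<mu> \<equiv> riesz_mutual s \<mu> \<mu>"

lemma measurable_emeasure_Icc [measurable]:
  assumes "sets \<mu> = sets borel" "finite_measure \<mu>"
    "f \<in> borel_measurable M" "g \<in> borel_measurable M"
  shows "(\<lambda>x. emeasure \<mu> {f x..g x :: real}) \<in> borel_measurable M"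
proof -
  interpret finite_measure \<mu> by fact
  note [measurable] = assms(3,4)
  have [measurable_cong]: "sets \<mu> = sets borel" by fact
  have "emeasure \<mu> {f x..g x} = (\<integral>\<^sup>+y. indicator {f x..g x} y \<partial>\<mu>)" for x
    by (subst nn_integral_indicator) (auto simp: assms)
  moreover have "(\<lambda>x. (\<integral>\<^sup>+y. indicator {f x..g x} y \<partial>\<mu>)) \<in> borel_measurable M"
    unfolding indicator_def atLeastAtMost_iff by measurable
  ultimately show ?thesis by simp
qed

lemma riesz_mutual_eq_interval_integral:
  assumes s: "s > 0"
    and \<mu>: "sets \<mu> = sets borel" "finite_measure \<mu>" and \<nu>: "sets \<nu> = sets borel" "finite_measure \<nu>"
  shows "riesz_mutual s \<mu> \<nu> = (\<integral>\<^sup>+p. \<integral>\<^sup>+q. ennreal (s * (s + 1) * (q - p) powr (- s - 2)) *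
           (emeasure \<mu> {p..q} * emeasure \<nu> {p..q}) \<partial>lborel \<partial>lborel)"
proof -
  interpret M: finite_measure \<mu> by fact
  interpret N: finite_measure \<nu> by fact
  have [measurable_cong]: "sets \<mu> = sets borel" "sets \<nu> = sets borel" by fact+
  interpret LM: pair_sigma_finite lborel \<mu> ..
  interpret LN: pair_sigma_finite lborel \<nu> ..
  let ?g = "\<lambda>p q :: real. ennreal (s * (s + 1) * (q - p) powr (- s - 2))"
  have [measurable]: "(\<lambda>x. indicator {f x..g x} (h x) :: ennreal) \<in> borel_measurable M"
    if [measurable]: "f \<in> borel_measurable M" "g \<in> borel_measurable M" "h \<in> borel_measurable M"
    for f g h :: "'z \<Rightarrow> real" and M
    unfolding indicator_def atLeastAtMost_iff by measurable
  have 1: "(\<integral>\<^sup>+y. riesz s (x - y) \<partial>\<nu>) = (\<integral>\<^sup>+p. \<integral>\<^sup>+q. ?g p q * (indicator {p..q} x * emeasure \<nu> {p..q}) \<partial>lborel \<partial>lborel)"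
    for x
  proof -
    have "(\<integral>\<^sup>+y. riesz s (x - y) \<partial>\<nu>) = (\<integral>\<^sup>+y. \<integral>\<^sup>+p. \<integral>\<^sup>+q. ?g p q *
           (indicator {p..q} x * indicator {p..q} y) \<partial>lborel \<partial>lborel \<partial>\<nu>)"
      by (intro nn_integral_cong riesz_eq_interval_integral s)
    also have "\<dots> = (\<integral>\<^sup>+p. \<integral>\<^sup>+y. \<integral>\<^sup>+q. ?g p q *
           (indicator {p..q} x * indicator {p..q} y) \<partial>lborel \<partial>\<nu> \<partial>lborel)"
      by (rule LN.Fubini') measurable
    also have "\<dots> = (\<integral>\<^sup>+p. \<integral>\<^sup>+q. \<integral>\<^sup>+y. ?g p q *
           (indicator {p..q} x * indicator {p..q} y) \<partial>\<nu> \<partial>lborel \<partial>lborel)"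
      by (intro nn_integral_cong LN.Fubini') measurable
    also have "\<dots> = (\<integral>\<^sup>+p. \<integral>\<^sup>+q. ?g p q * (indicator {p..q} x * emeasure \<nu> {p..q}) \<partial>lborel \<partial>lborel)"
      by (intro nn_integral_cong)
         (simp add: nn_integral_cmult nn_integral_indicator \<nu>(1))
    finally show ?thesis .
  qed
  have [measurable]: "(\<lambda>x. emeasure \<mu> {f x..g x}) \<in> borel_measurable M"
     "(\<lambda>x. emeasure \<nu> {f x..g x}) \<in> borel_measurable M"
    if "f \<in> borel_measurable M" "g \<in> borel_measurable M" for f g :: "'z \<Rightarrow> real" and M
    using that \<mu> \<nu> by (auto intro!: measurable_emeasure_Icc)
  have "riesz_mutual s \<mu> \<nu> = (\<integral>\<^sup>+x. \<integral>\<^sup>+p. \<integral>\<^sup>+q. ?g p q * (indicator {p..q} x * emeasure \<nu> {p..q}) \<partial>lborel \<partial>lborel \<partial>\<mu>)"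
    unfolding riesz_mutual_def 1 ..
  also have "\<dots> = (\<integral>\<^sup>+p. \<integral>\<^sup>+x. \<integral>\<^sup>+q. ?g p q * (indicator {p..q} x * emeasure \<nu> {p..q}) \<partial>lborel \<partial>\<mu> \<partial>lborel)"
    by (rule LM.Fubini') measurable
  also have "\<dots> = (\<integral>\<^sup>+p. \<integral>\<^sup>+q. \<integral>\<^sup>+x. ?g p q * (indicator {p..q} x * emeasure \<nu> {p..q}) \<partial>\<mu> \<partial>lborel \<partial>lborel)"
    by (intro nn_integral_cong LM.Fubini') measurable
  also have "\<dots> = (\<integral>\<^sup>+p. \<integral>\<^sup>+q. ?g p q * (emeasure \<mu> {p..q} * emeasure \<nu> {p..q}) \<partial>lborel \<partial>lborel)"
    by (intro nn_integral_cong)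
       (simp add: nn_integral_cmult nn_integral_multc nn_integral_indicator \<mu>(1))
  finally show ?thesis .
qed

text \<open>The Riesz energy of the signed measure \<open>\<mu> - \<nu>\<close>, expressed by the masses of intervals. This form
  needs no subtraction of energies, which may be infinite.\<close>

definition riesz_distance :: "real \<Rightarrow> real measure \<Rightarrow> real measure \<Rightarrow> ennreal" where
  "riesz_distance s \<mu> \<nu> = (\<integral>\<^sup>+p. \<integral>\<^sup>+q. ennreal (s * (s + 1) * (q - p) powr (- s - 2)) *
           ennreal ((measure \<mu> {p..q} - measure \<nu> {p..q})\<^sup>2) \<partial>lborel \<partial>lborel)"

text \<open>The identity \<open>a\<^sup>2 + b\<^sup>2 = 2 a b + (a - b)\<^sup>2\<close> for the masses of each interval, integrated over all
  intervals.\<close>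

lemma riesz_polarization:
  assumes s: "s > 0"
    and \<mu>: "sets \<mu> = sets borel" "finite_measure \<mu>" and \<nu>: "sets \<nu> = sets borel" "finite_measure \<nu>"
  shows "riesz_energy s \<mu> + riesz_energy s \<nu> = 2 * riesz_mutual s \<mu> \<nu> + riesz_distance s \<mu> \<nu>"
proof -
  interpret M: finite_measure \<mu> by fact
  interpret N: finite_measure \<nu> by fact
  let ?g = "\<lambda>p q :: real. ennreal (s * (s + 1) * (q - p) powr (- s - 2))"
  let ?m = "\<lambda>p q :: real. emeasure \<mu> {p..q}" and ?n = "\<lambda>p q :: real. emeasure \<nu> {p..q}"
  let ?d = "\<lambda>p q :: real. ennreal ((measure \<mu> {p..q} - measure \<nu> {p..q})\<^sup>2)"
  have [measurable]: "(\<lambda>x. emeasure \<mu> {f x..g x}) \<in> borel_measurable M"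
     "(\<lambda>x. emeasure \<nu> {f x..g x}) \<in> borel_measurable M"
    if "f \<in> borel_measurable M" "g \<in> borel_measurable M" for f g :: "'z \<Rightarrow> real" and M
    using that \<mu> \<nu> by (auto intro!: measurable_emeasure_Icc)
  have [measurable]: "(\<lambda>x. measure \<mu> {f x..g x}) \<in> borel_measurable M"
     "(\<lambda>x. measure \<nu> {f x..g x}) \<in> borel_measurable M"
    if [measurable]: "f \<in> borel_measurable M" "g \<in> borel_measurable M" for f g :: "'z \<Rightarrow> real" and M
    unfolding measure_def by measurable
  have pw: "?m p q * ?m p q + ?n p q * ?n p q = 2 * (?m p q * ?n p q) + ?d p q" for p q
  proof -
    define a b where "a = measure \<mu> {p..q}" and "b = measure \<nu> {p..q}"
    have "?m p q = ennreal a" "?n p q = ennreal b" "a \<ge> 0" "b \<ge> 0"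
      by (auto simp: a_def b_def M.emeasure_eq_measure N.emeasure_eq_measure)
    moreover have "ennreal a * ennreal a + ennreal b * ennreal b = 2 * (ennreal a * ennreal b) + ennreal ((a - b)\<^sup>2)"
    proof -
      have "ennreal a * ennreal a + ennreal b * ennreal b = ennreal (a * a + b * b)"
        using \<open>a \<ge> 0\<close> \<open>b \<ge> 0\<close> by (simp add: ennreal_mult')
      also have "a * a + b * b = 2 * (a * b) + (a - b)\<^sup>2" by (simp add: power2_eq_square algebra_simps)
      also have "ennreal \<dots> = 2 * (ennreal a * ennreal b) + ennreal ((a - b)\<^sup>2)"
        using \<open>a \<ge> 0\<close> \<open>b \<ge> 0\<close> by (simp add: ennreal_mult')
      finally show ?thesis .
    qed
    ultimately show ?thesis by (simp add: a_def b_def)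
  qed
  have "riesz_energy s \<mu> + riesz_energy s \<nu> =
     (\<integral>\<^sup>+p. \<integral>\<^sup>+q. ?g p q * (?m p q * ?m p q + ?n p q * ?n p q) \<partial>lborel \<partial>lborel)"
    unfolding riesz_mutual_eq_interval_integral[OF s \<mu> \<mu>] riesz_mutual_eq_interval_integral[OF s \<nu> \<nu>]
    by (simp add: nn_integral_add distrib_left)
  also have "\<dots> = (\<integral>\<^sup>+p. \<integral>\<^sup>+q. 2 * (?g p q * (?m p q * ?n p q)) + ?g p q * ?d p q \<partial>lborel \<partial>lborel)"
    unfolding pw by (simp add: distrib_left mult_ac)
  also have "\<dots> = 2 * riesz_mutual s \<mu> \<nu> + riesz_distance s \<mu> \<nu>"
    unfolding riesz_mutual_eq_interval_integral[OF s \<mu> \<nu>] riesz_distance_def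
    by (simp add: nn_integral_add nn_integral_cmult)
  finally show ?thesis .
qed

text \<open>Almost all intervals have the same mass under both measures. Left ends tending to \<open>-\<infinity>\<close> and right
  ends decreasing to a given point then yield equal distribution functions.\<close>

lemma riesz_distance_eq_0_imp_eq:
  assumes s: "s > 0"
    and \<mu>: "sets \<mu> = sets borel" "prob_space \<mu>" and \<nu>: "sets \<nu> = sets borel" "prob_space \<nu>"
    and zero: "riesz_distance s \<mu> \<nu> = 0"
  shows "\<mu> = \<nu>"
proof -
  interpret M: prob_space \<mu> by fact
  interpret N: prob_space \<nu> by fact
  have [measurable_cong]: "sets \<mu> = sets borel" "sets \<nu> = sets borel" by fact+
  have fin: "finite_measure \<mu>" "finite_measure \<nu>" by unfold_locales
  have [measurable]: "(\<lambda>x. measure \<mu> {f x..g x}) \<in> borel_measurable M"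
     "(\<lambda>x. measure \<nu> {f x..g x}) \<in> borel_measurable M"
    if "f \<in> borel_measurable M" "g \<in> borel_measurable M" for f g :: "'z \<Rightarrow> real" and M
    unfolding measure_def using that \<mu> \<nu> fin
    by (auto intro!: measurable_emeasure_Icc borel_measurable_enn2real)
  have "AE p in lborel. (\<integral>\<^sup>+q. ennreal (s * (s + 1) * (q - p) powr (- s - 2)) *
           ennreal ((measure \<mu> {p..q} - measure \<nu> {p..q})\<^sup>2) \<partial>lborel) = 0"
    using zero unfolding riesz_distance_def by (subst (asm) nn_integral_0_iff_AE) auto
  then have ae: "AE p in lborel. AE q in lborel. p < q \<longrightarrow> measure \<mu> {p..q} = measure \<nu> {p..q}"
  proof eventually_elim
    case (elim p)
    then have "AE q in lborel. ennreal (s * (s + 1) * (q - p) powr (- s - 2)) *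
           ennreal ((measure \<mu> {p..q} - measure \<nu> {p..q})\<^sup>2) = 0"
      by (subst (asm) nn_integral_0_iff_AE) auto
    then show ?case
    proof eventually_elim
      case (elim q)
      show ?case
      proof
        assume "p < q"
        then have "s * (s + 1) * (q - p) powr (- s - 2) > 0" using s by simp
        with elim show "measure \<mu> {p..q} = measure \<nu> {p..q}"
          using s by (auto simp: ennreal_mult'[symmetric] ennreal_eq_0_iff mult_le_0_iff)
      qed
    qed
  qed
  have ex_good: "\<exists>p \<in> {a<..<b}. P p" if "AE p in lborel. P p" "a < b" for P and a b :: real
  proof (rule ccontr)
    assume "\<not> ?thesis"
    with that(1) have "AE p in lborel. p \<notin> {a<..<b}" by (auto elim!: eventually_mono)
    then have "{a<..<b} \<in> null_sets lborel" by (subst (asm) AE_iff_null_sets[symmetric]) auto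
    then show False using that(2) by (auto simp: null_sets_def)
  qed
  \<comment> \<open>Left ends that avoid the exceptional null set and tend to \<open>-\<infinity>\<close>.\<close>
  have "\<exists>p. \<forall>n::nat. p n \<in> {- real n - 1 <..< - real n} \<and> (AE q in lborel. p n < q \<longrightarrow> measure \<mu> {p n..q} = measure \<nu> {p n..q})"
    using ex_good[OF ae] by (intro choice) (auto simp: Bex_def)
  then obtain p where p: "\<And>n::nat. p n \<in> {- real n - 1 <..< - real n}"
      "\<And>n. AE q in lborel. p n < q \<longrightarrow> measure \<mu> {p n..q} = measure \<nu> {p n..q}" by metis
  have lim: "(\<lambda>n. measure m {p n..q}) \<longlonglongrightarrow> measure m {..q}" if "sets m = sets borel" "prob_space m" for m q
  proof -
    interpret m: prob_space m by fact
    have "(\<lambda>n. measure m {p n..q}) \<longlonglongrightarrow> measure m (\<Union>n. {p n..q})"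
    proof (rule m.finite_Lim_measure_incseq)
      show "incseq (\<lambda>n. {p n..q})"
      proof (rule incseq_SucI)
        fix n show "{p n..q} \<subseteq> {p (Suc n)..q}" using p(1)[of n] p(1)[of "Suc n"] by auto
      qed
    qed (auto simp: that)
    also have "(\<Union>n. {p n..q}) = {..q}"
    proof -
      have "\<exists>n. p n \<le> x" for x
      proof -
        obtain n :: nat where "- x < real n" using reals_Archimedean2 by blast
        with p(1)[of n] show ?thesis by (intro exI[of _ n]) auto
      qed
      then show ?thesis by auto
    qed
    finally show ?thesis .
  qed
  have "AE q in lborel. measure \<mu> {..q} = measure \<nu> {..q}"
  proof -
    have "AE q in lborel. \<forall>n. p n < q \<longrightarrow> measure \<mu> {p n..q} = measure \<nu> {p n..q}"
      using p(2) by (simp add: AE_all_countable)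
    then show ?thesis
    proof eventually_elim
      case (elim q)
      obtain N :: nat where "- q < real N" using reals_Archimedean2 by blast
      have "\<forall>\<^sub>F n in sequentially. measure \<mu> {p n..q} = measure \<nu> {p n..q}"
        unfolding eventually_sequentially
      proof (intro exI[of _ N] allI impI)
        fix n assume "N \<le> n"
        with p(1)[of n] \<open>- q < real N\<close> have "p n < q" by auto
        then show "measure \<mu> {p n..q} = measure \<nu> {p n..q}" using elim by auto
      qed
      then have "(\<lambda>n. measure \<mu> {p n..q}) \<longlonglongrightarrow> measure \<nu> {..q}"
        using lim[OF \<nu>, of q] by (simp add: tendsto_cong)
      with lim[OF \<mu>, of q] show ?case by (rule LIMSEQ_unique)
    qed
  qed
  from ex_good[OF this] have "\<exists>q. \<forall>n::nat. q n \<in> {x <..< x + 1 / real (Suc n)} \<and> measure \<mu> {..q n} = measure \<nu> {..q n}" for x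
    by (intro choice) (auto simp: Bex_def)
  then have cdf: "cdf \<mu> x = cdf \<nu> x" for x
  proof -
    obtain q where q: "\<And>n::nat. q n \<in> {x <..< x + 1 / real (Suc n)}" "\<And>n. measure \<mu> {..q n} = measure \<nu> {..q n}"
      using \<open>\<And>x. \<exists>q. \<forall>n::nat. q n \<in> {x <..< x + 1 / real (Suc n)} \<and> measure \<mu> {..q n} = measure \<nu> {..q n}\<close>[of x] by metis
    have qx: "q \<longlonglongrightarrow> x"
    proof (rule tendsto_sandwich[of "\<lambda>_. x" q _ "\<lambda>n. x + 1 / real (Suc n)"])
      show "(\<lambda>n. x + 1 / real (Suc n)) \<longlonglongrightarrow> x" using tendsto_add[OF tendsto_const LIMSEQ_inverse_real_of_nat, of x]
        by (simp add: inverse_eq_divide)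
    qed (use q(1) in \<open>auto intro!: always_eventually less_imp_le simp del: of_nat_Suc\<close>)
    have qr: "filterlim q (at_right x) sequentially"
      using qx q(1) by (auto simp: filterlim_at less_imp_neq[symmetric] simp del: of_nat_Suc intro!: always_eventually)
    have rc: "((\<lambda>n. cdf m (q n)) \<longlonglongrightarrow> cdf m x)" if "sets m = sets borel" "prob_space m" for m
    proof -
      interpret m: prob_space m by fact
      interpret m: finite_borel_measure m by unfold_locales (rule that)
      have "(cdf m \<longlongrightarrow> cdf m x) (at_right x)"
        using m.cdf_is_right_cont[of x] by (simp add: continuous_within)
      from filterlim_compose[OF this qr] show ?thesis .
    qed
    have "(\<lambda>n. cdf \<mu> (q n)) \<longlonglongrightarrow> cdf \<nu> x" using rc[OF \<nu>] q(2) by (simp add: cdf_def)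
    with rc[OF \<mu>] show ?thesis by (rule LIMSEQ_unique)
  qed
  interpret MM: real_distribution \<mu> using \<mu> by unfold_locales (auto simp: sets_eq_imp_space_eq)
  interpret NN: real_distribution \<nu> using \<nu> by unfold_locales (auto simp: sets_eq_imp_space_eq)
  show ?thesis
    by (rule cdf_unique) (use MM.real_distribution_axioms NN.real_distribution_axioms cdf in auto)
qed

section \<open>The equilibrium measure of an interval\<close>

lemma nn_integral_substitution':
  fixes f :: "real \<Rightarrow> ennreal" and g g' :: "real \<Rightarrow> real"
  assumes [measurable]: "f \<in> borel_measurable borel"
    and "\<And>x. x \<in> {a..b} \<Longrightarrow> (g has_real_derivative g' x) (at x)"
    and "continuous_on {a..b} g'" "\<And>x. x \<in> {a..b} \<Longrightarrow> g' x \<ge> 0" "a < b"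
  shows "(\<integral>\<^sup>+x. f x * indicator {g a..g b} x \<partial>lborel) = (\<integral>\<^sup>+x. f (g x) * g' x * indicator {a..b} x \<partial>lborel)"
  by (rule nn_integral_substitution_aux) (use assms in auto)

text \<open>Substitutions on intervals produce identities that fail at the end points and at one interior
  point at most.\<close>

lemma AE_lborel_avoid_three: "AE x::real in lborel. P x"
  if "\<And>x. x \<noteq> a \<Longrightarrow> x \<noteq> b \<Longrightarrow> x \<noteq> c \<Longrightarrow> P x"
proof -
  have "AE x in lborel. x \<noteq> a" "AE x in lborel. x \<noteq> b" "AE x in lborel. x \<noteq> c" by (rule AE_lborel_singleton)+
  then show ?thesis by eventually_elim (rule that)
qed

lemma power2_powr_half: "(w\<^sup>2) powr (a / 2) = w powr a" if "w > 0" for w a :: real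
proof -
  have "(w powr 2) powr (a / 2) = w powr a"
    unfolding powr_powr by (rule arg_cong[where f = "\<lambda>z. w powr z"]) simp
  then show ?thesis using that by simp
qed

text \<open>The Beta integral \<open>B((1 - s) / 2, (1 + s) / 2)\<close>.\<close>

definition equilibrium_constant :: "real \<Rightarrow> ennreal" where
  "equilibrium_constant s =
     (\<integral>\<^sup>+p. ennreal ((1 - p) powr ((s - 1) / 2) * p powr (- (s + 1) / 2)) * indicator {0..1} p \<partial>lborel)"

text \<open>The density \<open>(1 - y\<^sup>2)\<^sup>(\<^sup>s\<^sup>-\<^sup>1\<^sup>)\<^sup>/\<^sup>2\<close> is the unnormalized equilibrium density of \<open>[-1, 1]\<close> for the
  kernel \<open>|t|\<^sup>-\<^sup>s\<close>.\<close>

definition equilibrium_potential :: "real \<Rightarrow> real \<Rightarrow> ennreal" where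
  "equilibrium_potential s t =
     (\<integral>\<^sup>+y. ennreal ((1 - y\<^sup>2) powr ((s - 1) / 2)) * riesz s (t - y) * indicator {-1..1} y \<partial>lborel)"

lemma equilibrium_constant_finite:
  assumes "0 < s" "s < 1"
  shows "equilibrium_constant s < \<infinity>"
proof -
  have "((\<lambda>t. t powr ((1 - s) / 2 - 1) * (1 - t) powr ((1 + s) / 2 - 1)) has_integral Beta ((1 - s) / 2) ((1 + s) / 2)) {0..1}"
    by (rule has_integral_Beta_real) (use assms in auto)
  from nn_integral_has_integral_lebesgue'[OF _ this]
  have "(\<integral>\<^sup>+x. ennreal (x powr ((1 - s) / 2 - 1) * (1 - x) powr ((1 + s) / 2 - 1)) * indicator {0..1} x \<partial>lborel) < \<infinity>"
    by (auto simp: top.not_eq_extremum)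
  moreover have "(1 - s) / 2 - 1 = - (s + 1) / 2" "(1 + s) / 2 - 1 = (s - 1) / 2" by (auto simp: field_simps)
  ultimately show ?thesis unfolding equilibrium_constant_def by (simp add: mult.commute)
qed

text \<open>The substitution \<open>v = p / (1 - t\<^sup>2 + t\<^sup>2 p)\<close> maps \<open>[0, 1]\<close> to itself and absorbs the denominator
  \<open>1 - t\<^sup>2 v\<close>, leaving a Beta integral independent of \<open>t\<close>.\<close>

lemma equilibrium_integral_moebius:
  fixes t :: real
  assumes t: "\<bar>t\<bar> < 1"
  shows "(\<integral>\<^sup>+v. ennreal ((1 - v) powr ((s - 1) / 2) * v powr (- (s + 1) / 2) / (1 - t\<^sup>2 * v)) * indicator {0..1} v \<partial>lborel)
       = ennreal ((1 - t\<^sup>2) powr ((s - 1) / 2)) * equilibrium_constant s"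
proof -
  define d where "d = 1 - t\<^sup>2"
  have d: "0 < d" "d \<le> 1" using t by (auto simp: d_def abs_square_less_1)
  have D: "d + t\<^sup>2 * p > 0" if "p \<ge> 0" for p using d that by (simp add: add_pos_nonneg)
  let ?f = "\<lambda>v. ennreal ((1 - v) powr ((s - 1) / 2) * v powr (- (s + 1) / 2) / (1 - t\<^sup>2 * v))"
  let ?g = "\<lambda>p. p / (d + t\<^sup>2 * p)" and ?g' = "\<lambda>p. d / (d + t\<^sup>2 * p)\<^sup>2"
  have "(\<integral>\<^sup>+v. ?f v * indicator {?g 0..?g 1} v \<partial>lborel) = (\<integral>\<^sup>+p. ?f (?g p) * ?g' p * indicator {0..1} p \<partial>lborel)"
  proof (rule nn_integral_substitution')
    fix x :: real assume "x \<in> {0..1}"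
    then have "d + t\<^sup>2 * x \<noteq> 0" using D[of x] by auto
    then show "(?g has_real_derivative ?g' x) (at x)"
      by (auto intro!: derivative_eq_intros simp: power2_eq_square field_simps)
  next
    show "continuous_on {0..1} ?g'" by (intro continuous_intros) (use D in force)
  qed (use d in auto)
  also have "?g 0 = 0" by simp
  also have "?g 1 = 1" by (simp add: d_def)
  also have "(\<integral>\<^sup>+p. ?f (?g p) * ?g' p * indicator {0..1} p \<partial>lborel)
     = (\<integral>\<^sup>+p. ennreal (d powr ((s - 1) / 2)) * (ennreal ((1 - p) powr ((s - 1) / 2) * p powr (- (s + 1) / 2)) * indicator {0..1} p) \<partial>lborel)"
  proof (rule nn_integral_cong_AE, rule AE_lborel_avoid_three[of 0 1 1])
    fix p :: real assume p: "p \<noteq> 0" "p \<noteq> 1"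
    show "?f (?g p) * ?g' p * indicator {0..1} p = ennreal (d powr ((s - 1) / 2)) * (ennreal ((1 - p) powr ((s - 1) / 2) * p powr (- (s + 1) / 2)) * indicator {0..1} p)"
    proof (cases "p \<in> {0..1}")
      case True
      then have p: "0 < p" "p < 1" using p by auto
      define E where "E = d + t\<^sup>2 * p"
      have E: "E > 0" using D[of p] p by (auto simp: E_def)
      have 1: "1 - p / E = d * (1 - p) / E" using E by (simp add: field_simps E_def d_def)
      have 2: "1 - t\<^sup>2 * (p / E) = d / E" using E by (simp add: field_simps E_def)
      have 3: "(1 - p / E) powr ((s - 1) / 2) = d powr ((s - 1) / 2) * (1 - p) powr ((s - 1) / 2) * E powr (- (s - 1) / 2)"
      proof -
        have "(d * (1 - p) / E) powr a = d powr a * (1 - p) powr a * E powr (- a)" for a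
          using E d p by (simp add: powr_mult powr_divide powr_minus_divide)
        then show ?thesis unfolding 1 minus_divide_left[symmetric] .
      qed
      have 4: "(p / E) powr (- (s + 1) / 2) = p powr (- (s + 1) / 2) * E powr ((s + 1) / 2)"
      proof -
        have "(p / E) powr (- a) = p powr (- a) * E powr a" for a
          using E p by (simp add: powr_divide powr_minus_divide)
        from this[of "(s + 1) / 2"] show ?thesis unfolding minus_divide_left[symmetric] .
      qed
      have 5: "E powr (- (s - 1) / 2) * E powr ((s + 1) / 2) = E"
        using E by (simp add: powr_add[symmetric] field_simps)
      have "(1 - p / E) powr ((s - 1) / 2) * (p / E) powr (- (s + 1) / 2) / (1 - t\<^sup>2 * (p / E)) * (d / E\<^sup>2)
        = d powr ((s - 1) / 2) * ((1 - p) powr ((s - 1) / 2) * p powr (- (s + 1) / 2)) * (E powr (- (s - 1) / 2) * E powr ((s + 1) / 2)) / (d / E) * (d / E\<^sup>2)"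
        unfolding 2 3 4 by (simp add: mult_ac)
      also have "\<dots> = d powr ((s - 1) / 2) * ((1 - p) powr ((s - 1) / 2) * p powr (- (s + 1) / 2))"
        unfolding 5 using E d by (simp add: power2_eq_square)
      finally show ?thesis
        using True E d p by (simp add: E_def[symmetric] ennreal_mult'[symmetric] ennreal_mult''[symmetric])
    qed auto
  qed
  also have "\<dots> = ennreal ((1 - t\<^sup>2) powr ((s - 1) / 2)) * equilibrium_constant s"
    unfolding equilibrium_constant_def d_def by (rule nn_integral_cmult) measurable
  finally show ?thesis .
qed

lemma nn_integral_symmetric_interval:
  fixes h :: "real \<Rightarrow> ennreal"
  assumes [measurable]: "h \<in> borel_measurable borel"
  shows "(\<integral>\<^sup>+w. h w * indicator {-1..1} w \<partial>lborel) = (\<integral>\<^sup>+w. (h w + h (- w)) * indicator {0..1} w \<partial>lborel)"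
proof -
  have "(\<integral>\<^sup>+w. h w * indicator {-1..1} w \<partial>lborel)
      = (\<integral>\<^sup>+w. h w * indicator {0..1} w + h w * indicator {-1..0} w \<partial>lborel)"
    by (intro nn_integral_cong_AE AE_lborel_avoid_three[of 0 0 0]) (auto simp: indicator_def)
  also have "\<dots> = (\<integral>\<^sup>+w. h w * indicator {0..1} w \<partial>lborel) + (\<integral>\<^sup>+w. h w * indicator {-1..0} w \<partial>lborel)"
    by (rule nn_integral_add) measurable
  also have "(\<integral>\<^sup>+w. h w * indicator {-1..0} w \<partial>lborel) = (\<integral>\<^sup>+w. h (- w) * indicator {-1..0} (- w) \<partial>lborel)"
    by (rule nn_integral_lborel_reflect[symmetric]) measurable
  also have "\<dots> = (\<integral>\<^sup>+w. h (- w) * indicator {0..1} w \<partial>lborel)"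
    by (intro nn_integral_cong) (auto simp: indicator_def)
  finally show ?thesis by (simp add: nn_integral_add[symmetric] distrib_right)
qed

text \<open>The Moebius map \<open>y = (t + w) / (1 + t w)\<close> preserves \<open>[-1, 1]\<close> and sends \<open>0\<close> to \<open>t\<close>; both
  \<open>1 - y\<^sup>2\<close> and \<open>t - y\<close> factorize under it. The singularity is then at \<open>w = 0\<close>, and adding the
  values at \<open>w\<close> and \<open>- w\<close> leaves an integral in \<open>v = w\<^sup>2\<close> in which \<open>t\<close> occurs only through
  \<open>1 - t\<^sup>2 v\<close>.\<close>

lemma equilibrium_potential_inside:
  fixes t :: real
  assumes t: "\<bar>t\<bar> < 1" and s: "0 < s" "s < 1"
  shows "equilibrium_potential s t = equilibrium_constant s"
proof -
  define d where "d = 1 - t\<^sup>2"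
  have d: "0 < d" using t by (auto simp: d_def abs_square_less_1)
  have D: "1 + t * w > 0" if "w \<in> {-1..1}" for w
  proof -
    have "\<bar>t * w\<bar> < 1" using t that by (auto simp: abs_mult intro!: mult_le_less_imp_less[of _ 1 _ 1, simplified] intro: le_less_trans[OF mult_left_le])
    then show ?thesis by linarith
  qed
  let ?f = "\<lambda>y. ennreal ((1 - y\<^sup>2) powr ((s - 1) / 2)) * riesz s (t - y)"
  let ?g = "\<lambda>w. (t + w) / (1 + t * w)" and ?g' = "\<lambda>w. d / (1 + t * w)\<^sup>2"
  let ?F = "\<lambda>w. (1 - w\<^sup>2) powr ((s - 1) / 2) * \<bar>w\<bar> powr (- s)"
  let ?H = "\<lambda>v. (1 - v) powr ((s - 1) / 2) * v powr (- (s + 1) / 2) / (1 - t\<^sup>2 * v)"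
  have "(\<integral>\<^sup>+y. ?f y * indicator {?g (-1)..?g 1} y \<partial>lborel) = (\<integral>\<^sup>+w. ?f (?g w) * ?g' w * indicator {-1..1} w \<partial>lborel)"
  proof (rule nn_integral_substitution')
    fix x :: real assume "x \<in> {-1..1}"
    then have "1 + t * x \<noteq> 0" using D[of x] by auto
    then show "(?g has_real_derivative ?g' x) (at x)"
      by (auto intro!: derivative_eq_intros simp: power2_eq_square field_simps d_def)
  next
    show "continuous_on {-1..1} ?g'" by (intro continuous_intros) (use D in force)
  qed (use d in auto)
  also have "?g (-1) = -1" using t by (auto simp: field_simps)
  also have "?g 1 = 1" using t by (auto simp: field_simps)
  also have "(\<integral>\<^sup>+w. ?f (?g w) * ?g' w * indicator {-1..1} w \<partial>lborel)
     = (\<integral>\<^sup>+w. ennreal (d powr ((1 - s) / 2) * (?F w / (1 + t * w))) * indicator {-1..1} w \<partial>lborel)"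
  proof (rule nn_integral_cong_AE, rule AE_lborel_avoid_three[of 0 1 "-1"])
    fix w :: real assume w: "w \<noteq> 0" "w \<noteq> 1" "w \<noteq> -1"
    show "?f (?g w) * ?g' w * indicator {-1..1} w = ennreal (d powr ((1 - s) / 2) * (?F w / (1 + t * w))) * indicator {-1..1} w"
    proof (cases "w \<in> {-1..1}")
      case True
      then have w': "-1 < w" "w < 1" using w by auto
      then have w1: "1 - w\<^sup>2 > 0" by (simp add: abs_square_less_1 abs_less_iff)
      define E where "E = 1 + t * w"
      have E: "E > 0" using D[of w] True by (auto simp: E_def)
      have 1: "1 - ((t + w) / E)\<^sup>2 = d * (1 - w\<^sup>2) / E\<^sup>2"
        using E by (simp add: field_simps power_divide) (simp add: E_def d_def power2_eq_square algebra_simps)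
      have 2: "t - (t + w) / E = - (w * d / E)"
        using E by (simp add: field_simps) (simp add: E_def d_def power2_eq_square algebra_simps)
      have 3: "(1 - ((t + w) / E)\<^sup>2) powr ((s - 1) / 2) = d powr ((s - 1) / 2) * (1 - w\<^sup>2) powr ((s - 1) / 2) * E powr (1 - s)"
      proof -
        have "(E powr 2) powr ((s - 1) / 2) = E powr (s - 1)"
          unfolding powr_powr by (rule arg_cong[where f = "\<lambda>z. E powr z"]) (simp add: field_simps)
        then have "(E\<^sup>2) powr ((s - 1) / 2) = E powr (s - 1)" using E by simp
        then have f: "1 / (E\<^sup>2) powr ((s - 1) / 2) = E powr (1 - s)" using powr_minus_divide[of E "s - 1"] by simp
        have g: "(d * (1 - w\<^sup>2) / E\<^sup>2) powr ((s - 1) / 2)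
           = d powr ((s - 1) / 2) * (1 - w\<^sup>2) powr ((s - 1) / 2) * (1 / (E\<^sup>2) powr ((s - 1) / 2))"
          using E d w1 by (simp add: powr_mult powr_divide)
        show ?thesis unfolding 1 g f ..
      qed
      have 4: "riesz s (t - (t + w) / E) = ennreal (\<bar>w\<bar> powr (- s) * d powr (- s) * E powr s)"
        unfolding 2 riesz_minus using E d w
        by (simp add: riesz_nonzero abs_mult powr_mult powr_divide powr_minus_divide)
      have 5: "E powr (1 - s) * E powr s = E" "d powr ((s - 1) / 2) * d powr (- s) * d = d powr ((1 - s) / 2)"
        using E d by (simp_all add: powr_add[symmetric] powr_mult_base field_simps)
      have "?f (?g w) * ?g' w = ennreal (d powr ((s - 1) / 2) * (1 - w\<^sup>2) powr ((s - 1) / 2) * E powr (1 - s)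
             * (\<bar>w\<bar> powr (- s) * d powr (- s) * E powr s) * (d / E\<^sup>2))"
        unfolding E_def[symmetric] 3 4 using d E
        by (simp add: ennreal_mult'[symmetric] ennreal_mult''[symmetric])
      also have "d powr ((s - 1) / 2) * (1 - w\<^sup>2) powr ((s - 1) / 2) * E powr (1 - s)
             * (\<bar>w\<bar> powr (- s) * d powr (- s) * E powr s) * (d / E\<^sup>2)
           = (d powr ((s - 1) / 2) * d powr (- s) * d) * ?F w * (E powr (1 - s) * E powr s) / E\<^sup>2"
        by simp
      also have "\<dots> = d powr ((1 - s) / 2) * (?F w / E)"
        unfolding 5 using E by (simp add: power2_eq_square)
      finally show ?thesis using True by (simp add: E_def)
    qed auto
  qed
  also have "\<dots> = (\<integral>\<^sup>+w. (ennreal (d powr ((1 - s) / 2) * (?F w / (1 + t * w))) + ennreal (d powr ((1 - s) / 2) * (?F (- w) / (1 + t * - w)))) * indicator {0..1} w \<partial>lborel)"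
    by (rule nn_integral_symmetric_interval) measurable
  also have "\<dots> = (\<integral>\<^sup>+w. ennreal (d powr ((1 - s) / 2)) * (ennreal (?H (w\<^sup>2)) * ennreal (2 * w) * indicator {0..1} w) \<partial>lborel)"
  proof (rule nn_integral_cong_AE, rule AE_lborel_avoid_three[of 0 1 1])
    fix w :: real assume w: "w \<noteq> 0" "w \<noteq> 1"
    show "(ennreal (d powr ((1 - s) / 2) * (?F w / (1 + t * w))) + ennreal (d powr ((1 - s) / 2) * (?F (- w) / (1 + t * - w)))) * indicator {0..1} w
       = ennreal (d powr ((1 - s) / 2)) * (ennreal (?H (w\<^sup>2)) * ennreal (2 * w) * indicator {0..1} w)"
    proof (cases "w \<in> {0..1}")
      case True
      then have w': "0 < w" "w < 1" using w by auto
      have D1: "1 + t * w > 0" "1 - t * w > 0" using D[of w] D[of "-w"] True by auto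
      have "1 / (1 + t * w) + 1 / (1 - t * w) = 2 / (1 - t\<^sup>2 * w\<^sup>2)"
      proof -
        have "1 - t\<^sup>2 * w\<^sup>2 = (1 + t * w) * (1 - t * w)" by (simp add: power2_eq_square algebra_simps)
        then show ?thesis using D1 by (simp add: field_simps)
      qed
      then have h: "1 / (1 + t * w) + 1 / (1 - t * w) = 2 / (1 - t\<^sup>2 * w\<^sup>2)" .
      have "?F w / (1 + t * w) + ?F (- w) / (1 + t * - w) = ?F w / (1 + t * w) + ?F w / (1 - t * w)" by simp
      also have "\<dots> = ?F w * (1 / (1 + t * w) + 1 / (1 - t * w))"
        by (simp only: distrib_left times_divide_eq_right mult_1_right)
      finally have e: "?F w / (1 + t * w) + ?F (- w) / (1 + t * - w) = 2 * ?F w / (1 - t\<^sup>2 * w\<^sup>2)"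
        unfolding h by simp
      have "(w\<^sup>2) powr (- (s + 1) / 2) = w powr (- s - 1)"
        using power2_powr_half[OF w'(1), of "- (s + 1)"] by simp
      then have f: "(w\<^sup>2) powr (- (s + 1) / 2) * w = w powr (- s)"
        using w' by (simp add: powr_diff)
      have "?H (w\<^sup>2) * (2 * w) = 2 * (1 - w\<^sup>2) powr ((s - 1) / 2) * ((w\<^sup>2) powr (- (s + 1) / 2) * w) / (1 - t\<^sup>2 * w\<^sup>2)"
        by simp
      also have "\<dots> = 2 * ?F w / (1 - t\<^sup>2 * w\<^sup>2)" unfolding f using w' by simp
      finally have g: "?F w / (1 + t * w) + ?F (- w) / (1 + t * - w) = ?H (w\<^sup>2) * (2 * w)"
        by (rule trans[OF e sym])
      have "ennreal (d powr ((1 - s) / 2) * (?F w / (1 + t * w))) + ennreal (d powr ((1 - s) / 2) * (?F (- w) / (1 + t * - w)))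
         = ennreal (d powr ((1 - s) / 2) * (?F w / (1 + t * w) + ?F (- w) / (1 + t * - w)))"
        using D1 d by (simp add: ennreal_plus[symmetric] distrib_left del: ennreal_plus)
      also have "\<dots> = ennreal (d powr ((1 - s) / 2)) * (ennreal (?H (w\<^sup>2)) * ennreal (2 * w))"
        unfolding g by (subst ennreal_mult', simp, subst ennreal_mult'') (use w' in auto)
      finally show ?thesis using True by simp
    qed auto
  qed
  also have "\<dots> = ennreal (d powr ((1 - s) / 2)) * (\<integral>\<^sup>+w. (ennreal (?H (w\<^sup>2)) * ennreal (2 * w) * indicator {0..1} w) \<partial>lborel)"
    by (rule nn_integral_cmult) measurable
  also have "(\<integral>\<^sup>+w. (ennreal (?H (w\<^sup>2)) * ennreal (2 * w) * indicator {0..1} w) \<partial>lborel)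
     = (\<integral>\<^sup>+v. ennreal (?H v) * indicator {0\<^sup>2..1\<^sup>2} v \<partial>lborel)"
    by (rule nn_integral_substitution'[symmetric])
       (auto intro!: derivative_eq_intros continuous_intros)
  also have "\<dots> = ennreal (d powr ((s - 1) / 2)) * equilibrium_constant s"
    using equilibrium_integral_moebius[OF t, of s] by (simp add: d_def)
  also have "ennreal (d powr ((1 - s) / 2)) * (ennreal (d powr ((s - 1) / 2)) * equilibrium_constant s)
      = ennreal (d powr ((1 - s) / 2) * d powr ((s - 1) / 2)) * equilibrium_constant s"
    by (simp add: ennreal_mult mult.assoc)
  also have "d powr ((1 - s) / 2) * d powr ((s - 1) / 2) = 1"
    using d by (simp add: powr_add[symmetric] add_divide_distrib[symmetric])
  finally show ?thesis unfolding equilibrium_potential_def by simp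
qed

lemma equilibrium_potential_minus: "equilibrium_potential s (- t) = equilibrium_potential s t"
proof -
  have "equilibrium_potential s (- t) = (\<integral>\<^sup>+y. ennreal ((1 - (- y)\<^sup>2) powr ((s - 1) / 2)) * riesz s (- t - (- y)) * indicator {-1..1} (- y) \<partial>lborel)"
    unfolding equilibrium_potential_def by (rule nn_integral_lborel_reflect[symmetric]) measurable
  also have "\<dots> = equilibrium_potential s t"
    unfolding equilibrium_potential_def
  proof (rule nn_integral_cong)
    fix y :: real
    have "riesz s (- t - (- y)) = riesz s (t - y)" using riesz_minus[of s "t - y"] by simp
    then show "ennreal ((1 - (- y)\<^sup>2) powr ((s - 1) / 2)) * riesz s (- t - (- y)) * indicator {-1..1} (- y)
      = ennreal ((1 - y\<^sup>2) powr ((s - 1) / 2)) * riesz s (t - y) * indicator {-1..1} y"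
      by (auto simp: indicator_def)
  qed
  finally show ?thesis .
qed

lemma equilibrium_potential_1: "equilibrium_potential s 1 = equilibrium_constant s"
proof -
  have "equilibrium_potential s 1 = ennreal \<bar>-2\<bar> * (\<integral>\<^sup>+p. ennreal ((1 - (1 + -2 * p)\<^sup>2) powr ((s - 1) / 2)) * riesz s (1 - (1 + -2 * p)) * indicator {-1..1} (1 + -2 * p) \<partial>lborel)"
    unfolding equilibrium_potential_def by (rule nn_integral_real_affine) auto
  also have "\<dots> = (\<integral>\<^sup>+p. 2 * (ennreal ((1 - (1 + -2 * p)\<^sup>2) powr ((s - 1) / 2)) * riesz s (1 - (1 + -2 * p)) * indicator {-1..1} (1 + -2 * p)) \<partial>lborel)"
    by (subst nn_integral_cmult) auto
  also have "\<dots> = equilibrium_constant s"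
    unfolding equilibrium_constant_def
  proof (rule nn_integral_cong_AE, rule AE_lborel_avoid_three[of 0 1 1])
    fix p :: real assume p: "p \<noteq> 0" "p \<noteq> 1"
    show "2 * (ennreal ((1 - (1 + -2 * p)\<^sup>2) powr ((s - 1) / 2)) * riesz s (1 - (1 + -2 * p)) * indicator {-1..1} (1 + -2 * p))
       = ennreal ((1 - p) powr ((s - 1) / 2) * p powr (- (s + 1) / 2)) * indicator {0..1} p"
    proof (cases "p \<in> {0..1}")
      case True
      then have p: "0 < p" "p < 1" using p by auto
      have 1: "1 - (1 + -2 * p)\<^sup>2 = 4 * (p * (1 - p))" by (simp add: power2_eq_square algebra_simps)
      have "(4::real) powr ((s - 1) / 2) = (2 powr 2) powr ((s - 1) / 2)" by simp
      also have "\<dots> = 2 powr (s - 1)"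
        unfolding powr_powr by (rule arg_cong[where f = "\<lambda>z. 2 powr z"]) (simp add: field_simps)
      finally have 4: "(4::real) powr ((s - 1) / 2) = 2 powr (s - 1)" .
      have 5: "2 * (2 powr (s - 1) * 2 powr (- s)) = (1::real)"
        using powr_add[of 2 "s - 1" "- s"] by (simp add: powr_minus)
      have 6: "p powr ((s - 1) / 2) * p powr (- s) = p powr (- (s + 1) / 2)" by (simp add: powr_add[symmetric] field_simps)
      have "2 * (ennreal ((1 - (1 + -2 * p)\<^sup>2) powr ((s - 1) / 2)) * riesz s (1 - (1 + -2 * p)))
        = ennreal (2 * ((4 * (p * (1 - p))) powr ((s - 1) / 2) * (2 * p) powr (- s)))"
        unfolding 1 using p by (simp add: riesz_nonzero ennreal_mult' abs_mult)
      also have "2 * ((4 * (p * (1 - p))) powr ((s - 1) / 2) * (2 * p) powr (- s))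
        = (2 * (2 powr (s - 1) * 2 powr (- s))) * (p powr ((s - 1) / 2) * p powr (- s)) * (1 - p) powr ((s - 1) / 2)"
        using p by (simp add: powr_mult 4)
      also have "\<dots> = (1 - p) powr ((s - 1) / 2) * p powr (- (s + 1) / 2)" unfolding 5 6 by simp
      finally show ?thesis using True by (simp add: indicator_def)
    qed (auto simp: indicator_def)
  qed
  finally show ?thesis .
qed

text \<open>For \<open>t \<ge> 1\<close> every point of the interval is at least as far from \<open>t\<close> as from \<open>1\<close>.\<close>

lemma equilibrium_potential_le:
  assumes s: "0 < s" "s < 1"
  shows "equilibrium_potential s t \<le> equilibrium_constant s"
proof -
  have *: "equilibrium_potential s t \<le> equilibrium_constant s" if "t \<ge> 1" for t
    unfolding equilibrium_potential_1[symmetric] equilibrium_potential_def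
  proof (rule nn_integral_mono_AE, rule AE_lborel_avoid_three[of 1 1 1])
    fix y :: real assume "y \<noteq> 1"
    show "ennreal ((1 - y\<^sup>2) powr ((s - 1) / 2)) * riesz s (t - y) * indicator {-1..1} y
      \<le> ennreal ((1 - y\<^sup>2) powr ((s - 1) / 2)) * riesz s (1 - y) * indicator {-1..1} y"
    proof (cases "y \<in> {-1..1}")
      case True
      then have "y < 1" using \<open>y \<noteq> 1\<close> by auto
      then have "riesz s (t - y) \<le> riesz s (1 - y)"
        using that s by (auto simp: riesz_nonzero intro!: ennreal_leI powr_mono2')
      then show ?thesis by (intro mult_mono) auto
    qed auto
  qed
  consider "\<bar>t\<bar> < 1" | "t \<ge> 1" | "- t \<ge> 1" by linarith
  then show ?thesis
    by cases (use *[of t] *[of "- t"] equilibrium_potential_inside[OF _ s, of t] equilibrium_potential_minus[of s t] in simp_all)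
qed

lemma equilibrium_potential_constant:
  assumes s: "0 < s" "s < 1" and "\<bar>t\<bar> \<le> 1"
  shows "equilibrium_potential s t = equilibrium_constant s"
proof -
  consider "\<bar>t\<bar> < 1" | "t = 1" | "t = - 1" using assms by linarith
  then show ?thesis
    using equilibrium_potential_inside[OF _ s, of t] equilibrium_potential_minus[of s 1] equilibrium_potential_1[of s]
    by cases auto
qed

lemma measurable_equilibrium_potential [measurable]: "equilibrium_potential s \<in> borel_measurable borel"
  unfolding equilibrium_potential_def by measurable

section \<open>The extremal profile on the line\<close>

definition profile :: "real \<Rightarrow> real \<Rightarrow> real" where
  "profile s y = max 0 (1 - y\<^sup>2) powr ((1 + s) / 2)"

definition profile_potential :: "real \<Rightarrow> real \<Rightarrow> ennreal" where
  "profile_potential s t = (\<integral>\<^sup>+y. ennreal (profile s y) * riesz s (t - y) \<partial>lborel)"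

text \<open>The profile is a superposition of the equilibrium densities of the intervals \<open>[-r, r]\<close> with
  \<open>r \<le> 1\<close>: integrate \<open>x\<^sup>(\<^sup>s\<^sup>-\<^sup>1\<^sup>)\<^sup>/\<^sup>2\<close> up to \<open>1 - y\<^sup>2\<close> and put \<open>x = r\<^sup>2 - y\<^sup>2\<close>.\<close>

lemma profile_eq_mixture:
  assumes s: "0 < s"
  shows "ennreal (profile s y) = (\<integral>\<^sup>+r. ennreal ((s + 1) * r) * ennreal (max 0 (r\<^sup>2 - y\<^sup>2) powr ((s - 1) / 2)) * indicator {0..1} r \<partial>lborel)"
proof (cases "\<bar>y\<bar> < 1")
  case True
  define c where "c = 1 - y\<^sup>2"
  have c: "c > 0" using True by (simp add: c_def abs_square_less_1)
  let ?f = "\<lambda>\<tau>. ennreal ((s + 1) / 2 * \<tau> powr ((s - 1) / 2))"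
  have "((\<lambda>x. x powr ((s - 1) / 2)) has_integral (c powr ((s - 1) / 2 + 1) / ((s - 1) / 2 + 1))) {0..c}"
    using s c by (intro has_integral_powr_from_0) auto
  moreover have "(s - 1) / 2 + 1 = (s + 1) / 2" by (simp add: field_simps)
  ultimately have "((\<lambda>x. (s + 1) / 2 * x powr ((s - 1) / 2)) has_integral (s + 1) / 2 * (c powr ((s + 1) / 2) / ((s + 1) / 2))) {0..c}"
    by (intro has_integral_mult_right) simp
  moreover have "(s + 1) / 2 * (c powr ((s + 1) / 2) / ((s + 1) / 2)) = c powr ((1 + s) / 2)"
    using s by (simp add: add.commute)
  ultimately have I: "((\<lambda>x. (s + 1) / 2 * x powr ((s - 1) / 2)) has_integral c powr ((1 + s) / 2)) {0..c}"
    by simp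
  have "ennreal (profile s y) = ennreal (c powr ((1 + s) / 2))"
    using c by (simp add: profile_def c_def)
  also have "\<dots> = (\<integral>\<^sup>+\<tau>. ?f \<tau> * indicator {0..c} \<tau> \<partial>lborel)"
    using s by (intro nn_integral_has_integral_lebesgue'[symmetric] I) auto
  also have "\<dots> = (\<integral>\<^sup>+\<tau>. ?f \<tau> * indicator {\<bar>y\<bar>\<^sup>2 - y\<^sup>2..1\<^sup>2 - y\<^sup>2} \<tau> \<partial>lborel)"
    by (simp add: c_def)
  also have "\<dots> = (\<integral>\<^sup>+r. ?f (r\<^sup>2 - y\<^sup>2) * ennreal (2 * r) * indicator {\<bar>y\<bar>..1} r \<partial>lborel)"
    using True by (intro nn_integral_substitution') (auto intro!: derivative_eq_intros continuous_intros)
  also have "\<dots> = (\<integral>\<^sup>+r. ennreal ((s + 1) * r) * ennreal (max 0 (r\<^sup>2 - y\<^sup>2) powr ((s - 1) / 2)) * indicator {0..1} r \<partial>lborel)"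
  proof (rule nn_integral_cong)
    fix r :: real
    consider "r < 0" | "0 \<le> r" "r < \<bar>y\<bar>" | "\<bar>y\<bar> \<le> r" by linarith
    then show "?f (r\<^sup>2 - y\<^sup>2) * ennreal (2 * r) * indicator {\<bar>y\<bar>..1} r
       = ennreal ((s + 1) * r) * ennreal (max 0 (r\<^sup>2 - y\<^sup>2) powr ((s - 1) / 2)) * indicator {0..1} r"
    proof cases
      case 2
      then have "r\<^sup>2 - y\<^sup>2 \<le> 0" by (simp add: abs_le_square_iff[symmetric])
      with 2 show ?thesis by (simp add: max_def)
    next
      case 3
      then have "r \<ge> 0" "r\<^sup>2 - y\<^sup>2 \<ge> 0" by (auto simp: abs_le_square_iff[symmetric])
      with s have "?f (r\<^sup>2 - y\<^sup>2) * ennreal (2 * r) = ennreal ((s + 1) * r) * ennreal (max 0 (r\<^sup>2 - y\<^sup>2) powr ((s - 1) / 2))"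
        by (simp add: ennreal_mult'[symmetric] ennreal_mult''[symmetric] max_def)
      with 3 \<open>r \<ge> 0\<close> show ?thesis by (auto simp: indicator_def)
    qed (auto simp: indicator_def)
  qed
  finally show ?thesis .
next
  case False
  then have y: "y\<^sup>2 \<ge> 1" by (simp add: abs_square_le_1 abs_square_less_1 not_less[symmetric])
  have "(\<integral>\<^sup>+r. ennreal ((s + 1) * r) * ennreal (max 0 (r\<^sup>2 - y\<^sup>2) powr ((s - 1) / 2)) * indicator {0..1} r \<partial>lborel)
     = (\<integral>\<^sup>+r. 0 \<partial>(lborel :: real measure))"
  proof (rule nn_integral_cong)
    fix r :: real
    have "r\<^sup>2 - y\<^sup>2 \<le> 0" if "r \<in> {0..1}"
      using that y by (simp add: power_le_one order_trans[of "r\<^sup>2" 1])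
    then show "ennreal ((s + 1) * r) * ennreal (max 0 (r\<^sup>2 - y\<^sup>2) powr ((s - 1) / 2)) * indicator {0..1} r = 0"
      by (auto simp: indicator_def max_def)
  qed
  then show ?thesis using y by (simp add: profile_def max_def)
qed

lemma equilibrium_potential_rescaled:
  assumes r: "r > 0" and s: "0 < s"
  shows "(\<integral>\<^sup>+y. ennreal (max 0 (r\<^sup>2 - y\<^sup>2) powr ((s - 1) / 2)) * riesz s (t - y) \<partial>lborel) = equilibrium_potential s (t / r)"
proof -
  have "(\<integral>\<^sup>+y. ennreal (max 0 (r\<^sup>2 - y\<^sup>2) powr ((s - 1) / 2)) * riesz s (t - y) \<partial>lborel)
    = ennreal \<bar>r\<bar> * (\<integral>\<^sup>+y. ennreal (max 0 (r\<^sup>2 - (0 + r * y)\<^sup>2) powr ((s - 1) / 2)) * riesz s (t - (0 + r * y)) \<partial>lborel)"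
    by (rule nn_integral_real_affine) (use r in auto)
  also have "\<dots> = (\<integral>\<^sup>+y. ennreal r * (ennreal (max 0 (r\<^sup>2 - (r * y)\<^sup>2) powr ((s - 1) / 2)) * riesz s (t - (r * y))) \<partial>lborel)"
    using r by (subst nn_integral_cmult) auto
  also have "\<dots> = equilibrium_potential s (t / r)"
    unfolding equilibrium_potential_def
  proof (rule nn_integral_cong_AE, rule AE_lborel_avoid_three[of "-1" 1 1])
    fix y :: real assume "y \<noteq> -1" "y \<noteq> 1"
    have 1: "r\<^sup>2 - (r * y)\<^sup>2 = r\<^sup>2 * (1 - y\<^sup>2)" by (simp add: power_mult_distrib algebra_simps)
    have 2: "riesz s (t - r * y) = ennreal (r powr - s) * riesz s (t / r - y)"
      using riesz_scale[OF r, of s "t / r - y"] r by (simp add: algebra_simps)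
    show "ennreal r * (ennreal (max 0 (r\<^sup>2 - (r * y)\<^sup>2) powr ((s - 1) / 2)) * riesz s (t - (r * y))) =
        ennreal ((1 - y\<^sup>2) powr ((s - 1) / 2)) * riesz s (t / r - y) * indicator {-1..1} y"
    proof (cases "y \<in> {-1..1}")
      case True
      then have y: "1 - y\<^sup>2 > 0" using \<open>y \<noteq> -1\<close> \<open>y \<noteq> 1\<close> by (simp add: abs_square_less_1 abs_less_iff)
      have "(r powr 2) powr ((s - 1) / 2) = r powr (s - 1)"
        unfolding powr_powr by (rule arg_cong[where f = "\<lambda>z. r powr z"]) (simp add: field_simps)
      then have "(max 0 (r\<^sup>2 - (r * y)\<^sup>2)) powr ((s - 1) / 2) = r powr (s - 1) * (1 - y\<^sup>2) powr ((s - 1) / 2)"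
        unfolding 1 using r y by (simp add: powr_mult)
      then have "ennreal r * (ennreal (max 0 (r\<^sup>2 - (r * y)\<^sup>2) powr ((s - 1) / 2)) * riesz s (t - (r * y)))
         = ennreal r * ((ennreal (r powr (s - 1)) * ennreal ((1 - y\<^sup>2) powr ((s - 1) / 2))) * (ennreal (r powr - s) * riesz s (t / r - y)))"
        unfolding 2 using r by (simp add: ennreal_mult)
      also have "\<dots> = (ennreal r * ennreal (r powr (s - 1)) * ennreal (r powr - s)) * (ennreal ((1 - y\<^sup>2) powr ((s - 1) / 2)) * riesz s (t / r - y))"
        by (simp add: mult_ac)
      also have "ennreal r * ennreal (r powr (s - 1)) * ennreal (r powr - s) = ennreal (r * (r powr (s - 1) * r powr - s))"
        using r by (simp add: ennreal_mult mult.assoc)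
      also have "r powr (s - 1) * r powr - s = r powr (- 1)"
        by (simp add: powr_add[symmetric])
      also have "r * r powr (- 1) = 1"
        using r by (simp add: powr_minus)
      finally show ?thesis using True by simp
    next
      case False
      then have "1 - y\<^sup>2 \<le> 0" using abs_square_le_1[of y] by (auto simp: abs_le_iff)
      then have "r\<^sup>2 * (1 - y\<^sup>2) \<le> 0" by (intro mult_nonneg_nonpos) auto
      then have "max 0 (r\<^sup>2 - (r * y)\<^sup>2) = 0" unfolding 1 by simp
      with False show ?thesis by simp
    qed
  qed
  finally show ?thesis .
qed

lemma profile_potential_eq_mixture:
  assumes s: "0 < s"
  shows "profile_potential s t = (\<integral>\<^sup>+r. ennreal ((s + 1) * r) * equilibrium_potential s (t / r) * indicator {0..1} r \<partial>lborel)"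
proof -
  have "profile_potential s t = (\<integral>\<^sup>+y. \<integral>\<^sup>+r. ennreal ((s + 1) * r) * ennreal (max 0 (r\<^sup>2 - y\<^sup>2) powr ((s - 1) / 2)) * indicator {0..1} r * riesz s (t - y) \<partial>lborel \<partial>lborel)"
    unfolding profile_potential_def profile_eq_mixture[OF s] by (subst nn_integral_multc) auto
  also have "\<dots> = (\<integral>\<^sup>+r. \<integral>\<^sup>+y. ennreal ((s + 1) * r) * ennreal (max 0 (r\<^sup>2 - y\<^sup>2) powr ((s - 1) / 2)) * indicator {0..1} r * riesz s (t - y) \<partial>lborel \<partial>lborel)"
    by (rule lborel_pair.Fubini') measurable
  also have "\<dots> = (\<integral>\<^sup>+r. \<integral>\<^sup>+y. ennreal ((s + 1) * r) * indicator {0..1} r * (ennreal (max 0 (r\<^sup>2 - y\<^sup>2) powr ((s - 1) / 2)) * riesz s (t - y)) \<partial>lborel \<partial>lborel)"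
    by (simp add: mult_ac)
  also have "\<dots> = (\<integral>\<^sup>+r. ennreal ((s + 1) * r) * indicator {0..1} r * (\<integral>\<^sup>+y. (ennreal (max 0 (r\<^sup>2 - y\<^sup>2) powr ((s - 1) / 2)) * riesz s (t - y)) \<partial>lborel) \<partial>lborel)"
    by (intro nn_integral_cong nn_integral_cmult) measurable
  also have "\<dots> = (\<integral>\<^sup>+r. ennreal ((s + 1) * r) * equilibrium_potential s (t / r) * indicator {0..1} r \<partial>lborel)"
  proof (rule nn_integral_cong_AE, rule AE_lborel_avoid_three[of 0 0 0])
    fix r :: real assume "r \<noteq> 0"
    show "ennreal ((s + 1) * r) * indicator {0..1} r * (\<integral>\<^sup>+y. (ennreal (max 0 (r\<^sup>2 - y\<^sup>2) powr ((s - 1) / 2)) * riesz s (t - y)) \<partial>lborel)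
       = ennreal ((s + 1) * r) * equilibrium_potential s (t / r) * indicator {0..1} r"
      using \<open>r \<noteq> 0\<close> by (cases "r \<in> {0..1}") (auto simp: equilibrium_potential_rescaled s)
  qed
  finally show ?thesis .
qed

lemma nn_integral_linear_Icc:
  assumes "0 \<le> a" "a \<le> b" "0 \<le> k"
  shows "(\<integral>\<^sup>+r. ennreal (k * r) * indicator {a..b} r \<partial>lborel) = ennreal (k * (b\<^sup>2 - a\<^sup>2) / 2)"
proof -
  have "(\<integral>\<^sup>+r. ennreal (k * r) * indicator {a..b} r \<partial>lborel) = ennreal (k * b\<^sup>2 / 2 - k * a\<^sup>2 / 2)"
    by (rule nn_integral_FTC_Icc) (use assms in \<open>auto intro!: derivative_eq_intros\<close>)
  then show ?thesis by (simp add: field_simps)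
qed

text \<open>The potential at \<open>t\<close> is a mixture over \<open>r \<le> 1\<close> of equilibrium potentials at \<open>t / r\<close>. For
  \<open>0 \<le> t \<le> 1\<close> the radii \<open>r \<ge> t\<close> contribute the constant value, which gives a multiple of
  \<open>1 - t\<^sup>2\<close>, and the radii \<open>r \<le> t\<close> contribute a multiple of \<open>t\<^sup>2\<close> by scaling. For \<open>t > 1\<close> the same
  scaling gives the contribution of all radii up to \<open>t\<close>, and those between \<open>1\<close> and \<open>t\<close>
  contribute at most the constant value.\<close>

lemma profile_potential_quadratic:
  assumes s: "0 < s" "s < 1"
  shows "\<exists>A B. (\<forall>t. ennreal (A - B * t\<^sup>2) \<le> profile_potential s t) \<and>
               (\<forall>t. \<bar>t\<bar> \<le> 1 \<longrightarrow> 0 \<le> A - B * t\<^sup>2 \<and> profile_potential s t = ennreal (A - B * t\<^sup>2))"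
proof -
  let ?u = "equilibrium_potential s"
  define c where "c = enn2real (equilibrium_constant s)"
  have c: "equilibrium_constant s = ennreal c" "c \<ge> 0"
    using equilibrium_constant_finite[OF s] by (auto simp: c_def)
  have u_le: "?u t \<le> ennreal c" for t using equilibrium_potential_le[OF s, of t] c by simp
  have u_eq: "?u t = ennreal c" if "\<bar>t\<bar> \<le> 1" for t using equilibrium_potential_constant[OF s that] c by simp
  \<comment> \<open>The part of the potential at \<open>t\<close> that comes from the intervals of radius at most \<open>b\<close>.\<close>
  define W where "W t b = (\<integral>\<^sup>+r. ennreal ((s + 1) * r) * ?u (t / r) * indicator {0..b} r \<partial>lborel)" for t b :: real
  have U: "profile_potential s t = W t 1" for t
    unfolding W_def by (rule profile_potential_eq_mixture[OF s(1)])
  have W_split: "W t b = W t a + (\<integral>\<^sup>+r. ennreal ((s + 1) * r) * ?u (t / r) * indicator {a..b} r \<partial>lborel)"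
    if "0 \<le> a" "a \<le> b" for t a b
  proof -
    have "W t b = (\<integral>\<^sup>+r. ennreal ((s + 1) * r) * ?u (t / r) * indicator {0..a} r + ennreal ((s + 1) * r) * ?u (t / r) * indicator {a..b} r \<partial>lborel)"
      unfolding W_def using that
      by (intro nn_integral_cong_AE AE_lborel_avoid_three[of a a a]) (auto simp: indicator_def)
    then show ?thesis unfolding W_def by (subst (asm) nn_integral_add) auto
  qed
  have W_le: "(\<integral>\<^sup>+r. ennreal ((s + 1) * r) * ?u (t / r) * indicator {a..b} r \<partial>lborel) \<le> ennreal ((s + 1) * c * (b\<^sup>2 - a\<^sup>2) / 2)"
    if "0 \<le> a" "a \<le> b" for t a b
  proof -
    have "(\<integral>\<^sup>+r. ennreal ((s + 1) * r) * ?u (t / r) * indicator {a..b} r \<partial>lborel)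
       \<le> (\<integral>\<^sup>+r. ennreal ((s + 1) * c * r) * indicator {a..b} r \<partial>lborel)"
    proof (rule nn_integral_mono)
      fix r
      have "ennreal ((s + 1) * r) * ?u (t / r) \<le> ennreal ((s + 1) * r) * ennreal c" by (intro mult_left_mono u_le) auto
      also have "\<dots> = ennreal ((s + 1) * c * r)" using c(2) by (simp add: mult_ac) (simp add: ennreal_mult')
      finally show "ennreal ((s + 1) * r) * ?u (t / r) * indicator {a..b} r \<le> ennreal ((s + 1) * c * r) * indicator {a..b} r"
        by (intro mult_right_mono) auto
    qed
    also have "\<dots> = ennreal ((s + 1) * c * (b\<^sup>2 - a\<^sup>2) / 2)"
      using that s c by (intro nn_integral_linear_Icc) auto
    finally show ?thesis .
  qed
  have W_eq: "(\<integral>\<^sup>+r. ennreal ((s + 1) * r) * ?u (t / r) * indicator {a..b} r \<partial>lborel) = ennreal ((s + 1) * c * (b\<^sup>2 - a\<^sup>2) / 2)"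
    if "0 \<le> t" "t \<le> a" "a \<le> b" for t a b
  proof -
    have "(\<integral>\<^sup>+r. ennreal ((s + 1) * r) * ?u (t / r) * indicator {a..b} r \<partial>lborel)
       = (\<integral>\<^sup>+r. ennreal ((s + 1) * c * r) * indicator {a..b} r \<partial>lborel)"
    proof (rule nn_integral_cong)
      fix r
      show "ennreal ((s + 1) * r) * ?u (t / r) * indicator {a..b} r = ennreal ((s + 1) * c * r) * indicator {a..b} r"
      proof (cases "r \<in> {a..b}")
        case True
        then have "\<bar>t / r\<bar> \<le> 1" using that by (auto simp: divide_le_eq)
        have "ennreal ((s + 1) * r) * ennreal c = ennreal ((s + 1) * c * r)"
          using c(2) by (simp add: mult_ac) (simp add: ennreal_mult')
        then show ?thesis by (simp add: u_eq[OF \<open>\<bar>t / r\<bar> \<le> 1\<close>])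
      qed auto
    qed
    also have "\<dots> = ennreal ((s + 1) * c * (b\<^sup>2 - a\<^sup>2) / 2)"
      using that s c by (intro nn_integral_linear_Icc) auto
    finally show ?thesis .
  qed
  define q where "q = enn2real (W 1 1)"
  have "W 1 1 \<le> ennreal ((s + 1) * c * (1\<^sup>2 - 0\<^sup>2) / 2)" unfolding W_def by (rule W_le) auto
  then have q: "W 1 1 = ennreal q" "q \<ge> 0"
    unfolding q_def using le_less_trans[of "W 1 1" _ top] by (auto)
  have W_scale: "W t t = ennreal (t\<^sup>2 * q)" if "t > 0" for t
  proof -
    have "W t t = ennreal \<bar>t\<bar> * (\<integral>\<^sup>+r. ennreal ((s + 1) * (0 + t * r)) * ?u (t / (0 + t * r)) * indicator {0..t} (0 + t * r) \<partial>lborel)"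
      unfolding W_def by (rule nn_integral_real_affine) (use that in auto)
    also have "(\<integral>\<^sup>+r. ennreal ((s + 1) * (0 + t * r)) * ?u (t / (0 + t * r)) * indicator {0..t} (0 + t * r) \<partial>lborel)
      = (\<integral>\<^sup>+r. ennreal t * (ennreal ((s + 1) * r) * ?u (1 / r) * indicator {0..1} r) \<partial>lborel)"
    proof (rule nn_integral_cong)
      fix r :: real
      have "ennreal ((s + 1) * (0 + t * r)) = ennreal t * ennreal ((s + 1) * r)"
        using that by (simp add: ennreal_mult'[symmetric] mult_ac)
      moreover have "indicator {0..t} (0 + t * r) = (indicator {0..1} r :: ennreal)"
        using that by (auto simp: indicator_def zero_le_mult_iff)
      ultimately show "ennreal ((s + 1) * (0 + t * r)) * ?u (t / (0 + t * r)) * indicator {0..t} (0 + t * r)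
        = ennreal t * (ennreal ((s + 1) * r) * ?u (1 / r) * indicator {0..1} r)"
        using that by (simp add: mult_ac)
    qed
    also have "\<dots> = ennreal t * W 1 1"
      unfolding W_def by (rule nn_integral_cmult) measurable
    finally show ?thesis unfolding q using that q by (simp add: ennreal_mult'[symmetric] power2_eq_square mult_ac)
  qed
  \<comment> \<open>\<open>A\<close> comes from all radii at the constant value; \<open>B\<close> is the deficit of the radii below \<open>t\<close>,
    per unit of \<open>t\<^sup>2\<close>.\<close>
  define A B where "A = (s + 1) * c / 2" and "B = (s + 1) * c / 2 - q"
  have in1: "0 \<le> A - B * t\<^sup>2 \<and> profile_potential s t = ennreal (A - B * t\<^sup>2)" if "0 \<le> t" "t \<le> 1" for t
  proof -
    have AB: "A - B * t\<^sup>2 = t\<^sup>2 * q + (s + 1) * c * (1\<^sup>2 - t\<^sup>2) / 2"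
      by (simp add: A_def B_def field_simps)
    have t2: "t\<^sup>2 \<le> 1" using that by (simp add: power_le_one)
    have nn: "t\<^sup>2 * q \<ge> 0" "(s + 1) * c * (1\<^sup>2 - t\<^sup>2) / 2 \<ge> 0" using q s c t2 by auto
    have "W t t = ennreal (t\<^sup>2 * q)"
    proof (cases "t = 0")
      case True
      then have "W t t \<le> ennreal ((s + 1) * c * (0\<^sup>2 - 0\<^sup>2) / 2)" unfolding W_def using that by (intro order_trans[OF W_le]) auto
      then show ?thesis using True by simp
    qed (use that W_scale in auto)
    then have "profile_potential s t = ennreal (t\<^sup>2 * q) + ennreal ((s + 1) * c * (1\<^sup>2 - t\<^sup>2) / 2)"
      unfolding U using that W_split[of t 1 t] W_eq[of t t 1] by simp
    also have "\<dots> = ennreal (A - B * t\<^sup>2)"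
      using nn by (simp only: AB ennreal_plus)
    finally show ?thesis unfolding AB using nn by auto
  qed
  have out1: "ennreal (A - B * t\<^sup>2) \<le> profile_potential s t" if "1 \<le> t" for t
  proof -
    have "W t 1 \<le> ennreal ((s + 1) * c * (1\<^sup>2 - 0\<^sup>2) / 2)" unfolding W_def by (rule W_le) auto
    then obtain x where x: "W t 1 = ennreal x" "x \<ge> 0" by (cases "W t 1") (auto simp: top_unique)
    have t2: "t\<^sup>2 \<ge> 1" using that by simp
    then have nn: "(s + 1) * c * (t\<^sup>2 - 1\<^sup>2) / 2 \<ge> 0" using s c by auto
    have "ennreal (t\<^sup>2 * q) = W t t" using that W_scale[of t] by simp
    also have "\<dots> \<le> W t 1 + ennreal ((s + 1) * c * (t\<^sup>2 - 1\<^sup>2) / 2)"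
      using that by (subst W_split[of 1 t]) (auto intro!: W_le[of 1 t t, simplified])
    also have "\<dots> = ennreal (x + (s + 1) * c * (t\<^sup>2 - 1\<^sup>2) / 2)"
      unfolding x using x nn by (simp add: ennreal_plus)
    finally have "t\<^sup>2 * q \<le> x + (s + 1) * c * (t\<^sup>2 - 1\<^sup>2) / 2"
      using x nn by (subst (asm) ennreal_le_iff) auto
    then have "A - B * t\<^sup>2 \<le> x" by (simp add: A_def B_def field_simps)
    then show ?thesis unfolding U x by (rule ennreal_leI)
  qed
  have minus: "profile_potential s (- t) = profile_potential s t" for t
    unfolding U W_def using equilibrium_potential_minus[of s "t / _"] by simp
  show ?thesis
  proof (rule exI[of _ A], rule exI[of _ B], intro conjI allI impI)
    fix t :: real
    have "ennreal (A - B * \<bar>t\<bar>\<^sup>2) \<le> profile_potential s \<bar>t\<bar>"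
      using in1[of "\<bar>t\<bar>"] out1[of "\<bar>t\<bar>"] by (cases "\<bar>t\<bar> \<le> 1") auto
    then show "ennreal (A - B * t\<^sup>2) \<le> profile_potential s t"
      using minus[of t] by (auto simp: abs_if split: if_splits)
  next
    fix t :: real assume "\<bar>t\<bar> \<le> 1"
    then show "0 \<le> A - B * t\<^sup>2" "profile_potential s t = ennreal (A - B * t\<^sup>2)"
      using in1[of "\<bar>t\<bar>"] minus[of t] by (auto simp: abs_if split: if_splits)
  qed
qed

lemma measurable_profile [measurable]: "profile s \<in> borel_measurable borel"
  unfolding profile_def by measurable

lemma profile_nonneg [simp]: "profile s y \<ge> 0"
  by (simp add: profile_def)

lemma profile_outside: "\<bar>y\<bar> \<ge> 1 \<Longrightarrow> profile s y = 0"
proof -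
  assume "\<bar>y\<bar> \<ge> 1"
  then have "\<not> y\<^sup>2 < 1" by (simp add: abs_square_less_1)
  then show ?thesis by (simp add: profile_def max_def)
qed

lemma profile_pos: "\<bar>y\<bar> < 1 \<Longrightarrow> profile s y > 0"
  using abs_square_less_1[of y] by (simp add: profile_def)

lemma profile_eq_0_iff: "profile s y = 0 \<longleftrightarrow> \<bar>y\<bar> \<ge> 1"
  using profile_outside[of y s] profile_pos[of y s] by (cases "\<bar>y\<bar> < 1") auto

lemma profile_le_1: "s > 0 \<Longrightarrow> profile s y \<le> 1"
  unfolding profile_def by (intro powr_le1) auto

definition profile_mass :: "real \<Rightarrow> real" where
  "profile_mass s = enn2real (\<integral>\<^sup>+y. ennreal (profile s y) \<partial>lborel)"

lemma profile_mass:
  assumes "s > 0"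
  shows "(\<integral>\<^sup>+y. ennreal (profile s y) \<partial>lborel) = ennreal (profile_mass s)" "profile_mass s > 0"
proof -
  let ?I = "\<integral>\<^sup>+y. ennreal (profile s y) \<partial>lborel"
  have "?I \<le> (\<integral>\<^sup>+y. indicator {-1..1} y \<partial>(lborel::real measure))"
    using profile_le_1[OF assms] by (intro nn_integral_mono) (auto simp: indicator_def profile_outside)
  also have "\<dots> < \<infinity>" by simp
  finally have fin: "?I < \<infinity>" .
  have "?I \<noteq> 0"
  proof
    assume "?I = 0"
    then have "AE y in lborel. profile s y = 0" by (subst (asm) nn_integral_0_iff_AE) (auto simp: order.antisym)
    then have "AE y::real in lborel. y \<notin> {-1<..<1}"
      by eventually_elim (auto simp: profile_eq_0_iff)
    then have "{-1<..<1::real} \<in> null_sets lborel" by (subst (asm) AE_iff_null_sets[symmetric]) auto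
    then show False by (auto simp: null_sets_def)
  qed
  with fin show "?I = ennreal (profile_mass s)" "profile_mass s > 0"
    unfolding profile_mass_def by (auto simp: enn2real_positive_iff zero_less_iff_neq_zero)
qed

definition profile_measure :: "real \<Rightarrow> real measure" where
  "profile_measure s = density lborel (\<lambda>y. ennreal (profile s y / profile_mass s))"

text \<open>The profile dilated to \<open>[-L, L]\<close>; for \<open>L = 0\<close> it is the point mass at \<open>0\<close>.\<close>

definition profile_law :: "real \<Rightarrow> real \<Rightarrow> real measure" where
  "profile_law s L = distr (profile_measure s) borel (\<lambda>x. L * x)"

lemma sets_profile_measure [simp, measurable_cong]: "sets (profile_measure s) = sets borel"
  by (simp add: profile_measure_def)

lemma sets_profile_law [simp, measurable_cong]: "sets (profile_law s L) = sets borel"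
  by (simp add: profile_law_def)

lemma nn_integral_profile_measure:
  assumes "s > 0" and [measurable]: "f \<in> borel_measurable borel"
  shows "(\<integral>\<^sup>+y. f y \<partial>profile_measure s) = (\<integral>\<^sup>+y. ennreal (profile s y) * f y \<partial>lborel) / ennreal (profile_mass s)"
proof -
  have "(\<integral>\<^sup>+y. f y \<partial>profile_measure s) = (\<integral>\<^sup>+y. ennreal (profile s y / profile_mass s) * f y \<partial>lborel)"
    unfolding profile_measure_def by (subst nn_integral_density) auto
  also have "\<dots> = (\<integral>\<^sup>+y. (ennreal (profile s y) * f y) / ennreal (profile_mass s) \<partial>lborel)"
    using profile_mass[OF assms(1)]
    by (intro nn_integral_cong) (simp add: divide_ennreal[symmetric] ennreal_times_divide[symmetric] mult_ac ennreal_divide_times)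
  also have "\<dots> = (\<integral>\<^sup>+y. ennreal (profile s y) * f y \<partial>lborel) / ennreal (profile_mass s)"
    by (rule nn_integral_divide) measurable
  finally show ?thesis .
qed

lemma prob_space_profile_measure:
  assumes "s > 0"
  shows "prob_space (profile_measure s)"
proof (rule prob_spaceI)
  have "emeasure (profile_measure s) (space (profile_measure s)) = (\<integral>\<^sup>+y. 1 \<partial>profile_measure s)"
    by simp
  also have "\<dots> = 1" using profile_mass[OF assms]
    by (subst nn_integral_profile_measure) (auto simp: assms ennreal_divide_self)
  finally show "emeasure (profile_measure s) (space (profile_measure s)) = 1" .
qed

lemma prob_space_profile_law:
  assumes "s > 0"
  shows "prob_space (profile_law s L)"
  unfolding profile_law_def by (rule prob_space.prob_space_distr[OF prob_space_profile_measure[OF assms]]) auto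

lemma AE_profile_measure: "AE x in profile_measure s. \<bar>x\<bar> < 1"
  unfolding profile_measure_def
proof (subst AE_density)
  have "\<bar>x\<bar> < 1" if "0 < ennreal (profile s x / profile_mass s)" for x
    using that by (rule_tac ccontr) (simp add: profile_outside)
  then show "AE x in lborel. 0 < ennreal (profile s x / profile_mass s) \<longrightarrow> \<bar>x\<bar> < 1" by simp
qed simp

lemma AE_profile_law: "L \<ge> 0 \<Longrightarrow> AE x in profile_law s L. \<bar>x\<bar> \<le> L"
  unfolding profile_law_def
  by (subst AE_distr_iff) (auto simp: abs_mult intro!: eventually_mono[OF AE_profile_measure] mult_left_le)

lemma nn_integral_profile_law:
  assumes [measurable]: "f \<in> borel_measurable borel"
  shows "(\<integral>\<^sup>+y. f y \<partial>profile_law s L) = (\<integral>\<^sup>+y. f (L * y) \<partial>profile_measure s)"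
  unfolding profile_law_def by (subst nn_integral_distr) auto

definition profile_variance :: "real \<Rightarrow> real" where
  "profile_variance s = (LINT x|profile_measure s. x\<^sup>2)"

lemma integrable_profile_measure_square:
  assumes "s > 0" shows "integrable (profile_measure s) (\<lambda>x. x\<^sup>2)"
proof -
  interpret prob_space "profile_measure s" using prob_space_profile_measure[OF assms] .
  have "AE x in profile_measure s. x\<^sup>2 \<le> 1"
    using AE_profile_measure by eventually_elim (simp add: abs_square_le_1)
  then show ?thesis by (intro integrable_const_bound[where B = 1]) auto
qed

lemma profile_variance_pos:
  assumes "s > 0" shows "profile_variance s > 0"
proof -
  interpret prob_space "profile_measure s" using prob_space_profile_measure[OF assms] .
  have "profile_variance s \<ge> 0" unfolding profile_variance_def by simp
  moreover have "profile_variance s \<noteq> 0"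
  proof
    assume "profile_variance s = 0"
    then have "AE x in profile_measure s. x\<^sup>2 = 0"
      unfolding profile_variance_def using integrable_profile_measure_square[OF assms]
      by (subst (asm) integral_nonneg_eq_0_iff_AE) auto
    moreover have "AE x in profile_measure s. x \<noteq> 0"
      unfolding profile_measure_def by (subst AE_density) (auto intro: eventually_mono[OF AE_lborel_singleton])
    ultimately have "AE x in profile_measure s. False" by eventually_elim simp
    then show False by simp
  qed
  ultimately show ?thesis by simp
qed

lemma profile_law_second_moment:
  assumes "s > 0"
  shows "integrable (profile_law s L) (\<lambda>x. x\<^sup>2)" "(LINT x|profile_law s L. x\<^sup>2) = L\<^sup>2 * profile_variance s"
  unfolding profile_law_def profile_variance_def using integrable_profile_measure_square[OF assms]
  by (auto simp: integrable_distr_eq integral_distr power_mult_distrib)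

lemma profile_law_potential:
  assumes s: "s > 0" and L: "L > 0"
  shows "(\<integral>\<^sup>+y. riesz s (t - y) \<partial>profile_law s L) = ennreal (L powr (- s) / profile_mass s) * profile_potential s (t / L)"
proof -
  have "riesz s (t - L * y) = ennreal (L powr (- s)) * riesz s (t / L - y)" for y
    using riesz_scale[OF L, of s "t / L - y"] L by (simp add: algebra_simps)
  then have "(\<integral>\<^sup>+y. riesz s (t - y) \<partial>profile_law s L) = (\<integral>\<^sup>+y. ennreal (L powr (- s)) * riesz s (t / L - y) \<partial>profile_measure s)"
    by (subst nn_integral_profile_law) auto
  also have "\<dots> = ennreal (L powr (- s)) * (\<integral>\<^sup>+y. riesz s (t / L - y) \<partial>profile_measure s)"
    by (rule nn_integral_cmult) measurable
  also have "(\<integral>\<^sup>+y. riesz s (t / L - y) \<partial>profile_measure s) = profile_potential s (t / L) / ennreal (profile_mass s)"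
    using s by (subst nn_integral_profile_measure) (auto simp: profile_potential_def)
  finally show ?thesis using profile_mass(2)[OF s]
    by (simp add: divide_ennreal[symmetric] ennreal_times_divide ennreal_divide_times mult_ac)
qed

lemma profile_law_potential_quadratic:
  assumes s: "0 < s" "s < 1" and L: "L > 0"
  obtains A B where "\<And>t. ennreal (A - B * t\<^sup>2) \<le> (\<integral>\<^sup>+y. riesz s (t - y) \<partial>profile_law s L)"
    "\<And>t. \<bar>t\<bar> \<le> L \<Longrightarrow> 0 \<le> A - B * t\<^sup>2"
    "\<And>t. \<bar>t\<bar> \<le> L \<Longrightarrow> (\<integral>\<^sup>+y. riesz s (t - y) \<partial>profile_law s L) = ennreal (A - B * t\<^sup>2)"
proof -
  obtain A B where AB: "\<And>t. ennreal (A - B * t\<^sup>2) \<le> profile_potential s t"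
    "\<And>t. \<bar>t\<bar> \<le> 1 \<Longrightarrow> 0 \<le> A - B * t\<^sup>2" "\<And>t. \<bar>t\<bar> \<le> 1 \<Longrightarrow> profile_potential s t = ennreal (A - B * t\<^sup>2)"
    using profile_potential_quadratic[OF s] by blast
  define c where "c = L powr (- s) / profile_mass s"
  have c: "c > 0" using L profile_mass(2)[OF s(1)] by (simp add: c_def)
  have eq: "c * A - c * B / L\<^sup>2 * t\<^sup>2 = c * (A - B * (t / L)\<^sup>2)" for t
    by (simp add: power_divide right_diff_distrib)
  have le: "\<bar>t / L\<bar> \<le> 1" if "\<bar>t\<bar> \<le> L" for t using that L by simp
  show ?thesis
  proof (rule that[of "c * A" "c * B / L\<^sup>2"], unfold profile_law_potential[OF s(1) L] eq c_def[symmetric])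
    show "ennreal (c * (A - B * (t / L)\<^sup>2)) \<le> ennreal c * profile_potential s (t / L)" for t
      using c AB(1)[of "t / L"] by (subst ennreal_mult') (auto intro: mult_left_mono)
  next
    fix t assume "\<bar>t\<bar> \<le> L"
    from AB(2)[OF le[OF this]] show "0 \<le> c * (A - B * (t / L)\<^sup>2)" using c by auto
    from AB(3)[OF le[OF \<open>\<bar>t\<bar> \<le> L\<close>]] c show "ennreal c * profile_potential s (t / L) = ennreal (c * (A - B * (t / L)\<^sup>2))"
      by (simp add: ennreal_mult')
  qed
qed

text \<open>Integrating the quadratic lower bound of the potential of the profile law against \<open>\<mu>\<close> gives a
  number that depends only on the second moment, so it is the energy of the profile law itself.
  Thus the mutual energy is at least that energy, and polarization turns this into a comparison
  of energies with the distance as remainder.\<close>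

lemma riesz_energy_ge_profile_law:
  assumes s: "0 < s" "s < 1" and L: "L > 0"
    and \<mu>: "sets \<mu> = sets borel" "prob_space \<mu>"
    and int: "integrable \<mu> (\<lambda>x. x\<^sup>2)" and V: "(LINT x|\<mu>. x\<^sup>2) = L\<^sup>2 * profile_variance s"
  shows "riesz_energy s (profile_law s L) < \<infinity>"
    and "riesz_energy s (profile_law s L) + riesz_distance s \<mu> (profile_law s L) \<le> riesz_energy s \<mu>"
proof -
  interpret prob_space \<mu> by fact
  interpret P: prob_space "profile_law s L" by (rule prob_space_profile_law[OF s(1)])
  obtain A B where AB: "\<And>t. ennreal (A - B * t\<^sup>2) \<le> (\<integral>\<^sup>+y. riesz s (t - y) \<partial>profile_law s L)"
    "\<And>t. \<bar>t\<bar> \<le> L \<Longrightarrow> 0 \<le> A - B * t\<^sup>2"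
    "\<And>t. \<bar>t\<bar> \<le> L \<Longrightarrow> (\<integral>\<^sup>+y. riesz s (t - y) \<partial>profile_law s L) = ennreal (A - B * t\<^sup>2)"
    using profile_law_potential_quadratic[OF s L] by blast
  have AE_L: "AE x in profile_law s L. \<bar>x\<bar> \<le> L" using L by (intro AE_profile_law) auto
  have "riesz_energy s (profile_law s L) = (\<integral>\<^sup>+x. ennreal (A - B * x\<^sup>2) \<partial>profile_law s L)"
    unfolding riesz_mutual_def by (rule nn_integral_cong_AE, use AE_L in eventually_elim) (rule AB)
  also have "\<dots> = ennreal (LINT x|profile_law s L. A - B * x\<^sup>2)"
    by (rule nn_integral_eq_integral) (use profile_law_second_moment[OF s(1)] AE_L AB(2) in \<open>auto elim!: eventually_mono\<close>)
  also have "(LINT x|profile_law s L. A - B * x\<^sup>2) = A - B * (L\<^sup>2 * profile_variance s)"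
    using profile_law_second_moment[OF s(1), of L] by (simp add: P.prob_space)
  finally have E: "riesz_energy s (profile_law s L) = ennreal (A - B * (L\<^sup>2 * profile_variance s))" .
  then show fin: "riesz_energy s (profile_law s L) < \<infinity>" by simp
  have "A - B * (L\<^sup>2 * profile_variance s) = (LINT x|\<mu>. A - B * x\<^sup>2)"
    using V int by (simp add: prob_space)
  also have "ennreal \<dots> \<le> (\<integral>\<^sup>+x. ennreal (A - B * x\<^sup>2) \<partial>\<mu>)"
  proof -
    \<comment> \<open>The parabola may be negative off the support of the profile law, where its embedding into
      the extended nonnegative reals is \<open>0\<close>.\<close>
    have "(LINT x|\<mu>. A - B * x\<^sup>2) \<le> (LINT x|\<mu>. max 0 (A - B * x\<^sup>2))"
      using int by (intro integral_mono) auto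
    then have "ennreal (LINT x|\<mu>. A - B * x\<^sup>2) \<le> ennreal (LINT x|\<mu>. max 0 (A - B * x\<^sup>2))"
      by (rule ennreal_leI)
    also have "\<dots> = (\<integral>\<^sup>+x. ennreal (max 0 (A - B * x\<^sup>2)) \<partial>\<mu>)"
      using int by (intro nn_integral_eq_integral[symmetric]) auto
    finally have "ennreal (LINT x|\<mu>. A - B * x\<^sup>2) \<le> (\<integral>\<^sup>+x. ennreal (max 0 (A - B * x\<^sup>2)) \<partial>\<mu>)" .
    moreover have "ennreal (max 0 r) = ennreal r" for r by (auto simp: max_def ennreal_neg)
    ultimately show ?thesis by simp
  qed
  also have "\<dots> \<le> riesz_mutual s \<mu> (profile_law s L)"
    unfolding riesz_mutual_def by (intro nn_integral_mono AB)
  finally have le: "riesz_energy s (profile_law s L) \<le> riesz_mutual s \<mu> (profile_law s L)"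
    unfolding E .
  have pol: "riesz_energy s \<mu> + riesz_energy s (profile_law s L)
     = 2 * riesz_mutual s \<mu> (profile_law s L) + riesz_distance s \<mu> (profile_law s L)"
    by (rule riesz_polarization) (use s \<mu> finite_measure_axioms P.finite_measure_axioms in auto)
  have "riesz_energy s (profile_law s L) + riesz_energy s (profile_law s L) + riesz_distance s \<mu> (profile_law s L)
    \<le> 2 * riesz_mutual s \<mu> (profile_law s L) + riesz_distance s \<mu> (profile_law s L)"
    using le by (intro add_right_mono) (simp add: mult_2 add_mono)
  also note pol[symmetric]
  finally show "riesz_energy s (profile_law s L) + riesz_distance s \<mu> (profile_law s L) \<le> riesz_energy s \<mu>"
    using fin by (auto simp: add.assoc add.commute[of "riesz_energy s \<mu>"] ennreal_add_left_cancel_le)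
qed

lemma riesz_energy_dirac:
  assumes "prob_space \<mu>" "sets \<mu> = sets borel" "AE x in \<mu>. x = c"
  shows "riesz_energy s \<mu> = \<infinity>"
proof -
  interpret prob_space \<mu> by fact
  have [measurable_cong]: "sets \<mu> = sets borel" by fact
  have "riesz_energy s \<mu> = (\<integral>\<^sup>+x. \<integral>\<^sup>+y. \<infinity> \<partial>\<mu> \<partial>\<mu>)"
    unfolding riesz_mutual_def
  proof (rule nn_integral_cong_AE, use assms(3) in eventually_elim)
    case (elim x)
    show ?case
      by (rule nn_integral_cong_AE, use assms(3) in eventually_elim) (use elim in simp)
  qed
  then show ?thesis by (simp add: emeasure_space_1)
qed

text \<open>The product is invariant under dilation.\<close>

definition profile_energy_constant :: "real \<Rightarrow> ennreal" where
  "profile_energy_constant s = riesz_energy s (profile_measure s) * ennreal (profile_variance s powr (s / 2))"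

lemma riesz_half_square: "riesz (s / 2) (x\<^sup>2) = riesz s x"
proof -
  have "\<bar>x\<^sup>2\<bar> powr (s / 2) = \<bar>x\<bar> powr s"
    by (cases "x = 0") (use power2_powr_half[of "\<bar>x\<bar>" s] in auto)
  then show ?thesis by (simp add: riesz_def)
qed

text \<open>Scaling. For \<open>L = 0\<close> the law is a point mass and both sides are infinite.\<close>

lemma riesz_energy_profile_law:
  assumes s: "0 < s" "s < 1" and L: "L \<ge> 0"
  shows "riesz_energy s (profile_law s L) = profile_energy_constant s * riesz (s / 2) (L\<^sup>2 * profile_variance s)"
proof (cases "L = 0")
  case True
  interpret P: prob_space "profile_measure s" by (rule prob_space_profile_measure[OF s(1)])
  interpret P0: prob_space "profile_law s 0" by (rule prob_space_profile_law[OF s(1)])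
  have "riesz_energy s (profile_law s 0) = \<infinity>"
    using AE_profile_law[of 0 s] by (intro riesz_energy_dirac[where c = 0] P0.prob_space_axioms) auto
  moreover have "profile_energy_constant s \<noteq> 0"
  proof
    assume "profile_energy_constant s = 0"
    then have "riesz_energy s (profile_measure s) = 0"
      using profile_variance_pos[OF s(1)] by (simp add: profile_energy_constant_def)
    then have "AE x in profile_measure s. (\<integral>\<^sup>+y. riesz s (x - y) \<partial>profile_measure s) = 0"
      unfolding riesz_mutual_def by (subst (asm) nn_integral_0_iff_AE) auto
    moreover have "(\<integral>\<^sup>+y. riesz s (x - y) \<partial>profile_measure s) \<noteq> 0" for x
    proof
      assume "(\<integral>\<^sup>+y. riesz s (x - y) \<partial>profile_measure s) = 0"
      then have "AE y in profile_measure s. riesz s (x - y) = 0"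
        by (subst (asm) nn_integral_0_iff_AE) auto
      then have "AE y in profile_measure s. False" by eventually_elim (simp add: riesz_def)
      then show False by simp
    qed
    ultimately have "AE x in profile_measure s. False" by simp
    then show False by simp
  qed
  ultimately show ?thesis using True by (simp add: ennreal_mult_top)
next
  case False
  then have L: "L > 0" using L by simp
  interpret P0: prob_space "profile_law s L" by (rule prob_space_profile_law[OF s(1)])
  have "riesz_energy s (profile_law s L) = (\<integral>\<^sup>+x. \<integral>\<^sup>+y. riesz s (L * x - L * y) \<partial>profile_measure s \<partial>profile_measure s)"
    unfolding riesz_mutual_def
    by (subst nn_integral_profile_law, measurable) (simp add: nn_integral_profile_law)
  also have "\<dots> = (\<integral>\<^sup>+x. \<integral>\<^sup>+y. ennreal (L powr (- s)) * riesz s (x - y) \<partial>profile_measure s \<partial>profile_measure s)"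
    by (simp add: riesz_scale[OF L] right_diff_distrib[symmetric])
  also have "\<dots> = ennreal (L powr (- s)) * riesz_energy s (profile_measure s)"
  proof -
    interpret P: prob_space "profile_measure s" by (rule prob_space_profile_measure[OF s(1)])
    show ?thesis unfolding riesz_mutual_def by (simp add: nn_integral_cmult)
  qed
  also have "ennreal (L powr (- s)) = ennreal (profile_variance s powr (s / 2)) * riesz (s / 2) (L\<^sup>2 * profile_variance s)"
  proof -
    have v: "profile_variance s > 0" by (rule profile_variance_pos[OF s(1)])
    have "riesz (s / 2) (profile_variance s * L\<^sup>2) = ennreal (profile_variance s powr - (s / 2)) * riesz s L"
      by (subst riesz_scale[OF v]) (simp add: riesz_half_square)
    also have "riesz s L = ennreal (L powr - s)" using L by (simp add: riesz_nonzero)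
    finally have "ennreal (profile_variance s powr (s / 2)) * riesz (s / 2) (L\<^sup>2 * profile_variance s)
       = ennreal (profile_variance s powr (s / 2) * profile_variance s powr - (s / 2) * L powr - s)"
      by (simp add: ennreal_mult mult_ac)
    also have "profile_variance s powr (s / 2) * profile_variance s powr - (s / 2) = 1"
      using v by (simp add: powr_minus)
    finally show ?thesis by simp
  qed
  finally show ?thesis by (simp add: profile_energy_constant_def mult_ac)
qed

lemma profile_energy_constant_finite:
  assumes s: "0 < s" "s < 1"
  shows "profile_energy_constant s < \<infinity>" "profile_energy_constant s > 0"
proof -
  have "(*) (1::real) = (\<lambda>x. x)" by auto
  then have 1: "profile_law s 1 = profile_measure s" unfolding profile_law_def by (simp add: distr_id2)
  interpret P: prob_space "profile_measure s" by (rule prob_space_profile_measure[OF s(1)])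
  have "riesz_energy s (profile_measure s) < \<infinity>"
    using riesz_energy_ge_profile_law(1)[OF s, of 1 "profile_measure s"] integrable_profile_measure_square[OF s(1)]
    by (simp add: 1 P.prob_space_axioms profile_variance_def)
  then show "profile_energy_constant s < \<infinity>"
    unfolding profile_energy_constant_def by (simp add: ennreal_mult_less_top)
  \<comment> \<open>The infinite energy of a point mass is a multiple of the constant, so the constant is not
    \<open>0\<close>.\<close>
  have "riesz_energy s (profile_law s 0) = \<infinity>"
    by (intro riesz_energy_dirac[where c = 0] prob_space_profile_law) (use AE_profile_law[of 0 s] s in auto)
  then show "profile_energy_constant s > 0"
    unfolding riesz_energy_profile_law[OF s, of 0, simplified] by (auto simp: zero_less_iff_neq_zero)
qed

text \<open>The extremal inequality on the line: compare with the profile law of the same second moment. In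
  the equality case the remainder \<open>riesz_distance\<close> vanishes. The second moment is taken about
  \<open>0\<close>, not about the mean.\<close>

theorem riesz_energy_ge_second_moment:
  assumes s: "0 < s" "s < 1"
    and \<mu>: "sets \<mu> = sets borel" "prob_space \<mu>" and int: "integrable \<mu> (\<lambda>x. x\<^sup>2)"
  shows "profile_energy_constant s * riesz (s / 2) (LINT x|\<mu>. x\<^sup>2) \<le> riesz_energy s \<mu>"
    and "riesz_energy s \<mu> = profile_energy_constant s * riesz (s / 2) (LINT x|\<mu>. x\<^sup>2) \<Longrightarrow> (LINT x|\<mu>. x\<^sup>2) > 0 \<Longrightarrow>
           \<mu> = profile_law s (sqrt ((LINT x|\<mu>. x\<^sup>2) / profile_variance s))"
proof -
  interpret prob_space \<mu> by fact
  have [measurable_cong]: "sets \<mu> = sets borel" by fact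
  define V where "V = (LINT x|\<mu>. x\<^sup>2)"
  define L where "L = sqrt (V / profile_variance s)"
  have v: "profile_variance s > 0" by (rule profile_variance_pos[OF s(1)])
  have "V \<ge> 0" by (simp add: V_def)
  then have L: "L \<ge> 0" "V = L\<^sup>2 * profile_variance s" using v by (auto simp: L_def)
  have "(riesz_energy s (profile_law s L) \<le> riesz_energy s \<mu>) \<and> (riesz_energy s \<mu> = riesz_energy s (profile_law s L) \<longrightarrow> V > 0 \<longrightarrow> \<mu> = profile_law s L)"
  proof (cases "V = 0")
    case True
    have "AE x in \<mu>. x\<^sup>2 = 0"
      using True int unfolding V_def by (subst (asm) integral_nonneg_eq_0_iff_AE) auto
    then have "riesz_energy s \<mu> = \<infinity>" by (intro riesz_energy_dirac[where c = 0] prob_space_axioms \<mu>) auto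
    with True show ?thesis by simp
  next
    case False
    then have L0: "L > 0" using L by (cases "L = 0") auto
    note * = riesz_energy_ge_profile_law[OF s L0 \<mu> int, folded V_def, OF L(2)]
    show ?thesis
    proof (intro conjI impI)
      show "riesz_energy s (profile_law s L) \<le> riesz_energy s \<mu>"
        by (rule order_trans[OF _ *(2)]) simp
      assume "riesz_energy s \<mu> = riesz_energy s (profile_law s L)"
      with * have "riesz_distance s \<mu> (profile_law s L) = 0"
        using ennreal_add_left_cancel_le[of "riesz_energy s (profile_law s L)" _ 0] by auto
      then show "\<mu> = profile_law s L"
        by (intro riesz_distance_eq_0_imp_eq[OF s(1) \<mu>]) (auto intro!: prob_space_profile_law s)
    qed
  qed
  then show "profile_energy_constant s * riesz (s / 2) (LINT x|\<mu>. x\<^sup>2) \<le> riesz_energy s \<mu>"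
    and "riesz_energy s \<mu> = profile_energy_constant s * riesz (s / 2) (LINT x|\<mu>. x\<^sup>2) \<Longrightarrow> (LINT x|\<mu>. x\<^sup>2) > 0 \<Longrightarrow>
           \<mu> = profile_law s (sqrt ((LINT x|\<mu>. x\<^sup>2) / profile_variance s))"
    unfolding riesz_energy_profile_law[OF s L(1)] L(2)[symmetric] V_def[symmetric] L_def[symmetric] by auto
qed

section \<open>Integration over the plane along lines through the origin\<close>

lemma vector2_eq_axes: "(vector [a, b] :: real^2) = a *\<^sub>R axis 1 1 + b *\<^sub>R axis 2 1"
  by (simp add: vec_eq_iff forall_2 axis_def)

lemma vector2_collapse [simp]: "vector [x $ 1, x $ 2] = (x :: real^2)"
  by (simp add: vec_eq_iff forall_2)

lemma measurable_vector2 [measurable]: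
  assumes [measurable]: "f \<in> borel_measurable M" "g \<in> borel_measurable M"
  shows "(\<lambda>x. vector [f x, g x] :: real^2) \<in> borel_measurable M"
  unfolding vector2_eq_axes by measurable

lemma measurable_vec_nth2 [measurable]: "(\<lambda>x::real^2. x $ i) \<in> borel_measurable borel"
  by (intro borel_measurable_continuous_onI continuous_intros)

lemma inner_2: "(x :: real^2) \<bullet> y = x $ 1 * y $ 1 + x $ 2 * y $ 2"
  by (simp add: inner_vec_def sum_2)

lemma norm_2: "norm (x :: real^2) = sqrt ((x $ 1)\<^sup>2 + (x $ 2)\<^sup>2)"
  by (simp add: norm_eq_sqrt_inner inner_2 power2_eq_square)

lemma norm_2_square: "(norm (x :: real^2))\<^sup>2 = (x $ 1)\<^sup>2 + (x $ 2)\<^sup>2"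
  by (simp add: norm_2)

lemma lborel_plane: "(lborel :: (real^2) measure) = distr (lborel \<Otimes>\<^sub>M lborel) borel (\<lambda>(a, b). vector [a, b])"
proof (rule lborel_eqI)
  have B: "(Basis :: (real^2) set) = {axis 1 1, axis 2 1}"
    by (auto simp: Basis_vec_def UNIV_2)
  have ne: "axis 1 1 \<noteq> (axis 2 1 :: real^2)" by (simp add: axis_eq_axis)
  fix l u :: "real^2"
  assume le: "\<And>b. b \<in> Basis \<Longrightarrow> l \<bullet> b \<le> u \<bullet> b"
  have le': "l $ 1 \<le> u $ 1" "l $ 2 \<le> u $ 2"
    using le[of "axis 1 1"] le[of "axis 2 1"] by (auto simp: B inner_axis)
  have "emeasure (distr (lborel \<Otimes>\<^sub>M lborel) borel (\<lambda>(a, b). vector [a, b] :: real^2)) (box l u)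
     = emeasure (lborel \<Otimes>\<^sub>M lborel) ((\<lambda>(a, b). vector [a, b] :: real^2) -` box l u \<inter> space (lborel \<Otimes>\<^sub>M lborel))"
    by (rule emeasure_distr) auto
  also have "(\<lambda>(a, b). vector [a, b] :: real^2) -` box l u \<inter> space (lborel \<Otimes>\<^sub>M lborel) = {l $ 1<..<u $ 1} \<times> {l $ 2<..<u $ 2}"
    by (auto simp: box_def B inner_axis space_pair_measure)
  also have "emeasure (lborel \<Otimes>\<^sub>M lborel) \<dots> = ennreal ((u $ 1 - l $ 1) * (u $ 2 - l $ 2))"
    using le' by (subst lborel.emeasure_pair_measure_Times) (auto simp: ennreal_mult)
  also have "(u $ 1 - l $ 1) * (u $ 2 - l $ 2) = (\<Prod>b\<in>Basis. (u - l) \<bullet> b)"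
    using ne by (simp add: B inner_axis)
  finally show "emeasure (distr (lborel \<Otimes>\<^sub>M lborel) borel (\<lambda>(a, b). vector [a, b] :: real^2)) (box l u) = (\<Prod>b\<in>Basis. (u - l) \<bullet> b)" .
qed simp

lemma nn_integral_plane:
  fixes f :: "real^2 \<Rightarrow> ennreal"
  assumes [measurable]: "f \<in> borel_measurable borel"
  shows "(\<integral>\<^sup>+x. f x \<partial>lborel) = (\<integral>\<^sup>+a. \<integral>\<^sup>+b. f (vector [a, b]) \<partial>lborel \<partial>lborel)"
  by (subst lborel_plane) (simp add: nn_integral_distr lborel.nn_integral_fst[symmetric] split_beta')

lemma integral_plane:
  fixes f :: "real^2 \<Rightarrow> 'a :: {banach, second_countable_topology}"
  assumes f: "integrable lborel f"
  shows "(LINT x|lborel. f x) = (LINT a|lborel. LINT b|lborel. f (vector [a, b]))"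
    and "integrable (lborel \<Otimes>\<^sub>M lborel) (\<lambda>(a, b). f (vector [a, b]))"
proof -
  have [measurable]: "f \<in> borel_measurable borel" using f by auto
  show 1: "integrable (lborel \<Otimes>\<^sub>M lborel) (\<lambda>(a, b). f (vector [a, b]))"
    using f by (subst (asm) lborel_plane) (simp add: integrable_distr_eq split_beta')
  show "(LINT x|lborel. f x) = (LINT a|lborel. LINT b|lborel. f (vector [a, b]))"
    by (subst lborel_plane) (simp add: integral_distr split_beta' lborel_pair.integral_fst'[symmetric] 1[unfolded split_beta'])
qed

text \<open>The slopes \<open>v\<close> parametrize all lines through the origin but the vertical one, which is a null
  set; this replaces polar coordinates.\<close>

definition slope :: "real \<Rightarrow> real^2 \<Rightarrow> real" where
  "slope v x = x $ 1 + v * x $ 2"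

lemma measurable_slope [measurable]:
  assumes [measurable]: "f \<in> borel_measurable M" "g \<in> borel_measurable M"
  shows "(\<lambda>x. slope (f x) (g x)) \<in> borel_measurable M"
proof -
  have [measurable]: "(\<lambda>x. g x $ i) \<in> borel_measurable M" for i
    using measurable_compose[OF assms(2) measurable_vec_nth2] .
  show ?thesis unfolding slope_def by measurable
qed

text \<open>The coordinates \<open>(u, u v)\<close> have Jacobian \<open>|u|\<close>.\<close>

lemma nn_integral_slopes:
  fixes f :: "real^2 \<Rightarrow> ennreal"
  assumes [measurable]: "f \<in> borel_measurable borel"
  shows "(\<integral>\<^sup>+x. f x \<partial>lborel) = (\<integral>\<^sup>+v. \<integral>\<^sup>+u. ennreal \<bar>u\<bar> * f (vector [u, u * v]) \<partial>lborel \<partial>lborel)"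
proof -
  have "(\<integral>\<^sup>+x. f x \<partial>lborel) = (\<integral>\<^sup>+u. \<integral>\<^sup>+b. f (vector [u, b]) \<partial>lborel \<partial>lborel)"
    by (rule nn_integral_plane) fact
  also have "\<dots> = (\<integral>\<^sup>+u. \<integral>\<^sup>+v. ennreal \<bar>u\<bar> * f (vector [u, u * v]) \<partial>lborel \<partial>lborel)"
  proof (rule nn_integral_cong_AE)
    have "AE u::real in lborel. u \<noteq> 0" by (rule AE_lborel_singleton)
    then show "AE u in lborel. (\<integral>\<^sup>+b. f (vector [u, b]) \<partial>lborel) = (\<integral>\<^sup>+v. ennreal \<bar>u\<bar> * f (vector [u, u * v]) \<partial>lborel)"
      by eventually_elim (subst nn_integral_real_affine[where t = 0], auto simp: nn_integral_cmult)
  qed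
  also have "\<dots> = (\<integral>\<^sup>+v. \<integral>\<^sup>+u. ennreal \<bar>u\<bar> * f (vector [u, u * v]) \<partial>lborel \<partial>lborel)"
    by (rule lborel_pair.Fubini') measurable
  finally show ?thesis .
qed

lemma integral_slopes:
  fixes f :: "real^2 \<Rightarrow> real"
  assumes f: "integrable lborel f"
  shows "(LINT x|lborel. f x) = (LINT v|lborel. LINT u|lborel. \<bar>u\<bar> * f (vector [u, u * v]))"
    and "integrable lborel (\<lambda>v. LINT u|lborel. \<bar>u\<bar> * f (vector [u, u * v]))"
proof -
  have [measurable]: "f \<in> borel_measurable borel" using f by auto
  have int: "integrable (lborel \<Otimes>\<^sub>M lborel) (\<lambda>(u, v). \<bar>u\<bar> * f (vector [u, u * v]))"
  proof (rule integrableI_bounded)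
    have "(\<integral>\<^sup>+x. ennreal (norm ((\<lambda>(u, v). \<bar>u\<bar> * f (vector [u, u * v])) x)) \<partial>(lborel \<Otimes>\<^sub>M lborel))
       = (\<integral>\<^sup>+v. \<integral>\<^sup>+u. ennreal \<bar>u\<bar> * ennreal (norm (f (vector [u, u * v]))) \<partial>lborel \<partial>lborel)"
      by (subst lborel_pair.nn_integral_snd[symmetric]) (auto simp: split_beta' abs_mult ennreal_mult)
    also have "\<dots> = (\<integral>\<^sup>+x. ennreal (norm (f x)) \<partial>lborel)"
      by (rule nn_integral_slopes[symmetric]) measurable
    also have "\<dots> < \<infinity>" using f by (simp add: integrable_iff_bounded)
    finally show "(\<integral>\<^sup>+x. ennreal (norm ((\<lambda>(u, v). \<bar>u\<bar> * f (vector [u, u * v])) x)) \<partial>(lborel \<Otimes>\<^sub>M lborel)) < \<infinity>" .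
  qed measurable
  have "(LINT x|lborel. f x) = (LINT u|lborel. LINT b|lborel. f (vector [u, b]))"
    by (rule integral_plane) fact
  also have "\<dots> = (LINT u|lborel. LINT v|lborel. \<bar>u\<bar> * f (vector [u, u * v]))"
  proof (rule integral_cong_AE)
    have "AE u::real in lborel. u \<noteq> 0" by (rule AE_lborel_singleton)
    then show "AE u in lborel. (LINT b|lborel. f (vector [u, b])) = (LINT v|lborel. \<bar>u\<bar> * f (vector [u, u * v]))"
      by eventually_elim (subst lborel_integral_real_affine[where t = 0], auto)
  qed measurable
  also have "\<dots> = (LINT v|lborel. LINT u|lborel. \<bar>u\<bar> * f (vector [u, u * v]))"
    using lborel_pair.Fubini_integral[OF int] by simp
  finally show "(LINT x|lborel. f x) = (LINT v|lborel. LINT u|lborel. \<bar>u\<bar> * f (vector [u, u * v]))" .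
  show "integrable lborel (\<lambda>v. LINT u|lborel. \<bar>u\<bar> * f (vector [u, u * v]))"
    using lborel_pair.integrable_snd[of "\<lambda>u v. \<bar>u\<bar> * f (vector [u, u * v])"] int by simp
qed

section \<open>Gaussian mixtures and the Fourier transform of the Riesz kernel\<close>

text \<open>The parameter \<open>\<kappa>\<close> is the variance, so that convolution adds parameters.\<close>

definition gauss :: "real \<Rightarrow> real \<Rightarrow> real" where
  "gauss \<kappa> t = normal_density 0 (sqrt \<kappa>) t"

lemma gauss_eq: "\<kappa> > 0 \<Longrightarrow> gauss \<kappa> t = exp (- t\<^sup>2 / (2 * \<kappa>)) / sqrt (2 * pi * \<kappa>)"
  by (simp add: gauss_def normal_density_def)

lemma gauss_nonneg [simp]: "gauss \<kappa> t \<ge> 0"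
  by (simp add: gauss_def)

lemma gauss_minus [simp]: "gauss \<kappa> (- t) = gauss \<kappa> t"
  by (simp add: gauss_def normal_density_def)

lemma measurable_gauss [measurable]:
  assumes [measurable]: "f \<in> borel_measurable M" "g \<in> borel_measurable M"
  shows "(\<lambda>x. gauss (f x) (g x)) \<in> borel_measurable M"
  unfolding gauss_def normal_density_def by measurable

lemma nn_integral_gauss: "\<kappa> > 0 \<Longrightarrow> (\<integral>\<^sup>+t. ennreal (gauss \<kappa> t) \<partial>lborel) = 1"
  using nn_integral_eq_integral[OF integrable_normal_density[of "sqrt \<kappa>" 0]] unfolding gauss_def by simp

lemma gauss_convolution:
  assumes "\<kappa> > 0" "\<tau> > 0"
  shows "(\<integral>\<^sup>+t. ennreal (gauss \<kappa> (x - t)) * ennreal (gauss \<tau> t) \<partial>lborel) = ennreal (gauss (\<kappa> + \<tau>) x)"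
  using conv_normal_density_zero_mean[of "sqrt \<kappa>" "sqrt \<tau>"] assms
  by (simp add: gauss_def ennreal_mult[symmetric] fun_eq_iff)

text \<open>The characteristic function of the standard normal distribution, rescaled.\<close>

lemma gauss_fourier:
  assumes "\<kappa> > 0"
  shows "(LINT u|lborel. complex_of_real (exp (- 2 * pi\<^sup>2 * \<kappa> * u\<^sup>2)) * exp (2 * of_real pi * \<i> * of_real (u * m))) = of_real (gauss \<kappa> m)"
    and "integrable lborel (\<lambda>u. complex_of_real (exp (- 2 * pi\<^sup>2 * \<kappa> * u\<^sup>2)) * exp (2 * of_real pi * \<i> * of_real (u * m)))"
proof -
  define c where "c = 2 * pi * sqrt \<kappa>"
  have c: "c > 0" using assms by (simp add: c_def)
  define t where "t = m / sqrt \<kappa>"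
  have ct: "t * c = 2 * pi * m" using assms by (simp add: t_def c_def)
  let ?f = "\<lambda>u. complex_of_real (exp (- 2 * pi\<^sup>2 * \<kappa> * u\<^sup>2)) * exp (2 * of_real pi * \<i> * of_real (u * m))"
  let ?g = "\<lambda>x. std_normal_density x *\<^sub>R iexp (t * x)"
  have fg: "?f u = sqrt (2 * pi) *\<^sub>R ?g (0 + c * u)" for u
  proof -
    have A: "- (0 + c * u)\<^sup>2 / 2 = - 2 * pi\<^sup>2 * \<kappa> * u\<^sup>2"
      using assms by (simp add: c_def power_mult_distrib)
    have "complex_of_real (t * (0 + c * u)) = complex_of_real (2 * pi * (u * m))"
      using ct by (simp add: mult.assoc[symmetric])
    then have B: "\<i> * complex_of_real (t * (0 + c * u)) = 2 * of_real pi * \<i> * of_real (u * m)"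
      by (simp only: of_real_mult of_real_numeral mult_ac)
    show ?thesis unfolding std_normal_density_def A B by (simp add: scaleR_conv_of_real)
  qed
  have intg: "integrable lborel ?g"
  proof -
    have "integrable lborel (\<lambda>x. std_normal_density x *\<^sub>R (1::complex))"
      by (intro integrable_scaleR_left) auto
    then show ?thesis by (rule Bochner_Integration.integrable_bound) (auto simp: norm_mult)
  qed
  show "integrable lborel ?f"
    unfolding fg using intg c by (intro integrable_scaleR_right) (subst lborel_integrable_real_affine_iff, auto)
  have "complex_of_real (exp (- t\<^sup>2 / 2)) = (LINT x|lborel. ?g x)"
    using fun_cong[OF char_std_normal_distribution, of t] unfolding char_def
    by (subst (asm) integral_density) auto
  also have "\<dots> = c *\<^sub>R (LINT u|lborel. ?g (0 + c * u))"
    using c by (subst lborel_integral_real_affine[where c = c and t = 0]) auto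
  finally have "(LINT u|lborel. ?g (0 + c * u)) = complex_of_real (exp (- t\<^sup>2 / 2) / c)"
    using c by (simp add: scaleR_conv_of_real field_simps)
  then have "(LINT u|lborel. ?f u) = complex_of_real (sqrt (2 * pi) * (exp (- t\<^sup>2 / 2) / c))"
    unfolding fg by (subst integral_scaleR_right) (simp add: scaleR_conv_of_real)
  also have "sqrt (2 * pi) * (exp (- t\<^sup>2 / 2) / c) = gauss \<kappa> m"
  proof -
    have "sqrt (2 * pi) / c = 1 / sqrt (2 * pi * \<kappa>)"
    proof -
      have "c = sqrt (2 * pi) * sqrt (2 * pi * \<kappa>)"
        unfolding c_def real_sqrt_mult[of "2 * pi" \<kappa>] mult.assoc[symmetric] by simp
      then show ?thesis using assms by simp
    qed
    moreover have "t\<^sup>2 / 2 = m\<^sup>2 / (2 * \<kappa>)" using assms by (simp add: t_def power_divide)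
    ultimately show ?thesis using assms by (simp add: gauss_eq field_simps)
  qed
  finally show "(LINT u|lborel. ?f u) = of_real (gauss \<kappa> m)" .
qed

lemma gauss_fourier_cos:
  assumes "\<kappa> > 0"
  shows "(LINT u|lborel. exp (- 2 * pi\<^sup>2 * \<kappa> * u\<^sup>2) * cos (2 * pi * u * m)) = gauss \<kappa> m"
    and "integrable lborel (\<lambda>u. exp (- 2 * pi\<^sup>2 * \<kappa> * u\<^sup>2))"
proof -
  let ?f = "\<lambda>m u. complex_of_real (exp (- 2 * pi\<^sup>2 * \<kappa> * u\<^sup>2)) * exp (2 * of_real pi * \<i> * of_real (u * m))"
  have "Re (?f m u) = exp (- 2 * pi\<^sup>2 * \<kappa> * u\<^sup>2) * cos (2 * pi * u * m)" for u
    by (simp add: Re_exp mult_ac)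
  then have "(LINT u|lborel. exp (- 2 * pi\<^sup>2 * \<kappa> * u\<^sup>2) * cos (2 * pi * u * m)) = (LINT u|lborel. Re (?f m u))"
    by simp
  also have "\<dots> = Re (LINT u|lborel. ?f m u)"
    using gauss_fourier(2)[OF assms] by (rule integral_Re)
  finally show "(LINT u|lborel. exp (- 2 * pi\<^sup>2 * \<kappa> * u\<^sup>2) * cos (2 * pi * u * m)) = gauss \<kappa> m"
    using gauss_fourier(1)[OF assms, of m] by simp
  show "integrable lborel (\<lambda>u. exp (- 2 * pi\<^sup>2 * \<kappa> * u\<^sup>2))"
    using integrable_Re[OF gauss_fourier(2)[OF assms, of 0]] by simp
qed

text \<open>The mixtures over the variance \<open>\<kappa>\<close> that represent \<open>|t|\<^sup>-\<^sup>s\<close> and \<open>|u|\<^sup>s\<^sup>-\<^sup>1\<close>, at the points \<open>t = 1\<close>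
  and \<open>u = 1\<close>. Both use the same weight \<open>\<kappa>\<^sup>-\<^sup>(\<^sup>1\<^sup>+\<^sup>s\<^sup>)\<^sup>/\<^sup>2\<close>, and \<open>exp (- 2 \<pi>\<^sup>2 \<kappa> u\<^sup>2)\<close> is the Fourier
  transform of \<open>gauss \<kappa>\<close>; this is how the two powers become Fourier transforms of each other.\<close>

definition gauss_mixture_constant :: "real \<Rightarrow> ennreal" where
  "gauss_mixture_constant s = (\<integral>\<^sup>+\<kappa>. ennreal (\<kappa> powr (- (1 + s) / 2) * gauss \<kappa> 1) * indicator {0<..} \<kappa> \<partial>lborel)"

definition exp_mixture_constant :: "real \<Rightarrow> ennreal" where
  "exp_mixture_constant s = (\<integral>\<^sup>+\<kappa>. ennreal (\<kappa> powr (- (1 + s) / 2) * exp (- 2 * pi\<^sup>2 * \<kappa>)) * indicator {0<..} \<kappa> \<partial>lborel)"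

lemma nn_integral_Ioi_scale:
  fixes f :: "real \<Rightarrow> ennreal"
  assumes [measurable]: "f \<in> borel_measurable borel" and c: "c > 0"
  shows "(\<integral>\<^sup>+x. f x * indicator {0<..} x \<partial>lborel) = (\<integral>\<^sup>+x. ennreal c * f (c * x) * indicator {0<..} x \<partial>lborel)"
proof -
  have "(\<integral>\<^sup>+x. f x * indicator {0<..} x \<partial>lborel) = ennreal \<bar>c\<bar> * (\<integral>\<^sup>+x. f (0 + c * x) * indicator {0<..} (0 + c * x) \<partial>lborel)"
    by (rule nn_integral_real_affine) (use c in auto)
  also have "\<dots> = (\<integral>\<^sup>+x. ennreal \<bar>c\<bar> * (f (0 + c * x) * indicator {0<..} (0 + c * x)) \<partial>lborel)"
    by (rule nn_integral_cmult[symmetric]) measurable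
  also have "\<dots> = (\<integral>\<^sup>+x. ennreal c * f (c * x) * indicator {0<..} x \<partial>lborel)"
    using c by (intro nn_integral_cong) (auto simp: indicator_def zero_less_mult_iff)
  finally show ?thesis .
qed

text \<open>Substitute \<open>\<kappa> = t\<^sup>2 \<kappa>'\<close>.\<close>

lemma riesz_eq_gauss_mixture:
  assumes "t \<noteq> 0"
  shows "(\<integral>\<^sup>+\<kappa>. ennreal (\<kappa> powr (- (1 + s) / 2) * gauss \<kappa> t) * indicator {0<..} \<kappa> \<partial>lborel)
    = gauss_mixture_constant s * riesz s t"
proof -
  have t2: "t\<^sup>2 > 0" using assms by simp
  have "(\<integral>\<^sup>+\<kappa>. ennreal (\<kappa> powr (- (1 + s) / 2) * gauss \<kappa> t) * indicator {0<..} \<kappa> \<partial>lborel)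
     = (\<integral>\<^sup>+\<kappa>. ennreal (t\<^sup>2) * ennreal ((t\<^sup>2 * \<kappa>) powr (- (1 + s) / 2) * gauss (t\<^sup>2 * \<kappa>) t) * indicator {0<..} \<kappa> \<partial>lborel)"
    by (rule nn_integral_Ioi_scale[OF _ t2]) measurable
  also have "\<dots> = (\<integral>\<^sup>+\<kappa>. ennreal (\<kappa> powr (- (1 + s) / 2) * gauss \<kappa> 1) * indicator {0<..} \<kappa> * riesz s t \<partial>lborel)"
  proof (rule nn_integral_cong)
    fix \<kappa> :: real
    show "ennreal (t\<^sup>2) * ennreal ((t\<^sup>2 * \<kappa>) powr (- (1 + s) / 2) * gauss (t\<^sup>2 * \<kappa>) t) * indicator {0<..} \<kappa>
      = ennreal (\<kappa> powr (- (1 + s) / 2) * gauss \<kappa> 1) * indicator {0<..} \<kappa> * riesz s t"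
    proof (cases "\<kappa> > 0")
      case True
      have g: "gauss (t\<^sup>2 * \<kappa>) t = gauss \<kappa> 1 / \<bar>t\<bar>"
        using True t2 by (simp add: gauss_eq real_sqrt_mult power_divide)
      have p: "(t\<^sup>2 * \<kappa>) powr (- (1 + s) / 2) = \<bar>t\<bar> powr (- (1 + s)) * \<kappa> powr (- (1 + s) / 2)"
        using True t2 power2_powr_half[of "\<bar>t\<bar>" "- (1 + s)"] by (simp add: powr_mult)
      have q: "t\<^sup>2 * \<bar>t\<bar> powr (- (1 + s)) / \<bar>t\<bar> = \<bar>t\<bar> powr (- s)"
      proof -
        have "\<bar>t\<bar> powr (- s) = \<bar>t\<bar> * \<bar>t\<bar> powr (- (1 + s))"
          using powr_add[of "\<bar>t\<bar>" 1 "- (1 + s)"] assms by simp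
        moreover have "t\<^sup>2 / \<bar>t\<bar> = \<bar>t\<bar>" using assms by (simp add: power2_eq_square abs_if)
        ultimately show ?thesis by (metis times_divide_eq_left)
      qed
      have "t\<^sup>2 * ((t\<^sup>2 * \<kappa>) powr (- (1 + s) / 2) * gauss (t\<^sup>2 * \<kappa>) t) = \<kappa> powr (- (1 + s) / 2) * gauss \<kappa> 1 * (t\<^sup>2 * \<bar>t\<bar> powr (- (1 + s)) / \<bar>t\<bar>)"
        unfolding g p by simp
      then have "ennreal (t\<^sup>2) * ennreal ((t\<^sup>2 * \<kappa>) powr (- (1 + s) / 2) * gauss (t\<^sup>2 * \<kappa>) t) = ennreal (\<kappa> powr (- (1 + s) / 2) * gauss \<kappa> 1) * ennreal (\<bar>t\<bar> powr (- s))"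
        unfolding q by (simp add: ennreal_mult'[symmetric])
      with True assms show ?thesis by (simp add: riesz_nonzero)
    qed auto
  qed
  also have "\<dots> = gauss_mixture_constant s * riesz s t"
    unfolding gauss_mixture_constant_def by (rule nn_integral_multc) measurable
  finally show ?thesis .
qed

text \<open>Substitute \<open>\<kappa> = \<kappa>' / u\<^sup>2\<close>.\<close>

lemma riesz_eq_exp_mixture:
  assumes "u \<noteq> 0"
  shows "(\<integral>\<^sup>+\<kappa>. ennreal (\<kappa> powr (- (1 + s) / 2) * exp (- 2 * pi\<^sup>2 * \<kappa> * u\<^sup>2)) * indicator {0<..} \<kappa> \<partial>lborel)
    = exp_mixture_constant s * ennreal (\<bar>u\<bar> powr (s - 1))"
proof -
  have u2: "u\<^sup>2 > 0" using assms by simp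
  have "exp_mixture_constant s = (\<integral>\<^sup>+\<kappa>. ennreal (u\<^sup>2) * ennreal ((u\<^sup>2 * \<kappa>) powr (- (1 + s) / 2) * exp (- 2 * pi\<^sup>2 * (u\<^sup>2 * \<kappa>))) * indicator {0<..} \<kappa> \<partial>lborel)"
    unfolding exp_mixture_constant_def by (rule nn_integral_Ioi_scale[OF _ u2]) measurable
  also have "\<dots> = (\<integral>\<^sup>+\<kappa>. ennreal (\<kappa> powr (- (1 + s) / 2) * exp (- 2 * pi\<^sup>2 * \<kappa> * u\<^sup>2)) * indicator {0<..} \<kappa> * ennreal (\<bar>u\<bar> powr (1 - s)) \<partial>lborel)"
  proof (rule nn_integral_cong)
    fix \<kappa> :: real
    show "ennreal (u\<^sup>2) * ennreal ((u\<^sup>2 * \<kappa>) powr (- (1 + s) / 2) * exp (- 2 * pi\<^sup>2 * (u\<^sup>2 * \<kappa>))) * indicator {0<..} \<kappa>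
      = ennreal (\<kappa> powr (- (1 + s) / 2) * exp (- 2 * pi\<^sup>2 * \<kappa> * u\<^sup>2)) * indicator {0<..} \<kappa> * ennreal (\<bar>u\<bar> powr (1 - s))"
    proof (cases "\<kappa> > 0")
      case True
      have p: "(u\<^sup>2 * \<kappa>) powr (- (1 + s) / 2) = \<bar>u\<bar> powr (- (1 + s)) * \<kappa> powr (- (1 + s) / 2)"
        using True u2 power2_powr_half[of "\<bar>u\<bar>" "- (1 + s)"] by (simp add: powr_mult)
      have q: "u\<^sup>2 * \<bar>u\<bar> powr (- (1 + s)) = \<bar>u\<bar> powr (1 - s)"
        using powr_add[of "\<bar>u\<bar>" 2 "- (1 + s)"] assms by simp
      have "u\<^sup>2 * ((u\<^sup>2 * \<kappa>) powr (- (1 + s) / 2) * exp (- 2 * pi\<^sup>2 * (u\<^sup>2 * \<kappa>))) = \<kappa> powr (- (1 + s) / 2) * exp (- 2 * pi\<^sup>2 * \<kappa> * u\<^sup>2) * (u\<^sup>2 * \<bar>u\<bar> powr (- (1 + s)))"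
        unfolding p by (simp add: mult_ac)
      then have "ennreal (u\<^sup>2) * ennreal ((u\<^sup>2 * \<kappa>) powr (- (1 + s) / 2) * exp (- 2 * pi\<^sup>2 * (u\<^sup>2 * \<kappa>)))
         = ennreal (\<kappa> powr (- (1 + s) / 2) * exp (- 2 * pi\<^sup>2 * \<kappa> * u\<^sup>2)) * ennreal (\<bar>u\<bar> powr (1 - s))"
        unfolding q by (simp add: ennreal_mult'[symmetric])
      with True show ?thesis by simp
    qed auto
  qed
  also have "\<dots> = (\<integral>\<^sup>+\<kappa>. ennreal (\<kappa> powr (- (1 + s) / 2) * exp (- 2 * pi\<^sup>2 * \<kappa> * u\<^sup>2)) * indicator {0<..} \<kappa> \<partial>lborel) * ennreal (\<bar>u\<bar> powr (1 - s))"
    by (rule nn_integral_multc) measurable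
  finally have "exp_mixture_constant s * ennreal (\<bar>u\<bar> powr (s - 1)) = (\<integral>\<^sup>+\<kappa>. ennreal (\<kappa> powr (- (1 + s) / 2) * exp (- 2 * pi\<^sup>2 * \<kappa> * u\<^sup>2)) * indicator {0<..} \<kappa> \<partial>lborel) * (ennreal (\<bar>u\<bar> powr (1 - s)) * ennreal (\<bar>u\<bar> powr (s - 1)))"
    by (simp add: mult.assoc)
  also have "ennreal (\<bar>u\<bar> powr (1 - s)) * ennreal (\<bar>u\<bar> powr (s - 1)) = ennreal 1"
    using powr_add[of "\<bar>u\<bar>" "1 - s" "s - 1", symmetric] assms by (simp add: ennreal_mult'[symmetric])
  finally show ?thesis by simp
qed

lemma exp_minus_le_inverse_square: "exp (- x) \<le> 2 / x\<^sup>2" if "x > 0" for x :: real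
proof -
  have "x\<^sup>2 / 2 \<le> exp x" using exp_lower_Taylor_quadratic[of x] that by simp
  then show ?thesis using that by (simp add: exp_minus field_simps)
qed

lemma nn_integral_powr_head:
  fixes a :: real
  assumes "a > -1"
  shows "(\<integral>\<^sup>+x. ennreal (x powr a) * indicator {0..1} x \<partial>lborel) < \<infinity>"
  using nn_integral_has_integral_lebesgue'[OF _ has_integral_powr_from_0[of a 1]] assms by auto

lemma nn_integral_Ioi_finite: "(\<integral>\<^sup>+\<kappa>. ennreal (f \<kappa>) * indicator {0<..} \<kappa> \<partial>lborel) < \<infinity>"
    if f: "\<And>\<kappa>. 0 < \<kappa> \<Longrightarrow> \<kappa> \<le> 1 \<Longrightarrow> f \<kappa> \<le> K * \<kappa> powr a" "\<And>\<kappa>. 1 \<le> \<kappa> \<Longrightarrow> f \<kappa> \<le> K' * \<kappa> powr (- b - 1)"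
      and ab: "a > -1" "b > 0" "K \<ge> 0" "K' \<ge> 0" for f K K' a b
  proof -
    have "(\<integral>\<^sup>+\<kappa>. ennreal (f \<kappa>) * indicator {0<..} \<kappa> \<partial>lborel)
       \<le> (\<integral>\<^sup>+\<kappa>. ennreal K * (ennreal (\<kappa> powr a) * indicator {0..1} \<kappa>) + ennreal K' * (ennreal (\<kappa> powr (- b - 1)) * indicator {1..} \<kappa>) \<partial>lborel)"
    proof (rule nn_integral_mono)
      fix \<kappa> :: real
      consider "\<kappa> \<le> 0" | "0 < \<kappa>" "\<kappa> < 1" | "\<kappa> \<ge> 1" by linarith
      then show "ennreal (f \<kappa>) * indicator {0<..} \<kappa> \<le> ennreal K * (ennreal (\<kappa> powr a) * indicator {0..1} \<kappa>) + ennreal K' * (ennreal (\<kappa> powr (- b - 1)) * indicator {1..} \<kappa>)"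
      proof cases
        case 2
        with f(1)[of \<kappa>] ab show ?thesis by (simp add: ennreal_mult'[symmetric] ennreal_leI)
      next
        case 3
        with f(2)[of \<kappa>] ab show ?thesis
          by (auto simp: ennreal_mult'[symmetric] ennreal_leI intro: add_increasing)
      qed auto
    qed
    also have "\<dots> = ennreal K * (\<integral>\<^sup>+\<kappa>. ennreal (\<kappa> powr a) * indicator {0..1} \<kappa> \<partial>lborel) + ennreal K' * (\<integral>\<^sup>+\<kappa>. ennreal (\<kappa> powr (- b - 1)) * indicator {1..} \<kappa> \<partial>lborel)"
      by (simp add: nn_integral_add nn_integral_cmult)
    also have "\<dots> < \<infinity>"
      using nn_integral_powr_head[OF ab(1)] nn_integral_powr_tail[of b 1] ab
      by (simp add: ennreal_mult_less_top)
    finally show ?thesis .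
  qed

text \<open>At \<open>\<kappa> \<rightarrow> 0\<close> the Gaussian at \<open>1\<close> vanishes faster than any power, and the exponential mixture has
  the singularity \<open>\<kappa>\<^sup>-\<^sup>(\<^sup>1\<^sup>+\<^sup>s\<^sup>)\<^sup>/\<^sup>2\<close>, integrable as \<open>s < 1\<close>. At \<open>\<kappa> \<rightarrow> \<infinity>\<close> the Gaussian mixture decays
  like \<open>\<kappa>\<^sup>-\<^sup>1\<^sup>-\<^sup>s\<^sup>/\<^sup>2\<close>, integrable as \<open>s > 0\<close>.\<close>

lemma mixture_constants_finite:
  assumes s: "0 < s" "s < 1"
  shows "gauss_mixture_constant s < \<infinity>" "exp_mixture_constant s < \<infinity>"
    "gauss_mixture_constant s > 0" "exp_mixture_constant s > 0"
proof -
  have pos: "(\<integral>\<^sup>+\<kappa>. ennreal (f \<kappa>) * indicator {0<..} \<kappa> \<partial>lborel) > 0"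
    if f: "\<And>\<kappa>::real. 0 < \<kappa> \<Longrightarrow> f \<kappa> > (0::real)" and [measurable]: "f \<in> borel_measurable borel" for f
  proof (rule ccontr)
    assume "\<not> ?thesis"
    then have "(\<integral>\<^sup>+\<kappa>. ennreal (f \<kappa>) * indicator {0<..} \<kappa> \<partial>lborel) = 0" by (simp add: zero_less_iff_neq_zero)
    then have "AE \<kappa> in lborel. ennreal (f \<kappa>) * indicator {0<..} \<kappa> = 0"
      by (subst (asm) nn_integral_0_iff_AE) auto
    then have "AE \<kappa>::real in lborel. \<kappa> \<notin> {0<..<1}"
    proof eventually_elim
      case (elim \<kappa>)
      then show ?case using f[of \<kappa>] by (auto simp: indicator_def split: if_splits)
    qed
    then have "{0<..<1::real} \<in> null_sets lborel" by (subst (asm) AE_iff_null_sets[symmetric]) auto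
    then show False by (auto simp: null_sets_def)
  qed
  show "gauss_mixture_constant s < \<infinity>"
    unfolding gauss_mixture_constant_def
  \<comment> \<open>The constant \<open>8\<close> comes from \<open>exp (- x) \<le> 2 / x\<^sup>2\<close> at \<open>x = 1 / (2 \<kappa>)\<close>.\<close>
  proof (rule nn_integral_Ioi_finite[where a = 0 and b = "s / 2" and K = 8 and K' = 1])
    have g: "\<kappa> powr (- (1 + s) / 2) * gauss \<kappa> 1 \<le> \<kappa> powr (- (s / 2) - 1) * exp (- 1 / (2 * \<kappa>))" if "\<kappa> > 0" for \<kappa>
    proof -
      have "1 / sqrt (2 * pi * \<kappa>) \<le> 1 / sqrt \<kappa>"
        using that pi_gt3 by (intro divide_left_mono) auto
      also have "1 / sqrt \<kappa> = \<kappa> powr (- (1 / 2))" using that by (simp add: powr_minus_divide powr_half_sqrt)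
      finally have "1 / sqrt (2 * pi * \<kappa>) \<le> \<kappa> powr (- (1 / 2))" .
      then have "gauss \<kappa> 1 \<le> \<kappa> powr (- (1 / 2)) * exp (- 1 / (2 * \<kappa>))"
        using that mult_right_mono[of "1 / sqrt (2 * pi * \<kappa>)" "\<kappa> powr (- (1 / 2))" "exp (- 1 / (2 * \<kappa>))"]
        by (simp add: gauss_eq)
      then have "\<kappa> powr (- (1 + s) / 2) * gauss \<kappa> 1 \<le> \<kappa> powr (- (1 + s) / 2) * (\<kappa> powr (- (1 / 2)) * exp (- 1 / (2 * \<kappa>)))"
        by (intro mult_left_mono) auto
      also have "\<dots> = (\<kappa> powr (- (1 + s) / 2) * \<kappa> powr (- (1 / 2))) * exp (- 1 / (2 * \<kappa>))" by simp
      also have "\<kappa> powr (- (1 + s) / 2) * \<kappa> powr (- (1 / 2)) = \<kappa> powr (- (s / 2) - 1)"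
        unfolding powr_add[symmetric] by (rule arg_cong[where f = "\<lambda>z. \<kappa> powr z"]) (simp add: field_simps)
      finally show ?thesis .
    qed
    show "\<kappa> powr (- (1 + s) / 2) * gauss \<kappa> 1 \<le> 8 * \<kappa> powr 0" if "0 < \<kappa>" "\<kappa> \<le> 1" for \<kappa>
    proof -
      have "exp (- 1 / (2 * \<kappa>)) \<le> 8 * \<kappa>\<^sup>2"
        using exp_minus_le_inverse_square[of "1 / (2 * \<kappa>)"] that by (simp add: power_divide power_mult_distrib)
      then have "\<kappa> powr (- (s / 2) - 1) * exp (- 1 / (2 * \<kappa>)) \<le> \<kappa> powr (- (s / 2) - 1) * (8 * \<kappa>\<^sup>2)"
        by (intro mult_left_mono) auto
      also have "\<dots> = 8 * (\<kappa> powr (- (s / 2) - 1) * \<kappa> powr 2)" using that by simp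
      also have "\<kappa> powr (- (s / 2) - 1) * \<kappa> powr 2 = \<kappa> powr (1 - s / 2)" by (simp add: powr_add[symmetric])
      also have "8 * \<kappa> powr (1 - s / 2) \<le> 8 * 1"
        using that s by (intro mult_left_mono powr_le1) auto
      finally show ?thesis using g[OF that(1)] that by simp
    qed
    show "\<kappa> powr (- (1 + s) / 2) * gauss \<kappa> 1 \<le> 1 * \<kappa> powr (- (s / 2) - 1)" if "1 \<le> \<kappa>" for \<kappa>
    proof -
      have "\<kappa> powr (- (s / 2) - 1) * exp (- 1 / (2 * \<kappa>)) \<le> \<kappa> powr (- (s / 2) - 1) * 1"
        using that by (intro mult_left_mono) auto
      from order_trans[OF g this] that show ?thesis by simp
    qed
  qed (use s in auto)
  show "exp_mixture_constant s < \<infinity>"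
    unfolding exp_mixture_constant_def
  proof (rule nn_integral_Ioi_finite[where a = "- (1 + s) / 2" and b = 1 and K = 1 and K' = 2])
    show "\<kappa> powr (- (1 + s) / 2) * exp (- 2 * pi\<^sup>2 * \<kappa>) \<le> 1 * \<kappa> powr (- (1 + s) / 2)" if "0 < \<kappa>" for \<kappa>
      using that by simp
    show "\<kappa> powr (- (1 + s) / 2) * exp (- 2 * pi\<^sup>2 * \<kappa>) \<le> 2 * \<kappa> powr (- 1 - 1)" if "1 \<le> \<kappa>" for \<kappa>
    proof -
      have 1: "\<kappa> powr (- (1 + s) / 2) \<le> \<kappa> powr 0" using that s by (intro powr_mono) auto
      have "1\<^sup>2 \<le> pi\<^sup>2" using pi_gt3 by (intro power_mono) auto
      then have "1 \<le> 2 * pi\<^sup>2" by simp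
      then have "1 * \<kappa> \<le> 2 * pi\<^sup>2 * \<kappa>" using that by (intro mult_right_mono) auto
      then have "exp (- 2 * pi\<^sup>2 * \<kappa>) \<le> exp (- \<kappa>)" by simp
      also have "exp (- \<kappa>) \<le> 2 / \<kappa>\<^sup>2"
        using exp_minus_le_inverse_square[of \<kappa>] that by simp
      also have "2 / \<kappa>\<^sup>2 = 2 * \<kappa> powr (- 1 - 1)" using that by (simp add: powr_minus_divide)
      finally have 2: "exp (- 2 * pi\<^sup>2 * \<kappa>) \<le> 2 * \<kappa> powr (- 1 - 1)" .
      show ?thesis using mult_mono[OF 1 2] that by simp
    qed
  qed (use s in auto)
  show "gauss_mixture_constant s > 0" unfolding gauss_mixture_constant_def
    by (rule pos) (auto simp: gauss_eq)
  show "exp_mixture_constant s > 0" unfolding exp_mixture_constant_def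
    by (rule pos) auto
qed

section \<open>Modulated Gaussians as test functions\<close>

text \<open>The polynomial factors that arise when a modulated Gaussian is differentiated repeatedly.\<close>

inductive plane_poly :: "(real^2 \<Rightarrow> complex) \<Rightarrow> bool" where
  const: "plane_poly (\<lambda>x. c)"
| coord: "plane_poly (\<lambda>x. complex_of_real (x $ i))"
| add: "plane_poly f \<Longrightarrow> plane_poly g \<Longrightarrow> plane_poly (\<lambda>x. f x + g x)"
| mult: "plane_poly f \<Longrightarrow> plane_poly g \<Longrightarrow> plane_poly (\<lambda>x. f x * g x)"

lemma plane_poly_differentiable: "plane_poly f \<Longrightarrow> f differentiable (at x)"
proof (induction rule: plane_poly.induct)
  case (coord i)
  have "((\<lambda>x::real^2. complex_of_real (x $ i)) has_derivative (\<lambda>h. complex_of_real (h $ i))) (at x)"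
    by (intro bounded_linear_imp_has_derivative bounded_linear_compose[OF bounded_linear_of_real bounded_linear_vec_nth])
  then show ?case by (rule differentiableI)
qed (auto intro: differentiable_add differentiable_mult)

lemma plane_poly_directional_derivative:
  "plane_poly f \<Longrightarrow> \<exists>g. plane_poly g \<and> (\<forall>x. ((\<lambda>t. f (x + t *\<^sub>R axis j 1)) has_vector_derivative g x) (at 0))"
proof (induction rule: plane_poly.induct)
  case (const c)
  show ?case by (rule exI[of _ "\<lambda>x. 0"]) (auto intro: plane_poly.const)
next
  case (coord i)
  have "((\<lambda>t. complex_of_real ((x + t *\<^sub>R axis j 1) $ i)) has_vector_derivative (if i = j then 1 else 0)) (at 0)"
    for x :: "real^2"
  proof -
    have "((\<lambda>t. complex_of_real (x $ i) + t *\<^sub>R (if i = j then 1 else 0)) has_vector_derivative 0 + (1 *\<^sub>R (if i = j then 1 else 0))) (at 0)"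
      by (intro has_vector_derivative_add has_vector_derivative_const has_vector_derivative_scaleR[THEN has_vector_derivative_eq_rhs])
         (auto intro: derivative_eq_intros)
    moreover have "complex_of_real ((x + t *\<^sub>R axis j 1) $ i) = complex_of_real (x $ i) + t *\<^sub>R (if i = j then 1 else 0)" for t
      by (simp add: axis_def scaleR_conv_of_real[of t "1::complex"])
    ultimately show ?thesis by simp
  qed
  then show ?case by (intro exI[of _ "\<lambda>x. if i = j then 1 else 0"]) (auto intro: plane_poly.const)
next
  case (add f g)
  then obtain f' g' where "plane_poly f'" "plane_poly g'"
    and "\<And>x. ((\<lambda>t. f (x + t *\<^sub>R axis j 1)) has_vector_derivative f' x) (at 0)"
    and "\<And>x. ((\<lambda>t. g (x + t *\<^sub>R axis j 1)) has_vector_derivative g' x) (at 0)" by blast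
  then show ?case
    by (intro exI[of _ "\<lambda>x. f' x + g' x"]) (auto intro: plane_poly.add has_vector_derivative_add)
next
  case (mult f g)
  then obtain f' g' where *: "plane_poly f'" "plane_poly g'"
    and d: "\<And>x. ((\<lambda>t. f (x + t *\<^sub>R axis j 1)) has_vector_derivative f' x) (at 0)"
     "\<And>x. ((\<lambda>t. g (x + t *\<^sub>R axis j 1)) has_vector_derivative g' x) (at 0)" by blast
  have "((\<lambda>t. f (x + t *\<^sub>R axis j 1) * g (x + t *\<^sub>R axis j 1)) has_vector_derivative f x * g' x + f' x * g x) (at 0)" for x
    using has_vector_derivative_mult[OF d[of x]] by simp
  then show ?case
    using * mult.hyps by (intro exI[of _ "\<lambda>x. f x * g' x + f' x * g x"]) (auto intro: plane_poly.intros)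
qed

lemma plane_poly_growth: "plane_poly f \<Longrightarrow> \<exists>C N. C \<ge> 0 \<and> (\<forall>x. norm (f x) \<le> C * (1 + norm x) ^ N)"
proof (induction rule: plane_poly.induct)
  case (const c)
  show ?case by (intro exI[of _ "norm c"] exI[of _ 0]) auto
next
  case (coord i)
  have "norm (complex_of_real (x $ i)) \<le> 1 * (1 + norm x) ^ 1" for x :: "real^2"
    using component_le_norm_cart[of x i] by simp
  then show ?case by (intro exI[of _ 1] exI[of _ 1]) auto
next
  case (add f g)
  then obtain C N D M where "C \<ge> 0" "D \<ge> 0"
    and f: "\<And>x. norm (f x) \<le> C * (1 + norm x) ^ N" and g: "\<And>x. norm (g x) \<le> D * (1 + norm x) ^ M" by blast
  have "norm (f x + g x) \<le> (C + D) * (1 + norm x) ^ (N + M)" for x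
  proof -
    have "norm (f x + g x) \<le> C * (1 + norm x) ^ N + D * (1 + norm x) ^ M"
      by (rule norm_triangle_le) (intro add_mono f g)
    also have "\<dots> \<le> C * (1 + norm x) ^ (N + M) + D * (1 + norm x) ^ (N + M)"
      using \<open>C \<ge> 0\<close> \<open>D \<ge> 0\<close> by (intro add_mono mult_left_mono power_increasing) auto
    finally show ?thesis by (simp add: distrib_right)
  qed
  then show ?case using \<open>C \<ge> 0\<close> \<open>D \<ge> 0\<close> by (intro exI[of _ "C + D"] exI[of _ "N + M"]) auto
next
  case (mult f g)
  then obtain C N D M where "C \<ge> 0" "D \<ge> 0"
    and f: "\<And>x. norm (f x) \<le> C * (1 + norm x) ^ N" and g: "\<And>x. norm (g x) \<le> D * (1 + norm x) ^ M" by blast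
  have "norm (f x * g x) \<le> (C * D) * (1 + norm x) ^ (N + M)" for x
  proof -
    have "norm (f x * g x) \<le> (C * (1 + norm x) ^ N) * (D * (1 + norm x) ^ M)"
      unfolding norm_mult using \<open>C \<ge> 0\<close> by (intro mult_mono f g) auto
    then show ?thesis by (simp add: power_add mult_ac)
  qed
  then show ?case using \<open>C \<ge> 0\<close> \<open>D \<ge> 0\<close> by (intro exI[of _ "C * D"] exI[of _ "N + M"]) auto
qed

text \<open>Its Fourier transform is a Gaussian density centred at \<open>y\<close>. Pairing the Fourier transform of \<open>T\<close>
  with it therefore gives the average of \<open>T\<close> over a Gaussian around \<open>y\<close>.\<close>

definition modulated_gaussian :: "real \<Rightarrow> real^2 \<Rightarrow> real^2 \<Rightarrow> complex" where
  "modulated_gaussian a y x = exp (complex_of_real (- a * (x \<bullet> x)) + 2 * of_real pi * \<i> * of_real (y \<bullet> x))"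

lemma modulated_gaussian_has_derivative:
  "(modulated_gaussian a y has_derivative (\<lambda>h. modulated_gaussian a y x * (of_real (- 2 * a * (x \<bullet> h)) + 2 * of_real pi * \<i> * of_real (y \<bullet> h)))) (at x)"
proof -
  have "((\<lambda>x. complex_of_real (- a * (x \<bullet> x)) + 2 * of_real pi * \<i> * of_real (y \<bullet> x)) has_derivative
     (\<lambda>h. of_real (- 2 * a * (x \<bullet> h)) + 2 * of_real pi * \<i> * of_real (y \<bullet> h))) (at x)"
    by (auto intro!: derivative_eq_intros simp: inner_commute algebra_simps)
  moreover have "(exp has_derivative (\<lambda>h. exp z * h)) (at z)" for z :: complex
    using DERIV_exp[of z] by (simp add: has_field_derivative_def)
  ultimately show ?thesis
    unfolding modulated_gaussian_def by (rule has_derivative_compose)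
qed

lemma partial_deriv_gaussian:
  assumes f: "plane_poly f"
  shows "\<exists>g. plane_poly g \<and> partial_deriv j (\<lambda>x. f x * modulated_gaussian a y x) = (\<lambda>x. g x * modulated_gaussian a y x)"
proof -
  obtain f' where f': "plane_poly f'" "\<And>x. ((\<lambda>t. f (x + t *\<^sub>R axis j 1)) has_vector_derivative f' x) (at 0)"
    using plane_poly_directional_derivative[OF f, of j] by blast
  define q where "q x = complex_of_real (- 2 * a) * complex_of_real (x $ j) + 2 * of_real pi * \<i> * of_real (y $ j)" for x
  have q: "plane_poly q" unfolding q_def by (intro plane_poly.intros)
  have G: "((\<lambda>t. modulated_gaussian a y (x + t *\<^sub>R axis j 1)) has_vector_derivative modulated_gaussian a y x * q x) (at 0)" for x
  proof -
    have "((\<lambda>t::real. x + t *\<^sub>R axis j 1) has_derivative (\<lambda>t. t *\<^sub>R axis j 1)) (at 0)"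
      by (auto intro!: derivative_eq_intros)
    moreover have "(modulated_gaussian a y has_derivative (\<lambda>h. modulated_gaussian a y x * (of_real (- 2 * a * (x \<bullet> h)) + 2 * of_real pi * \<i> * of_real (y \<bullet> h)))) (at (x + 0 *\<^sub>R axis j 1))"
      unfolding scaleR_zero_left add_0_right by (rule modulated_gaussian_has_derivative)
    ultimately have "((\<lambda>t. modulated_gaussian a y (x + t *\<^sub>R axis j 1)) has_derivative
      (\<lambda>t. modulated_gaussian a y x * (of_real (- 2 * a * (x \<bullet> (t *\<^sub>R axis j 1))) + 2 * of_real pi * \<i> * of_real (y \<bullet> (t *\<^sub>R axis j 1))))) (at 0)"
      by (rule has_derivative_compose)
    then show ?thesis
      unfolding has_vector_derivative_def
      by (rule has_derivative_eq_rhs) (auto simp: fun_eq_iff q_def inner_axis scaleR_conv_of_real[where 'a = complex] algebra_simps)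
  qed
  have "((\<lambda>t. f (x + t *\<^sub>R axis j 1) * modulated_gaussian a y (x + t *\<^sub>R axis j 1)) has_vector_derivative
     (f' x + f x * q x) * modulated_gaussian a y x) (at 0)" for x
    using has_vector_derivative_mult[OF f'(2)[of x] G[of x]]
    by (simp add: algebra_simps)
  then have "partial_deriv j (\<lambda>x. f x * modulated_gaussian a y x) = (\<lambda>x. (f' x + f x * q x) * modulated_gaussian a y x)"
    unfolding partial_deriv_def by (intro ext vector_derivative_at)
  moreover have "plane_poly (\<lambda>x. f' x + f x * q x)" by (intro plane_poly.intros f f' q)
  ultimately show ?thesis by blast
qed

lemma foldr_partial_deriv_gaussian:
  "\<exists>g. plane_poly g \<and> foldr partial_deriv is (modulated_gaussian a y) = (\<lambda>x. g x * modulated_gaussian a y x)"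
proof (induction "is")
  case Nil
  show ?case by (rule exI[of _ "\<lambda>x. 1"]) (auto intro: plane_poly.const)
next
  case (Cons i "is")
  then obtain g where "plane_poly g" "foldr partial_deriv is (modulated_gaussian a y) = (\<lambda>x. g x * modulated_gaussian a y x)"
    by blast
  with partial_deriv_gaussian[of g i a y] show ?case by simp
qed

lemma norm_modulated_gaussian: "norm (modulated_gaussian a y x) = exp (- a * (norm x)\<^sup>2)"
  by (simp add: modulated_gaussian_def Re_exp power2_norm_eq_inner)

text \<open>Every iterated partial derivative is a polynomial times the Gaussian, and the polynomial factor
  is absorbed after bounding it by an exponential and completing the square.\<close>

lemma schwartz_modulated_gaussian:
  assumes a: "a > 0"
  shows "schwartz (modulated_gaussian a y)"
  unfolding schwartz_def
proof (intro allI conjI)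
  fix "is" and k :: nat and x :: "real^2"
  obtain g where g: "plane_poly g" "foldr partial_deriv is (modulated_gaussian a y) = (\<lambda>x. g x * modulated_gaussian a y x)"
    using foldr_partial_deriv_gaussian by blast
  show "foldr partial_deriv is (modulated_gaussian a y) differentiable (at x)"
    unfolding g(2)
    by (intro differentiable_mult plane_poly_differentiable g differentiableI[OF modulated_gaussian_has_derivative])
  obtain C N where C: "C \<ge> 0" "\<And>x. norm (g x) \<le> C * (1 + norm x) ^ N"
    using plane_poly_growth[OF g(1)] by blast
  have "norm x ^ k * norm (g x * modulated_gaussian a y x) \<le> C * exp ((real (N + k))\<^sup>2 / (4 * a))" for x
  proof -
    define t where "t = norm x"
    have t: "t \<ge> 0" by (simp add: t_def)
    have e: "(1 + t) ^ (N + k) \<le> exp (real (N + k) * t)"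
      using t power_mono[OF exp_ge_add_one_self, of t "N + k"] by (simp add: exp_of_nat_mult del: of_nat_add)
    have q: "real (N + k) * t - a * t\<^sup>2 \<le> (real (N + k))\<^sup>2 / (4 * a)"
    proof -
      have "0 \<le> a * (t - real (N + k) / (2 * a))\<^sup>2" using a by simp
      also have "\<dots> = a * t\<^sup>2 - real (N + k) * t + (real (N + k))\<^sup>2 / (4 * a)"
        using a by (simp add: power2_eq_square field_simps del: of_nat_add)
      finally show ?thesis by simp
    qed
    have "norm x ^ k * norm (g x * modulated_gaussian a y x) = t ^ k * norm (g x) * exp (- a * t\<^sup>2)"
      by (simp add: norm_mult norm_modulated_gaussian t_def)
    also have "\<dots> \<le> (1 + t) ^ k * (C * (1 + t) ^ N) * exp (- a * t\<^sup>2)"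
      using t C by (intro mult_right_mono mult_mono power_mono) (auto simp: t_def)
    also have "\<dots> = C * ((1 + t) ^ (N + k) * exp (- a * t\<^sup>2))" by (simp add: power_add mult_ac)
    also have "\<dots> \<le> C * (exp (real (N + k) * t) * exp (- a * t\<^sup>2))"
      using C e by (intro mult_left_mono mult_right_mono) auto
    also have "exp (real (N + k) * t) * exp (- a * t\<^sup>2) = exp (real (N + k) * t - a * t\<^sup>2)"
      by (simp add: exp_add[symmetric])
    also have "C * \<dots> \<le> C * exp ((real (N + k))\<^sup>2 / (4 * a))"
      using C q by (intro mult_left_mono) auto
    finally show ?thesis .
  qed
  then show "\<exists>C. \<forall>x. norm x ^ k * norm (foldr partial_deriv is (modulated_gaussian a y) x) \<le> C"
    unfolding g(2) by blast
qed

definition gauss2 :: "real \<Rightarrow> real^2 \<Rightarrow> real" where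
  "gauss2 \<kappa> x = gauss \<kappa> (x $ 1) * gauss \<kappa> (x $ 2)"

lemma gauss2_nonneg [simp]: "gauss2 \<kappa> x \<ge> 0"
  by (simp add: gauss2_def)

lemma measurable_gauss2 [measurable]: "gauss2 \<kappa> \<in> borel_measurable borel"
  unfolding gauss2_def by measurable

lemma measurable_modulated_gaussian [measurable]: "modulated_gaussian a y \<in> borel_measurable borel"
  unfolding modulated_gaussian_def by measurable

lemma nn_integral_gauss2: "\<kappa> > 0 \<Longrightarrow> (\<integral>\<^sup>+x. ennreal (gauss2 \<kappa> x) \<partial>lborel) = 1"
  by (subst nn_integral_plane)
     (simp_all add: gauss2_def ennreal_mult nn_integral_cmult nn_integral_multc nn_integral_gauss)

lemma fourier_modulated_gaussian:
  assumes "\<kappa> > 0"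
  shows "fourier (modulated_gaussian (2 * pi\<^sup>2 * \<kappa>) y) x = of_real (gauss2 \<kappa> (x - y))"
proof -
  let ?F = "\<lambda>m u. complex_of_real (exp (- 2 * pi\<^sup>2 * \<kappa> * u\<^sup>2)) * exp (2 * of_real pi * \<i> * of_real (u * m))"
  have eq: "modulated_gaussian (2 * pi\<^sup>2 * \<kappa>) y \<xi> * exp (- 2 * of_real pi * \<i> * of_real (\<xi> \<bullet> x))
      = ?F (y $ 1 - x $ 1) (\<xi> $ 1) * ?F (y $ 2 - x $ 2) (\<xi> $ 2)" for \<xi>
    unfolding modulated_gaussian_def exp_of_real[symmetric] exp_add[symmetric]
    by (rule arg_cong[where f = exp]) (simp add: inner_2 power2_eq_square algebra_simps)
  have int: "integrable lborel (\<lambda>\<xi>. modulated_gaussian (2 * pi\<^sup>2 * \<kappa>) y \<xi> * exp (- 2 * of_real pi * \<i> * of_real (\<xi> \<bullet> x)))"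
  proof (rule integrableI_bounded)
    have "(\<integral>\<^sup>+\<xi>. ennreal (norm (modulated_gaussian (2 * pi\<^sup>2 * \<kappa>) y \<xi> * exp (- 2 * of_real pi * \<i> * of_real (\<xi> \<bullet> x)))) \<partial>lborel)
       = (\<integral>\<^sup>+a. \<integral>\<^sup>+b. ennreal (exp (- 2 * pi\<^sup>2 * \<kappa> * a\<^sup>2)) * ennreal (exp (- 2 * pi\<^sup>2 * \<kappa> * b\<^sup>2)) \<partial>lborel \<partial>lborel)"
      by (subst nn_integral_plane, measurable)
         (simp add: norm_mult norm_modulated_gaussian norm_2_square exp_add[symmetric] ennreal_mult'[symmetric] algebra_simps)
    also have "\<dots> = (\<integral>\<^sup>+a. ennreal (exp (- 2 * pi\<^sup>2 * \<kappa> * a\<^sup>2)) \<partial>lborel) * (\<integral>\<^sup>+b. ennreal (exp (- 2 * pi\<^sup>2 * \<kappa> * b\<^sup>2)) \<partial>lborel)"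
      by (simp add: nn_integral_cmult nn_integral_multc)
    also have "\<dots> < \<infinity>"
      using gauss_fourier_cos(2)[OF assms] by (simp add: integrable_iff_bounded ennreal_mult_less_top)
    finally show "(\<integral>\<^sup>+\<xi>. ennreal (norm (modulated_gaussian (2 * pi\<^sup>2 * \<kappa>) y \<xi> * exp (- 2 * of_real pi * \<i> * of_real (\<xi> \<bullet> x)))) \<partial>lborel) < \<infinity>" .
  qed measurable
  have "fourier (modulated_gaussian (2 * pi\<^sup>2 * \<kappa>) y) x = (LINT a|lborel. LINT b|lborel. ?F (y $ 1 - x $ 1) a * ?F (y $ 2 - x $ 2) b)"
    unfolding fourier_def using integral_plane(1)[OF int] unfolding eq vector_2 .
  also have "\<dots> = of_real (gauss \<kappa> (y $ 1 - x $ 1)) * of_real (gauss \<kappa> (y $ 2 - x $ 2))"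
    by (simp only: integral_mult_right_zero integral_mult_left_zero gauss_fourier(1)[OF assms])
  also have "\<dots> = of_real (gauss2 \<kappa> (x - y))"
    using gauss_minus[of \<kappa> "x $ 1 - y $ 1"] gauss_minus[of \<kappa> "x $ 2 - y $ 2"] by (simp add: gauss2_def)
  finally show ?thesis .
qed

section \<open>Riesz kernels smoothed by Gaussians\<close>

definition gauss_riesz :: "real \<Rightarrow> real \<Rightarrow> real \<Rightarrow> ennreal" where
  "gauss_riesz s \<kappa> m = (\<integral>\<^sup>+t. riesz s t * ennreal (gauss \<kappa> (m - t)) \<partial>lborel)"

lemma measurable_gauss_riesz [measurable]:
  assumes [measurable]: "f \<in> borel_measurable M" "g \<in> borel_measurable M"
  shows "(\<lambda>x. gauss_riesz s (f x) (g x)) \<in> borel_measurable M"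
  unfolding gauss_riesz_def by measurable

definition fourier_constant :: "real \<Rightarrow> real" where
  "fourier_constant s = enn2real (gauss_mixture_constant s) / enn2real (exp_mixture_constant s)"

lemma fourier_constant_pos: "0 < s \<Longrightarrow> s < 1 \<Longrightarrow> fourier_constant s > 0"
  using mixture_constants_finite[of s] by (simp add: fourier_constant_def enn2real_positive_iff)

text \<open>Smooth each Gaussian in the mixture for \<open>|t|\<^sup>-\<^sup>s\<close>; the variances add.\<close>

lemma gauss_mixture_gauss_riesz:
  assumes \<tau>: "\<tau> > 0"
  shows "gauss_mixture_constant s * gauss_riesz s \<tau> m
    = (\<integral>\<^sup>+\<kappa>. ennreal (\<kappa> powr (- (1 + s) / 2) * gauss (\<kappa> + \<tau>) m) * indicator {0<..} \<kappa> \<partial>lborel)"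
proof -
  let ?p = "\<lambda>\<kappa>::real. \<kappa> powr (- (1 + s) / 2)"
  have "gauss_mixture_constant s * gauss_riesz s \<tau> m
     = (\<integral>\<^sup>+t. gauss_mixture_constant s * riesz s t * ennreal (gauss \<tau> (m - t)) \<partial>lborel)"
    unfolding gauss_riesz_def by (simp add: nn_integral_cmult mult.assoc)
  also have "\<dots> = (\<integral>\<^sup>+t. \<integral>\<^sup>+\<kappa>. ennreal (?p \<kappa> * gauss \<kappa> t) * indicator {0<..} \<kappa> * ennreal (gauss \<tau> (m - t)) \<partial>lborel \<partial>lborel)"
  proof (rule nn_integral_cong_AE)
    have "AE t::real in lborel. t \<noteq> 0" by (rule AE_lborel_singleton)
    then show "AE t in lborel. gauss_mixture_constant s * riesz s t * ennreal (gauss \<tau> (m - t))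
       = (\<integral>\<^sup>+\<kappa>. ennreal (?p \<kappa> * gauss \<kappa> t) * indicator {0<..} \<kappa> * ennreal (gauss \<tau> (m - t)) \<partial>lborel)"
      by eventually_elim (simp add: riesz_eq_gauss_mixture[symmetric] nn_integral_multc)
  qed
  also have "\<dots> = (\<integral>\<^sup>+\<kappa>. \<integral>\<^sup>+t. ennreal (?p \<kappa> * gauss \<kappa> t) * indicator {0<..} \<kappa> * ennreal (gauss \<tau> (m - t)) \<partial>lborel \<partial>lborel)"
    by (rule lborel_pair.Fubini') measurable
  also have "\<dots> = (\<integral>\<^sup>+\<kappa>. ennreal (?p \<kappa> * gauss (\<kappa> + \<tau>) m) * indicator {0<..} \<kappa> \<partial>lborel)"
  proof (rule nn_integral_cong)
    fix \<kappa> :: real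
    show "(\<integral>\<^sup>+t. ennreal (?p \<kappa> * gauss \<kappa> t) * indicator {0<..} \<kappa> * ennreal (gauss \<tau> (m - t)) \<partial>lborel)
       = ennreal (?p \<kappa> * gauss (\<kappa> + \<tau>) m) * indicator {0<..} \<kappa>"
    proof (cases "\<kappa> > 0")
      case True
      have "(\<integral>\<^sup>+t. ennreal (?p \<kappa> * gauss \<kappa> t) * indicator {0<..} \<kappa> * ennreal (gauss \<tau> (m - t)) \<partial>lborel)
         = (\<integral>\<^sup>+t. ennreal (?p \<kappa>) * (ennreal (gauss \<tau> (m - t)) * ennreal (gauss \<kappa> t)) \<partial>lborel)"
        using True by (intro nn_integral_cong) (simp add: ennreal_mult mult_ac)
      also have "\<dots> = ennreal (?p \<kappa>) * ennreal (gauss (\<tau> + \<kappa>) m)"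
        using gauss_convolution[OF \<tau> True, of m] by (simp add: nn_integral_cmult)
      finally show ?thesis using True by (simp add: ennreal_mult add.commute)
    qed simp
  qed
  finally show ?thesis .
qed

text \<open>The point \<open>0\<close> maximizes a centred Gaussian, so this bounds the mixture at every point.\<close>

lemma gauss_riesz_mixture_finite:
  assumes s: "0 < s" "s < 1" and \<tau>: "\<tau> > 0"
  shows "(\<integral>\<^sup>+\<kappa>. ennreal (\<kappa> powr (- (1 + s) / 2) * gauss (\<kappa> + \<tau>) 0) * indicator {0<..} \<kappa> \<partial>lborel) < \<infinity>"
proof (rule nn_integral_Ioi_finite[where a = "- (1 + s) / 2" and b = "s / 2" and K = "1 / sqrt (2 * pi * \<tau>)" and K' = 1])
  fix \<kappa> :: real assume \<kappa>: "0 < \<kappa>"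
  have "gauss (\<kappa> + \<tau>) 0 = 1 / sqrt (2 * pi * (\<kappa> + \<tau>))" using \<kappa> \<tau> by (simp add: gauss_eq)
  also have "\<dots> \<le> 1 / sqrt (2 * pi * \<tau>)" using \<kappa> \<tau> by (intro divide_left_mono) auto
  finally have "\<kappa> powr (- (1 + s) / 2) * gauss (\<kappa> + \<tau>) 0 \<le> \<kappa> powr (- (1 + s) / 2) * (1 / sqrt (2 * pi * \<tau>))"
    by (intro mult_left_mono) auto
  then show "\<kappa> powr (- (1 + s) / 2) * gauss (\<kappa> + \<tau>) 0 \<le> 1 / sqrt (2 * pi * \<tau>) * \<kappa> powr (- (1 + s) / 2)"
    by simp
next
  fix \<kappa> :: real assume \<kappa>: "1 \<le> \<kappa>"
  have "gauss (\<kappa> + \<tau>) 0 = 1 / sqrt (2 * pi * (\<kappa> + \<tau>))" using \<kappa> \<tau> by (simp add: gauss_eq)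
  also have "\<dots> \<le> 1 / sqrt \<kappa>"
  proof (intro divide_left_mono)
    have "1 * \<kappa> \<le> (2 * pi) * (\<kappa> + \<tau>)" using \<kappa> \<tau> pi_gt3 by (intro mult_mono) auto
    then show "sqrt \<kappa> \<le> sqrt (2 * pi * (\<kappa> + \<tau>))" by simp
  qed (use \<kappa> \<tau> in auto)
  also have "\<dots> = \<kappa> powr (- (1 / 2))" using \<kappa> by (simp add: powr_minus_divide powr_half_sqrt)
  finally have "\<kappa> powr (- (1 + s) / 2) * gauss (\<kappa> + \<tau>) 0 \<le> \<kappa> powr (- (1 + s) / 2) * \<kappa> powr (- (1 / 2))"
    by (intro mult_left_mono) auto
  also have "\<dots> = 1 * \<kappa> powr (- (s / 2) - 1)"
    unfolding powr_add[symmetric] mult_1 by (rule arg_cong[where f = "\<lambda>z. \<kappa> powr z"]) (simp add: field_simps)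
  finally show "\<kappa> powr (- (1 + s) / 2) * gauss (\<kappa> + \<tau>) 0 \<le> 1 * \<kappa> powr (- (s / 2) - 1)" .
qed (use s \<tau> in auto)

text \<open>Insert the exponential mixture for \<open>|u|\<^sup>s\<^sup>-\<^sup>1\<close>, exchange the integrals, transform each Gaussian,
  and recognize the smoothed Gaussian mixture for \<open>|t|\<^sup>-\<^sup>s\<close>.\<close>

lemma riesz_fourier_gauss:
  assumes s: "0 < s" "s < 1" and \<tau>: "\<tau> > 0"
  shows "ennreal (LINT u|lborel. \<bar>u\<bar> powr (s - 1) * (exp (- 2 * pi\<^sup>2 * \<tau> * u\<^sup>2) * cos (2 * pi * u * m)))
           = ennreal (fourier_constant s) * gauss_riesz s \<tau> m"
    and "(LINT u|lborel. \<bar>u\<bar> powr (s - 1) * (exp (- 2 * pi\<^sup>2 * \<tau> * u\<^sup>2) * cos (2 * pi * u * m))) \<ge> 0"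
    and "integrable lborel (\<lambda>u. \<bar>u\<bar> powr (s - 1) * exp (- 2 * pi\<^sup>2 * \<tau> * u\<^sup>2))"
proof -
  let ?p = "\<lambda>\<kappa>::real. \<kappa> powr (- (1 + s) / 2) * indicator {0<..} \<kappa>"
  let ?e = "\<lambda>\<kappa> u. exp (- 2 * pi\<^sup>2 * \<kappa> * u\<^sup>2)"
  define cg where "cg = enn2real (gauss_mixture_constant s)"
  define ce where "ce = enn2real (exp_mixture_constant s)"
  have cg: "gauss_mixture_constant s = ennreal cg" "cg > 0" and ce: "exp_mixture_constant s = ennreal ce" "ce > 0"
    using mixture_constants_finite[OF s] by (auto simp: cg_def ce_def enn2real_positive_iff)
  have e_add: "?e (\<kappa> + \<tau>) u = ?e \<kappa> u * ?e \<tau> u" for \<kappa> u by (simp add: exp_add[symmetric] algebra_simps)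
  have mix: "(\<integral>\<^sup>+\<kappa>. ennreal (?p \<kappa> * ?e \<kappa> u) \<partial>lborel) = ennreal (ce * \<bar>u\<bar> powr (s - 1))" if "u \<noteq> 0" for u
  proof -
    have "(\<integral>\<^sup>+\<kappa>. ennreal (?p \<kappa> * ?e \<kappa> u) \<partial>lborel)
      = (\<integral>\<^sup>+\<kappa>. ennreal (\<kappa> powr (- (1 + s) / 2) * ?e \<kappa> u) * indicator {0<..} \<kappa> \<partial>lborel)"
      by (intro nn_integral_cong) (auto simp: indicator_def)
    then show ?thesis
      unfolding riesz_eq_exp_mixture[OF that] using ce by (simp add: ennreal_mult')
  qed
  have AE0: "AE u::real in lborel. u \<noteq> 0" by (rule AE_lborel_singleton)
  \<comment> \<open>The absolute value of the integrand is the case \<open>m = 0\<close>, whose mixture of Gaussians is finite.\<close>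
  have fin: "(\<integral>\<^sup>+u. \<integral>\<^sup>+\<kappa>. ennreal (?p \<kappa> * ?e (\<kappa> + \<tau>) u) \<partial>lborel \<partial>lborel) < \<infinity>"
  proof -
    have "(\<integral>\<^sup>+u. \<integral>\<^sup>+\<kappa>. ennreal (?p \<kappa> * ?e (\<kappa> + \<tau>) u) \<partial>lborel \<partial>lborel)
       = (\<integral>\<^sup>+\<kappa>. \<integral>\<^sup>+u. ennreal (?p \<kappa> * ?e (\<kappa> + \<tau>) u) \<partial>lborel \<partial>lborel)"
      by (rule lborel_pair.Fubini') measurable
    also have "\<dots> = (\<integral>\<^sup>+\<kappa>. ennreal (\<kappa> powr (- (1 + s) / 2) * gauss (\<kappa> + \<tau>) 0) * indicator {0<..} \<kappa> \<partial>lborel)"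
    proof (rule nn_integral_cong)
      fix \<kappa> :: real
      show "(\<integral>\<^sup>+u. ennreal (?p \<kappa> * ?e (\<kappa> + \<tau>) u) \<partial>lborel) = ennreal (\<kappa> powr (- (1 + s) / 2) * gauss (\<kappa> + \<tau>) 0) * indicator {0<..} \<kappa>"
      proof (cases "\<kappa> > 0")
        case True
        then have kt: "\<kappa> + \<tau> > 0" using \<tau> by simp
        have "(\<integral>\<^sup>+u. ennreal (?e (\<kappa> + \<tau>) u) \<partial>lborel) = ennreal (LINT u|lborel. ?e (\<kappa> + \<tau>) u)"
          by (rule nn_integral_eq_integral[OF gauss_fourier_cos(2)[OF kt]]) auto
        also have "(LINT u|lborel. ?e (\<kappa> + \<tau>) u) = gauss (\<kappa> + \<tau>) 0"
          using gauss_fourier_cos(1)[OF kt, of 0] by simp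
        finally show ?thesis using True by (simp add: ennreal_mult nn_integral_cmult)
      qed simp
    qed
    also have "\<dots> < \<infinity>" by (rule gauss_riesz_mixture_finite[OF s \<tau>])
    finally show ?thesis .
  qed
  have inner: "(\<integral>\<^sup>+\<kappa>. ennreal (?p \<kappa> * ?e (\<kappa> + \<tau>) u) \<partial>lborel) = ennreal (ce * (\<bar>u\<bar> powr (s - 1) * ?e \<tau> u))" if "u \<noteq> 0" for u
  proof -
    have "(\<integral>\<^sup>+\<kappa>. ennreal (?p \<kappa> * ?e (\<kappa> + \<tau>) u) \<partial>lborel) = (\<integral>\<^sup>+\<kappa>. ennreal (?p \<kappa> * ?e \<kappa> u) * ennreal (?e \<tau> u) \<partial>lborel)"
      unfolding e_add by (intro nn_integral_cong) (simp add: ennreal_mult mult_ac)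
    also have "\<dots> = (\<integral>\<^sup>+\<kappa>. ennreal (?p \<kappa> * ?e \<kappa> u) \<partial>lborel) * ennreal (?e \<tau> u)"
      by (rule nn_integral_multc) measurable
    also have "\<dots> = ennreal (ce * (\<bar>u\<bar> powr (s - 1) * ?e \<tau> u))"
      unfolding mix[OF that] using ce by (simp add: ennreal_mult'' mult_ac)
    finally show ?thesis .
  qed
  have fin2: "(\<integral>\<^sup>+u. ennreal (ce * (\<bar>u\<bar> powr (s - 1) * ?e \<tau> u)) \<partial>lborel) < \<infinity>"
  proof -
    have "(\<integral>\<^sup>+u. ennreal (ce * (\<bar>u\<bar> powr (s - 1) * ?e \<tau> u)) \<partial>lborel) = (\<integral>\<^sup>+u. \<integral>\<^sup>+\<kappa>. ennreal (?p \<kappa> * ?e (\<kappa> + \<tau>) u) \<partial>lborel \<partial>lborel)"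
      by (rule nn_integral_cong_AE, use AE0 in eventually_elim) (rule inner[symmetric])
    with fin show ?thesis by simp
  qed
  have "integrable lborel (\<lambda>u. ce * (\<bar>u\<bar> powr (s - 1) * ?e \<tau> u))"
    using fin2 ce by (intro integrableI_nonneg) auto
  then show "integrable lborel (\<lambda>u. \<bar>u\<bar> powr (s - 1) * ?e \<tau> u)"
    using ce by simp
  \<comment> \<open>The oscillation has modulus at most \<open>1\<close>, so the previous bound justifies exchanging the integrals.\<close>
  let ?f = "\<lambda>(u, \<kappa>). ?p \<kappa> * (?e (\<kappa> + \<tau>) u * cos (2 * pi * u * m))"
  have int: "integrable (lborel \<Otimes>\<^sub>M lborel) ?f"
  proof (rule integrableI_bounded)
    have "(\<integral>\<^sup>+x. ennreal (norm (?f x)) \<partial>(lborel \<Otimes>\<^sub>M lborel)) \<le> (\<integral>\<^sup>+x. (case x of (u, \<kappa>) \<Rightarrow> ennreal (?p \<kappa> * ?e (\<kappa> + \<tau>) u)) \<partial>(lborel \<Otimes>\<^sub>M lborel))"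
      by (intro nn_integral_mono) (auto simp: abs_mult indicator_def intro!: ennreal_leI mult_left_mono mult_left_le)
    also have "\<dots> = (\<integral>\<^sup>+u. \<integral>\<^sup>+\<kappa>. ennreal (?p \<kappa> * ?e (\<kappa> + \<tau>) u) \<partial>lborel \<partial>lborel)"
      by (subst lborel.nn_integral_fst[symmetric]) auto
    finally show "(\<integral>\<^sup>+x. ennreal (norm (?f x)) \<partial>(lborel \<Otimes>\<^sub>M lborel)) < \<infinity>" using fin by simp
  qed measurable
  have "(LINT u|lborel. ce * (\<bar>u\<bar> powr (s - 1) * (?e \<tau> u * cos (2 * pi * u * m)))) = (LINT u|lborel. LINT \<kappa>|lborel. ?f (u, \<kappa>))"
  proof (rule integral_cong_AE)
    show "AE u in lborel. ce * (\<bar>u\<bar> powr (s - 1) * (?e \<tau> u * cos (2 * pi * u * m))) = (LINT \<kappa>|lborel. ?f (u, \<kappa>))"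
      using AE0
    proof eventually_elim
      case (elim u)
      have "(LINT \<kappa>|lborel. ?p \<kappa> * ?e (\<kappa> + \<tau>) u) = ce * (\<bar>u\<bar> powr (s - 1) * ?e \<tau> u)"
        using inner[OF elim] ce by (subst integral_eq_nn_integral) auto
      moreover have "(LINT \<kappa>|lborel. ?f (u, \<kappa>)) = (LINT \<kappa>|lborel. (?p \<kappa> * ?e (\<kappa> + \<tau>) u) * cos (2 * pi * u * m))"
        by (simp add: mult.assoc)
      moreover have "\<dots> = (LINT \<kappa>|lborel. ?p \<kappa> * ?e (\<kappa> + \<tau>) u) * cos (2 * pi * u * m)"
        by (rule integral_mult_left_zero)
      ultimately show ?case by simp
    qed
  qed measurable
  also have "\<dots> = (LINT \<kappa>|lborel. LINT u|lborel. ?f (u, \<kappa>))"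
    using lborel_pair.Fubini_integral[OF int] by simp
  also have "\<dots> = (LINT \<kappa>|lborel. ?p \<kappa> * gauss (\<kappa> + \<tau>) m)"
  proof (rule Bochner_Integration.integral_cong)
    fix \<kappa> :: real
    show "(LINT u|lborel. ?f (u, \<kappa>)) = ?p \<kappa> * gauss (\<kappa> + \<tau>) m"
    proof (cases "\<kappa> > 0")
      case True
      then have kt: "\<kappa> + \<tau> > 0" using \<tau> by simp
      show ?thesis using gauss_fourier_cos(1)[OF kt, of m] by simp
    qed simp
  qed simp
  finally have L: "ce * (LINT u|lborel. \<bar>u\<bar> powr (s - 1) * (?e \<tau> u * cos (2 * pi * u * m))) = (LINT \<kappa>|lborel. ?p \<kappa> * gauss (\<kappa> + \<tau>) m)"
    by simp
  have "(LINT \<kappa>|lborel. ?p \<kappa> * gauss (\<kappa> + \<tau>) m) \<ge> 0" by (intro Bochner_Integration.integral_nonneg) auto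
  then have "0 \<le> ce * (LINT u|lborel. \<bar>u\<bar> powr (s - 1) * (?e \<tau> u * cos (2 * pi * u * m)))"
    unfolding L .
  then show nonneg: "(LINT u|lborel. \<bar>u\<bar> powr (s - 1) * (?e \<tau> u * cos (2 * pi * u * m))) \<ge> 0"
    using mult_pos_neg[OF ce(2), of "LINT u|lborel. \<bar>u\<bar> powr (s - 1) * (?e \<tau> u * cos (2 * pi * u * m))"]
    by linarith
  have "(\<integral>\<^sup>+\<kappa>. ennreal (?p \<kappa> * gauss (\<kappa> + \<tau>) m) \<partial>lborel) < \<infinity>"
  proof (rule le_less_trans[OF _ gauss_riesz_mixture_finite[OF s \<tau>]], rule nn_integral_mono)
    fix \<kappa> :: real
    show "ennreal (?p \<kappa> * gauss (\<kappa> + \<tau>) m) \<le> ennreal (\<kappa> powr (- (1 + s) / 2) * gauss (\<kappa> + \<tau>) 0) * indicator {0<..} \<kappa>"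
      using \<tau> by (auto simp: indicator_def gauss_eq intro!: ennreal_leI mult_left_mono divide_right_mono)
  qed
  then have "(\<integral>\<^sup>+\<kappa>. ennreal (?p \<kappa> * gauss (\<kappa> + \<tau>) m) \<partial>lborel) = ennreal (LINT \<kappa>|lborel. ?p \<kappa> * gauss (\<kappa> + \<tau>) m)"
    by (intro nn_integral_eq_integral integrableI_nonneg) auto
  moreover have "(\<integral>\<^sup>+\<kappa>. ennreal (?p \<kappa> * gauss (\<kappa> + \<tau>) m) \<partial>lborel) = ennreal cg * gauss_riesz s \<tau> m"
    unfolding cg(1)[symmetric] gauss_mixture_gauss_riesz[OF \<tau>]
    by (intro nn_integral_cong) (auto simp: indicator_def)
  ultimately have E: "ennreal ce * ennreal (LINT u|lborel. \<bar>u\<bar> powr (s - 1) * (?e \<tau> u * cos (2 * pi * u * m))) = ennreal cg * gauss_riesz s \<tau> m"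
    using ce L nonneg by (simp add: ennreal_mult[symmetric])
  have "ennreal (1 / ce) * (ennreal ce * ennreal (LINT u|lborel. \<bar>u\<bar> powr (s - 1) * (?e \<tau> u * cos (2 * pi * u * m))))
      = ennreal (1 / ce) * (ennreal cg * gauss_riesz s \<tau> m)"
    unfolding E ..
  moreover have "ennreal (1 / ce) * ennreal ce = 1" "ennreal (1 / ce) * ennreal cg = ennreal (fourier_constant s)"
    using cg ce by (simp_all add: ennreal_mult[symmetric] fourier_constant_def)
  ultimately show "ennreal (LINT u|lborel. \<bar>u\<bar> powr (s - 1) * (?e \<tau> u * cos (2 * pi * u * m))) = ennreal (fourier_constant s) * gauss_riesz s \<tau> m"
    by (simp add: mult.assoc[symmetric])
qed

text \<open>Dominated convergence. The singular kernels below are first cut off near their singularity, so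
  that a bounded function remains.\<close>

lemma approximate_identity_bounded:
  fixes F :: "'a :: euclidean_space \<Rightarrow> real"
  assumes N: "prob_space N" "sets N = sets borel" and r: "r \<longlonglongrightarrow> 0"
    and F: "F \<in> borel_measurable borel" "\<And>x. 0 \<le> F x" "\<And>x. F x \<le> B" "isCont F y"
  shows "(\<lambda>n. \<integral>\<^sup>+z. ennreal (F (y + r n *\<^sub>R z)) \<partial>N) \<longlonglongrightarrow> ennreal (F y)"
proof -
  interpret prob_space N by fact
  have [measurable_cong]: "sets N = sets borel" by fact
  note [measurable] = F(1)
  have "(\<lambda>n. \<integral>\<^sup>+z. ennreal (F (y + r n *\<^sub>R z)) \<partial>N) \<longlonglongrightarrow> (\<integral>\<^sup>+z. ennreal (F y) \<partial>N)"
  proof (rule nn_integral_dominated_convergence[where w = "\<lambda>_. ennreal B"])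
    show "(\<integral>\<^sup>+x. ennreal B \<partial>N) < \<infinity>" by (simp add: emeasure_space_1)
    show "AE z in N. (\<lambda>n. ennreal (F (y + r n *\<^sub>R z))) \<longlonglongrightarrow> ennreal (F y)"
    proof (rule AE_I2)
      fix z
      have "(\<lambda>n. y + r n *\<^sub>R z) \<longlonglongrightarrow> y + 0 *\<^sub>R z" by (intro tendsto_intros r)
      then have "(\<lambda>n. y + r n *\<^sub>R z) \<longlonglongrightarrow> y" by simp
      from isCont_tendsto_compose[OF F(4) this]
      show "(\<lambda>n. ennreal (F (y + r n *\<^sub>R z))) \<longlonglongrightarrow> ennreal (F y)" by (intro tendsto_ennrealI)
    qed
  qed (auto intro!: AE_I2 ennreal_leI F)
  then show ?thesis by (simp add: emeasure_space_1)
qed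

text \<open>Scaling reduces all points to \<open>m = 1\<close>, so that a single bound and a single limit serve all
  slopes.\<close>

lemma gauss_riesz_scale:
  assumes m: "m \<noteq> 0" and \<tau>: "\<tau> > 0"
  shows "gauss_riesz s \<tau> m = riesz s m * gauss_riesz s (\<tau> / m\<^sup>2) 1"
proof -
  have "gauss_riesz s \<tau> m = ennreal \<bar>m\<bar> * (\<integral>\<^sup>+t. riesz s (0 + m * t) * ennreal (gauss \<tau> (m - (0 + m * t))) \<partial>lborel)"
    unfolding gauss_riesz_def by (rule nn_integral_real_affine) (use m in auto)
  also have "\<dots> = (\<integral>\<^sup>+t. ennreal \<bar>m\<bar> * (riesz s (m * t) * ennreal (gauss \<tau> (m - m * t))) \<partial>lborel)"
    by (simp add: nn_integral_cmult)
  also have "\<dots> = (\<integral>\<^sup>+t. riesz s m * (riesz s t * ennreal (gauss (\<tau> / m\<^sup>2) (1 - t))) \<partial>lborel)"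
  proof (rule nn_integral_cong)
    fix t
    have A: "riesz s (m * t) = ennreal (\<bar>m\<bar> powr - s) * riesz s t"
    proof -
      have "riesz s (m * t) = riesz s (\<bar>m\<bar> * t)" using riesz_minus[of s "m * t"] by (cases "m < 0") auto
      then show ?thesis using riesz_scale[of "\<bar>m\<bar>" s t] m by simp
    qed
    have B: "ennreal \<bar>m\<bar> * ennreal (gauss \<tau> (m - m * t)) = ennreal (gauss (\<tau> / m\<^sup>2) (1 - t))"
    proof -
      have "(m - m * t)\<^sup>2 = m\<^sup>2 * (1 - t)\<^sup>2" by (simp add: power2_eq_square algebra_simps)
      then have "\<bar>m\<bar> * gauss \<tau> (m - m * t) = gauss (\<tau> / m\<^sup>2) (1 - t)"
        using m \<tau> by (simp add: gauss_eq real_sqrt_divide real_sqrt_mult field_simps)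
      then show ?thesis by (simp add: ennreal_mult'[symmetric])
    qed
    have "ennreal \<bar>m\<bar> * (riesz s (m * t) * ennreal (gauss \<tau> (m - m * t)))
       = (ennreal \<bar>m\<bar> * ennreal (gauss \<tau> (m - m * t))) * (ennreal (\<bar>m\<bar> powr - s) * riesz s t)"
      unfolding A by (simp add: mult_ac)
    then show "ennreal \<bar>m\<bar> * (riesz s (m * t) * ennreal (gauss \<tau> (m - m * t))) = riesz s m * (riesz s t * ennreal (gauss (\<tau> / m\<^sup>2) (1 - t)))"
      unfolding B using m by (simp add: riesz_nonzero mult_ac)
  qed
  also have "\<dots> = riesz s m * gauss_riesz s (\<tau> / m\<^sup>2) 1"
    unfolding gauss_riesz_def by (rule nn_integral_cmult) measurable
  finally show ?thesis .
qed

text \<open>At \<open>x = 1 / (8 \<tau>)\<close> the bound \<open>exp (- x) \<le> 2 / x\<^sup>2\<close> gives the factor \<open>128 \<tau>\<^sup>2\<close>. For \<open>\<tau> \<le> 1\<close> one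
  power of \<open>\<tau>\<close> pays for the denominator of the density.\<close>

lemma gauss_half_le:
  assumes "\<tau> > 0"
  shows "gauss \<tau> (1 / 2) \<le> 128" "\<tau> \<le> 1 \<Longrightarrow> gauss \<tau> (1 / 2) \<le> 128 * \<tau>"
proof -
  have g: "gauss \<tau> (1 / 2) = exp (- 1 / (8 * \<tau>)) / sqrt (2 * pi * \<tau>)"
    using assms by (simp add: gauss_eq power2_eq_square)
  have sq: "sqrt \<tau> \<le> sqrt (2 * pi * \<tau>)" using assms pi_gt3 by simp
  show *: "gauss \<tau> (1 / 2) \<le> 128 * \<tau>" if "\<tau> \<le> 1"
  proof -
    have "exp (- 1 / (8 * \<tau>)) \<le> 128 * \<tau>\<^sup>2"
      using exp_minus_le_inverse_square[of "1 / (8 * \<tau>)"] assms by (simp add: power_divide power_mult_distrib)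
    moreover have "\<tau> \<le> sqrt \<tau>"
      using that assms real_le_rsqrt[of \<tau> \<tau>] by (simp add: power2_eq_square mult_left_le)
    ultimately have "gauss \<tau> (1 / 2) \<le> 128 * \<tau>\<^sup>2 / \<tau>"
      unfolding g using assms order_trans[OF _ sq] by (intro frac_le) auto
    then show ?thesis using assms by (simp add: power2_eq_square)
  qed
  show "gauss \<tau> (1 / 2) \<le> 128"
  proof (cases "\<tau> \<le> 1")
    case False
    then have "1 \<le> sqrt (2 * pi * \<tau>)" using sq by (intro order_trans[OF _ sq]) auto
    then have "gauss \<tau> (1 / 2) \<le> 1 / 1" unfolding g using assms by (intro frac_le) auto
    then show ?thesis by simp
  qed (use * in auto)
qed

lemma riesz_integrable_near_0:
  assumes "s < 1"
  shows "(\<integral>\<^sup>+t. riesz s t * indicator {-1..1} t \<partial>lborel) < \<infinity>"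
proof -
  have "(\<integral>\<^sup>+t. riesz s t * indicator {-1..1} t \<partial>lborel) = (\<integral>\<^sup>+t. (riesz s t + riesz s (- t)) * indicator {0..1} t \<partial>lborel)"
    by (rule nn_integral_symmetric_interval) measurable
  also have "\<dots> = (\<integral>\<^sup>+t. 2 * (ennreal (t powr (- s)) * indicator {0..1} t) \<partial>lborel)"
    by (rule nn_integral_cong_AE, rule AE_lborel_avoid_three[of 0 0 0])
       (auto simp: indicator_def riesz_nonzero mult_2)
  also have "\<dots> = 2 * (\<integral>\<^sup>+t. ennreal (t powr (- s)) * indicator {0..1} t \<partial>lborel)"
    by (rule nn_integral_cmult) measurable
  also have "\<dots> < \<infinity>"
    using nn_integral_powr_head[of "- s"] assms by (simp add: ennreal_mult_less_top)
  finally show ?thesis .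
qed

text \<open>Cut at \<open>|t| = 1/2\<close>. The far part of the kernel is bounded and continuous at \<open>1\<close>; on the near
  part the Gaussian centred at \<open>1\<close> is at most its value at distance \<open>1/2\<close>, and the kernel is
  integrable.\<close>

lemma gauss_riesz_split:
  fixes s :: real
  defines "F \<equiv> \<lambda>t. \<bar>t\<bar> powr (- s) * indicator (- {-1/2..1/2}) t"
  assumes \<tau>: "\<tau> > 0"
  shows "gauss_riesz s \<tau> 1 \<le> (\<integral>\<^sup>+z. ennreal (F (1 + sqrt \<tau> *\<^sub>R z)) \<partial>density lborel (gauss 1)) + ennreal (gauss \<tau> (1 / 2)) * (\<integral>\<^sup>+t. riesz s t * indicator {-1..1} t \<partial>lborel)"
    and "(\<integral>\<^sup>+z. ennreal (F (1 + sqrt \<tau> *\<^sub>R z)) \<partial>density lborel (gauss 1)) \<le> gauss_riesz s \<tau> 1"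
proof -
  let ?U = "{-1/2..1/2::real}"
  have [measurable]: "F \<in> borel_measurable borel" unfolding F_def by measurable
  have 1: "(\<integral>\<^sup>+z. ennreal (F (1 + sqrt \<tau> *\<^sub>R z)) \<partial>density lborel (gauss 1)) = (\<integral>\<^sup>+t. ennreal (F t) * ennreal (gauss \<tau> (1 - t)) \<partial>lborel)"
  proof -
    have "(\<integral>\<^sup>+t. ennreal (F t) * ennreal (gauss \<tau> (1 - t)) \<partial>lborel)
      = ennreal \<bar>sqrt \<tau>\<bar> * (\<integral>\<^sup>+t. ennreal (F (1 + sqrt \<tau> * t)) * ennreal (gauss \<tau> (1 - (1 + sqrt \<tau> * t))) \<partial>lborel)"
      by (rule nn_integral_real_affine) (use \<tau> in auto)
    also have "\<dots> = (\<integral>\<^sup>+t. ennreal \<bar>sqrt \<tau>\<bar> * (ennreal (F (1 + sqrt \<tau> * t)) * ennreal (gauss \<tau> (1 - (1 + sqrt \<tau> * t)))) \<partial>lborel)"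
      by (rule nn_integral_cmult[symmetric]) measurable
    also have "\<dots> = (\<integral>\<^sup>+t. ennreal (gauss 1 t) * ennreal (F (1 + sqrt \<tau> * t)) \<partial>lborel)"
    proof (rule nn_integral_cong)
      fix t
      have "sqrt \<tau> * gauss \<tau> (- (sqrt \<tau> * t)) = gauss 1 t"
        using \<tau> by (simp add: gauss_eq power_mult_distrib real_sqrt_mult)
      then have "ennreal (sqrt \<tau>) * ennreal (gauss \<tau> (- (sqrt \<tau> * t))) = ennreal (gauss 1 t)"
        using \<tau> by (simp add: ennreal_mult'[symmetric])
      then show "ennreal \<bar>sqrt \<tau>\<bar> * (ennreal (F (1 + sqrt \<tau> * t)) * ennreal (gauss \<tau> (1 - (1 + sqrt \<tau> * t)))) = ennreal (gauss 1 t) * ennreal (F (1 + sqrt \<tau> * t))"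
      proof -
        have "ennreal \<bar>sqrt \<tau>\<bar> * (ennreal (F (1 + sqrt \<tau> * t)) * ennreal (gauss \<tau> (1 - (1 + sqrt \<tau> * t))))
          = (ennreal (sqrt \<tau>) * ennreal (gauss \<tau> (- (sqrt \<tau> * t)))) * ennreal (F (1 + sqrt \<tau> * t))"
          using \<tau> by (simp add: mult_ac)
        then show ?thesis unfolding \<open>ennreal (sqrt \<tau>) * ennreal (gauss \<tau> (- (sqrt \<tau> * t))) = ennreal (gauss 1 t)\<close> .
      qed
    qed
    also have "\<dots> = (\<integral>\<^sup>+z. ennreal (F (1 + sqrt \<tau> *\<^sub>R z)) \<partial>density lborel (gauss 1))"
      by (subst nn_integral_density) auto
    finally show ?thesis ..
  qed
  have "gauss_riesz s \<tau> 1 \<le> (\<integral>\<^sup>+t. ennreal (F t) * ennreal (gauss \<tau> (1 - t)) + ennreal (gauss \<tau> (1 / 2)) * (riesz s t * indicator {-1..1} t) \<partial>lborel)"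
    unfolding gauss_riesz_def
  proof (rule nn_integral_mono)
    fix t
    show "riesz s t * ennreal (gauss \<tau> (1 - t)) \<le> ennreal (F t) * ennreal (gauss \<tau> (1 - t)) + ennreal (gauss \<tau> (1 / 2)) * (riesz s t * indicator {-1..1} t)"
    proof (cases "t \<in> ?U")
      case True
      then have "(1 / 2)\<^sup>2 \<le> (1 - t)\<^sup>2" by (intro power_mono) auto
      then have "gauss \<tau> (1 - t) \<le> gauss \<tau> (1 / 2)"
        using \<tau> by (auto simp: gauss_eq intro!: divide_right_mono)
      then have "riesz s t * ennreal (gauss \<tau> (1 - t)) \<le> ennreal (gauss \<tau> (1 / 2)) * riesz s t"
        by (subst mult.commute) (intro mult_right_mono ennreal_leI, auto)
      then show ?thesis using True by (simp add: F_def)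
    next
      case False
      then have "t \<noteq> 0" by auto
      with False show ?thesis by (simp add: F_def riesz_nonzero)
    qed
  qed
  then show "gauss_riesz s \<tau> 1 \<le> (\<integral>\<^sup>+z. ennreal (F (1 + sqrt \<tau> *\<^sub>R z)) \<partial>density lborel (gauss 1)) + ennreal (gauss \<tau> (1 / 2)) * (\<integral>\<^sup>+t. riesz s t * indicator {-1..1} t \<partial>lborel)"
    unfolding 1 by (simp add: nn_integral_add nn_integral_cmult)
  show "(\<integral>\<^sup>+z. ennreal (F (1 + sqrt \<tau> *\<^sub>R z)) \<partial>density lborel (gauss 1)) \<le> gauss_riesz s \<tau> 1"
    unfolding 1 gauss_riesz_def
  proof (intro nn_integral_mono mult_right_mono)
    fix t show "ennreal (F t) \<le> riesz s t" by (cases "t = 0") (auto simp: F_def riesz_nonzero indicator_def)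
  qed simp
qed

lemma prob_space_gauss: "prob_space (density lborel (gauss 1))"
  by (rule prob_spaceI) (simp add: emeasure_density nn_integral_gauss)

lemma gauss_riesz_1_bound:
  assumes s: "0 < s" "s < 1"
  shows "\<exists>K\<ge>0. \<forall>\<tau>>0. gauss_riesz s \<tau> 1 \<le> ennreal K"
proof -
  interpret prob_space "density lborel (gauss 1)" by (rule prob_space_gauss)
  obtain R where R: "(\<integral>\<^sup>+t. riesz s t * indicator {-1..1} t \<partial>lborel) = ennreal R" "R \<ge> 0"
    using riesz_integrable_near_0[OF s(2)] by (cases "(\<integral>\<^sup>+t. riesz s t * indicator {-1..1} t \<partial>lborel)") auto
  show ?thesis
  proof (intro exI[of _ "2 powr s + 128 * R"] conjI allI impI)
    fix \<tau> :: real assume \<tau>: "\<tau> > 0"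
    have F: "\<bar>t\<bar> powr (- s) * indicator (- {-1/2..1/2}) t \<le> 2 powr s" for t :: real
    proof (cases "t \<in> {-1/2..1/2}")
      case False
      then have "\<bar>t\<bar> powr (- s) \<le> (1 / 2) powr (- s)" using s by (intro powr_mono2') auto
      also have "\<dots> = 2 powr s" by (simp add: powr_minus_divide powr_divide)
      finally show ?thesis by (simp add: indicator_def)
    qed simp
    have "gauss_riesz s \<tau> 1 \<le> (\<integral>\<^sup>+z. ennreal (2 powr s) \<partial>density lborel (gauss 1)) + ennreal (gauss \<tau> (1 / 2)) * ennreal R"
      by (rule order_trans[OF gauss_riesz_split(1)[OF \<tau>]], unfold R(1))
         (intro add_mono nn_integral_mono ennreal_leI F order.refl)
    also have "\<dots> \<le> ennreal (2 powr s) + ennreal 128 * ennreal R"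
      using gauss_half_le(1)[OF \<tau>] by (intro add_mono mult_right_mono ennreal_leI) (use emeasure_space_1 in auto)
    also have "\<dots> = ennreal (2 powr s + 128 * R)" using R by (simp add: ennreal_mult)
    finally show "gauss_riesz s \<tau> 1 \<le> ennreal (2 powr s + 128 * R)" .
  qed (use R in auto)
qed

lemma gauss_riesz_1_tendsto:
  assumes s: "0 < s" "s < 1" and \<tau>: "\<And>n. \<tau> n > 0" "\<tau> \<longlonglongrightarrow> 0"
  shows "(\<lambda>n. gauss_riesz s (\<tau> n) 1) \<longlonglongrightarrow> 1"
proof -
  obtain R where R: "(\<integral>\<^sup>+t. riesz s t * indicator {-1..1} t \<partial>lborel) = ennreal R" "R \<ge> 0"
    using riesz_integrable_near_0[OF s(2)] by (cases "(\<integral>\<^sup>+t. riesz s t * indicator {-1..1} t \<partial>lborel)") auto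
  define F where "F = (\<lambda>t::real. \<bar>t\<bar> powr (- s) * indicator (- {-1/2..1/2}) t)"
  have lim: "(\<lambda>n. \<integral>\<^sup>+z. ennreal (F (1 + sqrt (\<tau> n) *\<^sub>R z)) \<partial>density lborel (gauss 1)) \<longlonglongrightarrow> ennreal (F 1)"
  proof (rule approximate_identity_bounded)
    show "prob_space (density lborel (gauss 1))" by (rule prob_space_gauss)
    show "(\<lambda>n. sqrt (\<tau> n)) \<longlonglongrightarrow> 0" using tendsto_real_sqrt[OF \<tau>(2)] by simp
    show "F x \<le> 2 powr s" for x
    proof (cases "x \<in> {-1/2..1/2}")
      case False
      then have "\<bar>x\<bar> powr (- s) \<le> (1 / 2) powr (- s)" using s by (intro powr_mono2') auto
      also have "\<dots> = 2 powr s" by (simp add: powr_minus_divide powr_divide)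
      finally show ?thesis by (simp add: F_def indicator_def)
    qed (simp add: F_def)
    have "isCont (\<lambda>t::real. \<bar>t\<bar> powr (- s)) 1" by (intro continuous_intros) auto
    moreover have "\<forall>\<^sub>F t in nhds 1. F t = \<bar>t\<bar> powr (- s)"
    proof -
      have "\<forall>\<^sub>F t in nhds (1::real). t \<in> {1/2<..}" by (intro eventually_nhds_in_open) auto
      then show ?thesis by eventually_elim (auto simp: F_def)
    qed
    ultimately show "isCont F 1" using isCont_cong by fastforce
  qed (auto simp: F_def)
  have F1: "F 1 = 1" by (simp add: F_def)
  show ?thesis
  proof (rule tendsto_sandwich)
    show "(\<lambda>n. \<integral>\<^sup>+z. ennreal (F (1 + sqrt (\<tau> n) *\<^sub>R z)) \<partial>density lborel (gauss 1)) \<longlonglongrightarrow> 1"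
      using lim F1 by simp
    show "\<forall>\<^sub>F n in sequentially. (\<integral>\<^sup>+z. ennreal (F (1 + sqrt (\<tau> n) *\<^sub>R z)) \<partial>density lborel (gauss 1)) \<le> gauss_riesz s (\<tau> n) 1"
      using gauss_riesz_split(2)[OF \<tau>(1)] unfolding F_def by simp
    have "(\<lambda>n. ennreal (128 * \<tau> n * R)) \<longlonglongrightarrow> ennreal (128 * 0 * R)"
      by (intro tendsto_intros \<tau>(2))
    then have "(\<lambda>n. ennreal (128 * \<tau> n) * ennreal R) \<longlonglongrightarrow> 0"
      using R(2) by (simp add: ennreal_mult'')
    from tendsto_add[OF lim this]
    show "(\<lambda>n. (\<integral>\<^sup>+z. ennreal (F (1 + sqrt (\<tau> n) *\<^sub>R z)) \<partial>density lborel (gauss 1)) + ennreal (128 * \<tau> n) * ennreal R) \<longlonglongrightarrow> 1"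
      using F1 by simp
    have "\<forall>\<^sub>F n in sequentially. \<tau> n < 1" using \<tau>(2) by (rule order_tendstoD) simp
    then show "\<forall>\<^sub>F n in sequentially. gauss_riesz s (\<tau> n) 1 \<le> (\<integral>\<^sup>+z. ennreal (F (1 + sqrt (\<tau> n) *\<^sub>R z)) \<partial>density lborel (gauss 1)) + ennreal (128 * \<tau> n) * ennreal R"
    proof eventually_elim
      case (elim n)
      show ?case
        by (rule order_trans[OF gauss_riesz_split(1)[OF \<tau>(1)]], unfold R(1) F_def)
           (use gauss_half_le(2)[OF \<tau>(1), of n] elim in \<open>intro add_mono mult_right_mono ennreal_leI, auto\<close>)
    qed
  qed
qed

lemma gauss2_eq: "\<kappa> > 0 \<Longrightarrow> gauss2 \<kappa> x = exp (- (norm x)\<^sup>2 / (2 * \<kappa>)) / (2 * pi * \<kappa>)"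
  by (simp add: gauss2_def gauss_eq exp_add[symmetric] norm_2_square add_divide_distrib diff_divide_distrib)

lemma prob_space_gauss2: "prob_space (density lborel (gauss2 1))"
  by (rule prob_spaceI) (simp add: emeasure_density nn_integral_gauss2)

lemma nn_integral_gauss2_affine:
  fixes F :: "real^2 \<Rightarrow> ennreal"
  assumes [measurable]: "F \<in> borel_measurable borel" and \<tau>: "\<tau> > 0"
  shows "(\<integral>\<^sup>+x. F x * ennreal (gauss2 \<tau> (x - y)) \<partial>lborel) = (\<integral>\<^sup>+z. F (y + sqrt \<tau> *\<^sub>R z) \<partial>density lborel (gauss2 1))"
proof -
  have "(\<integral>\<^sup>+x. F x * ennreal (gauss2 \<tau> (x - y)) \<partial>lborel)
    = (\<integral>\<^sup>+x. F x * ennreal (gauss2 \<tau> (x - y)) \<partial>density (distr lborel borel (\<lambda>x. y + sqrt \<tau> *\<^sub>R x)) (\<lambda>_. \<bar>sqrt \<tau>\<bar> ^ DIM(real^2)))"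
    using lborel_affine[of "sqrt \<tau>" y] \<tau> by simp
  also have "\<dots> = (\<integral>\<^sup>+z. ennreal \<tau> * (F (y + sqrt \<tau> *\<^sub>R z) * ennreal (gauss2 \<tau> (sqrt \<tau> *\<^sub>R z))) \<partial>lborel)"
    using \<tau> by (simp add: nn_integral_density nn_integral_distr)
  also have "\<dots> = (\<integral>\<^sup>+z. ennreal (gauss2 1 z) * F (y + sqrt \<tau> *\<^sub>R z) \<partial>lborel)"
  proof (rule nn_integral_cong)
    fix z :: "real^2"
    have "\<tau> * gauss2 \<tau> (sqrt \<tau> *\<^sub>R z) = gauss2 1 z"
      using \<tau> by (simp add: gauss2_eq power_mult_distrib)
    then have "ennreal \<tau> * ennreal (gauss2 \<tau> (sqrt \<tau> *\<^sub>R z)) = ennreal (gauss2 1 z)"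
      using \<tau> by (simp add: ennreal_mult'[symmetric])
    then show "ennreal \<tau> * (F (y + sqrt \<tau> *\<^sub>R z) * ennreal (gauss2 \<tau> (sqrt \<tau> *\<^sub>R z))) = ennreal (gauss2 1 z) * F (y + sqrt \<tau> *\<^sub>R z)"
      by (metis mult.assoc mult.commute)
  qed
  also have "\<dots> = (\<integral>\<^sup>+z. F (y + sqrt \<tau> *\<^sub>R z) \<partial>density lborel (gauss2 1))"
    by (subst nn_integral_density) auto
  finally show ?thesis .
qed

text \<open>The same cut in the plane, at distance \<open>\<delta>\<close> from the origin.\<close>

lemma gauss2_approximates_singular_kernel:
  fixes T :: "real^2 \<Rightarrow> real"
  assumes s: "0 < s" "s < 1" and \<tau>: "\<And>n. \<tau> n > 0" "\<tau> \<longlonglongrightarrow> 0"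
    and T: "T \<in> borel_measurable borel" "\<And>x. 0 \<le> T x" "\<And>x. T x \<le> C * norm x powr (- s)" "isCont T y" and y: "y \<noteq> 0"
  shows "(\<lambda>n. \<integral>\<^sup>+x. ennreal (T x) * ennreal (gauss2 (\<tau> n) (x - y)) \<partial>lborel) \<longlonglongrightarrow> ennreal (T y)"
proof -
  note [measurable] = T(1)
  define \<delta> where "\<delta> = min 1 (norm y / 2)"
  have \<delta>: "\<delta> > 0" "\<delta> \<le> 1" "2 * \<delta> \<le> norm y" using y by (auto simp: \<delta>_def)
  have C: "C \<ge> 0"
  proof -
    have "0 \<le> C * norm y powr (- s)" using T(2,3)[of y] by linarith
    then show ?thesis using y by (auto simp: zero_le_mult_iff)
  qed
  have [measurable]: "ball 0 \<delta> \<in> sets (borel :: (real^2) measure)" by auto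
  define F where "F x = T x * indicator (- ball 0 \<delta>) x" for x
  have [measurable]: "F \<in> borel_measurable borel" unfolding F_def by measurable
  have lim: "(\<lambda>n. \<integral>\<^sup>+z. ennreal (F (y + sqrt (\<tau> n) *\<^sub>R z)) \<partial>density lborel (gauss2 1)) \<longlonglongrightarrow> ennreal (F y)"
  proof (rule approximate_identity_bounded)
    show "prob_space (density lborel (gauss2 1))" by (rule prob_space_gauss2)
    show "(\<lambda>n. sqrt (\<tau> n)) \<longlonglongrightarrow> 0" using tendsto_real_sqrt[OF \<tau>(2)] by simp
    show "F x \<le> C * \<delta> powr (- s)" for x
    proof (cases "x \<in> ball 0 \<delta>")
      case False
      then have "norm x powr (- s) \<le> \<delta> powr (- s)" using s \<delta> by (intro powr_mono2') auto
      then have "C * norm x powr (- s) \<le> C * \<delta> powr (- s)" using C by (intro mult_left_mono)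
      then show ?thesis using T(3)[of x] False by (simp add: F_def)
    qed (use C in \<open>simp add: F_def\<close>)
    have "\<forall>\<^sub>F t in nhds y. F t = T t"
    proof -
      have "\<forall>\<^sub>F t in nhds y. t \<in> - cball 0 \<delta>" using \<delta> by (intro eventually_nhds_in_open) auto
      then show ?thesis by eventually_elim (auto simp: F_def)
    qed
    then show "isCont F y" using isCont_cong T(4) by blast
    show "0 \<le> F x" for x using T(2) by (simp add: F_def)
  qed auto
  have Fy: "F y = T y" using \<delta> by (auto simp: F_def)
  have lim': "(\<lambda>n. \<integral>\<^sup>+x. ennreal (F x) * ennreal (gauss2 (\<tau> n) (x - y)) \<partial>lborel) \<longlonglongrightarrow> ennreal (T y)"
    using lim unfolding Fy by (subst nn_integral_gauss2_affine[OF _ \<tau>(1)]) auto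
  define R where "R = (\<integral>\<^sup>+x. ennreal (T x) * indicator (ball 0 \<delta>) x \<partial>lborel)"
  \<comment> \<open>Integrability at the origin is inherited from the line, since \<open>|x|\<^sup>-\<^sup>s \<le> |x\<^sub>1|\<^sup>-\<^sup>s\<close>.\<close>
  have "R \<le> (\<integral>\<^sup>+x. ennreal C * (riesz s (x $ 1) * indicator {-1..1} (x $ 1) * indicator {-1..1} (x $ 2)) \<partial>(lborel :: (real^2) measure))"
    unfolding R_def
  proof (rule nn_integral_mono)
    fix x :: "real^2"
    show "ennreal (T x) * indicator (ball 0 \<delta>) x \<le> ennreal C * (riesz s (x $ 1) * indicator {-1..1} (x $ 1) * indicator {-1..1} (x $ 2))"
    proof (cases "x \<in> ball 0 \<delta>")
      case True
      then have "\<bar>x $ 1\<bar> \<le> 1" "\<bar>x $ 2\<bar> \<le> 1"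
        using component_le_norm_cart[of x 1] component_le_norm_cart[of x 2] \<delta> by auto
      moreover have "ennreal (T x) \<le> ennreal C * riesz s (x $ 1)"
      proof (cases "x $ 1 = 0")
        case True
        show ?thesis
        proof (cases "C = 0")
          case True
          then show ?thesis using T(2,3)[of x] by simp
        next
          case False
          then show ?thesis using True C by (simp add: ennreal_mult_top)
        qed
      next
        case False
        have "T x \<le> C * norm x powr (- s)" by (rule T(3))
        also have "\<dots> \<le> C * \<bar>x $ 1\<bar> powr (- s)"
          using C s False component_le_norm_cart[of x 1] by (intro mult_left_mono powr_mono2') auto
        finally have "ennreal (T x) \<le> ennreal (C * \<bar>x $ 1\<bar> powr (- s))" by (rule ennreal_leI)
        then show ?thesis using False C by (simp add: riesz_nonzero ennreal_mult)
      qed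
      ultimately show ?thesis using True by (simp add: abs_le_iff)
    qed simp
  qed
  also have "\<dots> = (\<integral>\<^sup>+a. \<integral>\<^sup>+b. ennreal C * (riesz s a * indicator {-1..1} a * indicator {-1..1} (b :: real)) \<partial>lborel \<partial>lborel)"
    by (subst nn_integral_plane) auto
  also have "\<dots> = ennreal C * ((\<integral>\<^sup>+a. riesz s a * indicator {-1..1} a \<partial>lborel) * 2)"
    by (simp add: nn_integral_cmult nn_integral_multc)
  also have "\<dots> < \<infinity>" using riesz_integrable_near_0[OF s(2)] by (simp add: ennreal_mult_less_top)
  finally obtain R' where R: "R = ennreal R'" "R' \<ge> 0" by (cases R) auto
  define K where "K = 4 / (pi * \<delta> ^ 4)"
  have K: "K \<ge> 0" using \<delta> by (simp add: K_def)
  have near: "gauss2 (\<tau> n) (x - y) \<le> K * \<tau> n" if "x \<in> ball 0 \<delta>" for x n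
  proof -
    have "\<delta> \<le> norm (x - y)" using that \<delta> norm_triangle_ineq2[of y x] by (simp add: norm_minus_commute)
    then have "\<delta>\<^sup>2 \<le> (norm (x - y))\<^sup>2" using \<delta> by (intro power_mono) auto
    then have "gauss2 (\<tau> n) (x - y) \<le> exp (- (\<delta>\<^sup>2 / (2 * \<tau> n))) / (2 * pi * \<tau> n)"
      using \<tau>(1)[of n] by (auto simp: gauss2_eq intro!: divide_right_mono)
    also have "\<dots> \<le> 2 / (\<delta>\<^sup>2 / (2 * \<tau> n))\<^sup>2 / (2 * pi * \<tau> n)"
      using \<tau>(1)[of n] \<delta> by (intro divide_right_mono exp_minus_le_inverse_square) auto
    also have "\<dots> = K * \<tau> n"
      using \<tau>(1)[of n] \<delta> by (simp add: K_def field_simps power2_eq_square power4_eq_xxxx)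
    finally show ?thesis .
  qed
  show ?thesis
  proof (rule tendsto_sandwich)
    show "(\<lambda>n. \<integral>\<^sup>+x. ennreal (F x) * ennreal (gauss2 (\<tau> n) (x - y)) \<partial>lborel) \<longlonglongrightarrow> ennreal (T y)" by (rule lim')
    show "\<forall>\<^sub>F n in sequentially. (\<integral>\<^sup>+x. ennreal (F x) * ennreal (gauss2 (\<tau> n) (x - y)) \<partial>lborel) \<le> (\<integral>\<^sup>+x. ennreal (T x) * ennreal (gauss2 (\<tau> n) (x - y)) \<partial>lborel)"
      using T(2) by (intro always_eventually allI nn_integral_mono mult_right_mono ennreal_leI) (auto simp: F_def indicator_def)
    have "(\<lambda>n. ennreal (K * \<tau> n * R')) \<longlonglongrightarrow> ennreal (K * 0 * R')"
      by (intro tendsto_intros \<tau>(2))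
    from tendsto_add[OF lim' this]
    show "(\<lambda>n. (\<integral>\<^sup>+x. ennreal (F x) * ennreal (gauss2 (\<tau> n) (x - y)) \<partial>lborel) + ennreal (K * \<tau> n * R')) \<longlonglongrightarrow> ennreal (T y)"
      by simp
    show "\<forall>\<^sub>F n in sequentially. (\<integral>\<^sup>+x. ennreal (T x) * ennreal (gauss2 (\<tau> n) (x - y)) \<partial>lborel) \<le> (\<integral>\<^sup>+x. ennreal (F x) * ennreal (gauss2 (\<tau> n) (x - y)) \<partial>lborel) + ennreal (K * \<tau> n * R')"
    proof (intro always_eventually allI)
      fix n
      have "(\<integral>\<^sup>+x. ennreal (T x) * ennreal (gauss2 (\<tau> n) (x - y)) \<partial>lborel)
        \<le> (\<integral>\<^sup>+x. ennreal (F x) * ennreal (gauss2 (\<tau> n) (x - y)) + ennreal (K * \<tau> n) * (ennreal (T x) * indicator (ball 0 \<delta>) x) \<partial>lborel)"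
      proof (rule nn_integral_mono)
        fix x
        show "ennreal (T x) * ennreal (gauss2 (\<tau> n) (x - y)) \<le> ennreal (F x) * ennreal (gauss2 (\<tau> n) (x - y)) + ennreal (K * \<tau> n) * (ennreal (T x) * indicator (ball 0 \<delta>) x)"
        proof (cases "x \<in> ball 0 \<delta>")
          case True
          have "ennreal (T x) * ennreal (gauss2 (\<tau> n) (x - y)) \<le> ennreal (K * \<tau> n) * ennreal (T x)"
            by (subst mult.commute) (intro mult_right_mono ennreal_leI near True, simp)
          with True show ?thesis by (simp add: F_def)
        qed (simp add: F_def)
      qed
      also have "\<dots> = (\<integral>\<^sup>+x. ennreal (F x) * ennreal (gauss2 (\<tau> n) (x - y)) \<partial>lborel) + ennreal (K * \<tau> n) * R"
        unfolding R_def by (subst nn_integral_add, measurable) (simp add: nn_integral_cmult)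
      also have "ennreal (K * \<tau> n) * R = ennreal (K * \<tau> n * R')"
        unfolding R using R(2) by (simp add: ennreal_mult'')
      finally show "(\<integral>\<^sup>+x. ennreal (T x) * ennreal (gauss2 (\<tau> n) (x - y)) \<partial>lborel) \<le> (\<integral>\<^sup>+x. ennreal (F x) * ennreal (gauss2 (\<tau> n) (x - y)) \<partial>lborel) + ennreal (K * \<tau> n * R')" .
    qed
  qed
qed

section \<open>The kernel as a mixture over slopes\<close>

lemma measurable_Arg [measurable]: "Arg \<in> borel_measurable borel"
proof -
  have 1: "(\<lambda>z. if z \<in> - \<real>\<^sub>\<le>\<^sub>0 then Arg z else pi) \<in> borel_measurable borel"
  proof (rule borel_measurable_continuous_on_if)
    show "continuous_on (- \<real>\<^sub>\<le>\<^sub>0) Arg"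
      by (auto intro!: continuous_at_imp_continuous_on continuous_at_Arg)
  qed auto
  have 2: "Arg = (\<lambda>z. if z \<in> {0} then 0 else (if z \<in> - \<real>\<^sub>\<le>\<^sub>0 then Arg z else pi))"
  proof
    fix z :: complex
    have "Arg z = pi" if "z \<in> \<real>\<^sub>\<le>\<^sub>0" "z \<noteq> 0"
      using that by (auto simp: Arg_eq_pi complex_nonpos_Reals_iff complex_eq_iff)
    then show "Arg z = (if z \<in> {0} then 0 else if z \<in> - \<real>\<^sub>\<le>\<^sub>0 then Arg z else pi)"
      by (auto simp: Arg_zero)
  qed
  show ?thesis by (subst 2, rule measurable_If_set) (use 1 in auto)
qed

lemma measurable_polar_angle [measurable]: "polar_angle \<in> borel_measurable borel"
proof -
  have eq: "polar_angle = (\<lambda>x. Arg (complex_of_real (x $ 1) + \<i> * complex_of_real (x $ 2)))"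
    by (simp add: polar_angle_def[abs_def] Complex_eq)
  show ?thesis unfolding eq by measurable
qed

lemma measurable_homogeneous_kernel [measurable]:
  assumes "continuous_on UNIV f"
  shows "homogeneous_kernel r f \<in> borel_measurable borel"
proof -
  have [measurable]: "f \<in> borel_measurable borel" using assms by (rule borel_measurable_continuous_onI)
  show ?thesis unfolding homogeneous_kernel_def by measurable
qed

lemma polar_angle_scale: "c > 0 \<Longrightarrow> polar_angle (c *\<^sub>R x) = polar_angle x"
proof -
  assume "c > 0"
  have "Complex ((c *\<^sub>R x) $ 1) ((c *\<^sub>R x) $ 2) = of_real c * Complex (x $ 1) (x $ 2)"
    by (simp add: complex_eq_iff)
  with \<open>c > 0\<close> show ?thesis unfolding polar_angle_def by simp
qed

lemma homogeneous_kernel_scale: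
  "c > 0 \<Longrightarrow> homogeneous_kernel r f (c *\<^sub>R x) = c powr r * homogeneous_kernel r f x"
  by (simp add: homogeneous_kernel_def polar_angle_scale powr_mult)

lemma homogeneous_kernel_bounded:
  assumes "continuous_on UNIV f"
  obtains C where "C \<ge> 0" "\<And>x r. \<bar>homogeneous_kernel r f x\<bar> \<le> C * norm x powr r"
proof -
  have "bounded (f ` {-pi..pi})"
    by (intro compact_imp_bounded compact_continuous_image continuous_on_subset[OF assms]) auto
  then obtain C where "\<forall>t\<in>{-pi..pi}. \<bar>f t\<bar> \<le> C"
    by (auto simp: bounded_iff)
  then have C: "\<And>t. t \<in> {-pi..pi} \<Longrightarrow> \<bar>f t\<bar> \<le> C" by blast
  have b: "\<bar>f (polar_angle x)\<bar> \<le> C" for x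
    using C[of "polar_angle x"] mpi_less_Arg[of "Complex (x $ 1) (x $ 2)"] Arg_le_pi[of "Complex (x $ 1) (x $ 2)"]
    by (simp add: polar_angle_def)
  show ?thesis
  proof (rule that)
    show "C \<ge> 0" using b[of 0] by linarith
    show "\<bar>homogeneous_kernel r f x\<bar> \<le> C * norm x powr r" for x r
      using mult_left_mono[OF b[of x], of "norm x powr r"] by (simp add: homogeneous_kernel_def abs_mult mult.commute)
  qed
qed

text \<open>The principal argument jumps across the negative real axis. There \<open>- z\<close> is a point of
  continuity, and periodicity with period \<open>\<pi>\<close> makes \<open>f (Arg z)\<close> invariant under \<open>z \<mapsto> - z\<close>.\<close>

lemma homogeneous_kernel_isCont:
  assumes f: "continuous_on UNIV f" "\<And>\<theta>. f (\<theta> + pi) = f \<theta>" and y: "y \<noteq> 0"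
  shows "isCont (homogeneous_kernel r f) y"
proof -
  have g_minus: "f (Arg (- z)) = f (Arg z)" if "z \<noteq> 0" for z
  proof (cases "Arg z \<le> 0")
    case True
    then show ?thesis using f(2)[of "Arg z"] that by (simp add: Arg_minus)
  next
    case False
    then show ?thesis using f(2)[of "Arg z - pi"] that by (simp add: Arg_minus)
  qed
  have cont1: "isCont (\<lambda>z. f (Arg z)) z" if "z \<notin> \<real>\<^sub>\<le>\<^sub>0" for z
  proof -
    have "isCont f (Arg z)" using f(1) by (simp add: continuous_on_eq_continuous_at)
    from isCont_o2[OF continuous_at_Arg[OF that] this] show ?thesis .
  qed
  have cont: "isCont (\<lambda>z. f (Arg z)) z" if "z \<noteq> 0" for z
  proof (cases "z \<in> \<real>\<^sub>\<le>\<^sub>0")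
    case True
    then have "- z \<notin> \<real>\<^sub>\<le>\<^sub>0" using that by (auto simp: complex_nonpos_Reals_iff complex_eq_iff)
    from isCont_o2[OF isCont_minus[OF continuous_ident] cont1[OF this]]
    have "isCont (\<lambda>z. f (Arg (- z))) z" .
    moreover have "\<forall>\<^sub>F w in nhds z. f (Arg (- w)) = f (Arg w)"
    proof -
      have "\<forall>\<^sub>F w in nhds z. w \<in> - {0}" using that by (intro eventually_nhds_in_open) auto
      then show ?thesis by eventually_elim (auto simp: g_minus)
    qed
    ultimately show ?thesis
      using isCont_cong[of "\<lambda>z. f (Arg (- z))" "\<lambda>z. f (Arg z)" z] by simp
  qed (rule cont1)
  have "isCont (\<lambda>x::real^2. Complex (x $ 1) (x $ 2)) y"
    unfolding Complex_eq by (intro continuous_intros)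
  moreover have "Complex (y $ 1) (y $ 2) \<noteq> 0" using y by (auto simp: complex_eq_iff vec_eq_iff forall_2)
  ultimately have "isCont (\<lambda>x. f (polar_angle x)) y"
    unfolding polar_angle_def by (rule isCont_o2[OF _ cont])
  then show ?thesis
    unfolding homogeneous_kernel_def using y by (intro continuous_intros) auto
qed

text \<open>The integrand decays like \<open>|v|\<^sup>s\<^sup>-\<^sup>2\<close>, and \<open>s < 1\<close>.\<close>

lemma nn_integral_slope_weight_finite:
  assumes s: "s < 1"
  shows "(\<integral>\<^sup>+v. ennreal (sqrt (1 + v\<^sup>2) powr (- 2 + s)) \<partial>lborel) < \<infinity>"
proof -
  have "(\<integral>\<^sup>+v. ennreal (sqrt (1 + v\<^sup>2) powr (- 2 + s)) \<partial>lborel)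
     \<le> (\<integral>\<^sup>+v. indicator {-1..1} v + (ennreal (v powr (- (1 - s) - 1)) * indicator {1..} v + ennreal ((- v) powr (- (1 - s) - 1)) * indicator {1..} (- v)) \<partial>lborel)"
  proof (rule nn_integral_mono)
    fix v :: real
    have *: "sqrt (1 + v\<^sup>2) powr (- 2 + s) \<le> \<bar>v\<bar> powr (- (1 - s) - 1)" if "1 \<le> \<bar>v\<bar>"
    proof -
      have "\<bar>v\<bar> \<le> sqrt (1 + v\<^sup>2)" by (rule real_le_rsqrt) simp
      then have "sqrt (1 + v\<^sup>2) powr (- 2 + s) \<le> \<bar>v\<bar> powr (- 2 + s)"
        using that s by (intro powr_mono2') auto
      then show ?thesis by simp
    qed
    have **: "sqrt (1 + v\<^sup>2) powr (- 2 + s) \<le> 1"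
      using s powr_mono2'[of "- 2 + s" 1 "sqrt (1 + v\<^sup>2)"] by simp
    consider "\<bar>v\<bar> \<le> 1" | "v > 1" | "v < -1" by linarith
    then show "ennreal (sqrt (1 + v\<^sup>2) powr (- 2 + s)) \<le> indicator {-1..1} v + (ennreal (v powr (- (1 - s) - 1)) * indicator {1..} v + ennreal ((- v) powr (- (1 - s) - 1)) * indicator {1..} (- v))"
    proof cases
      case 1
      then have "indicator {-1..1} v = (1 :: ennreal)" by (auto simp: indicator_def abs_le_iff)
      then show ?thesis using ** by (intro add_increasing2) (auto simp: ennreal_le_1)
    qed (use * in \<open>auto simp: indicator_def intro!: ennreal_leI\<close>)
  qed
  also have "\<dots> = 2 + ((\<integral>\<^sup>+v. ennreal (v powr (- (1 - s) - 1)) * indicator {1..} v \<partial>lborel) + (\<integral>\<^sup>+v. ennreal ((- v) powr (- (1 - s) - 1)) * indicator {1..} (- v) \<partial>lborel))"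
    by (simp add: nn_integral_add)
  also have "(\<integral>\<^sup>+v. ennreal ((- v) powr (- (1 - s) - 1)) * indicator {1..} (- v) \<partial>lborel) = (\<integral>\<^sup>+v. ennreal (v powr (- (1 - s) - 1)) * indicator {1..} v \<partial>lborel)"
    by (rule nn_integral_lborel_reflect) measurable
  also have "2 + (\<dots> + \<dots>) < \<infinity>"
    using nn_integral_powr_tail[of "1 - s" 1] s by simp
  finally show ?thesis .
qed

lemma integral_even_times_signed:
  fixes g :: "real \<Rightarrow> real"
  assumes g: "integrable lborel g" and even: "\<And>u. g (- u) = g u"
  shows "(LINT u|lborel. (if u > 0 then a else b) * g u) = (a + b) / 2 * (LINT u|lborel. g u)"
proof -
  have [measurable]: "g \<in> borel_measurable borel" using g by auto
  let ?h = "\<lambda>u. (if u > 0 then a else b) * g u"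
  have int: "integrable lborel ?h"
    by (rule Bochner_Integration.integrable_bound[where f = "\<lambda>u. (\<bar>a\<bar> + \<bar>b\<bar>) * g u"])
       (use g in \<open>auto simp: abs_mult intro!: mult_right_mono\<close>)
  have "(LINT u|lborel. ?h u) = \<bar>-1\<bar> *\<^sub>R (LINT u|lborel. ?h (0 + -1 * u))"
    by (rule lborel_integral_real_affine) simp
  then have refl: "(LINT u|lborel. ?h u) = (LINT u|lborel. ?h (- u))" by simp
  have int': "integrable lborel (\<lambda>u. ?h (- u))"
    using lborel_integrable_real_affine[OF int, of "-1" 0] by simp
  have "2 * (LINT u|lborel. ?h u) = (LINT u|lborel. ?h u) + (LINT u|lborel. ?h (- u))"
    using refl by simp
  also have "\<dots> = (LINT u|lborel. ?h u + ?h (- u))"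
    using int int' by (rule Bochner_Integration.integral_add[symmetric])
  also have "\<dots> = (LINT u|lborel. (a + b) * g u)"
  proof (rule integral_cong_AE)
    have "AE u::real in lborel. u \<noteq> 0" by (rule AE_lborel_singleton)
    then show "AE u in lborel. ?h u + ?h (- u) = (a + b) * g u"
      by eventually_elim (auto simp: even distrib_right)
  qed measurable
  also have "\<dots> = (a + b) * (LINT u|lborel. g u)" by simp
  finally show ?thesis by simp
qed

text \<open>As \<open>u\<close> changes sign, the frequency \<open>(u, u v)\<close> runs through two opposite rays; against the even
  functions of \<open>u\<close> that occur here only the mean of the values on the two rays matters.\<close>

definition slope_weight :: "real \<Rightarrow> (real \<Rightarrow> real) \<Rightarrow> real \<Rightarrow> real" where
  "slope_weight s \<Omega>t v = fourier_constant s *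
     ((homogeneous_kernel (- 2 + s) \<Omega>t (vector [1, v]) + homogeneous_kernel (- 2 + s) \<Omega>t (vector [-1, - v])) / 2)"

lemma measurable_slope_weight [measurable]:
  assumes "continuous_on UNIV \<Omega>t"
  shows "slope_weight s \<Omega>t \<in> borel_measurable borel"
proof -
  note [measurable] = measurable_homogeneous_kernel[OF assms]
  show ?thesis unfolding slope_weight_def by measurable
qed

text \<open>The Fourier identity tested against the modulated Gaussian. On the frequency side, integrate
  along the lines of slope \<open>v\<close>: homogeneity leaves \<open>|u|\<^sup>s\<^sup>-\<^sup>1\<close> times a Gaussian and an oscillation,
  which is a smoothed Riesz kernel in \<open>slope v y\<close>. The factor \<open>1 + v\<^sup>2\<close> in its variance comes
  from \<open>|(u, u v)|\<^sup>2 = u\<^sup>2 (1 + v\<^sup>2)\<close>. The Fourier identity is one of Bochner integrals, which are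
  \<open>0\<close> by default for functions that are not integrable; finiteness of the left side rules this
  out.\<close>

lemma smoothed_kernel_eq:
  assumes s: "0 < s" "s < 1" and cont: "continuous_on UNIV \<Omega>" and pos: "\<And>\<theta>. \<Omega> \<theta> > 0"
    and ang: "angular_fourier s \<Omega> \<Omega>t" and nonneg: "\<And>\<phi>. \<Omega>t \<phi> \<ge> 0"
    and \<tau>: "\<tau> > 0"
    and fin: "(\<integral>\<^sup>+x. ennreal (homogeneous_kernel (- s) \<Omega> x) * ennreal (gauss2 \<tau> (x - y)) \<partial>lborel) < \<infinity>"
  shows "(\<integral>\<^sup>+x. ennreal (homogeneous_kernel (- s) \<Omega> x) * ennreal (gauss2 \<tau> (x - y)) \<partial>lborel)
    = (\<integral>\<^sup>+v. ennreal (slope_weight s \<Omega>t v) * gauss_riesz s (\<tau> * (1 + v\<^sup>2)) (slope v y) \<partial>lborel)"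
proof -
  define T where "T = homogeneous_kernel (- s) \<Omega>"
  define S where "S = homogeneous_kernel (- 2 + s) \<Omega>t"
  have cont': "continuous_on UNIV \<Omega>t" and four: "has_tempered_fourier T S"
    using ang by (auto simp: angular_fourier_def T_def S_def)
  have [measurable]: "T \<in> borel_measurable borel" "S \<in> borel_measurable borel"
    unfolding T_def S_def by (intro measurable_homogeneous_kernel cont cont')+
  have T0: "T x \<ge> 0" for x using pos[of "polar_angle x"] by (simp add: T_def homogeneous_kernel_def)
  have S0: "S x \<ge> 0" for x using nonneg by (simp add: S_def homogeneous_kernel_def)
  obtain M where M: "M \<ge> 0" "\<And>x. S x \<le> M * norm x powr (- 2 + s)"
    using homogeneous_kernel_bounded[OF cont'] unfolding S_def by (metis abs_le_D1)
  let ?g = "\<lambda>\<tau> u. \<bar>u\<bar> powr (s - 1) * exp (- 2 * pi\<^sup>2 * \<tau> * u\<^sup>2)"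
  let ?\<psi> = "modulated_gaussian (2 * pi\<^sup>2 * \<tau>) y"
  have a: "2 * pi\<^sup>2 * \<tau> > 0" using \<tau> by simp
  \<comment> \<open>The Jacobian \<open>|u|\<close> turns degree \<open>-2 + s\<close> into the one-dimensional degree \<open>s - 1\<close>.\<close>
  have S_slope: "\<bar>u\<bar> * S (vector [u, u * v]) = (if u > 0 then S (vector [1, v]) else S (vector [-1, - v])) * \<bar>u\<bar> powr (s - 1)"
    if "u \<noteq> 0" for u v
  proof -
    have A: "S (vector [u, u * v]) = \<bar>u\<bar> powr (- 2 + s) * (if u > 0 then S (vector [1, v]) else S (vector [-1, - v]))"
    proof (cases "u > 0")
      case True
      have "(vector [u, u * v] :: real^2) = u *\<^sub>R vector [1, v]" by (simp add: vec_eq_iff forall_2)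
      then show ?thesis using True homogeneous_kernel_scale[of u] by (simp add: S_def)
    next
      case False
      then have "- u > 0" using that by simp
      have "(vector [u, u * v] :: real^2) = (- u) *\<^sub>R vector [-1, - v]" by (simp add: vec_eq_iff forall_2)
      then show ?thesis using False \<open>- u > 0\<close> homogeneous_kernel_scale[of "- u"] by (simp add: S_def)
    qed
    have B: "\<bar>u\<bar> * \<bar>u\<bar> powr (- 2 + s) = \<bar>u\<bar> powr (s - 1)"
      using that powr_add[of "\<bar>u\<bar>" 1 "- 2 + s"] by simp
    show ?thesis unfolding A mult.assoc[symmetric] B by (rule mult.commute)
  qed
  have weight_bound: "S (vector [1, v]) \<le> M * sqrt (1 + v\<^sup>2) powr (- 2 + s)" "S (vector [-1, - v]) \<le> M * sqrt (1 + v\<^sup>2) powr (- 2 + s)" for v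
    using M(2)[of "vector [1, v]"] M(2)[of "vector [-1, - v]"] by (simp_all add: norm_2)
  have g_int: "integrable lborel (?g \<tau>')" if "\<tau>' > 0" for \<tau>'
    using riesz_fourier_gauss(3)[OF s that] .
  have intS: "integrable lborel (\<lambda>\<xi>. S \<xi> * exp (- (2 * pi\<^sup>2 * \<tau>) * (norm \<xi>)\<^sup>2))"
  proof (rule integrableI_bounded)
    have "(\<integral>\<^sup>+\<xi>. ennreal (norm (S \<xi> * exp (- (2 * pi\<^sup>2 * \<tau>) * (norm \<xi>)\<^sup>2))) \<partial>lborel)
       = (\<integral>\<^sup>+\<xi>. ennreal (S \<xi> * exp (- (2 * pi\<^sup>2 * \<tau>) * (norm \<xi>)\<^sup>2)) \<partial>lborel)"
      using S0 by simp
    also have "\<dots> = (\<integral>\<^sup>+v. \<integral>\<^sup>+u. ennreal \<bar>u\<bar> * ennreal (S (vector [u, u * v]) * exp (- (2 * pi\<^sup>2 * \<tau>) * (norm (vector [u, u * v] :: real^2))\<^sup>2)) \<partial>lborel \<partial>lborel)"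
      by (rule nn_integral_slopes) measurable
    also have "\<dots> \<le> (\<integral>\<^sup>+v. \<integral>\<^sup>+u. ennreal (M * sqrt (1 + v\<^sup>2) powr (- 2 + s)) * ennreal (?g \<tau> u) \<partial>lborel \<partial>lborel)"
    proof (intro nn_integral_mono)
      fix v u :: real
      show "ennreal \<bar>u\<bar> * ennreal (S (vector [u, u * v]) * exp (- (2 * pi\<^sup>2 * \<tau>) * (norm (vector [u, u * v] :: real^2))\<^sup>2))
         \<le> ennreal (M * sqrt (1 + v\<^sup>2) powr (- 2 + s)) * ennreal (?g \<tau> u)"
      proof (cases "u = 0")
        case False
        have e: "exp (- (2 * pi\<^sup>2 * \<tau>) * (norm (vector [u, u * v] :: real^2))\<^sup>2) \<le> exp (- 2 * pi\<^sup>2 * \<tau> * u\<^sup>2)"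
        proof -
          have "u\<^sup>2 \<le> (norm (vector [u, u * v] :: real^2))\<^sup>2" by (simp add: norm_2_square)
          then have "(2 * pi\<^sup>2 * \<tau>) * u\<^sup>2 \<le> (2 * pi\<^sup>2 * \<tau>) * (norm (vector [u, u * v] :: real^2))\<^sup>2"
            using a by (intro mult_left_mono) auto
          then show ?thesis by simp
        qed
        have "\<bar>u\<bar> * (S (vector [u, u * v]) * exp (- (2 * pi\<^sup>2 * \<tau>) * (norm (vector [u, u * v] :: real^2))\<^sup>2))
          = (if u > 0 then S (vector [1, v]) else S (vector [-1, - v])) * \<bar>u\<bar> powr (s - 1) * exp (- (2 * pi\<^sup>2 * \<tau>) * (norm (vector [u, u * v] :: real^2))\<^sup>2)"
          by (simp only: mult.assoc[symmetric] S_slope[OF False])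
        also have "\<dots> \<le> M * sqrt (1 + v\<^sup>2) powr (- 2 + s) * \<bar>u\<bar> powr (s - 1) * exp (- 2 * pi\<^sup>2 * \<tau> * u\<^sup>2)"
          using weight_bound[of v] S0 M(1) by (intro mult_mono e) auto
        finally show ?thesis
          using S0 M(1) by (simp add: ennreal_mult'[symmetric] ennreal_leI mult.assoc)
      qed simp
    qed
    also have "\<dots> = (\<integral>\<^sup>+v. ennreal M * ennreal (sqrt (1 + v\<^sup>2) powr (- 2 + s)) * (\<integral>\<^sup>+u. ennreal (?g \<tau> u) \<partial>lborel) \<partial>lborel)"
      using M(1) by (simp add: nn_integral_cmult ennreal_mult)
    also have "\<dots> = ennreal M * (\<integral>\<^sup>+v. ennreal (sqrt (1 + v\<^sup>2) powr (- 2 + s)) \<partial>lborel) * (\<integral>\<^sup>+u. ennreal (?g \<tau> u) \<partial>lborel)"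
      by (simp add: nn_integral_cmult nn_integral_multc)
    also have "\<dots> < \<infinity>"
      using nn_integral_slope_weight_finite[OF s(2)] g_int[OF \<tau>]
      by (simp add: ennreal_mult_less_top integrable_iff_bounded)
    finally show "(\<integral>\<^sup>+\<xi>. ennreal (norm (S \<xi> * exp (- (2 * pi\<^sup>2 * \<tau>) * (norm \<xi>)\<^sup>2))) \<partial>lborel) < \<infinity>" .
  qed measurable
  have intc: "integrable lborel (\<lambda>\<xi>. complex_of_real (S \<xi>) * ?\<psi> \<xi>)"
    by (rule Bochner_Integration.integrable_bound[OF intS]) (auto simp: norm_mult norm_modulated_gaussian)
  define f where "f \<xi> = S \<xi> * (exp (- (2 * pi\<^sup>2 * \<tau>) * (norm \<xi>)\<^sup>2) * cos (2 * pi * (y \<bullet> \<xi>)))" for \<xi>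
  have f_eq: "f \<xi> = Re (complex_of_real (S \<xi>) * ?\<psi> \<xi>)" for \<xi>
    by (simp add: f_def modulated_gaussian_def Re_exp power2_norm_eq_inner mult_ac)
  have int_f: "integrable lborel f" unfolding f_eq[abs_def] by (rule integrable_Re[OF intc])
  have "complex_of_real (LINT x|lborel. T x * gauss2 \<tau> (x - y)) = (LINT x|lborel. of_real (T x) * fourier ?\<psi> x)"
    unfolding fourier_modulated_gaussian[OF \<tau>] integral_complex_of_real[symmetric] by simp
  also have "\<dots> = (LINT \<xi>|lborel. of_real (S \<xi>) * ?\<psi> \<xi>)"
    using four schwartz_modulated_gaussian[OF a] unfolding has_tempered_fourier_def by blast
  finally have "Re (complex_of_real (LINT x|lborel. T x * gauss2 \<tau> (x - y))) = Re (LINT \<xi>|lborel. of_real (S \<xi>) * ?\<psi> \<xi>)"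
    by (rule arg_cong)
  then have "(LINT x|lborel. T x * gauss2 \<tau> (x - y)) = Re (LINT \<xi>|lborel. of_real (S \<xi>) * ?\<psi> \<xi>)"
    unfolding Re_complex_of_real .
  also have "\<dots> = (LINT \<xi>|lborel. f \<xi>)"
    unfolding f_eq[abs_def] by (rule integral_Re[OF intc, symmetric])
  also have "\<dots> = (LINT v|lborel. LINT u|lborel. \<bar>u\<bar> * f (vector [u, u * v]))"
    by (rule integral_slopes(1)[OF int_f])
  finally have L: "(LINT x|lborel. T x * gauss2 \<tau> (x - y)) = (LINT v|lborel. LINT u|lborel. \<bar>u\<bar> * f (vector [u, u * v]))" .
  define J where "J v = (LINT u|lborel. \<bar>u\<bar> powr (s - 1) * (exp (- 2 * pi\<^sup>2 * (\<tau> * (1 + v\<^sup>2)) * u\<^sup>2) * cos (2 * pi * u * slope v y)))" for v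
  define w where "w v = (S (vector [1, v]) + S (vector [-1, - v])) / 2" for v
  have w0: "w v \<ge> 0" for v using S0 by (simp add: w_def)
  have pos_var: "\<tau> * (1 + v\<^sup>2) > 0" for v using \<tau> by (intro mult_pos_pos) (auto intro: add_pos_nonneg)
  have J0: "J v \<ge> 0" for v unfolding J_def by (rule riesz_fourier_gauss(2)[OF s pos_var])
  have inner: "(LINT u|lborel. \<bar>u\<bar> * f (vector [u, u * v])) = w v * J v" for v
  proof -
    let ?h = "\<lambda>u. \<bar>u\<bar> powr (s - 1) * (exp (- 2 * pi\<^sup>2 * (\<tau> * (1 + v\<^sup>2)) * u\<^sup>2) * cos (2 * pi * u * slope v y))"
    have "(LINT u|lborel. \<bar>u\<bar> * f (vector [u, u * v])) = (LINT u|lborel. (if u > 0 then S (vector [1, v]) else S (vector [-1, - v])) * ?h u)"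
    proof (rule Bochner_Integration.integral_cong)
      fix u :: real
      show "\<bar>u\<bar> * f (vector [u, u * v]) = (if u > 0 then S (vector [1, v]) else S (vector [-1, - v])) * ?h u"
      proof (cases "u = 0")
        case False
        have n: "- (2 * pi\<^sup>2 * \<tau>) * (norm (vector [u, u * v] :: real^2))\<^sup>2 = - 2 * pi\<^sup>2 * (\<tau> * (1 + v\<^sup>2)) * u\<^sup>2"
          by (simp add: norm_2_square power_mult_distrib algebra_simps)
        have i: "2 * pi * (y \<bullet> vector [u, u * v]) = 2 * pi * u * slope v y"
          by (simp add: inner_2 slope_def algebra_simps)
        have "\<bar>u\<bar> * f (vector [u, u * v]) = (\<bar>u\<bar> * S (vector [u, u * v])) * (exp (- 2 * pi\<^sup>2 * (\<tau> * (1 + v\<^sup>2)) * u\<^sup>2) * cos (2 * pi * u * slope v y))"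
          unfolding f_def n i by (simp add: mult.assoc)
        then show ?thesis unfolding S_slope[OF False] by (simp add: mult.assoc)
      qed simp
    qed simp
    also have "\<dots> = w v * J v"
      unfolding w_def J_def
    proof (rule integral_even_times_signed)
      show "integrable lborel ?h"
        by (rule Bochner_Integration.integrable_bound[OF g_int[OF pos_var[of v]]])
           (auto simp: abs_mult intro!: mult_left_mono mult_left_le)
    qed simp
    finally show ?thesis .
  qed
  have int_wJ: "integrable lborel (\<lambda>v. w v * J v)"
    using integral_slopes(2)[OF int_f] by (simp only: inner)
  have intT: "integrable lborel (\<lambda>x. T x * gauss2 \<tau> (x - y))"
    using fin T0 by (intro integrableI_nonneg) (auto simp: T_def[symmetric] ennreal_mult')
  have "(\<integral>\<^sup>+x. ennreal (T x) * ennreal (gauss2 \<tau> (x - y)) \<partial>lborel) = ennreal (LINT x|lborel. T x * gauss2 \<tau> (x - y))"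
    using nn_integral_eq_integral[OF intT] T0 by (simp add: ennreal_mult')
  also have "\<dots> = ennreal (LINT v|lborel. w v * J v)"
    unfolding L inner ..
  also have "\<dots> = (\<integral>\<^sup>+v. ennreal (w v * J v) \<partial>lborel)"
    using w0 J0 by (intro nn_integral_eq_integral[symmetric] int_wJ) auto
  also have "\<dots> = (\<integral>\<^sup>+v. ennreal (slope_weight s \<Omega>t v) * gauss_riesz s (\<tau> * (1 + v\<^sup>2)) (slope v y) \<partial>lborel)"
  proof (rule nn_integral_cong)
    fix v
    have "ennreal (w v * J v) = ennreal (w v) * (ennreal (fourier_constant s) * gauss_riesz s (\<tau> * (1 + v\<^sup>2)) (slope v y))"
      using w0 riesz_fourier_gauss(1)[OF s pos_var[of v], of "slope v y"] by (simp add: ennreal_mult' J_def)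
    moreover have "slope_weight s \<Omega>t v = fourier_constant s * w v"
      by (simp add: slope_weight_def w_def S_def)
    ultimately show "ennreal (w v * J v) = ennreal (slope_weight s \<Omega>t v) * gauss_riesz s (\<tau> * (1 + v\<^sup>2)) (slope v y)"
      using fourier_constant_pos[OF s] by (simp add: ennreal_mult' mult_ac)
  qed
  finally show ?thesis unfolding T_def .
qed

text \<open>Let the variance of the smoothing tend to \<open>0\<close>. The left side converges because the kernel is
  continuous at \<open>y \<noteq> 0\<close>. On the right side Fatou's lemma first shows that the limit integrand is
  integrable; being a bound for the smoothed integrands up to a constant, it then justifies
  dominated convergence.\<close>

theorem kernel_eq_slope_mixture:
  assumes s: "0 < s" "s < 1" and cont: "continuous_on UNIV \<Omega>" and pos: "\<And>\<theta>. \<Omega> \<theta> > 0"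
    and per: "\<And>\<theta>. \<Omega> (\<theta> + pi) = \<Omega> \<theta>"
    and ang: "angular_fourier s \<Omega> \<Omega>t" and nonneg: "\<And>\<phi>. \<Omega>t \<phi> \<ge> 0" and y: "y \<noteq> 0"
  shows "ennreal (homogeneous_kernel (- s) \<Omega> y) = (\<integral>\<^sup>+v. ennreal (slope_weight s \<Omega>t v) * riesz s (slope v y) \<partial>lborel)"
proof -
  have cont': "continuous_on UNIV \<Omega>t" using ang by (auto simp: angular_fourier_def)
  note [measurable] = measurable_slope_weight[OF cont']
  define T where "T = homogeneous_kernel (- s) \<Omega>"
  obtain C where C: "\<And>x. \<bar>T x\<bar> \<le> C * norm x powr (- s)"
    using homogeneous_kernel_bounded[OF cont] unfolding T_def by metis
  define \<tau> where "\<tau> n = 1 / real (Suc n)" for n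
  have \<tau>: "\<And>n. \<tau> n > 0" "\<tau> \<longlonglongrightarrow> 0"
    using LIMSEQ_inverse_real_of_nat by (auto simp: \<tau>_def[abs_def] inverse_eq_divide)
  let ?L = "\<lambda>n. \<integral>\<^sup>+x. ennreal (T x) * ennreal (gauss2 (\<tau> n) (x - y)) \<partial>lborel"
  let ?W = "\<lambda>v. ennreal (slope_weight s \<Omega>t v)"
  let ?R = "\<lambda>n v. ?W v * gauss_riesz s (\<tau> n * (1 + v\<^sup>2)) (slope v y)"
  let ?G = "\<lambda>v. ?W v * riesz s (slope v y)"
  have L: "?L \<longlonglongrightarrow> ennreal (T y)"
  proof (rule gauss2_approximates_singular_kernel[OF s \<tau>])
    show "T \<in> borel_measurable borel" unfolding T_def by (rule measurable_homogeneous_kernel[OF cont])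
    show "0 \<le> T x" for x using pos[of "polar_angle x"] by (simp add: T_def homogeneous_kernel_def)
    show "T x \<le> C * norm x powr (- s)" for x using C[of x] by simp
    show "isCont T y" unfolding T_def by (rule homogeneous_kernel_isCont[OF cont per y])
  qed fact
  have "\<forall>\<^sub>F n in sequentially. ?L n < \<infinity>" using L by (rule order_tendstoD) simp
  then have ev: "\<forall>\<^sub>F n in sequentially. ?L n = (\<integral>\<^sup>+v. ?R n v \<partial>lborel)"
    by eventually_elim (unfold T_def, rule smoothed_kernel_eq[OF s cont pos ang nonneg \<tau>(1)], simp)
  have R: "(\<lambda>n. \<integral>\<^sup>+v. ?R n v \<partial>lborel) \<longlonglongrightarrow> ennreal (T y)"
    using L ev by (rule Lim_transform_eventually)
  have ne: "AE v in lborel. slope v y \<noteq> 0"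
  proof (cases "y $ 2 = 0")
    case True
    then have "y $ 1 \<noteq> 0" using y by (auto simp: vec_eq_iff forall_2)
    with True show ?thesis by (simp add: slope_def)
  next
    case False
    have "AE v in lborel. v \<noteq> - y $ 1 / y $ 2" by (rule AE_lborel_singleton)
    then show ?thesis by eventually_elim (use False in \<open>auto simp: slope_def field_simps\<close>)
  qed
  have scale: "gauss_riesz s (\<tau> n * (1 + v\<^sup>2)) (slope v y) = riesz s (slope v y) * gauss_riesz s (\<tau> n * (1 + v\<^sup>2) / (slope v y)\<^sup>2) 1"
    if "slope v y \<noteq> 0" for n v
    using that \<tau>(1)[of n] by (intro gauss_riesz_scale mult_pos_pos) (auto intro: add_pos_nonneg)
  have lim: "(\<lambda>n. gauss_riesz s (\<tau> n * (1 + v\<^sup>2)) (slope v y)) \<longlonglongrightarrow> riesz s (slope v y)" if "slope v y \<noteq> 0" for v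
  proof -
    have "(\<lambda>n. gauss_riesz s (\<tau> n * (1 + v\<^sup>2) / (slope v y)\<^sup>2) 1) \<longlonglongrightarrow> 1"
    proof (rule gauss_riesz_1_tendsto[OF s])
      show "\<tau> n * (1 + v\<^sup>2) / (slope v y)\<^sup>2 > 0" for n
        using that \<tau>(1)[of n] by (intro divide_pos_pos mult_pos_pos) (auto intro: add_pos_nonneg)
      have "(\<lambda>n. \<tau> n * (1 + v\<^sup>2) / (slope v y)\<^sup>2) \<longlonglongrightarrow> 0 * (1 + v\<^sup>2) / (slope v y)\<^sup>2"
        using that by (intro tendsto_intros \<tau>(2)) auto
      then show "(\<lambda>n. \<tau> n * (1 + v\<^sup>2) / (slope v y)\<^sup>2) \<longlonglongrightarrow> 0" by simp
    qed
    then have "(\<lambda>n. riesz s (slope v y) * gauss_riesz s (\<tau> n * (1 + v\<^sup>2) / (slope v y)\<^sup>2) 1) \<longlonglongrightarrow> riesz s (slope v y) * 1"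
      using that by (intro ennreal_tendsto_cmult) (auto simp: riesz_nonzero)
    then show ?thesis by (simp add: scale[OF that])
  qed
  have limR: "AE v in lborel. (\<lambda>n. ?R n v) \<longlonglongrightarrow> ?G v"
    using ne by eventually_elim (intro ennreal_tendsto_cmult lim, auto)
  have "(\<integral>\<^sup>+v. ?G v \<partial>lborel) = (\<integral>\<^sup>+v. liminf (\<lambda>n. ?R n v) \<partial>lborel)"
  proof (rule nn_integral_cong_AE)
    show "AE v in lborel. ?G v = liminf (\<lambda>n. ?R n v)"
      using limR by eventually_elim (simp add: lim_imp_Liminf)
  qed
  also have "\<dots> \<le> liminf (\<lambda>n. \<integral>\<^sup>+v. ?R n v \<partial>lborel)"
    by (rule nn_integral_liminf) measurable
  also have "\<dots> = ennreal (T y)" using R by (simp add: lim_imp_Liminf)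
  finally have G_fin: "(\<integral>\<^sup>+v. ?G v \<partial>lborel) < \<infinity>" by (simp add: le_less_trans)
  obtain K where K: "\<And>\<tau>. \<tau> > 0 \<Longrightarrow> gauss_riesz s \<tau> 1 \<le> ennreal K" using gauss_riesz_1_bound[OF s] by blast
  have "(\<lambda>n. \<integral>\<^sup>+v. ?R n v \<partial>lborel) \<longlonglongrightarrow> (\<integral>\<^sup>+v. ?G v \<partial>lborel)"
  proof (rule nn_integral_dominated_convergence[where w = "\<lambda>v. ?G v * ennreal K"])
    show "(\<integral>\<^sup>+v. ?G v * ennreal K \<partial>lborel) < \<infinity>"
      using G_fin by (simp add: nn_integral_multc ennreal_mult_less_top)
    show "AE v in lborel. ?R n v \<le> ?G v * ennreal K" for n
      using ne
    proof eventually_elim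
      case (elim v)
      have "\<tau> n * (1 + v\<^sup>2) / (slope v y)\<^sup>2 > 0"
        using elim \<tau>(1)[of n] by (intro divide_pos_pos mult_pos_pos) (auto intro: add_pos_nonneg)
      from K[OF this] show ?case
        unfolding scale[OF elim] mult.assoc by (intro mult_left_mono) auto
    qed
    show "AE v in lborel. (\<lambda>n. ?R n v) \<longlonglongrightarrow> ?G v" by (rule limR)
  qed measurable
  with R have "ennreal (T y) = (\<integral>\<^sup>+v. ?G v \<partial>lborel)" by (rule LIMSEQ_unique)
  then show ?thesis unfolding T_def .
qed

section \<open>Rotations and the disc density\<close>

text \<open>The indicator of a closed set is the limit of the continuous functions \<open>max 0 (1 - n dist)\<close>, and
  the closed sets generate the Borel sets.\<close>

lemma measure_eqI_continuous:
  fixes \<mu> \<nu> :: "'a :: euclidean_space measure"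
  assumes \<mu>: "prob_space \<mu>" "sets \<mu> = sets borel" and \<nu>: "prob_space \<nu>" "sets \<nu> = sets borel"
    and eq: "\<And>f :: 'a \<Rightarrow> real. continuous_on UNIV f \<Longrightarrow> bounded (range f) \<Longrightarrow> (LINT x|\<mu>. f x) = (LINT x|\<nu>. f x)"
  shows "\<mu> = \<nu>"
proof -
  interpret M: prob_space \<mu> by fact
  interpret N: prob_space \<nu> by fact
  have closed_eq: "emeasure \<mu> C = emeasure \<nu> C" if C: "closed C" for C
  proof (cases "C = {}")
    case False
    define f where "f n x = max 0 (1 - real n * infdist x C)" for n and x :: 'a
    have f01: "0 \<le> f n x" "f n x \<le> 1" for n x
      using infdist_nonneg[of x C] by (auto simp: f_def)
    have cont: "continuous_on UNIV (f n)" for n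
      unfolding f_def by (intro continuous_intros)
    have lim: "(\<lambda>n. f n x) \<longlonglongrightarrow> indicator C x" for x
    proof (cases "x \<in> C")
      case False
      then have d: "infdist x C > 0" using C \<open>C \<noteq> {}\<close> by (simp add: infdist_pos_not_in_closed)
      obtain N :: nat where N: "1 / infdist x C < N" using reals_Archimedean2 by blast
      have "\<forall>\<^sub>F n in sequentially. f n x = 0"
      proof (rule eventually_sequentiallyI[of N])
        fix n assume "N \<le> n"
        then have "1 / infdist x C < real n" using N by linarith
        then show "f n x = 0" using d by (simp add: f_def field_simps)
      qed
      with False show ?thesis by (simp add: tendsto_eventually)
    qed (simp add: f_def)
    have *: "(\<lambda>n. LINT x|m. f n x) \<longlonglongrightarrow> measure m C" if "prob_space m" "sets m = sets borel" for m
    proof -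
      interpret m: prob_space m by fact
      have [measurable_cong]: "sets m = sets borel" by fact
      have "f n \<in> borel_measurable m" for n
        using borel_measurable_continuous_onI[OF cont] by measurable
      moreover have "C \<in> sets m" using C that by auto
      ultimately have "(\<lambda>n. LINT x|m. f n x) \<longlonglongrightarrow> (LINT x|m. indicator C x)"
        by (intro integral_dominated_convergence[where w = "\<lambda>_. 1"]) (use f01 lim in auto)
      then show ?thesis using \<open>C \<in> sets m\<close> by simp
    qed
    have "(LINT x|\<mu>. f n x) = (LINT x|\<nu>. f n x)" for n
      by (rule eq[OF cont]) (use f01 in \<open>auto simp: bounded_iff intro!: exI[of _ 1]\<close>)
    then have "measure \<mu> C = measure \<nu> C"
      using *[OF \<mu>] *[OF \<nu>] LIMSEQ_unique by simp
    then show ?thesis by (simp add: M.emeasure_eq_measure N.emeasure_eq_measure)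
  qed simp
  show ?thesis
  proof (rule measure_eqI_generator_eq)
    show "Int_stable (Collect closed :: 'a set set)" by (auto simp: Int_stable_def)
    show "sets \<mu> = sigma_sets UNIV (Collect closed)" "sets \<nu> = sigma_sets UNIV (Collect closed)"
      using \<mu> \<nu> by (simp_all add: borel_eq_closed)
    show "range (\<lambda>_::nat. UNIV) \<subseteq> (Collect closed :: 'a set set)" by auto
  qed (use M.emeasure_finite in \<open>auto simp: closed_eq\<close>)
qed

lemma rotation_apply:
  "rotation \<theta> *v x = vector [cos \<theta> * x $ 1 - sin \<theta> * x $ 2, sin \<theta> * x $ 1 + cos \<theta> * x $ 2]"
  by (simp add: vec_eq_iff forall_2 matrix_vector_mult_def sum_2 rotation_def)

lemma rotation_inverse [simp]: "rotation (- \<theta>) *v (rotation \<theta> *v x) = x" "rotation \<theta> *v (rotation (- \<theta>) *v x) = x"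
proof -
  have *: "c * (c * a - s * b) + s * (s * a + c * b) = (c\<^sup>2 + s\<^sup>2) * a"
    "c * (s * a + c * b) - s * (c * a - s * b) = (c\<^sup>2 + s\<^sup>2) * b" for a b c s :: real
    by (simp_all add: power2_eq_square algebra_simps)
  have 1: "rotation (- \<theta>) *v (rotation \<theta> *v x) = x" for \<theta>
    using *[where c = "cos \<theta>" and s = "sin \<theta>" and a = "x $ 1" and b = "x $ 2"] by (simp add: rotation_apply vec_eq_iff forall_2)
  show "rotation (- \<theta>) *v (rotation \<theta> *v x) = x" by (rule 1)
  show "rotation \<theta> *v (rotation (- \<theta>) *v x) = x" using 1[of "- \<theta>"] by simp
qed

lemma norm_rotation [simp]: "norm (rotation \<theta> *v x) = norm x"
proof -
  have "(c * a - s * b)\<^sup>2 + (s * a + c * b)\<^sup>2 = (c\<^sup>2 + s\<^sup>2) * (a\<^sup>2 + b\<^sup>2)" for a b c s :: real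
    by (simp add: power2_eq_square algebra_simps)
  from this[of "cos \<theta>" "x $ 1" "sin \<theta>" "x $ 2"] show ?thesis by (simp add: norm_2 rotation_apply)
qed

lemma orthogonal_transformation_rotation: "orthogonal_transformation (\<lambda>x. rotation \<theta> *v x)"
  unfolding orthogonal_transformation by simp

lemma measurable_rotation [measurable]: "(\<lambda>x. rotation \<theta> *v x) \<in> borel_measurable borel"
  by (intro borel_measurable_continuous_onI linear_continuous_on) (simp add: linear_conv_bounded_linear[symmetric])

lemma lborel_rotation: "distr lborel borel (\<lambda>x. rotation \<theta> *v x) = lborel"
proof (rule lborel_eqI[symmetric])
  fix l u :: "real^2"
  assume le: "\<And>b. b \<in> Basis \<Longrightarrow> l \<bullet> b \<le> u \<bullet> b"
  have pre: "(\<lambda>x. rotation \<theta> *v x) -` box l u = (\<lambda>x. rotation (- \<theta>) *v x) ` box l u"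
    by (auto intro: image_eqI[of _ _ "rotation \<theta> *v _"])
  have vb: "(\<lambda>x. rotation \<theta> *v x) -` box l u \<in> sets lborel"
    using measurable_sets[OF measurable_rotation[of \<theta>], of "box l u"] by simp
  have lm: "(\<lambda>x. rotation (- \<theta>) *v x) ` box l u \<in> lmeasurable"
    by (intro measurable_orthogonal_image orthogonal_transformation_rotation) simp
  have "emeasure (distr lborel borel (\<lambda>x. rotation \<theta> *v x)) (box l u) = emeasure lborel ((\<lambda>x. rotation \<theta> *v x) -` box l u)"
    by (subst emeasure_distr) auto
  also have "\<dots> = emeasure lebesgue ((\<lambda>x. rotation (- \<theta>) *v x) ` box l u)"
    unfolding pre[symmetric] emeasure_completion[OF sets_completionI_sets[OF vb]] main_part[OF vb] ..
  also have "\<dots> = ennreal (measure lebesgue ((\<lambda>x. rotation (- \<theta>) *v x) ` box l u))"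
    by (rule emeasure_eq_measure2[OF lm])
  also have "\<dots> = ennreal (measure lebesgue (box l u))"
    by (subst measure_orthogonal_image[OF orthogonal_transformation_rotation]) auto
  also have "\<dots> = (\<Prod>b\<in>Basis. (u - l) \<bullet> b)"
    using le by (simp add: measure_lborel_box_eq inner_diff_left)
  finally show "emeasure (distr lborel borel (\<lambda>x. rotation \<theta> *v x)) (box l u) = (\<Prod>b\<in>Basis. (u - l) \<bullet> b)" .
qed simp

lemma nn_integral_rotation:
  fixes f :: "real^2 \<Rightarrow> ennreal"
  assumes [measurable]: "f \<in> borel_measurable borel"
  shows "(\<integral>\<^sup>+x. f (rotation \<theta> *v x) \<partial>lborel) = (\<integral>\<^sup>+x. f x \<partial>lborel)"
  by (subst (2) lborel_rotation[of \<theta>, symmetric]) (simp add: nn_integral_distr)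

definition disc_measure :: "real \<Rightarrow> (real^2) measure" where
  "disc_measure s = density lborel (\<lambda>x. ennreal (rho2 s x))"

lemma sets_disc_measure [simp, measurable_cong]: "sets (disc_measure s) = sets borel"
  by (simp add: disc_measure_def)

lemma measurable_rho2 [measurable]: "rho2 s \<in> borel_measurable borel"
  unfolding rho2_def by measurable

text \<open>The third fact is the normalization of \<open>rho2\<close>.\<close>

lemma constants_pos:
  assumes "0 < s" "s < 1"
  shows "R2 s > 0" "C2 s > 0" "C2 s * (pi * R2 s powr (s + 2) * (2 / (s + 2))) = 1"
proof -
  have sn: "sin (s * pi / 2) > 0" using assms by (intro sin_gt_zero) (auto simp: field_simps)
  show "R2 s > 0" unfolding R2_def using assms sn by auto
  show "C2 s > 0" unfolding C2_def using assms sn by simp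
  have "R2 s powr (s + 2) = (8 * sin (s * pi / 2) / (s\<^sup>2 * (2 + s) * pi)) powr - 1"
    unfolding R2_def powr_powr using assms by simp
  also have "\<dots> = (s\<^sup>2 * (2 + s) * pi) / (8 * sin (s * pi / 2))"
    using assms sn by (simp add: powr_minus)
  finally have R: "R2 s powr (s + 2) = (s\<^sup>2 * (2 + s) * pi) / (8 * sin (s * pi / 2))" .
  show "C2 s * (pi * R2 s powr (s + 2) * (2 / (s + 2))) = 1"
  proof -
    have "4 * k / (s\<^sup>2 * p\<^sup>2) * (p * ((s\<^sup>2 * (2 + s) * p) / (8 * k)) * (2 / (s + 2))) = 1" if "k > 0" "p > 0" for k p :: real
    proof -
      have "s + 2 \<noteq> 0" using assms by simp
      then show ?thesis using that assms unfolding add.commute[of 2 s] by (simp add: divide_simps power2_eq_square)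
    qed
    from this[OF sn pi_gt_zero] show ?thesis unfolding R C2_def .
  qed
qed

text \<open>Write the power as an integral over levels \<open>t\<close>; each level set is a disc of area \<open>\<pi> (r\<^sup>2 - t)\<close>.\<close>

lemma nn_integral_paraboloid_power:
  assumes r: "r > 0" and a: "a > 0"
  shows "(\<integral>\<^sup>+x. ennreal (max 0 (r\<^sup>2 - (norm x)\<^sup>2) powr a) \<partial>(lborel :: (real^2) measure)) = ennreal (pi * r powr (2 * a + 2) / (a + 1))"
proof -
  have pw: "ennreal (max 0 c powr a) = (\<integral>\<^sup>+t. ennreal (a * t powr (a - 1)) * indicator {0<..c} t \<partial>lborel)" for c
  proof (cases "c > 0")
    case True
    have "((\<lambda>t. a * t powr (a - 1)) has_integral a * (c powr (a - 1 + 1) / (a - 1 + 1))) {0..c}"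
      using a True by (intro has_integral_mult_right has_integral_powr_from_0) auto
    then have "((\<lambda>t. a * t powr (a - 1)) has_integral c powr a) {0..c}" using a by simp
    from nn_integral_has_integral_lebesgue'[OF _ this] a
    have "ennreal (c powr a) = (\<integral>\<^sup>+t. ennreal (a * t powr (a - 1)) * indicator {0..c} t \<partial>lborel)" by simp
    also have "\<dots> = (\<integral>\<^sup>+t. ennreal (a * t powr (a - 1)) * indicator {0<..c} t \<partial>lborel)"
      by (intro nn_integral_cong_AE AE_lborel_avoid_three[of 0 0 0]) (auto simp: indicator_def)
    finally show ?thesis using True by simp
  next
    case False
    then have "{0<..c} = {}" by auto
    with False show ?thesis by (simp add: max_def)
  qed
  have "(\<integral>\<^sup>+x. ennreal (max 0 (r\<^sup>2 - (norm x)\<^sup>2) powr a) \<partial>(lborel :: (real^2) measure))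
     = (\<integral>\<^sup>+x. \<integral>\<^sup>+t. ennreal (a * t powr (a - 1)) * indicator {0<..} t * indicator {..r\<^sup>2} (t + (norm x)\<^sup>2) \<partial>lborel \<partial>(lborel :: (real^2) measure))"
    unfolding pw by (intro nn_integral_cong) (auto simp: indicator_def)
  also have "\<dots> = (\<integral>\<^sup>+t. \<integral>\<^sup>+x. ennreal (a * t powr (a - 1)) * indicator {0<..} t * indicator {..r\<^sup>2} (t + (norm x)\<^sup>2) \<partial>(lborel :: (real^2) measure) \<partial>lborel)"
    by (rule lborel_pair.Fubini') measurable
  also have "\<dots> = (\<integral>\<^sup>+t. ennreal (pi * r\<^sup>2 * a * t powr (a - 1) - pi * a * t powr a) * indicator {0..r\<^sup>2} t \<partial>lborel)"
  proof (rule nn_integral_cong_AE, rule AE_lborel_avoid_three[of 0 "r\<^sup>2" 0])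
    fix t :: real assume t: "t \<noteq> 0" "t \<noteq> r\<^sup>2"
    show "(\<integral>\<^sup>+x. ennreal (a * t powr (a - 1)) * indicator {0<..} t * indicator {..r\<^sup>2} (t + (norm x)\<^sup>2) \<partial>(lborel :: (real^2) measure))
      = ennreal (pi * r\<^sup>2 * a * t powr (a - 1) - pi * a * t powr a) * indicator {0..r\<^sup>2} t"
    proof (cases "0 < t \<and> t < r\<^sup>2")
      case True
      define q where "q = sqrt (r\<^sup>2 - t)"
      have q: "q \<ge> 0" "q\<^sup>2 = r\<^sup>2 - t" using True by (auto simp: q_def)
      have "indicator {..r\<^sup>2} (t + (norm x)\<^sup>2) = (indicator (cball 0 q) x :: ennreal)" for x :: "real^2"
      proof -
        have "t + (norm x)\<^sup>2 \<le> r\<^sup>2 \<longleftrightarrow> (norm x)\<^sup>2 \<le> q\<^sup>2" unfolding q by auto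
        also have "\<dots> \<longleftrightarrow> norm x \<le> q" using q(1) by (simp add: power2_le_iff_abs_le)
        finally show ?thesis by (auto simp: indicator_def)
      qed
      then have "(\<integral>\<^sup>+x. ennreal (a * t powr (a - 1)) * indicator {0<..} t * indicator {..r\<^sup>2} (t + (norm x)\<^sup>2) \<partial>(lborel :: (real^2) measure))
         = ennreal (a * t powr (a - 1)) * emeasure lborel (cball (0 :: real^2) q)"
        using True by (simp add: nn_integral_cmult_indicator)
      also have "emeasure lborel (cball (0 :: real^2) q) = ennreal (pi * q\<^sup>2)"
        using q(1) by (simp add: emeasure_cball unit_ball_vol_2 mult.commute)
      also have "ennreal (a * t powr (a - 1)) * ennreal (pi * q\<^sup>2) = ennreal (a * t powr (a - 1) * (pi * q\<^sup>2))"
        using a by (simp add: ennreal_mult')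
      also have "a * t powr (a - 1) * (pi * q\<^sup>2) = pi * r\<^sup>2 * a * t powr (a - 1) - pi * a * t powr a"
        unfolding q(2) using True powr_add[of t 1 "a - 1"] by (simp add: algebra_simps)
      finally show ?thesis using True by simp
    next
      case False
      then have "(\<integral>\<^sup>+x. ennreal (a * t powr (a - 1)) * indicator {0<..} t * indicator {..r\<^sup>2} (t + (norm x)\<^sup>2) \<partial>(lborel :: (real^2) measure)) = (\<integral>\<^sup>+x. 0 \<partial>(lborel :: (real^2) measure))"
      proof (intro nn_integral_cong)
        fix x :: "real^2"
        have "r\<^sup>2 < t + (norm x)\<^sup>2" if "0 < t" using that False t zero_le_power2[of "norm x"] by linarith
        then show "ennreal (a * t powr (a - 1)) * indicator {0<..} t * indicator {..r\<^sup>2} (t + (norm x)\<^sup>2) = 0"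
          by (auto simp: indicator_def)
      qed
      then show ?thesis using False t by (auto simp: indicator_def)
    qed
  qed
  also have "\<dots> = ennreal (pi * r\<^sup>2 * a * ((r\<^sup>2) powr (a - 1 + 1) / (a - 1 + 1)) - pi * a * ((r\<^sup>2) powr (a + 1) / (a + 1)))"
  proof (rule nn_integral_has_integral_lebesgue')
    fix t assume t: "t \<in> {0..r\<^sup>2}"
    show "0 \<le> pi * r\<^sup>2 * a * t powr (a - 1) - pi * a * t powr a"
    proof (cases "t = 0")
      case False
      have "pi * r\<^sup>2 * a * t powr (a - 1) - pi * a * t powr a = pi * a * t powr (a - 1) * (r\<^sup>2 - t)"
        using t False powr_add[of t 1 "a - 1"] by (simp add: algebra_simps)
      also have "\<dots> \<ge> 0" using t a by simp
      finally show ?thesis .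
    qed simp
  next
    show "((\<lambda>t. pi * r\<^sup>2 * a * t powr (a - 1) - pi * a * t powr a) has_integral
       (pi * r\<^sup>2 * a * ((r\<^sup>2) powr (a - 1 + 1) / (a - 1 + 1)) - pi * a * ((r\<^sup>2) powr (a + 1) / (a + 1)))) {0..r\<^sup>2}"
      by (intro has_integral_diff has_integral_mult_right has_integral_powr_from_0) (use a in auto)
  qed
  also have "pi * r\<^sup>2 * a * ((r\<^sup>2) powr (a - 1 + 1) / (a - 1 + 1)) - pi * a * ((r\<^sup>2) powr (a + 1) / (a + 1)) = pi * r powr (2 * a + 2) / (a + 1)"
  proof -
    have "(r\<^sup>2) powr (a + 1) = r powr (2 * a + 2)" using power2_powr_half[OF r, of "2 * a + 2"] by (simp add: add_divide_distrib)
    moreover have "r\<^sup>2 * (r\<^sup>2) powr a = (r\<^sup>2) powr (a + 1)" using powr_add[of "r\<^sup>2" 1 a] r by (simp add: add.commute)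
    moreover have "pi * r\<^sup>2 * a * ((r\<^sup>2) powr (a - 1 + 1) / (a - 1 + 1)) = pi * (r\<^sup>2 * (r\<^sup>2) powr a)" using a by simp
    ultimately show ?thesis using a by (simp add: field_simps)
  qed
  finally show ?thesis .
qed

lemma prob_space_disc_measure:
  assumes s: "0 < s" "s < 1"
  shows "prob_space (disc_measure s)"
proof (rule prob_spaceI)
  have "emeasure (disc_measure s) (space (disc_measure s)) = (\<integral>\<^sup>+x. ennreal (C2 s) * ennreal (max 0 ((R2 s)\<^sup>2 - (norm x)\<^sup>2) powr (s / 2)) \<partial>(lborel :: (real^2) measure))"
    using constants_pos(2)[OF s] by (simp add: disc_measure_def emeasure_density rho2_def ennreal_mult')
  also have "\<dots> = ennreal (C2 s) * ennreal (pi * R2 s powr (2 * (s / 2) + 2) / (s / 2 + 1))"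
    using s constants_pos(1)[OF s] by (subst nn_integral_cmult) (auto simp: nn_integral_paraboloid_power)
  also have "\<dots> = ennreal (C2 s * (pi * R2 s powr (s + 2) * (2 / (s + 2))))"
    using s constants_pos(2)[OF s] by (simp add: ennreal_mult'[symmetric] field_simps)
  finally show "emeasure (disc_measure s) (space (disc_measure s)) = 1"
    unfolding constants_pos(3)[OF s] by simp
qed

lemma nn_integral_disc_measure:
  assumes [measurable]: "f \<in> borel_measurable borel"
  shows "(\<integral>\<^sup>+x. f x \<partial>disc_measure s) = (\<integral>\<^sup>+x. ennreal (rho2 s x) * f x \<partial>lborel)"
  unfolding disc_measure_def by (subst nn_integral_density) auto

lemma disc_measure_rotation: "distr (disc_measure s) borel (\<lambda>x. rotation \<theta> *v x) = disc_measure s"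
proof (rule measure_eqI)
  fix A assume "A \<in> sets (distr (disc_measure s) borel (\<lambda>x. rotation \<theta> *v x))"
  then have [measurable]: "A \<in> sets borel" by simp
  have "emeasure (distr (disc_measure s) borel (\<lambda>x. rotation \<theta> *v x)) A = (\<integral>\<^sup>+x. indicator A (rotation \<theta> *v x) \<partial>disc_measure s)"
    using nn_integral_distr[of "\<lambda>x. rotation \<theta> *v x" "disc_measure s" borel "indicator A"] by simp
  also have "\<dots> = (\<integral>\<^sup>+x. ennreal (rho2 s (rotation \<theta> *v x)) * indicator A (rotation \<theta> *v x) \<partial>lborel)"
    by (subst nn_integral_disc_measure) (auto simp: rho2_def)
  also have "\<dots> = (\<integral>\<^sup>+x. ennreal (rho2 s x) * indicator A x \<partial>lborel)"
    by (rule nn_integral_rotation) measurable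
  also have "\<dots> = emeasure (disc_measure s) A"
    by (subst nn_integral_disc_measure[symmetric]) auto
  finally show "emeasure (distr (disc_measure s) borel (\<lambda>x. rotation \<theta> *v x)) A = emeasure (disc_measure s) A" .
qed simp

lemma nn_integral_circle_section:
  assumes s: "s > 0"
  shows "(\<integral>\<^sup>+b. ennreal (max 0 (d - b\<^sup>2) powr (s / 2)) \<partial>lborel)
       = ennreal (max 0 d powr ((1 + s) / 2)) * (\<integral>\<^sup>+b. ennreal (max 0 (1 - b\<^sup>2) powr (s / 2)) \<partial>lborel)"
proof (cases "d > 0")
  case True
  define q where "q = sqrt d"
  have q: "q > 0" "q\<^sup>2 = d" using True by (auto simp: q_def)
  have "(\<integral>\<^sup>+b. ennreal (max 0 (d - b\<^sup>2) powr (s / 2)) \<partial>lborel) = ennreal \<bar>q\<bar> * (\<integral>\<^sup>+b. ennreal (max 0 (d - (0 + q * b)\<^sup>2) powr (s / 2)) \<partial>lborel)"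
    by (rule nn_integral_real_affine) (use q in auto)
  also have "\<dots> = ennreal q * (\<integral>\<^sup>+b. ennreal (q powr s) * ennreal (max 0 (1 - b\<^sup>2) powr (s / 2)) \<partial>lborel)"
  proof -
    have "max 0 (d - (0 + q * b)\<^sup>2) powr (s / 2) = q powr s * max 0 (1 - b\<^sup>2) powr (s / 2)" for b
    proof -
      have "d - (0 + q * b)\<^sup>2 = q\<^sup>2 * (1 - b\<^sup>2)" using q by (simp add: power_mult_distrib algebra_simps)
      then have "max 0 (d - (0 + q * b)\<^sup>2) = q\<^sup>2 * max 0 (1 - b\<^sup>2)"
        using q(1) by (auto simp: max_def zero_le_mult_iff mult_le_0_iff)
      then show ?thesis using q(1) power2_powr_half[OF q(1), of s] by (simp add: powr_mult)
    qed
    then show ?thesis using q(1) by (simp add: ennreal_mult)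
  qed
  also have "\<dots> = (ennreal q * ennreal (q powr s)) * (\<integral>\<^sup>+b. ennreal (max 0 (1 - b\<^sup>2) powr (s / 2)) \<partial>lborel)"
    by (simp add: nn_integral_cmult mult.assoc)
  also have "ennreal q * ennreal (q powr s) = ennreal (max 0 d powr ((1 + s) / 2))"
    using q powr_add[of q 1 s] power2_powr_half[OF q(1), of "1 + s"] True by (simp add: ennreal_mult'[symmetric])
  finally show ?thesis .
next
  case False
  then have "max 0 (d - b\<^sup>2) = 0" for b
  proof -
    have "d - b\<^sup>2 \<le> 0" using False zero_le_power2[of b] by linarith
    then show ?thesis by simp
  qed
  with False show ?thesis by (simp add: max_def)
qed

text \<open>On the vertical line through \<open>(a, 0)\<close> the density is a multiple of \<open>(d - b\<^sup>2)\<^sup>s\<^sup>/\<^sup>2\<close> with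
  \<open>d = R\<^sup>2 - a\<^sup>2\<close>, whose integral scales as \<open>d\<^sup>(\<^sup>1\<^sup>+\<^sup>s\<^sup>)\<^sup>/\<^sup>2\<close>. This is the profile.\<close>

lemma disc_measure_marginal:
  assumes s: "0 < s" "s < 1"
  shows "distr (disc_measure s) borel (\<lambda>x. x $ 1) = profile_law s (R2 s)"
proof -
  define R where "R = R2 s"
  have R: "R > 0" using constants_pos(1)[OF s] by (simp add: R_def)
  define B where "B = (\<integral>\<^sup>+b. ennreal (max 0 (1 - b\<^sup>2) powr (s / 2)) \<partial>lborel)"
  define K where "K = ennreal (C2 s * R powr (2 + s) * profile_mass s) * B"
  have m: "profile_mass s > 0" by (rule profile_mass(2)[OF s(1)])
  have c2: "C2 s > 0" by (rule constants_pos(2)[OF s])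
  have eq: "(\<integral>\<^sup>+x. f (x $ 1) \<partial>disc_measure s) = K * (\<integral>\<^sup>+y. f y \<partial>profile_law s R)"
    if [measurable]: "f \<in> borel_measurable borel" for f
  proof -
    have "(\<integral>\<^sup>+x. f (x $ 1) \<partial>disc_measure s) = (\<integral>\<^sup>+a. \<integral>\<^sup>+b. ennreal (rho2 s (vector [a, b])) * f a \<partial>lborel \<partial>lborel)"
      by (subst nn_integral_disc_measure, measurable) (subst nn_integral_plane, auto)
    also have "\<dots> = (\<integral>\<^sup>+a. ennreal (C2 s) * (\<integral>\<^sup>+b. ennreal (max 0 ((R\<^sup>2 - a\<^sup>2) - b\<^sup>2) powr (s / 2)) \<partial>lborel) * f a \<partial>lborel)"
      using c2 by (simp add: rho2_def norm_2_square R_def ennreal_mult nn_integral_cmult nn_integral_multc diff_diff_eq)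
    also have "\<dots> = (\<integral>\<^sup>+a. ennreal (C2 s) * (ennreal (max 0 (R\<^sup>2 - a\<^sup>2) powr ((1 + s) / 2)) * B) * f a \<partial>lborel)"
      by (intro nn_integral_cong) (subst nn_integral_circle_section[OF s(1)], simp only: B_def)
    also have "\<dots> = ennreal \<bar>R\<bar> * (\<integral>\<^sup>+a. ennreal (C2 s) * (ennreal (max 0 (R\<^sup>2 - (0 + R * a)\<^sup>2) powr ((1 + s) / 2)) * B) * f (0 + R * a) \<partial>lborel)"
      by (rule nn_integral_real_affine) (use R in auto)
    also have "\<dots> = ennreal R * (\<integral>\<^sup>+a. (ennreal (C2 s) * ennreal (R powr (1 + s)) * B) * (ennreal (profile s a) * f (R * a)) \<partial>lborel)"
    proof -
      have "max 0 (R\<^sup>2 - (0 + R * a)\<^sup>2) powr ((1 + s) / 2) = R powr (1 + s) * profile s a" for a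
      proof -
        have "R\<^sup>2 - (0 + R * a)\<^sup>2 = R\<^sup>2 * (1 - a\<^sup>2)" by (simp add: power_mult_distrib algebra_simps)
        then have "max 0 (R\<^sup>2 - (0 + R * a)\<^sup>2) = R\<^sup>2 * max 0 (1 - a\<^sup>2)"
          using R by (auto simp: max_def zero_le_mult_iff mult_le_0_iff)
        then show ?thesis using R power2_powr_half[OF R, of "1 + s"] by (simp add: powr_mult profile_def)
      qed
      then show ?thesis using R by (simp add: ennreal_mult mult_ac)
    qed
    also have "\<dots> = ennreal R * ((ennreal (C2 s) * ennreal (R powr (1 + s)) * B) * (\<integral>\<^sup>+a. ennreal (profile s a) * f (R * a) \<partial>lborel))"
      by (subst nn_integral_cmult) auto
    also have "(\<integral>\<^sup>+a. ennreal (profile s a) * f (R * a) \<partial>lborel) = ennreal (profile_mass s) * (\<integral>\<^sup>+y. f y \<partial>profile_law s R)"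
    proof -
      have "(\<integral>\<^sup>+y. f y \<partial>profile_law s R) = (\<integral>\<^sup>+a. ennreal (profile s a) * f (R * a) \<partial>lborel) / ennreal (profile_mass s)"
        by (subst nn_integral_profile_law, measurable) (subst nn_integral_profile_measure, use s in auto)
      then show ?thesis
        using m by (simp only: ennreal_times_divide mult.commute[of "ennreal (profile_mass s)"])
          (rule mult_divide_eq_ennreal[symmetric], auto)
    qed
    also have "ennreal R * ((ennreal (C2 s) * ennreal (R powr (1 + s)) * B) * (ennreal (profile_mass s) * (\<integral>\<^sup>+y. f y \<partial>profile_law s R)))
       = (ennreal R * ennreal (C2 s) * ennreal (R powr (1 + s)) * ennreal (profile_mass s)) * B * (\<integral>\<^sup>+y. f y \<partial>profile_law s R)"
      by (simp add: mult_ac)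
    also have "ennreal R * ennreal (C2 s) * ennreal (R powr (1 + s)) * ennreal (profile_mass s) = ennreal (C2 s * R powr (2 + s) * profile_mass s)"
      using R c2 m powr_add[of R 1 "1 + s"] by (simp add: ennreal_mult'[symmetric] mult_ac)
    finally show ?thesis unfolding K_def .
  qed
  interpret D: prob_space "disc_measure s" by (rule prob_space_disc_measure[OF s])
  interpret P: prob_space "profile_law s R" by (rule prob_space_profile_law[OF s(1)])
  \<comment> \<open>Both measures have total mass \<open>1\<close>, which determines the proportionality constant.\<close>
  have K1: "K = 1" using eq[of "\<lambda>_. 1"] D.emeasure_space_1 P.emeasure_space_1 by simp
  show ?thesis unfolding R_def[symmetric]
  proof (rule measure_eqI)
    fix A assume "A \<in> sets (distr (disc_measure s) borel (\<lambda>x. x $ 1))"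
    then have [measurable]: "A \<in> sets borel" by simp
    have "emeasure (distr (disc_measure s) borel (\<lambda>x. x $ 1)) A = (\<integral>\<^sup>+x. indicator A (x $ 1) \<partial>disc_measure s)"
      using nn_integral_distr[of "\<lambda>x. x $ 1" "disc_measure s" borel "indicator A"] by simp
    also have "\<dots> = emeasure (profile_law s R) A" by (subst eq) (auto simp: K1)
    finally show "emeasure (distr (disc_measure s) borel (\<lambda>x. x $ 1)) A = emeasure (profile_law s R) A" .
  qed simp
qed

text \<open>By rotation invariance only the length of the coefficient vector matters.\<close>

lemma disc_measure_projection:
  assumes s: "0 < s" "s < 1"
  shows "distr (disc_measure s) borel (\<lambda>z. c * z $ 1 + d * z $ 2) = profile_law s (R2 s * sqrt (c\<^sup>2 + d\<^sup>2))"
proof -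
  define q where "q = sqrt (c\<^sup>2 + d\<^sup>2)"
  obtain t where t: "c = q * cos t" "d = q * sin t"
  proof (cases "q = 0")
    case True
    then have "c = 0" "d = 0" by (auto simp: q_def)
    with True that[of 0] show ?thesis by simp
  next
    case False
    then have "(c / q)\<^sup>2 + (d / q)\<^sup>2 = 1"
      by (simp add: power_divide add_divide_distrib[symmetric]) (simp add: q_def)
    then obtain t where "c / q = cos t" "d / q = sin t" using sincos_total_2pi_le by blast
    with False that[of t] show ?thesis by (simp add: field_simps)
  qed
  have "(\<lambda>z::real^2. c * z $ 1 + d * z $ 2) = (\<lambda>z. q * (rotation (- t) *v z) $ 1)"
    by (auto simp: rotation_apply t algebra_simps)
  then have "distr (disc_measure s) borel (\<lambda>z. c * z $ 1 + d * z $ 2) = distr (distr (disc_measure s) borel (\<lambda>z. rotation (- t) *v z)) borel (\<lambda>z. q * z $ 1)"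
    by (simp add: distr_distr comp_def)
  also have "\<dots> = distr (distr (disc_measure s) borel (\<lambda>z. z $ 1)) borel (\<lambda>z. q * z)"
    unfolding disc_measure_rotation by (simp add: distr_distr comp_def)
  also have "\<dots> = profile_law s (R2 s * q)"
  proof -
    have "(\<lambda>x. q * (R2 s * x)) = (\<lambda>x. R2 s * q * x)" by auto
    then show ?thesis unfolding disc_measure_marginal[OF s] profile_law_def by (simp add: distr_distr comp_def)
  qed
  finally show ?thesis unfolding q_def .
qed

section \<open>Ellipse and segment laws\<close>

text \<open>A linear image of the disc law. In contrast to a density, this also makes sense for \<open>a = 0\<close>,
  where it is the law on a segment.\<close>

definition ellipse_law :: "real \<Rightarrow> real \<Rightarrow> real \<Rightarrow> real \<Rightarrow> (real^2) measure" where
  "ellipse_law s a b \<eta> = distr (disc_measure s) borel (\<lambda>z. rotation \<eta> *v vector [a * z $ 1, b * z $ 2])"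

lemma sets_ellipse_law [simp, measurable_cong]: "sets (ellipse_law s a b \<eta>) = sets borel"
  by (simp add: ellipse_law_def)

lemma measurable_ellipse_map [measurable]: "(\<lambda>z::real^2. rotation \<eta> *v vector [a * z $ 1, b * z $ 2]) \<in> borel_measurable borel"
  by (rule measurable_compose[OF _ measurable_rotation]) measurable

lemma prob_space_ellipse_law:
  assumes "0 < s" "s < 1" shows "prob_space (ellipse_law s a b \<eta>)"
  unfolding ellipse_law_def by (rule prob_space.prob_space_distr[OF prob_space_disc_measure[OF assms]]) measurable

lemma slope_rotation:
  "slope v (rotation \<eta> *v vector [x, y]) = (cos \<eta> + v * sin \<eta>) * x + (v * cos \<eta> - sin \<eta>) * y"
  by (simp add: slope_def rotation_apply algebra_simps)

text \<open>The form \<open>slope v\<close>, pulled back to the disc by the linear map, has a coefficient vector; this is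
  its squared length.\<close>

definition ellipse_width2 :: "real \<Rightarrow> real \<Rightarrow> real \<Rightarrow> real \<Rightarrow> real" where
  "ellipse_width2 a b \<eta> v = (a * (cos \<eta> + v * sin \<eta>))\<^sup>2 + (b * (v * cos \<eta> - sin \<eta>))\<^sup>2"

lemma ellipse_law_projection:
  assumes "0 < s" "s < 1"
  shows "distr (ellipse_law s a b \<eta>) borel (slope v) = profile_law s (R2 s * sqrt (ellipse_width2 a b \<eta> v))"
proof -
  have "distr (ellipse_law s a b \<eta>) borel (slope v)
    = distr (disc_measure s) borel (\<lambda>z. slope v (rotation \<eta> *v vector [a * z $ 1, b * z $ 2]))"
    unfolding ellipse_law_def by (simp add: distr_distr comp_def)
  also have "(\<lambda>z::real^2. slope v (rotation \<eta> *v vector [a * z $ 1, b * z $ 2])) = (\<lambda>z. (a * (cos \<eta> + v * sin \<eta>)) * z $ 1 + (b * (v * cos \<eta> - sin \<eta>)) * z $ 2)"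
    by (simp add: slope_rotation mult_ac)
  finally show ?thesis unfolding disc_measure_projection[OF assms] ellipse_width2_def .
qed

lemma ellipse_measure_eq_law:
  assumes a: "a > 0" and b: "b > 0"
  shows "ellipse_measure s a b \<eta> = ellipse_law s a b \<eta>"
proof (rule measure_eqI)
  fix A assume "A \<in> sets (ellipse_measure s a b \<eta>)"
  then have [measurable]: "A \<in> sets borel" by (simp add: ellipse_measure_def)
  have [measurable]: "rho_ab s a b \<in> borel_measurable borel"
    unfolding rho_ab_def[abs_def] by measurable
  have "emeasure (ellipse_measure s a b \<eta>) A = (\<integral>\<^sup>+x. ennreal (rho_ab s a b (rotation (- \<eta>) *v x)) * indicator A x \<partial>lborel)"
    unfolding ellipse_measure_def by (subst emeasure_density) auto
  also have "\<dots> = (\<integral>\<^sup>+x. ennreal (rho_ab s a b (rotation (- \<eta>) *v (rotation \<eta> *v x))) * indicator A (rotation \<eta> *v x) \<partial>lborel)"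
    by (rule nn_integral_rotation[symmetric]) measurable
  also have "\<dots> = (\<integral>\<^sup>+x. ennreal (rho_ab s a b x) * indicator A (rotation \<eta> *v x) \<partial>lborel)"
    by simp
  also have "\<dots> = (\<integral>\<^sup>+y1. \<integral>\<^sup>+y2. ennreal (rho_ab s a b (vector [y1, y2])) * indicator A (rotation \<eta> *v vector [y1, y2]) \<partial>lborel \<partial>lborel)"
    by (rule nn_integral_plane) measurable
  also have "\<dots> = (\<integral>\<^sup>+y1. ennreal \<bar>b\<bar> * (\<integral>\<^sup>+y2. ennreal (rho_ab s a b (vector [y1, 0 + b * y2])) * indicator A (rotation \<eta> *v vector [y1, 0 + b * y2]) \<partial>lborel) \<partial>lborel)"
    using b by (intro nn_integral_cong nn_integral_real_affine) auto
  also have "\<dots> = ennreal \<bar>a\<bar> * (\<integral>\<^sup>+y1. ennreal \<bar>b\<bar> * (\<integral>\<^sup>+y2. ennreal (rho_ab s a b (vector [0 + a * y1, 0 + b * y2])) * indicator A (rotation \<eta> *v vector [0 + a * y1, 0 + b * y2]) \<partial>lborel) \<partial>lborel)"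
    using a by (intro nn_integral_real_affine) auto
  also have "\<dots> = (\<integral>\<^sup>+y1. \<integral>\<^sup>+y2. ennreal \<bar>a\<bar> * (ennreal \<bar>b\<bar> * (ennreal (rho_ab s a b (vector [0 + a * y1, 0 + b * y2])) * indicator A (rotation \<eta> *v vector [0 + a * y1, 0 + b * y2]))) \<partial>lborel \<partial>lborel)"
    by (simp add: nn_integral_cmult)
  also have "\<dots> = (\<integral>\<^sup>+y1. \<integral>\<^sup>+y2. ennreal (rho2 s (vector [y1, y2])) * indicator A (rotation \<eta> *v vector [a * y1, b * y2]) \<partial>lborel \<partial>lborel)"
  proof (intro nn_integral_cong)
    fix y1 y2 :: real
    have "a * (b * rho_ab s a b (vector [0 + a * y1, 0 + b * y2])) = rho2 s (vector [y1, y2])"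
      using a b by (simp add: rho_ab_def)
    then have "ennreal \<bar>a\<bar> * (ennreal \<bar>b\<bar> * ennreal (rho_ab s a b (vector [0 + a * y1, 0 + b * y2]))) = ennreal (rho2 s (vector [y1, y2]))"
      using a b by (simp add: ennreal_mult'[symmetric])
    then show "ennreal \<bar>a\<bar> * (ennreal \<bar>b\<bar> * (ennreal (rho_ab s a b (vector [0 + a * y1, 0 + b * y2])) * indicator A (rotation \<eta> *v vector [0 + a * y1, 0 + b * y2])))
       = ennreal (rho2 s (vector [y1, y2])) * indicator A (rotation \<eta> *v vector [a * y1, b * y2])"
      by (simp add: mult.assoc[symmetric])
  qed
  also have "\<dots> = (\<integral>\<^sup>+y1. \<integral>\<^sup>+y2. (\<lambda>z. ennreal (rho2 s z) * indicator A (rotation \<eta> *v vector [a * z $ 1, b * z $ 2])) (vector [y1, y2]) \<partial>lborel \<partial>lborel)"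
    by simp
  also have "\<dots> = (\<integral>\<^sup>+z. ennreal (rho2 s z) * indicator A (rotation \<eta> *v vector [a * z $ 1, b * z $ 2]) \<partial>lborel)"
    by (rule nn_integral_plane[symmetric]) measurable
  also have "\<dots> = (\<integral>\<^sup>+z. indicator A (rotation \<eta> *v vector [a * z $ 1, b * z $ 2]) \<partial>disc_measure s)"
    by (rule nn_integral_disc_measure[symmetric]) measurable
  also have "\<dots> = emeasure (ellipse_law s a b \<eta>) A"
    unfolding ellipse_law_def
    using nn_integral_distr[of "\<lambda>z. rotation \<eta> *v vector [a * z $ 1, b * z $ 2]" "disc_measure s" borel "indicator A"] by simp
  finally show "emeasure (ellipse_measure s a b \<eta>) A = emeasure (ellipse_law s a b \<eta>) A" .
qed (simp add: ellipse_measure_def)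

lemma continuous_rotation: "continuous_on UNIV (\<lambda>x. rotation \<theta> *v x)"
  by (intro linear_continuous_on) (simp add: linear_conv_bounded_linear[symmetric])

text \<open>As \<open>a \<rightarrow> 0\<close> the linear maps converge pointwise, so the laws converge weakly by dominated
  convergence on the disc; weak limits are unique.\<close>

lemma segment_measure_eq_law:
  assumes s: "0 < s" "s < 1" and b: "b > 0"
  shows "segment_measure s b \<eta> = ellipse_law s 0 b \<eta>"
  unfolding segment_measure_def
proof (rule the_equality)
  interpret D: prob_space "disc_measure s" by (rule prob_space_disc_measure[OF s])
  have lim: "weak_limit (\<lambda>a. ellipse_measure s a b \<eta>) (ellipse_law s 0 b \<eta>) (at_right 0)"
    unfolding weak_limit_def
  proof (intro allI impI)
    fix f :: "real^2 \<Rightarrow> real"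
    assume f: "continuous_on UNIV f \<and> bounded (range f)"
    then have [measurable]: "f \<in> borel_measurable borel" by (auto intro: borel_measurable_continuous_onI)
    obtain B where B: "\<And>x. \<bar>f x\<bar> \<le> B" using f by (auto simp: bounded_iff)
    have int: "(LINT x|ellipse_law s a b \<eta>. f x) = (LINT z|disc_measure s. f (rotation \<eta> *v vector [a * z $ 1, b * z $ 2]))" for a
      unfolding ellipse_law_def by (rule integral_distr) measurable
    show "((\<lambda>a. LINT x|ellipse_measure s a b \<eta>. f x) \<longlongrightarrow> (LINT x|ellipse_law s 0 b \<eta>. f x)) (at_right 0)"
    proof (rule tendsto_at_right_sequentially[of 0 1])
      fix S :: "nat \<Rightarrow> real" assume S: "\<And>n. 0 < S n" "S \<longlonglongrightarrow> 0"
      have "(\<lambda>n. LINT z|disc_measure s. f (rotation \<eta> *v vector [S n * z $ 1, b * z $ 2])) \<longlonglongrightarrow> (LINT z|disc_measure s. f (rotation \<eta> *v vector [0 * z $ 1, b * z $ 2]))"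
      proof (rule integral_dominated_convergence[where w = "\<lambda>_. B"])
        show "AE z in disc_measure s. (\<lambda>n. f (rotation \<eta> *v vector [S n * z $ 1, b * z $ 2])) \<longlonglongrightarrow> f (rotation \<eta> *v vector [0 * z $ 1, b * z $ 2])"
        proof (rule AE_I2)
          fix z :: "real^2"
          have "isCont (\<lambda>y. f (rotation \<eta> *v y)) y" for y
            using f continuous_on_compose2[of UNIV f UNIV "\<lambda>x. rotation \<eta> *v x"] continuous_rotation
            by (auto simp: continuous_on_eq_continuous_at)
          moreover have "(\<lambda>n. vector [S n * z $ 1, b * z $ 2] :: real^2) \<longlonglongrightarrow> vector [0 * z $ 1, b * z $ 2]"
            unfolding vector2_eq_axes by (intro tendsto_intros S(2))
          ultimately show "(\<lambda>n. f (rotation \<eta> *v vector [S n * z $ 1, b * z $ 2])) \<longlonglongrightarrow> f (rotation \<eta> *v vector [0 * z $ 1, b * z $ 2])"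
            by (rule isCont_tendsto_compose)
        qed
      qed (use B in auto)
      then show "(\<lambda>n. LINT x|ellipse_measure s (S n) b \<eta>. f x) \<longlonglongrightarrow> (LINT x|ellipse_law s 0 b \<eta>. f x)"
        unfolding ellipse_measure_eq_law[OF S(1) b] int .
    qed simp
  qed
  then show "ellipse_law s 0 b \<eta> \<in> prob_measures \<and> weak_limit (\<lambda>a. ellipse_measure s a b \<eta>) (ellipse_law s 0 b \<eta>) (at_right 0)"
    by (simp add: prob_measures_def prob_space_ellipse_law[OF s])
  fix \<mu> assume \<mu>: "\<mu> \<in> prob_measures \<and> weak_limit (\<lambda>a. ellipse_measure s a b \<eta>) \<mu> (at_right 0)"
  show "\<mu> = ellipse_law s 0 b \<eta>"
  proof (rule measure_eqI_continuous)
    fix f :: "real^2 \<Rightarrow> real" assume "continuous_on UNIV f" "bounded (range f)"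
    with \<mu> lim have "((\<lambda>a. LINT x|ellipse_measure s a b \<eta>. f x) \<longlongrightarrow> (LINT x|\<mu>. f x)) (at_right 0)"
      "((\<lambda>a. LINT x|ellipse_measure s a b \<eta>. f x) \<longlongrightarrow> (LINT x|ellipse_law s 0 b \<eta>. f x)) (at_right 0)"
      unfolding weak_limit_def by blast+
    then show "(LINT x|\<mu>. f x) = (LINT x|ellipse_law s 0 b \<eta>. f x)"
      by (rule tendsto_unique[rotated]) simp
  qed (use \<mu> prob_space_ellipse_law[OF s] in \<open>auto simp: prob_measures_def\<close>)
qed

lemma AE_disc_measure: "AE z in disc_measure s. norm z \<le> \<bar>R2 s\<bar>"
  unfolding disc_measure_def
proof (subst AE_density)
  have "norm z \<le> \<bar>R2 s\<bar>" if "0 < ennreal (rho2 s z)" for z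
  proof (rule ccontr)
    assume "\<not> norm z \<le> \<bar>R2 s\<bar>"
    then have "(R2 s)\<^sup>2 - (norm z)\<^sup>2 \<le> 0" by (simp add: abs_le_square_iff[symmetric])
    then have "rho2 s z = 0" by (simp add: rho2_def max_def)
    with that show False by simp
  qed
  then show "AE z in lborel. 0 < ennreal (rho2 s z) \<longrightarrow> norm z \<le> \<bar>R2 s\<bar>" by simp
qed measurable

lemma AE_ellipse_law: "AE x in ellipse_law s a b \<eta>. norm x \<le> (\<bar>a\<bar> + \<bar>b\<bar>) * \<bar>R2 s\<bar>"
  unfolding ellipse_law_def
proof (subst AE_distr_iff)
  show "AE z in disc_measure s. norm (rotation \<eta> *v vector [a * z $ 1, b * z $ 2]) \<le> (\<bar>a\<bar> + \<bar>b\<bar>) * \<bar>R2 s\<bar>"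
    using AE_disc_measure
  proof eventually_elim
    case (elim z)
    have "norm (vector [a * z $ 1, b * z $ 2] :: real^2) \<le> \<bar>a * z $ 1\<bar> + \<bar>b * z $ 2\<bar>"
      by (simp add: norm_2 sqrt_sum_squares_le_sum_abs)
    also have "\<dots> \<le> \<bar>a\<bar> * \<bar>R2 s\<bar> + \<bar>b\<bar> * \<bar>R2 s\<bar>"
      unfolding abs_mult using component_le_norm_cart[of z 1] component_le_norm_cart[of z 2] elim
      by (intro add_mono mult_left_mono) auto
    finally show ?case by (simp add: distrib_right)
  qed
qed auto

lemma AE_bounded_integrable:
  fixes f :: "real^2 \<Rightarrow> real"
  assumes "prob_space \<mu>" "sets \<mu> = sets borel" "AE x in \<mu>. norm x \<le> K" "continuous_on UNIV f"
  shows "integrable \<mu> f"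
proof -
  interpret prob_space \<mu> by fact
  have [measurable_cong]: "sets \<mu> = sets borel" by fact
  have [measurable]: "f \<in> borel_measurable borel" using assms(4) by (rule borel_measurable_continuous_onI)
  have "bounded (f ` cball 0 K)"
    by (intro compact_imp_bounded compact_continuous_image continuous_on_subset[OF assms(4)]) auto
  then obtain B where "\<forall>x\<in>cball 0 K. \<bar>f x\<bar> \<le> B" by (auto simp: bounded_iff)
  then have "AE x in \<mu>. norm (f x) \<le> B" using assms(3) by (auto elim!: eventually_mono)
  then show ?thesis by (intro integrable_const_bound) auto
qed

lemma ellipse_law_moments:
  assumes s: "0 < s" "s < 1"
  shows "integrable (ellipse_law s a b \<eta>) (\<lambda>x. (norm x)\<^sup>2)"
    and "(LINT x|ellipse_law s a b \<eta>. x $ i) = 0"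
    and "(LINT x|ellipse_law s a b \<eta>. (slope v x)\<^sup>2) = (R2 s)\<^sup>2 * profile_variance s * ellipse_width2 a b \<eta> v"
proof -
  let ?\<mu> = "ellipse_law s a b \<eta>"
  note int = AE_bounded_integrable[OF prob_space_ellipse_law[OF s] sets_ellipse_law AE_ellipse_law]
  show "integrable ?\<mu> (\<lambda>x. (norm x)\<^sup>2)" by (rule int) (intro continuous_intros)
  have "(LINT x|?\<mu>. (slope v x)\<^sup>2) = (LINT t|distr ?\<mu> borel (slope v). t\<^sup>2)"
    by (subst integral_distr) auto
  also have "\<dots> = (R2 s * sqrt (ellipse_width2 a b \<eta> v))\<^sup>2 * profile_variance s"
    unfolding ellipse_law_projection[OF s] by (rule profile_law_second_moment[OF s(1)])
  also have "\<dots> = (R2 s)\<^sup>2 * profile_variance s * ellipse_width2 a b \<eta> v"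
    by (simp add: power_mult_distrib ellipse_width2_def)
  finally show "(LINT x|?\<mu>. (slope v x)\<^sup>2) = (R2 s)\<^sup>2 * profile_variance s * ellipse_width2 a b \<eta> v" .
  have neg: "rotation pi *v z = - z" for z by (simp add: rotation_apply vec_eq_iff forall_2)
  let ?f = "\<lambda>z::real^2. (rotation \<eta> *v vector [a * z $ 1, b * z $ 2]) $ i"
  have "?f z = (if i = 1 then cos \<eta> * (a * z $ 1) - sin \<eta> * (b * z $ 2) else sin \<eta> * (a * z $ 1) + cos \<eta> * (b * z $ 2))" for z
    using exhaust_2[of i] by (auto simp: rotation_apply)
  then have odd: "?f (- z) = - ?f z" for z by (simp only:) (simp add: algebra_simps)
  have meas: "?f \<in> borel_measurable borel"
    by (rule measurable_compose[OF measurable_ellipse_map measurable_vec_nth2])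
  have "(LINT z|disc_measure s. ?f z) = (LINT z|distr (disc_measure s) borel (\<lambda>x. rotation pi *v x). ?f z)"
    unfolding disc_measure_rotation ..
  also have "\<dots> = (LINT z|disc_measure s. ?f (- z))"
    by (subst integral_distr[OF _ meas]) (auto simp: neg[abs_def])
  also have "\<dots> = - (LINT z|disc_measure s. ?f z)" unfolding odd by simp
  finally have "(LINT z|disc_measure s. ?f z) = 0" by simp
  then show "(LINT x|?\<mu>. x $ i) = 0"
    unfolding ellipse_law_def by (subst integral_distr) auto
qed

section \<open>Energy and second moments\<close>

lemma ennreal_half_cancel: "x / 2 = y / 2 \<Longrightarrow> x = (y :: ennreal)"
  by (cases x; cases y) (auto simp: ennreal_divide_numeral ennreal_top_divide)

text \<open>The interactions treated from here on: a positive superposition of Riesz kernels of the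
  projections, plus a quadratic confinement. The kernel equation includes \<open>x = 0\<close>, where the
  positive mass of \<open>w\<close> makes both sides infinite.\<close>

locale slope_mixture =
  fixes s :: real and W :: "real^2 \<Rightarrow> ennreal" and w :: "real \<Rightarrow> real"
  assumes s: "0 < s" "s < 1"
    and w_measurable [measurable]: "w \<in> borel_measurable borel"
    and w_nonneg: "w v \<ge> 0"
    and w_mass: "(\<integral>\<^sup>+v. ennreal (w v) \<partial>lborel) < \<infinity>" "(\<integral>\<^sup>+v. ennreal (w v) \<partial>lborel) \<noteq> 0"
    and kernel: "W x = (\<integral>\<^sup>+v. ennreal (w v) * riesz s (slope v x) \<partial>lborel) + ennreal ((norm x)\<^sup>2)"
begin

abbreviation "E \<equiv> energy W"

lemma slope_diff: "slope v (x - y) = slope v x - slope v y"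
  by (simp add: slope_def algebra_simps)

lemma energy_eq:
  assumes \<nu>: "prob_space \<nu>" "sets \<nu> = sets borel"
  shows "E \<nu> = (\<integral>\<^sup>+v. ennreal (w v) * riesz_energy s (distr \<nu> borel (slope v)) \<partial>lborel) / 2
            + (\<integral>\<^sup>+x. \<integral>\<^sup>+y. ennreal ((norm (x - y))\<^sup>2) \<partial>\<nu> \<partial>\<nu>) / 2"
proof -
  interpret prob_space \<nu> by fact
  have [measurable_cong]: "sets \<nu> = sets borel" by fact
  interpret LN: pair_sigma_finite lborel \<nu> ..
  have pr: "prob_space (distr \<nu> borel (slope v))" for v by (rule prob_space_distr) measurable
  have "(\<integral>\<^sup>+x. \<integral>\<^sup>+y. W (x - y) \<partial>\<nu> \<partial>\<nu>)
     = (\<integral>\<^sup>+x. \<integral>\<^sup>+y. \<integral>\<^sup>+v. ennreal (w v) * riesz s (slope v x - slope v y) \<partial>lborel \<partial>\<nu> \<partial>\<nu>)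
       + (\<integral>\<^sup>+x. \<integral>\<^sup>+y. ennreal ((norm (x - y))\<^sup>2) \<partial>\<nu> \<partial>\<nu>)"
    unfolding kernel slope_diff by (simp add: nn_integral_add)
  also have "(\<integral>\<^sup>+x. \<integral>\<^sup>+y. \<integral>\<^sup>+v. ennreal (w v) * riesz s (slope v x - slope v y) \<partial>lborel \<partial>\<nu> \<partial>\<nu>)
     = (\<integral>\<^sup>+x. \<integral>\<^sup>+v. \<integral>\<^sup>+y. ennreal (w v) * riesz s (slope v x - slope v y) \<partial>\<nu> \<partial>lborel \<partial>\<nu>)"
    by (intro nn_integral_cong LN.Fubini') measurable
  also have "\<dots> = (\<integral>\<^sup>+v. \<integral>\<^sup>+x. \<integral>\<^sup>+y. ennreal (w v) * riesz s (slope v x - slope v y) \<partial>\<nu> \<partial>\<nu> \<partial>lborel)"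
    by (rule LN.Fubini') measurable
  also have "\<dots> = (\<integral>\<^sup>+v. ennreal (w v) * riesz_energy s (distr \<nu> borel (slope v)) \<partial>lborel)"
  proof (rule nn_integral_cong)
    fix v
    interpret P: prob_space "distr \<nu> borel (slope v)" by (rule pr)
    have "riesz_energy s (distr \<nu> borel (slope v)) = (\<integral>\<^sup>+x. \<integral>\<^sup>+y. riesz s (slope v x - slope v y) \<partial>\<nu> \<partial>\<nu>)"
      unfolding riesz_mutual_def by (subst nn_integral_distr, measurable) (simp add: nn_integral_distr)
    then show "(\<integral>\<^sup>+x. \<integral>\<^sup>+y. ennreal (w v) * riesz s (slope v x - slope v y) \<partial>\<nu> \<partial>\<nu>) = ennreal (w v) * riesz_energy s (distr \<nu> borel (slope v))"
      by (simp add: nn_integral_cmult)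
  qed
  finally show ?thesis unfolding energy_def by (simp add: add_divide_distrib_ennreal)
qed

lemma energy_translate:
  assumes \<nu>: "prob_space \<nu>" "sets \<nu> = sets borel"
  shows "E (distr \<nu> borel (\<lambda>x. x + c)) = E \<nu>"
proof -
  have [measurable_cong]: "sets \<nu> = sets borel" by fact
  interpret prob_space \<nu> by fact
  interpret P: prob_space "distr \<nu> borel (\<lambda>x. x + c)" by (rule prob_space_distr) measurable
  have [measurable]: "W \<in> borel_measurable borel" unfolding kernel[abs_def] by measurable
  show ?thesis unfolding energy_def
    by (subst nn_integral_distr, measurable) (simp add: nn_integral_distr)
qed

text \<open>For some \<open>x\<close> the integral of \<open>|x - y|\<^sup>2\<close> over \<open>y\<close> is finite, and it controls that of \<open>|y|\<^sup>2\<close>.\<close>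

lemma finite_energy_imp_second_moment:
  fixes \<nu> :: "(real^2) measure"
  assumes \<nu>: "prob_space \<nu>" "sets \<nu> = sets borel" and fin: "E \<nu> < \<infinity>"
  shows "integrable \<nu> (\<lambda>x. (norm x)\<^sup>2)"
proof -
  have [measurable_cong]: "sets \<nu> = sets borel" by fact
  interpret prob_space \<nu> by fact
  have "(\<integral>\<^sup>+x. \<integral>\<^sup>+y. ennreal ((norm (x - y))\<^sup>2) \<partial>\<nu> \<partial>\<nu>) / 2 < \<infinity>"
    using fin unfolding energy_eq[OF \<nu>] by simp
  then have "(\<integral>\<^sup>+x. \<integral>\<^sup>+y. ennreal ((norm (x - y))\<^sup>2) \<partial>\<nu> \<partial>\<nu>) \<noteq> \<infinity>"
    by (auto simp: ennreal_top_divide)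
  then have "AE x in \<nu>. (\<integral>\<^sup>+y. ennreal ((norm (x - y))\<^sup>2) \<partial>\<nu>) \<noteq> \<infinity>"
    by (intro nn_integral_noteq_infinite) auto
  then obtain x where x: "(\<integral>\<^sup>+y. ennreal ((norm (x - y))\<^sup>2) \<partial>\<nu>) \<noteq> \<infinity>"
    using eventually_happens'[OF ae_filter_bot] by blast
  show ?thesis
  proof (rule integrableI_nonneg)
    have "(\<integral>\<^sup>+y. ennreal ((norm y)\<^sup>2) \<partial>\<nu>) \<le> (\<integral>\<^sup>+y. 2 * ennreal ((norm (x - y))\<^sup>2) + ennreal (2 * (norm x)\<^sup>2) \<partial>\<nu>)"
    proof (rule nn_integral_mono)
      fix y
      have "norm y \<le> norm (x - y) + norm x" using norm_triangle_ineq4[of x "x - y"] by simp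
      then have "(norm y)\<^sup>2 \<le> (norm (x - y) + norm x)\<^sup>2" by (intro power_mono) auto
      also have "\<dots> \<le> 2 * (norm (x - y))\<^sup>2 + 2 * (norm x)\<^sup>2"
        using sum_squares_bound[of "norm (x - y)" "norm x"] by (simp add: power2_sum)
      finally have "ennreal ((norm y)\<^sup>2) \<le> ennreal (2 * (norm (x - y))\<^sup>2 + 2 * (norm x)\<^sup>2)" by (rule ennreal_leI)
      then show "ennreal ((norm y)\<^sup>2) \<le> 2 * ennreal ((norm (x - y))\<^sup>2) + ennreal (2 * (norm x)\<^sup>2)"
        by (simp add: ennreal_mult')
    qed
    also have "\<dots> < \<infinity>"
      using x by (simp add: nn_integral_add nn_integral_cmult emeasure_space_1 ennreal_mult_less_top less_top[symmetric] ennreal_mult_eq_top_iff)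
    finally show "(\<integral>\<^sup>+y. ennreal ((norm y)\<^sup>2) \<partial>\<nu>) < \<infinity>" .
  qed auto
qed

lemma second_moment_integrable:
  fixes \<nu> :: "(real^2) measure"
  assumes \<nu>: "prob_space \<nu>" "sets \<nu> = sets borel" and int: "integrable \<nu> (\<lambda>x. (norm x)\<^sup>2)"
  shows "integrable \<nu> (\<lambda>x. x $ i)" "integrable \<nu> (\<lambda>x. x $ i * x $ j)"
proof -
  interpret prob_space \<nu> by fact
  have [measurable_cong]: "sets \<nu> = sets borel" by fact
  have c: "\<bar>x $ k\<bar> \<le> norm x" for x :: "real^2" and k :: 2 by (rule component_le_norm_cart)
  have "\<bar>x $ i\<bar> \<le> 1 + (norm x)\<^sup>2" for x :: "real^2"
    using c[of x i] sum_squares_bound[of 1 "norm x"] by (simp add: power2_eq_square)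
  then show "integrable \<nu> (\<lambda>x. x $ i)"
    using int by (intro Bochner_Integration.integrable_bound[of \<nu> "\<lambda>x. 1 + (norm x)\<^sup>2" "\<lambda>x. x $ i"]) auto
  have "\<bar>x $ i * x $ j\<bar> \<le> (norm x)\<^sup>2" for x :: "real^2"
    unfolding abs_mult power2_eq_square by (intro mult_mono c) auto
  then show "integrable \<nu> (\<lambda>x. x $ i * x $ j)"
    using int by (intro Bochner_Integration.integrable_bound[of \<nu> "\<lambda>x. (norm x)\<^sup>2" "\<lambda>x. x $ i * x $ j"]) auto
qed

text \<open>The triple \<open>(p, q, r)\<close> stands for the symmetric matrix with diagonal entries \<open>p\<close>, \<open>r\<close> and
  off-diagonal entry \<open>q\<close>.\<close>

type_synonym moments = "real \<times> real \<times> real"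

text \<open>The value of the quadratic form at \<open>(1, v)\<close>. For the second moments of a centred measure it is
  the variance of the projection \<open>slope v\<close>.\<close>

definition quad :: "real \<Rightarrow> moments \<Rightarrow> real" where
  "quad v M = (case M of (p, q, r) \<Rightarrow> p + 2 * q * v + r * v\<^sup>2)"

definition trace :: "moments \<Rightarrow> real" where
  "trace M = (case M of (p, q, r) \<Rightarrow> p + r)"

definition psd :: "moments set" where
  "psd = {(p, q, r). 0 \<le> p \<and> 0 \<le> r \<and> q\<^sup>2 \<le> p * r}"

definition second_moments :: "(real^2) measure \<Rightarrow> moments" where
  "second_moments \<nu> = (LINT x|\<nu>. x $ 1 * x $ 1, LINT x|\<nu>. x $ 1 * x $ 2, LINT x|\<nu>. x $ 2 * x $ 2)"

text \<open>The energy of a centred measure with second moments \<open>M\<close> if every projection had the least Riesz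
  energy that its variance permits.\<close>

definition reduced_energy :: "moments \<Rightarrow> ennreal" where
  "reduced_energy M = (\<integral>\<^sup>+v. ennreal (w v) * (profile_energy_constant s * riesz (s / 2) (quad v M)) \<partial>lborel) / 2 + ennreal (trace M)"

definition centered :: "(real^2) measure \<Rightarrow> bool" where
  "centered \<nu> \<longleftrightarrow> prob_space \<nu> \<and> sets \<nu> = sets borel \<and> integrable \<nu> (\<lambda>x. (norm x)\<^sup>2) \<and> (\<forall>i. (LINT x|\<nu>. x $ i) = 0)"

lemma quad_second_moments:
  assumes "centered \<nu>"
  shows "(LINT x|\<nu>. (slope v x)\<^sup>2) = quad v (second_moments \<nu>)" "integrable \<nu> (\<lambda>x. (slope v x)\<^sup>2)"
    and "trace (second_moments \<nu>) = (LINT x|\<nu>. (norm x)\<^sup>2)"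
proof -
  have \<nu>: "prob_space \<nu>" "sets \<nu> = sets borel" "integrable \<nu> (\<lambda>x. (norm x)\<^sup>2)" using assms by (auto simp: centered_def)
  note i = second_moment_integrable(2)[OF \<nu>]
  have eq: "(slope v x)\<^sup>2 = x $ 1 * x $ 1 + 2 * v * (x $ 1 * x $ 2) + v\<^sup>2 * (x $ 2 * x $ 2)" for x
    by (simp add: slope_def power2_eq_square algebra_simps)
  show "integrable \<nu> (\<lambda>x. (slope v x)\<^sup>2)" unfolding eq by (intro Bochner_Integration.integrable_add integrable_mult_right i)
  show "(LINT x|\<nu>. (slope v x)\<^sup>2) = quad v (second_moments \<nu>)"
    unfolding eq using i by (simp add: quad_def second_moments_def)
  show "trace (second_moments \<nu>) = (LINT x|\<nu>. (norm x)\<^sup>2)"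
    unfolding norm_2_square using i by (simp add: trace_def second_moments_def power2_eq_square)
qed

lemma psd_second_moments:
  assumes "centered \<nu>" shows "second_moments \<nu> \<in> psd"
proof -
  have \<nu>: "prob_space \<nu>" "sets \<nu> = sets borel" "integrable \<nu> (\<lambda>x. (norm x)\<^sup>2)" using assms by (auto simp: centered_def)
  obtain p q r where M: "second_moments \<nu> = (p, q, r)" by (cases "second_moments \<nu>")
  have p: "p \<ge> 0" and r: "r \<ge> 0" using M by (auto simp: second_moments_def)
  have quad_nonneg: "p + 2 * q * v + r * v\<^sup>2 \<ge> 0" for v
    using quad_second_moments(1)[OF assms, of v, symmetric] M by (simp add: quad_def)
  have "q\<^sup>2 \<le> p * r"
  proof (cases "r = 0")
    case True
    have "q = 0"
    proof (rule ccontr)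
      assume "q \<noteq> 0"
      then have "p + 2 * q * (- (p + 1) / (2 * q)) + r * (- (p + 1) / (2 * q))\<^sup>2 = -1" using True by simp
      with quad_nonneg[of "- (p + 1) / (2 * q)"] show False by simp
    qed
    with True show ?thesis by simp
  next
    case False
    then have r: "r > 0" using r by simp
    have "p + 2 * q * (- q / r) + r * (- q / r)\<^sup>2 = p - q\<^sup>2 / r"
      using r by (simp add: power2_eq_square field_simps)
    with quad_nonneg[of "- q / r"] have "q\<^sup>2 / r \<le> p" by simp
    then show ?thesis using r by (simp add: field_simps)
  qed
  with p r M show ?thesis by (simp add: psd_def)
qed

text \<open>For mean zero, \<open>|x - y|\<^sup>2\<close> integrates to twice the second moment.\<close>

lemma energy_centered:
  assumes c: "centered \<nu>"
  shows "E \<nu> = (\<integral>\<^sup>+v. ennreal (w v) * riesz_energy s (distr \<nu> borel (slope v)) \<partial>lborel) / 2 + ennreal (trace (second_moments \<nu>))"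
proof -
  have \<nu>: "prob_space \<nu>" "sets \<nu> = sets borel" "integrable \<nu> (\<lambda>x. (norm x)\<^sup>2)" and m: "\<And>i. (LINT x|\<nu>. x $ i) = 0"
    using c by (auto simp: centered_def)
  interpret prob_space \<nu> by fact
  have [measurable_cong]: "sets \<nu> = sets borel" by fact
  let ?M = "LINT x|\<nu>. (norm x)\<^sup>2"
  have eq: "(norm (x - y))\<^sup>2 = (norm x)\<^sup>2 - 2 * (x $ 1 * y $ 1 + x $ 2 * y $ 2) + (norm y)\<^sup>2" for x y :: "real^2"
    unfolding norm_2_square by (simp add: power2_eq_square algebra_simps)
  note i1 = second_moment_integrable(1)[OF \<nu>]
  have int: "integrable \<nu> (\<lambda>y. (norm (x - y))\<^sup>2)" for x
    unfolding eq using i1 \<nu>(3) by simp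
  have inner: "(\<integral>\<^sup>+y. ennreal ((norm (x - y))\<^sup>2) \<partial>\<nu>) = ennreal ((norm x)\<^sup>2 + ?M)" for x
  proof -
    have "(LINT y|\<nu>. (norm (x - y))\<^sup>2) = (norm x)\<^sup>2 + ?M"
      unfolding eq using i1 \<nu>(3) by (simp add: m prob_space)
    then show ?thesis using nn_integral_eq_integral[OF int] by simp
  qed
  have "(\<integral>\<^sup>+x. \<integral>\<^sup>+y. ennreal ((norm (x - y))\<^sup>2) \<partial>\<nu> \<partial>\<nu>) = (\<integral>\<^sup>+x. ennreal ((norm x)\<^sup>2 + ?M) \<partial>\<nu>)"
    unfolding inner ..
  also have "\<dots> = ennreal (LINT x|\<nu>. (norm x)\<^sup>2 + ?M)"
    using \<nu>(3) by (intro nn_integral_eq_integral) auto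
  also have "(LINT x|\<nu>. (norm x)\<^sup>2 + ?M) = 2 * ?M"
    using \<nu>(3) by (simp add: prob_space)
  finally have "(\<integral>\<^sup>+x. \<integral>\<^sup>+y. ennreal ((norm (x - y))\<^sup>2) \<partial>\<nu> \<partial>\<nu>) / 2 = ennreal (2 * ?M) / ennreal 2" by simp
  also have "\<dots> = ennreal (2 * ?M / 2)" by (rule divide_ennreal) auto
  finally show ?thesis unfolding energy_eq[OF \<nu>(1,2)] quad_second_moments(3)[OF c] by simp
qed

text \<open>The extremal inequality on the line, applied to every projection. If the integrals over \<open>v\<close>
  agree and are finite, then the integrands agree almost everywhere, and the equality case of
  the inequality applies wherever \<open>w\<close> is positive.\<close>

lemma reduced_energy_le:
  assumes c: "centered \<nu>"
  shows "reduced_energy (second_moments \<nu>) \<le> E \<nu>"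
    and "E \<nu> = reduced_energy (second_moments \<nu>) \<Longrightarrow> E \<nu> < \<infinity> \<Longrightarrow>
      AE v in lborel. w v > 0 \<longrightarrow> quad v (second_moments \<nu>) > 0 \<and>
         distr \<nu> borel (slope v) = profile_law s (sqrt (quad v (second_moments \<nu>) / profile_variance s))"
proof -
  have \<nu>: "prob_space \<nu>" "sets \<nu> = sets borel" "integrable \<nu> (\<lambda>x. (norm x)\<^sup>2)" using c by (auto simp: centered_def)
  interpret prob_space \<nu> by fact
  have [measurable_cong]: "sets \<nu> = sets borel" by fact
  let ?d = "\<lambda>v. distr \<nu> borel (slope v)"
  have pr: "prob_space (?d v)" for v by (rule prob_space_distr) measurable
  have V: "(LINT x|?d v. x\<^sup>2) = quad v (second_moments \<nu>)" "integrable (?d v) (\<lambda>x. x\<^sup>2)" for v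
    using quad_second_moments(1,2)[OF c, of v] by (simp_all add: integral_distr integrable_distr_eq)
  note R = riesz_energy_ge_second_moment[OF s _ pr V(2), unfolded V(1), OF sets_distr]
  let ?f = "\<lambda>v. ennreal (w v) * (profile_energy_constant s * riesz (s / 2) (quad v (second_moments \<nu>)))"
  let ?g = "\<lambda>v. ennreal (w v) * riesz_energy s (?d v)"
  have fg: "?f v \<le> ?g v" for v by (intro mult_left_mono R(1)) auto
  have [measurable]: "(\<lambda>v. quad v M) \<in> borel_measurable borel" for M
    unfolding quad_def by (cases M) auto
  have g_eq: "riesz_energy s (?d v) = (\<integral>\<^sup>+x. \<integral>\<^sup>+y. riesz s (slope v x - slope v y) \<partial>\<nu> \<partial>\<nu>)" for v
  proof -
    interpret P: prob_space "?d v" by (rule pr)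
    show ?thesis unfolding riesz_mutual_def by (subst nn_integral_distr, measurable) (simp add: nn_integral_distr)
  qed
  have [measurable]: "(\<lambda>v. riesz_energy s (?d v)) \<in> borel_measurable borel"
    unfolding g_eq by measurable
  show "reduced_energy (second_moments \<nu>) \<le> E \<nu>"
    unfolding energy_centered[OF c] reduced_energy_def
    by (intro add_right_mono divide_right_mono_ennreal nn_integral_mono fg)
  assume eq: "E \<nu> = reduced_energy (second_moments \<nu>)" and fin: "E \<nu> < \<infinity>"
  have "(\<integral>\<^sup>+v. ?g v \<partial>lborel) / 2 = (\<integral>\<^sup>+v. ?f v \<partial>lborel) / 2"
    using eq unfolding energy_centered[OF c] reduced_energy_def by simp
  then have I: "(\<integral>\<^sup>+v. ?g v \<partial>lborel) = (\<integral>\<^sup>+v. ?f v \<partial>lborel)"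
    by (rule ennreal_half_cancel)
  have gfin: "(\<integral>\<^sup>+v. ?g v \<partial>lborel) \<noteq> \<infinity>"
    using fin unfolding energy_centered[OF c] by (auto simp: ennreal_top_divide)
  have "AE v in lborel. ?g v \<le> ?f v"
  proof -
    have "(\<integral>\<^sup>+v. ?g v - ?f v \<partial>lborel) = (\<integral>\<^sup>+v. ?g v \<partial>lborel) - (\<integral>\<^sup>+v. ?f v \<partial>lborel)"
      using gfin I fg by (intro nn_integral_diff) auto
    also have "\<dots> = 0" using I gfin by simp
    finally have "AE v in lborel. ?g v - ?f v = 0" by (subst (asm) nn_integral_0_iff_AE) auto
    then show ?thesis by eventually_elim (simp add: diff_eq_0_iff_ennreal)
  qed
  moreover have "AE v in lborel. ?g v \<noteq> \<infinity>" using gfin by (intro nn_integral_noteq_infinite) auto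
  ultimately show "AE v in lborel. w v > 0 \<longrightarrow> quad v (second_moments \<nu>) > 0 \<and>
         ?d v = profile_law s (sqrt (quad v (second_moments \<nu>) / profile_variance s))"
  proof eventually_elim
    case (elim v)
    show ?case
    proof
      assume w: "w v > 0"
      have "riesz_energy s (?d v) = profile_energy_constant s * riesz (s / 2) (quad v (second_moments \<nu>))"
        using antisym[OF elim(1) fg] w by (simp add: ennreal_mult_cancel_left)
      moreover have "profile_energy_constant s \<noteq> 0" using profile_energy_constant_finite(2)[OF s] by auto
      then have "quad v (second_moments \<nu>) \<noteq> 0"
        using elim w R(1)[of v]
        by (auto simp: ennreal_mult_top ennreal_top_mult top_unique)
      moreover have "quad v (second_moments \<nu>) \<ge> 0" unfolding V(1)[symmetric] by simp
      ultimately show "quad v (second_moments \<nu>) > 0 \<and> ?d v = profile_law s (sqrt (quad v (second_moments \<nu>) / profile_variance s))"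
        using R(2)[of v] by simp
    qed
  qed
qed

end

section \<open>Existence and uniqueness of the optimal second moments\<close>

text \<open>Two applications of the inequality of arithmetic and geometric means: to \<open>x\<close> and \<open>y\<close>, then to
  \<open>x\<^sup>-\<^sup>a\<close> and \<open>y\<^sup>-\<^sup>a\<close>. The second one is strict unless the powers agree.\<close>

lemma powr_neg_midpoint:
  fixes a x y :: real
  assumes a: "a > 0" and x: "x > 0" and y: "y > 0"
  shows "2 * ((x + y) / 2) powr (- a) \<le> x powr (- a) + y powr (- a)"
    and "2 * ((x + y) / 2) powr (- a) = x powr (- a) + y powr (- a) \<Longrightarrow> x = y"
proof -
  define u v where "u = x powr (- a / 2)" and "v = y powr (- a / 2)"
  have u2: "u\<^sup>2 = x powr (- a)" and v2: "v\<^sup>2 = y powr (- a)"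
    using x y by (simp_all add: u_def v_def power2_eq_square powr_add[symmetric])
  have uv: "u * v = sqrt (x * y) powr (- a)"
    using x y power2_powr_half[of "sqrt (x * y)" "- a"] by (simp add: u_def v_def powr_mult)
  have am: "sqrt (x * y) \<le> (x + y) / 2" by (rule arith_geo_mean_sqrt) (use x y in auto)
  have *: "((x + y) / 2) powr (- a) \<le> u * v"
    unfolding uv using a x y am by (intro powr_mono2') auto
  have "2 * (u * v) \<le> u\<^sup>2 + v\<^sup>2" using sum_squares_bound[of u v] by simp
  with * show "2 * ((x + y) / 2) powr (- a) \<le> x powr (- a) + y powr (- a)"
    unfolding u2 v2 by linarith
  assume eq: "2 * ((x + y) / 2) powr (- a) = x powr (- a) + y powr (- a)"
  then have "u\<^sup>2 + v\<^sup>2 \<le> 2 * (u * v)" using * unfolding u2 v2 by linarith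
  then have "(u - v)\<^sup>2 \<le> 0" by (simp add: power2_diff)
  then have "u = v" by simp
  then have "ln x = ln y" using x y a by (simp add: u_def v_def powr_def)
  then show "x = y" using x y by simp
qed

lemma riesz_antimono: "0 < a \<Longrightarrow> 0 \<le> x \<Longrightarrow> x \<le> y \<Longrightarrow> riesz a y \<le> riesz a x"
  by (cases "x = 0") (auto simp: riesz_nonzero intro!: ennreal_leI powr_mono2')

lemma riesz_midpoint:
  fixes a x y :: real
  assumes a: "a > 0" and x: "x \<ge> 0" and y: "y \<ge> 0"
  shows "2 * riesz a ((x + y) / 2) \<le> riesz a x + riesz a y"
    and "2 * riesz a ((x + y) / 2) = riesz a x + riesz a y \<Longrightarrow> riesz a x + riesz a y < \<infinity> \<Longrightarrow> x = y"
proof -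
  have r: "2 * riesz a ((x + y) / 2) = ennreal (2 * ((x + y) / 2) powr (- a))" "riesz a x + riesz a y = ennreal (x powr (- a) + y powr (- a))"
    if "x > 0" "y > 0" using that by (simp_all add: riesz_nonzero ennreal_mult')
  show "2 * riesz a ((x + y) / 2) \<le> riesz a x + riesz a y"
  proof (cases "x > 0 \<and> y > 0")
    case True
    then show ?thesis using r powr_neg_midpoint(1)[OF a, of x y] by (simp only: ennreal_leI)
  next
    case False
    then have "x = 0 \<or> y = 0" using x y by auto
    then show ?thesis by auto
  qed
  assume eq: "2 * riesz a ((x + y) / 2) = riesz a x + riesz a y" and fin: "riesz a x + riesz a y < \<infinity>"
  then have xy: "x > 0" "y > 0" using x y by (auto simp: less_le)
  then show "x = y"
    using eq powr_neg_midpoint(2)[OF a xy] unfolding r[OF xy] by (subst (asm) ennreal_inj) auto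
qed

lemma riesz_tendsto:
  assumes a: "a > 0" and f: "f \<longlonglongrightarrow> l" "\<And>n. f n \<ge> 0"
  shows "(\<lambda>n. riesz a (f n)) \<longlonglongrightarrow> riesz a l"
proof -
  have "(\<lambda>n. \<bar>f n\<bar> powr a) \<longlonglongrightarrow> \<bar>l\<bar> powr a"
    using a by (intro tendsto_powr' tendsto_intros f) auto
  then have "(\<lambda>n. ennreal (\<bar>f n\<bar> powr a)) \<longlonglongrightarrow> ennreal (\<bar>l\<bar> powr a)" by (rule tendsto_ennrealI)
  then show ?thesis unfolding riesz_def
  proof (rule isCont_tendsto_compose[rotated])
    have "continuous_on UNIV (\<lambda>x::ennreal. inverse x)" by (intro continuous_on_inverse_ennreal continuous_on_id)
    then show "isCont inverse (ennreal (\<bar>l\<bar> powr a))" by (simp add: continuous_on_eq_continuous_at)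
  qed
qed

context slope_mixture
begin

lemma measurable_quad [measurable]: "(\<lambda>v. quad v M) \<in> borel_measurable borel"
  unfolding quad_def by (cases M) auto

lemma psd_quad_nonneg: "M \<in> psd \<Longrightarrow> quad v M \<ge> 0"
proof -
  assume "M \<in> psd"
  then obtain p q r where M: "M = (p, q, r)" and pr: "0 \<le> p" "0 \<le> r" "q\<^sup>2 \<le> p * r" by (auto simp: psd_def)
  have "\<bar>q\<bar> \<le> sqrt p * sqrt r"
    using pr by (simp add: real_sqrt_mult[symmetric] real_le_rsqrt)
  then have "\<bar>q * v\<bar> \<le> sqrt p * sqrt r * \<bar>v\<bar>" unfolding abs_mult by (rule mult_right_mono) simp
  moreover have "0 \<le> (sqrt p - sqrt r * \<bar>v\<bar>)\<^sup>2" by simp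
  moreover have "(sqrt p - sqrt r * \<bar>v\<bar>)\<^sup>2 = p - 2 * (sqrt p * sqrt r * \<bar>v\<bar>) + r * v\<^sup>2"
    using pr by (simp add: power2_diff power_mult_distrib)
  ultimately show ?thesis unfolding M quad_def by (simp add: abs_le_iff)
qed

text \<open>A finite set of slopes is a null set and cannot carry the mass of \<open>w\<close>.\<close>

lemma infinite_support:
  assumes "AE v in lborel. w v > 0 \<longrightarrow> P v"
  shows "infinite {v. P v}"
proof
  assume fin: "finite {v. P v}"
  have "{v. P v} \<in> null_sets lborel"
    using fin by (intro countable_imp_null_set_lborel countable_finite)
  then have "AE v in lborel. v \<notin> {v. P v}" by (rule AE_not_in)
  with assms have "AE v in lborel. ennreal (w v) = 0"
    by eventually_elim (auto simp: ennreal_eq_0_iff not_less)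
  then have "(\<integral>\<^sup>+v. ennreal (w v) \<partial>lborel) = 0" by (subst nn_integral_0_iff_AE) auto
  with w_mass(2) show False by simp
qed

text \<open>A quadratic polynomial in \<open>v\<close> with infinitely many zeros vanishes.\<close>

lemma quad_eqI:
  assumes "infinite {v. quad v M = quad v M'}"
  shows "M = M'"
proof -
  obtain p q r p' q' r' where M: "M = (p, q, r)" "M' = (p', q', r')" by (cases M; cases M')
  let ?P = "[:p - p', 2 * (q - q'), r - r':]"
  have "{v. quad v M = quad v M'} = {v. poly ?P v = 0}"
    by (auto simp: M quad_def power2_eq_square algebra_simps)
  with assms have "?P = 0" using poly_roots_finite by metis
  then show ?thesis by (simp add: M)
qed

text \<open>The trace bounds all entries of a positive semidefinite matrix, so a minimizing sequence has a
  convergent subsequence. The interaction part is lower semicontinuous by Fatou's lemma.\<close>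

lemma exists_reduced_minimizer:
  "\<exists>M\<in>psd. reduced_energy M < \<infinity> \<and> (\<forall>M'\<in>psd. reduced_energy M \<le> reduced_energy M')"
proof -
  \<comment> \<open>The identity matrix has finite reduced energy, since its quadratic form is at least \<open>1\<close>.\<close>
  define M0 :: moments where "M0 = (1, 0, 1)"
  have M0: "M0 \<in> psd" by (simp add: M0_def psd_def)
  have fin0: "reduced_energy M0 < \<infinity>"
  proof -
    have "(\<integral>\<^sup>+v. ennreal (w v) * (profile_energy_constant s * riesz (s / 2) (quad v M0)) \<partial>lborel)
       \<le> (\<integral>\<^sup>+v. ennreal (w v) * (profile_energy_constant s * 1) \<partial>lborel)"
    proof (intro nn_integral_mono mult_left_mono)
      fix v
      have "riesz (s / 2) (quad v M0) \<le> riesz (s / 2) 1"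
        using s by (intro riesz_antimono) (auto simp: M0_def quad_def)
      then show "riesz (s / 2) (quad v M0) \<le> 1" by (simp add: riesz_nonzero)
    qed auto
    also have "\<dots> < \<infinity>"
      using w_mass(1) profile_energy_constant_finite(1)[OF s] by (simp add: nn_integral_multc ennreal_mult_less_top)
    finally show ?thesis
      unfolding reduced_energy_def by (auto simp: ennreal_divide_eq_top_iff less_top[symmetric])
  qed
  define A where "A = reduced_energy ` {M \<in> psd. reduced_energy M \<le> reduced_energy M0}"
  have "reduced_energy M0 \<in> A" unfolding A_def using M0 by blast
  then have "A \<noteq> {}" by blast
  from ennreal_Inf_countable_INF[OF this] obtain f where f: "decseq f" "range f \<subseteq> A" "Inf A = (INF i. f i)" by blast
  then have flim: "f \<longlonglongrightarrow> Inf A" by (simp add: LIMSEQ_INF)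
  have "\<forall>i. \<exists>M. M \<in> psd \<and> reduced_energy M \<le> reduced_energy M0 \<and> f i = reduced_energy M"
    using f(2) by (auto simp: A_def image_iff subset_eq)
  then obtain M where M: "\<And>i. M i \<in> psd" "\<And>i. reduced_energy (M i) \<le> reduced_energy M0" "\<And>i. f i = reduced_energy (M i)"
    by metis
  define N where "N = enn2real (reduced_energy M0)"
  have N: "reduced_energy M0 = ennreal N" "N \<ge> 0" using fin0 by (simp_all add: N_def)
  have bound: "M i \<in> cbox (0, - N, 0) (N, N, N)" for i
  proof -
    obtain p q r where Mi: "M i = (p, q, r)" by (cases "M i")
    have pr: "0 \<le> p" "0 \<le> r" "q\<^sup>2 \<le> p * r" using M(1)[of i] by (auto simp: Mi psd_def)
    have "ennreal (p + r) \<le> reduced_energy (M i)" unfolding reduced_energy_def Mi trace_def by simp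
    also have "\<dots> \<le> ennreal N" using M(2)[of i] N by simp
    finally have "p + r \<le> N" using pr N by (subst (asm) ennreal_le_iff2) auto
    moreover have "\<bar>q\<bar> \<le> p + r"
    proof (rule abs_le_square_iff[THEN iffD2, of q "p + r", simplified abs_of_nonneg[OF add_nonneg_nonneg[OF pr(1,2)]]])
      have "p * r \<le> (p + r)\<^sup>2" using pr by (simp add: power2_sum)
      with pr(3) show "q\<^sup>2 \<le> (p + r)\<^sup>2" by linarith
    qed
    ultimately show ?thesis using pr by (auto simp: Mi cbox_Pair_eq)
  qed
  obtain L \<sigma> where \<sigma>: "strict_mono \<sigma>" and L: "(M \<circ> \<sigma>) \<longlonglongrightarrow> L"
    using compact_cbox[unfolded compact_def, rule_format, of M "(0, - N, 0)" "(N, N, N)"] bound by blast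
  obtain p q r where Lp: "L = (p, q, r)" by (cases L)
  define P Q R where "P i = fst (M (\<sigma> i))" and "Q i = fst (snd (M (\<sigma> i)))" and "R i = snd (snd (M (\<sigma> i)))" for i
  have PQR: "M (\<sigma> i) = (P i, Q i, R i)" for i by (simp add: P_def Q_def R_def)
  have lims: "P \<longlonglongrightarrow> p" "Q \<longlonglongrightarrow> q" "R \<longlonglongrightarrow> r"
    using tendsto_fst[OF L] tendsto_fst[OF tendsto_snd[OF L]] tendsto_snd[OF tendsto_snd[OF L]]
    by (simp_all add: P_def[abs_def] Q_def[abs_def] R_def[abs_def] Lp comp_def)
  have PQRpsd: "0 \<le> P i" "0 \<le> R i" "(Q i)\<^sup>2 \<le> P i * R i" for i
    using M(1)[of "\<sigma> i"] by (auto simp: PQR psd_def)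
  have Lpsd: "L \<in> psd"
  proof -
    have "0 \<le> p" "0 \<le> r" using lims PQRpsd by (auto intro: LIMSEQ_le_const)
    moreover have "q\<^sup>2 \<le> p * r"
      by (rule LIMSEQ_le[OF tendsto_power[OF lims(2)] tendsto_mult[OF lims(1,3)]]) (use PQRpsd in auto)
    ultimately show ?thesis by (simp add: Lp psd_def)
  qed
  have quad_lim: "(\<lambda>i. quad v (M (\<sigma> i))) \<longlonglongrightarrow> quad v L" for v
    unfolding PQR Lp quad_def prod.case by (intro tendsto_intros lims)
  have riesz_lim: "(\<lambda>i. riesz (s / 2) (quad v (M (\<sigma> i)))) \<longlonglongrightarrow> riesz (s / 2) (quad v L)" for v
    using s quad_lim psd_quad_nonneg[OF M(1)] by (intro riesz_tendsto) auto
  let ?h = "\<lambda>M v. ennreal (w v) * (profile_energy_constant s * riesz (s / 2) (quad v M))"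
  have hlim: "(\<lambda>i. ?h (M (\<sigma> i)) v) \<longlonglongrightarrow> ?h L v" for v
    using profile_energy_constant_finite[OF s] by (intro ennreal_tendsto_cmult riesz_lim) auto
  have "(\<integral>\<^sup>+v. ?h L v \<partial>lborel) = (\<integral>\<^sup>+v. liminf (\<lambda>i. ?h (M (\<sigma> i)) v) \<partial>lborel)"
    by (intro nn_integral_cong lim_imp_Liminf[symmetric] hlim) simp
  also have "\<dots> \<le> liminf (\<lambda>i. \<integral>\<^sup>+v. ?h (M (\<sigma> i)) v \<partial>lborel)"
    by (rule nn_integral_liminf) measurable
  finally have fatou: "(\<integral>\<^sup>+v. ?h L v \<partial>lborel) \<le> liminf (\<lambda>i. \<integral>\<^sup>+v. ?h (M (\<sigma> i)) v \<partial>lborel)" .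
  have tr: "(\<lambda>i. trace (M (\<sigma> i))) \<longlonglongrightarrow> trace L"
    unfolding PQR Lp trace_def prod.case by (intro tendsto_intros lims)
  have flim': "(\<lambda>i. reduced_energy (M (\<sigma> i))) \<longlonglongrightarrow> Inf A"
    using LIMSEQ_subseq_LIMSEQ[OF flim \<sigma>] M(3) by (simp add: comp_def)
  \<comment> \<open>The trace part converges, so the interaction part of the sequence converges as well.\<close>
  have "reduced_energy L \<le> Inf A"
  proof -
    have e: "(\<integral>\<^sup>+v. ?h (M (\<sigma> i)) v \<partial>lborel) / 2 = reduced_energy (M (\<sigma> i)) - ennreal (trace (M (\<sigma> i)))" for i
      unfolding reduced_energy_def by simp
    have "(\<lambda>i. reduced_energy (M (\<sigma> i)) - ennreal (trace (M (\<sigma> i)))) \<longlonglongrightarrow> Inf A - ennreal (trace L)"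
      by (intro tendsto_diff_ennreal_general flim' tendsto_ennrealI tr) simp
    then have "(\<lambda>i. 2 * ((\<integral>\<^sup>+v. ?h (M (\<sigma> i)) v \<partial>lborel) / 2)) \<longlonglongrightarrow> 2 * (Inf A - ennreal (trace L))"
      unfolding e by (intro ennreal_tendsto_cmult) auto
    then have "(\<lambda>i. \<integral>\<^sup>+v. ?h (M (\<sigma> i)) v \<partial>lborel) \<longlonglongrightarrow> 2 * (Inf A - ennreal (trace L))"
      by (simp add: ennreal_times_divide mult.commute[of 2] mult_divide_eq_ennreal)
    then have "liminf (\<lambda>i. \<integral>\<^sup>+v. ?h (M (\<sigma> i)) v \<partial>lborel) = 2 * (Inf A - ennreal (trace L))"
      by (simp add: lim_imp_Liminf)
    with fatou have "(\<integral>\<^sup>+v. ?h L v \<partial>lborel) / 2 \<le> (Inf A - ennreal (trace L)) * 2 / 2"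
      by (intro divide_right_mono_ennreal) (simp add: mult.commute)
    also have "\<dots> = Inf A - ennreal (trace L)" by (rule mult_divide_eq_ennreal) auto
    finally have "reduced_energy L \<le> Inf A - ennreal (trace L) + ennreal (trace L)"
      unfolding reduced_energy_def by (rule add_right_mono)
    also have "ennreal (trace L) \<le> Inf A"
    proof (rule LIMSEQ_le[OF tendsto_ennrealI[OF tr] flim'])
      show "\<exists>N. \<forall>n\<ge>N. ennreal (trace (M (\<sigma> n))) \<le> reduced_energy (M (\<sigma> n))"
        unfolding reduced_energy_def by auto
    qed
    then have "Inf A - ennreal (trace L) + ennreal (trace L) = Inf A" by (rule diff_add_cancel_ennreal)
    finally show ?thesis .
  qed
  moreover have "Inf A \<le> reduced_energy M'" if "M' \<in> psd" for M'
  proof (cases "reduced_energy M' \<le> reduced_energy M0")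
    case True
    with that show ?thesis by (intro Inf_lower) (auto simp: A_def)
  next
    case False
    have "Inf A \<le> reduced_energy M0" using M0 by (intro Inf_lower) (auto simp: A_def)
    with False show ?thesis by simp
  qed
  ultimately have "\<forall>M'\<in>psd. reduced_energy L \<le> reduced_energy M'" by (meson order_trans)
  moreover from this have "reduced_energy L < \<infinity>" using M0 fin0 by (meson le_less_trans)
  ultimately show ?thesis using Lpsd by blast
qed

text \<open>At the midpoint of two minimizers the interaction part cannot be smaller than the average, so
  convexity is an equality for almost every slope charged by \<open>w\<close>. Strict convexity then makes
  the quadratic forms agree at infinitely many slopes.\<close>

lemma reduced_minimizer_unique:
  assumes M: "M \<in> psd" "\<And>M'. M' \<in> psd \<Longrightarrow> reduced_energy M \<le> reduced_energy M'" and fin: "reduced_energy M < \<infinity>"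
    and M': "M' \<in> psd" "reduced_energy M' = reduced_energy M"
  shows "M' = M"
proof -
  obtain p q r p' q' r' where Mp: "M = (p, q, r)" "M' = (p', q', r')" by (cases M; cases M')
  define H :: moments where "H = ((p + p') / 2, (q + q') / 2, (r + r') / 2)"
  have H: "quad v H = (quad v M + quad v M') / 2" for v by (simp add: H_def Mp quad_def field_simps)
  have tH: "trace H = (trace M + trace M') / 2" by (simp add: H_def Mp trace_def field_simps)
  have Hpsd: "H \<in> psd"
  proof -
    have pr: "0 \<le> p" "0 \<le> r" "q\<^sup>2 \<le> p * r" "0 \<le> p'" "0 \<le> r'" "q'\<^sup>2 \<le> p' * r'" using M(1) M'(1) by (auto simp: Mp psd_def)
    have "(2 * (q * q'))\<^sup>2 \<le> (p * r' + p' * r)\<^sup>2"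
    proof -
      have "(q * q')\<^sup>2 \<le> (p * r) * (p' * r')" unfolding power_mult_distrib using pr by (intro mult_mono) auto
      moreover have "4 * ((p * r') * (p' * r)) \<le> (p * r' + p' * r)\<^sup>2"
        using zero_le_power2[of "p * r' - p' * r"] by (simp add: power2_sum power2_diff algebra_simps)
      ultimately show ?thesis by (simp add: power_mult_distrib mult_ac)
    qed
    then have "2 * (q * q') \<le> p * r' + p' * r" using pr by (intro power2_le_imp_le[of "2 * (q * q')"]) auto
    then have "(q + q')\<^sup>2 \<le> (p + p') * (r + r')" using pr by (simp add: power2_sum algebra_simps)
    then show ?thesis using pr by (simp add: H_def psd_def power_divide)
  qed
  let ?h = "\<lambda>M v. ennreal (w v) * (profile_energy_constant s * riesz (s / 2) (quad v M))"
  let ?I = "\<lambda>M. \<integral>\<^sup>+v. ?h M v \<partial>lborel"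
  have tr: "trace M \<ge> 0" "trace M' \<ge> 0" using M(1) M'(1) by (auto simp: Mp psd_def trace_def)
  have mid: "2 * ?h H v \<le> ?h M v + ?h M' v" for v
  proof -
    have "2 * ?h H v = ennreal (w v) * (profile_energy_constant s * (2 * riesz (s / 2) (quad v H)))" by (simp add: mult_ac)
    also have "\<dots> \<le> ennreal (w v) * (profile_energy_constant s * (riesz (s / 2) (quad v M) + riesz (s / 2) (quad v M')))"
      unfolding H using s psd_quad_nonneg M(1) M'(1) by (intro mult_left_mono riesz_midpoint) auto
    finally show ?thesis by (simp add: distrib_left)
  qed
  have "?I N < \<infinity>" if "reduced_energy N < \<infinity>" for N
    using that unfolding reduced_energy_def by (cases "?I N") (auto simp: ennreal_top_divide)
  from this[OF fin] this[of M'] have fI: "?I M < \<infinity>" "?I M' < \<infinity>" using fin M'(2) by simp_all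
  have H_le: "(\<integral>\<^sup>+v. 2 * ?h H v \<partial>lborel) \<le> (\<integral>\<^sup>+v. ?h M v + ?h M' v \<partial>lborel)" by (intro nn_integral_mono mid)
  have I2: "(\<integral>\<^sup>+v. ?h M v + ?h M' v \<partial>lborel) = ?I M + ?I M'" by (rule nn_integral_add) measurable
  have IH: "(\<integral>\<^sup>+v. 2 * ?h H v \<partial>lborel) = 2 * ?I H" by (rule nn_integral_cmult) measurable
  have fH: "?I H < \<infinity>"
    using H_le fI unfolding I2 IH by (cases "?I H") (auto simp: ennreal_mult_top top_unique)
  obtain i i' h where r: "?I M = ennreal i" "?I M' = ennreal i'" "?I H = ennreal h" "i \<ge> 0" "i' \<ge> 0" "h \<ge> 0"
  proof -
    have "\<exists>i\<ge>0. x = ennreal i" if "x < \<infinity>" for x using that by (cases x) auto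
    from this[OF fI(1)] this[OF fI(2)] this[OF fH] that show ?thesis by blast
  qed
  have "h / 2 + trace H \<ge> i / 2 + trace M"
  proof -
    have tH0: "trace H \<ge> 0" unfolding tH using tr by simp
    have "reduced_energy M \<le> reduced_energy H" by (rule M(2)[OF Hpsd])
    then have "ennreal (i / 2 + trace M) \<le> ennreal (h / 2 + trace H)"
      unfolding reduced_energy_def r using r tr tH0 by (simp add: ennreal_divide_numeral ennreal_plus[symmetric] del: ennreal_plus)
    then show ?thesis using r tH0 by (subst (asm) ennreal_le_iff) auto
  qed
  moreover have "i' / 2 + trace M' = i / 2 + trace M"
  proof -
    have "ennreal (i' / 2 + trace M') = ennreal (i / 2 + trace M)"
      using M'(2) unfolding reduced_energy_def r using r tr by (simp add: ennreal_divide_numeral ennreal_plus[symmetric] del: ennreal_plus)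
    then show ?thesis using r tr by (subst (asm) ennreal_inj) auto
  qed
  ultimately have "i + i' \<le> 2 * h" unfolding tH by (simp add: field_simps)
  then have ge: "(\<integral>\<^sup>+v. ?h M v + ?h M' v \<partial>lborel) \<le> (\<integral>\<^sup>+v. 2 * ?h H v \<partial>lborel)"
  proof -
    assume "i + i' \<le> 2 * h"
    then have "ennreal (i + i') \<le> ennreal (2 * h)" by (rule ennreal_leI)
    then show ?thesis unfolding I2 IH r using r by (simp only: ennreal_plus ennreal_mult' ennreal_numeral)
  qed
  have fin2: "(\<integral>\<^sup>+v. ?h M v + ?h M' v \<partial>lborel) \<noteq> \<infinity>" unfolding I2 r by simp
  have "AE v in lborel. ?h M v + ?h M' v \<le> 2 * ?h H v"
  proof -
    have "(\<integral>\<^sup>+v. (?h M v + ?h M' v) - 2 * ?h H v \<partial>lborel) = (\<integral>\<^sup>+v. ?h M v + ?h M' v \<partial>lborel) - (\<integral>\<^sup>+v. 2 * ?h H v \<partial>lborel)"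
      using mid H_le fin2 by (intro nn_integral_diff) (auto simp: top_unique)
    also have "\<dots> = 0" using ge H_le fin2 by (simp add: diff_eq_0_iff_ennreal less_top)
    finally have "AE v in lborel. (?h M v + ?h M' v) - 2 * ?h H v = 0" by (subst (asm) nn_integral_0_iff_AE) auto
    then show ?thesis by eventually_elim (auto simp: diff_eq_0_iff_ennreal)
  qed
  moreover have "AE v in lborel. ?h M v + ?h M' v \<noteq> \<infinity>" using fin2 by (intro nn_integral_noteq_infinite) auto
  ultimately have "AE v in lborel. w v > 0 \<longrightarrow> quad v M' = quad v M"
  proof eventually_elim
    case (elim v)
    show ?case
    proof
      assume wv: "w v > 0"
      have k: "profile_energy_constant s \<noteq> 0" "profile_energy_constant s \<noteq> \<top>" using profile_energy_constant_finite[OF s] by auto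
      have "?h M v + ?h M' v = 2 * ?h H v" using elim(1) mid by (rule antisym)
      then have "ennreal (w v) * (profile_energy_constant s * (riesz (s / 2) (quad v M) + riesz (s / 2) (quad v M')))
        = ennreal (w v) * (profile_energy_constant s * (2 * riesz (s / 2) (quad v H)))"
        by (simp add: distrib_left mult_ac)
      then have "riesz (s / 2) (quad v M) + riesz (s / 2) (quad v M') = 2 * riesz (s / 2) ((quad v M + quad v M') / 2)"
        using wv k unfolding H by (simp add: ennreal_mult_cancel_left)
      moreover have "riesz (s / 2) (quad v M) + riesz (s / 2) (quad v M') < \<infinity>"
        using elim(2) wv k by (auto simp: ennreal_mult_eq_top_iff less_top)
      ultimately show "quad v M' = quad v M"
        using riesz_midpoint(2)[of "s / 2" "quad v M" "quad v M'"] s psd_quad_nonneg M(1) M'(1) by auto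
    qed
  qed
  from quad_eqI[OF infinite_support[OF this]] show ?thesis .
qed

section \<open>Second moments of ellipses and segments\<close>

text \<open>The variance of the projections of the disc law under forms of unit length.\<close>

definition spread :: real where
  "spread = (R2 s)\<^sup>2 * profile_variance s"

lemma spread_pos: "spread > 0"
  unfolding spread_def using constants_pos(1)[OF s] profile_variance_pos[OF s(1)] by simp

text \<open>The matrix \<open>spread \<cdot> R diag(a\<^sup>2, b\<^sup>2) R\<^sup>T\<close> with \<open>R\<close> the rotation by \<open>\<eta>\<close>.\<close>

definition shape :: "real \<Rightarrow> real \<Rightarrow> real \<Rightarrow> moments" where
  "shape a b \<eta> = (spread * ((a * cos \<eta>)\<^sup>2 + (b * sin \<eta>)\<^sup>2), spread * ((a\<^sup>2 - b\<^sup>2) * (sin \<eta> * cos \<eta>)),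
     spread * ((a * sin \<eta>)\<^sup>2 + (b * cos \<eta>)\<^sup>2))"

lemma quad_shape: "quad v (shape a b \<eta>) = spread * ellipse_width2 a b \<eta> v"
  by (simp add: quad_def shape_def ellipse_width2_def power2_eq_square algebra_simps)

lemma centered_ellipse_law: "centered (ellipse_law s a b \<eta>)"
  unfolding centered_def using ellipse_law_moments(1,2)[OF s] prob_space_ellipse_law[OF s] by auto

lemma second_moments_ellipse_law: "second_moments (ellipse_law s a b \<eta>) = shape a b \<eta>"
proof (rule quad_eqI)
  have "quad v (second_moments (ellipse_law s a b \<eta>)) = quad v (shape a b \<eta>)" for v
    unfolding quad_second_moments(1)[OF centered_ellipse_law, symmetric] ellipse_law_moments(3)[OF s] quad_shape spread_def ..
  then show "infinite {v. quad v (second_moments (ellipse_law s a b \<eta>)) = quad v (shape a b \<eta>)}"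
    by (simp add: infinite_UNIV_char_0)
qed

lemma energy_ellipse_law: "E (ellipse_law s a b \<eta>) = reduced_energy (shape a b \<eta>)"
proof -
  have "riesz_energy s (distr (ellipse_law s a b \<eta>) borel (slope v)) = profile_energy_constant s * riesz (s / 2) (quad v (shape a b \<eta>))" for v
  proof -
    have "ellipse_width2 a b \<eta> v \<ge> 0" by (simp add: ellipse_width2_def)
    then have "(R2 s * sqrt (ellipse_width2 a b \<eta> v))\<^sup>2 * profile_variance s = quad v (shape a b \<eta>)"
      by (simp add: quad_shape spread_def power_mult_distrib)
    then show ?thesis
      unfolding ellipse_law_projection[OF s]
      using riesz_energy_profile_law[OF s, of "R2 s * sqrt (ellipse_width2 a b \<eta> v)"] constants_pos(1)[OF s] \<open>ellipse_width2 a b \<eta> v \<ge> 0\<close>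
      by simp
  qed
  then show ?thesis
    unfolding energy_centered[OF centered_ellipse_law] second_moments_ellipse_law reduced_energy_def by simp
qed

lemma shape_swap: "shape a b \<eta> = shape b a (\<eta> - pi / 2)"
  by (simp add: shape_def sin_diff cos_diff algebra_simps)

text \<open>The spectral decomposition, with the smaller eigenvalue first. The traceless part of a symmetric
  matrix rotates by twice the angle of the rotation, so \<open>(p - r, 2 q)\<close> is written in polar form
  with angle \<open>t = 2 \<eta>\<close>; the sign in front of \<open>\<rho>\<close> is that of \<open>a\<^sup>2 - b\<^sup>2\<close>.\<close>

lemma psd_shape_exists:
  assumes "M \<in> psd" "M \<noteq> (0, 0, 0)"
  obtains a b \<eta> where "0 \<le> a" "0 < b" "0 \<le> \<eta>" "\<eta> < pi" "shape a b \<eta> = M"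
proof -
  obtain p0 q0 r0 where M: "M = (p0, q0, r0)" by (cases M)
  define p q r where "p = p0 / spread" and "q = q0 / spread" and "r = r0 / spread"
  have M0: "p0 = spread * p" "q0 = spread * q" "r0 = spread * r" using spread_pos by (simp_all add: p_def q_def r_def)
  have pr: "0 \<le> p" "0 \<le> r" using assms spread_pos by (auto simp: M psd_def p_def r_def)
  have "spread\<^sup>2 * q\<^sup>2 \<le> spread\<^sup>2 * (p * r)"
    using assms(1) unfolding M M0 psd_def by (simp add: power2_eq_square mult_ac)
  then have qq: "q\<^sup>2 \<le> p * r" using spread_pos by simp
  define \<rho> where "\<rho> = sqrt ((p - r)\<^sup>2 + (2 * q)\<^sup>2)"
  have \<rho>0: "\<rho> \<ge> 0" and \<rho>2: "\<rho>\<^sup>2 = (p - r)\<^sup>2 + (2 * q)\<^sup>2" by (auto simp: \<rho>_def)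
  have "\<rho>\<^sup>2 \<le> (p + r)\<^sup>2" unfolding \<rho>2 using qq by (simp add: power2_sum power2_diff power_mult_distrib)
  then have \<rho>_le: "\<rho> \<le> p + r" using pr by (intro power2_le_imp_le[of \<rho>]) auto
  obtain t where t: "0 \<le> t" "t < 2 * pi" "p - r = - \<rho> * cos t" "2 * q = - \<rho> * sin t"
  proof (cases "\<rho> = 0")
    case True
    with \<rho>2 have "(p - r)\<^sup>2 + (2 * q)\<^sup>2 = 0" by (simp only: zero_power2)
    then have "p - r = 0 \<and> 2 * q = 0" unfolding sum_power2_eq_zero_iff .
    with True that[of 0] show ?thesis by simp
  next
    case False
    have "(- (p - r) / \<rho>)\<^sup>2 + (- (2 * q) / \<rho>)\<^sup>2 = ((p - r)\<^sup>2 + (2 * q)\<^sup>2) / \<rho>\<^sup>2"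
      by (simp add: power_divide add_divide_distrib power2_eq_square) (simp add: algebra_simps)
    also have "\<dots> = 1" unfolding \<rho>2[symmetric] using False by simp
    finally obtain t where "0 \<le> t" "t < 2 * pi" "- (p - r) / \<rho> = cos t" "- (2 * q) / \<rho> = sin t"
      using sincos_total_2pi by metis
    with False that[of t] show ?thesis by (simp add: field_simps)
  qed
  define a b \<eta> where "a = sqrt ((p + r - \<rho>) / 2)" and "b = sqrt ((p + r + \<rho>) / 2)" and "\<eta> = t / 2"
  have a2: "a\<^sup>2 = (p + r - \<rho>) / 2" and b2: "b\<^sup>2 = (p + r + \<rho>) / 2" using \<rho>0 \<rho>_le pr by (auto simp: a_def b_def)
  have cs: "(cos \<eta>)\<^sup>2 = (1 + cos t) / 2" "(sin \<eta>)\<^sup>2 = (1 - cos t) / 2" "sin \<eta> * cos \<eta> = sin t / 2"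
    using cos_double_cos[of \<eta>] cos_double_sin[of \<eta>] sin_double[of \<eta>] by (auto simp: \<eta>_def)
  show ?thesis
  proof (rule that)
    show "0 \<le> a" using \<rho>_le by (simp add: a_def)
    have "p + r + \<rho> \<noteq> 0"
    proof
      assume "p + r + \<rho> = 0"
      then have "p = 0" "r = 0" using pr \<rho>0 by auto
      with qq have "q = 0" by simp
      with \<open>p = 0\<close> \<open>r = 0\<close> assms(2) show False by (simp add: M M0)
    qed
    then show "0 < b" using pr \<rho>0 by (simp add: b_def)
    show "0 \<le> \<eta>" "\<eta> < pi" using t by (auto simp: \<eta>_def)
    have "(a * cos \<eta>)\<^sup>2 + (b * sin \<eta>)\<^sup>2 = (p + r - \<rho> * cos t) / 2"
      unfolding power_mult_distrib a2 b2 cs by (simp add: field_simps)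
    also have "\<dots> = p" using t(3) by (simp add: field_simps)
    finally have 1: "(a * cos \<eta>)\<^sup>2 + (b * sin \<eta>)\<^sup>2 = p" .
    have "(a * sin \<eta>)\<^sup>2 + (b * cos \<eta>)\<^sup>2 = (p + r + \<rho> * cos t) / 2"
      unfolding power_mult_distrib a2 b2 cs by (simp add: field_simps)
    also have "\<dots> = r" using t(3) by (simp add: field_simps)
    finally have 2: "(a * sin \<eta>)\<^sup>2 + (b * cos \<eta>)\<^sup>2 = r" .
    have "(a\<^sup>2 - b\<^sup>2) * (sin \<eta> * cos \<eta>) = q" unfolding a2 b2 cs using t(4) by (simp add: field_simps)
    with 1 2 show "shape a b \<eta> = M" by (simp add: shape_def M M0)
  qed
qed

definition moment_det :: "moments \<Rightarrow> real" where
  "moment_det M = (case M of (p, q, r) \<Rightarrow> p * r - q\<^sup>2)"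

lemma moment_det_shape: "moment_det (shape a b \<eta>) = (spread * a * b)\<^sup>2"
proof -
  have "((a * c)\<^sup>2 + (b * d)\<^sup>2) * ((a * d)\<^sup>2 + (b * c)\<^sup>2) - ((a\<^sup>2 - b\<^sup>2) * (d * c))\<^sup>2 = (a * b * (c\<^sup>2 + d\<^sup>2))\<^sup>2" for c d
    by (simp add: power2_eq_square algebra_simps)
  from this[of "cos \<eta>" "sin \<eta>"] have *: "((a * cos \<eta>)\<^sup>2 + (b * sin \<eta>)\<^sup>2) * ((a * sin \<eta>)\<^sup>2 + (b * cos \<eta>)\<^sup>2) - ((a\<^sup>2 - b\<^sup>2) * (sin \<eta> * cos \<eta>))\<^sup>2 = (a * b)\<^sup>2"
    by simp
  have "moment_det (shape a b \<eta>) = spread\<^sup>2 * (((a * cos \<eta>)\<^sup>2 + (b * sin \<eta>)\<^sup>2) * ((a * sin \<eta>)\<^sup>2 + (b * cos \<eta>)\<^sup>2) - ((a\<^sup>2 - b\<^sup>2) * (sin \<eta> * cos \<eta>))\<^sup>2)"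
    by (simp add: moment_det_def shape_def power2_eq_square algebra_simps)
  then show ?thesis unfolding * by (simp add: power_mult_distrib)
qed

text \<open>Compare the traces, and the traceless parts in polar form; the latter depend on \<open>\<eta>\<close> only through
  \<open>2 \<eta>\<close>.\<close>

lemma shape_eqD:
  assumes "shape a b \<eta> = shape a' b' \<eta>'"
  shows "a\<^sup>2 + b\<^sup>2 = a'\<^sup>2 + b'\<^sup>2" "(a\<^sup>2 - b\<^sup>2) * cos (2 * \<eta>) = (a'\<^sup>2 - b'\<^sup>2) * cos (2 * \<eta>')" "(a\<^sup>2 - b\<^sup>2) * sin (2 * \<eta>) = (a'\<^sup>2 - b'\<^sup>2) * sin (2 * \<eta>')"
proof -
  have e: "(a * cos \<eta>)\<^sup>2 + (b * sin \<eta>)\<^sup>2 = (a' * cos \<eta>')\<^sup>2 + (b' * sin \<eta>')\<^sup>2" "(a\<^sup>2 - b\<^sup>2) * (sin \<eta> * cos \<eta>) = (a'\<^sup>2 - b'\<^sup>2) * (sin \<eta>' * cos \<eta>')"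
     "(a * sin \<eta>)\<^sup>2 + (b * cos \<eta>)\<^sup>2 = (a' * sin \<eta>')\<^sup>2 + (b' * cos \<eta>')\<^sup>2"
    using assms spread_pos by (auto simp: shape_def)
  have p: "(x * cos t)\<^sup>2 + (y * sin t)\<^sup>2 + ((x * sin t)\<^sup>2 + (y * cos t)\<^sup>2) = x\<^sup>2 + y\<^sup>2"
    "(x * cos t)\<^sup>2 + (y * sin t)\<^sup>2 - ((x * sin t)\<^sup>2 + (y * cos t)\<^sup>2) = (x\<^sup>2 - y\<^sup>2) * cos (2 * t)" for x y t :: real
  proof -
    have "(x * cos t)\<^sup>2 + (y * sin t)\<^sup>2 + ((x * sin t)\<^sup>2 + (y * cos t)\<^sup>2) = (x\<^sup>2 + y\<^sup>2) * ((cos t)\<^sup>2 + (sin t)\<^sup>2)"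
      unfolding power_mult_distrib by (simp only: algebra_simps)
    also have "(cos t)\<^sup>2 + (sin t)\<^sup>2 = 1" by simp
    finally show "(x * cos t)\<^sup>2 + (y * sin t)\<^sup>2 + ((x * sin t)\<^sup>2 + (y * cos t)\<^sup>2) = x\<^sup>2 + y\<^sup>2" by (simp only: mult_1_right)
    show "(x * cos t)\<^sup>2 + (y * sin t)\<^sup>2 - ((x * sin t)\<^sup>2 + (y * cos t)\<^sup>2) = (x\<^sup>2 - y\<^sup>2) * cos (2 * t)"
      unfolding cos_double by (simp add: power_mult_distrib algebra_simps)
  qed
  show "a\<^sup>2 + b\<^sup>2 = a'\<^sup>2 + b'\<^sup>2" using p(1)[of a \<eta> b] p(1)[of a' \<eta>' b'] e by linarith
  show "(a\<^sup>2 - b\<^sup>2) * cos (2 * \<eta>) = (a'\<^sup>2 - b'\<^sup>2) * cos (2 * \<eta>')" using p(2)[of a \<eta> b] p(2)[of a' \<eta>' b'] e by linarith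
  show "(a\<^sup>2 - b\<^sup>2) * sin (2 * \<eta>) = (a'\<^sup>2 - b'\<^sup>2) * sin (2 * \<eta>')" unfolding sin_double using arg_cong[OF e(2), of "\<lambda>z. 2 * z"] by (simp only: mult_ac)
qed

text \<open>The eigenvalues agree up to their order. Exchanging them turns the double angle by \<open>\<pi>\<close>, which
  leaves the range \<open>[0, \<pi>)\<close> of \<open>2 \<eta>\<close>.\<close>

lemma shape_inj:
  assumes eq: "shape a b \<eta> = shape a' b' \<eta>'" and pos: "a > 0" "b > 0" "a' > 0" "b' > 0"
    and \<eta>: "0 \<le> \<eta>" "\<eta> < pi / 2" "0 \<le> \<eta>'" "\<eta>' < pi / 2" and norm: "a = b \<longrightarrow> \<eta> = 0" "a' = b' \<longrightarrow> \<eta>' = 0"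
  shows "a = a' \<and> b = b' \<and> \<eta> = \<eta>'"
proof -
  note D = shape_eqD[OF eq]
  define d d' where "d = a\<^sup>2 - b\<^sup>2" and "d' = a'\<^sup>2 - b'\<^sup>2"
  note D' = D[folded d_def d'_def]
  have "d\<^sup>2 = (d * cos (2 * \<eta>))\<^sup>2 + (d * sin (2 * \<eta>))\<^sup>2" by (simp add: power_mult_distrib distrib_left[symmetric])
  also have "\<dots> = d'\<^sup>2" unfolding D' by (simp add: power_mult_distrib distrib_left[symmetric])
  finally have "d = d' \<or> d = - d'" by (simp add: power2_eq_iff)
  moreover have "d = d'" if "d = - d'"
  proof (cases "d = 0")
    case False
    then have c: "cos (2 * \<eta>) = - cos (2 * \<eta>')" and sn: "sin (2 * \<eta>) = - sin (2 * \<eta>')"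
    proof -
      have "d' * (cos (2 * \<eta>) + cos (2 * \<eta>')) = 0" "d' * (sin (2 * \<eta>) + sin (2 * \<eta>')) = 0"
        using D'(2,3) that by (simp_all add: algebra_simps)
      with False that show "cos (2 * \<eta>) = - cos (2 * \<eta>')" "sin (2 * \<eta>) = - sin (2 * \<eta>')" by auto
    qed
    have nn: "0 \<le> sin (2 * \<eta>)" "0 \<le> sin (2 * \<eta>')" using \<eta> by (auto intro!: sin_ge_zero)
    have "\<eta> = 0" if "\<not> 0 < sin (2 * \<eta>)" using sin_gt_zero[of "2 * \<eta>"] that \<eta> by force
    moreover have "\<eta>' = 0" if "\<not> 0 < sin (2 * \<eta>')" using sin_gt_zero[of "2 * \<eta>'"] that \<eta> by force
    ultimately have "\<eta> = 0" "\<eta>' = 0" using sn nn by linarith+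
    with c show ?thesis by simp
  qed (use that in simp)
  ultimately have dd: "d = d'" by blast
  then have "a\<^sup>2 = a'\<^sup>2" "b\<^sup>2 = b'\<^sup>2" using D(1) by (auto simp: d_def d'_def)
  then have ab: "a = a'" "b = b'" using pos by (auto simp: power2_eq_iff)
  have "\<eta> = \<eta>'"
  proof (cases "d = 0")
    case True
    then have "a = b" using pos by (auto simp: d_def power2_eq_iff)
    then show ?thesis using ab norm by simp
  next
    case False
    then have "cos (2 * \<eta>) = cos (2 * \<eta>')" using D'(2) dd by simp
    then have "2 * \<eta> = 2 * \<eta>'" using \<eta> by (intro cos_inj_pi[of "2 * \<eta>" "2 * \<eta>'"]) linarith+
    then show ?thesis by simp
  qed
  with ab show ?thesis by simp
qed

lemma shape_segment_inj:
  assumes eq: "shape 0 b \<eta> = shape 0 b' \<eta>'" and pos: "b > 0" "b' > 0"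
    and \<eta>: "0 \<le> \<eta>" "\<eta> < pi" "0 \<le> \<eta>'" "\<eta>' < pi"
  shows "b = b' \<and> \<eta> = \<eta>'"
proof -
  note D = shape_eqD[OF eq]
  have b: "b = b'" using D(1) pos by (auto simp: power2_eq_iff)
  then have "cos (2 * \<eta>) = cos (2 * \<eta>')" "sin (2 * \<eta>) = sin (2 * \<eta>')" using D(2,3) pos by auto
  then obtain n :: int where n: "2 * \<eta> = 2 * \<eta>' + 2 * pi * n" using sin_cos_eq_iff by metis
  then have e: "\<eta> = \<eta>' + pi * n" by simp
  have "n = 0"
  proof (rule ccontr)
    assume "n \<noteq> 0"
    then consider "n \<ge> 1" | "n \<le> -1" by linarith
    then show False
    proof cases
      case 1
      then have "pi * 1 \<le> pi * n" by (intro mult_left_mono) auto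
      with e \<eta> show False by linarith
    next
      case 2
      then have "pi * n \<le> pi * (-1)" by (intro mult_left_mono) auto
      with e \<eta> show False by linarith
    qed
  qed
  with b e show ?thesis by simp
qed

end

section \<open>Nondegeneracy when the weight is bounded below\<close>

text \<open>Since \<open>x + \<delta> \<ge> 2 x\<close>, the shifted value is at most \<open>2\<^sup>-\<^sup>a\<close> times the value at \<open>x\<close>, and the latter
  is at least \<open>\<delta>\<^sup>-\<^sup>a\<close>.\<close>

lemma riesz_gap:
  assumes a: "a > 0" and x: "0 \<le> x" "x \<le> \<delta>" and \<delta>: "\<delta> > 0"
  shows "riesz a (x + \<delta>) + ennreal ((1 - 2 powr (- a)) * \<delta> powr (- a)) \<le> riesz a x"
proof (cases "x = 0")
  case False
  then have x0: "x > 0" using x by simp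
  have k: "0 \<le> 1 - 2 powr (- a)" using a powr_mono[of "- a" 0 2] by simp
  have "(x + \<delta>) powr (- a) \<le> (2 * x) powr (- a)" using x x0 a by (intro powr_mono2') auto
  also have "\<dots> = 2 powr (- a) * x powr (- a)" using x0 by (simp add: powr_mult)
  finally have 1: "(x + \<delta>) powr (- a) \<le> 2 powr (- a) * x powr (- a)" .
  have "\<delta> powr (- a) \<le> x powr (- a)" using x x0 a by (intro powr_mono2') auto
  then have "(1 - 2 powr (- a)) * \<delta> powr (- a) \<le> (1 - 2 powr (- a)) * x powr (- a)" using k by (rule mult_left_mono)
  with 1 have "(x + \<delta>) powr (- a) + (1 - 2 powr (- a)) * \<delta> powr (- a) \<le> x powr (- a)" by (simp add: algebra_simps)
  then show ?thesis using x0 \<delta> k by (simp add: riesz_nonzero ennreal_plus[symmetric] ennreal_leI del: ennreal_plus)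
qed simp

context slope_mixture
begin

lemma reduced_energy_zero: "reduced_energy (0, 0, 0) = \<infinity>"
  using w_mass(2) profile_energy_constant_finite(2)[OF s]
  by (simp add: reduced_energy_def quad_def nn_integral_multc ennreal_mult_top ennreal_top_divide)

text \<open>Suppose \<open>M\<close> has rank one and compare with \<open>M + \<epsilon> I\<close>. At the slopes where the quadratic form of
  \<open>M\<close> is at most that of \<open>\<epsilon> I\<close>, the weighted Riesz kernel drops by a multiple of
  \<open>\<epsilon>\<^sup>-\<^sup>a / (1 + v\<^sup>2)\<close>, where \<open>a = s / 2\<close>. These directions form an angle of order \<open>\<epsilon>\<^sup>1\<^sup>/\<^sup>2\<close> around the
  kernel of \<open>M\<close>. The gain of order \<open>\<epsilon>\<^sup>1\<^sup>/\<^sup>2\<^sup>-\<^sup>a\<close> exceeds the loss \<open>2 \<epsilon>\<close> in the trace for small \<open>\<epsilon>\<close>.\<close>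

lemma nondegenerate_of_lower_bound:
  assumes c: "c > 0" "\<And>v. c * sqrt (1 + v\<^sup>2) powr (- 2 + s) \<le> w v"
    and M: "M \<in> psd" "\<And>M'. M' \<in> psd \<Longrightarrow> reduced_energy M \<le> reduced_energy M'" and fin: "reduced_energy M < \<infinity>"
  shows "moment_det M \<noteq> 0"
proof
  assume det: "moment_det M = 0"
  obtain p q r where Mp: "M = (p, q, r)" by (cases M)
  have pr: "0 \<le> p" "0 \<le> r" and qq: "q\<^sup>2 = p * r" using M(1) det by (auto simp: Mp psd_def moment_det_def)
  have ne: "M \<noteq> (0, 0, 0)" using fin reduced_energy_zero by auto
  define a where "a = s / 2"
  have a: "a > 0" "a < 1 / 2" using s by (auto simp: a_def)
  define k where "k = enn2real (profile_energy_constant s)"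
  have k: "profile_energy_constant s = ennreal k" "k > 0"
    using profile_energy_constant_finite[OF s] by (auto simp: k_def enn2real_positive_iff)
  define g where "g = 1 - 2 powr (- a)"
  have g: "g > 0" using a powr_less_mono[of "- a" 0 2] by (simp add: g_def)
  \<comment> \<open>\<open>?D \<epsilon>\<close> is the angle taken up by the slopes in \<open>?V \<epsilon>\<close>, since \<open>dv / (1 + v\<^sup>2)\<close> is the angular
    measure.\<close>
  let ?V = "\<lambda>\<epsilon>. {v. quad v M \<le> \<epsilon> * (1 + v\<^sup>2)}"
  let ?D = "\<lambda>\<epsilon>. \<integral>\<^sup>+v. ennreal (1 / (1 + v\<^sup>2)) * indicator (?V \<epsilon>) v \<partial>lborel"
  have v1: "1 + v\<^sup>2 > 0" for v :: real by (simp add: add_pos_nonneg)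
  have upper: "ennreal (k * c * g * \<epsilon> powr (- a)) * ?D \<epsilon> \<le> ennreal (4 * \<epsilon>)" if \<epsilon>: "\<epsilon> > 0" for \<epsilon>
  proof -
    define N :: moments where "N = (p + \<epsilon>, q, r + \<epsilon>)"
    have N: "N \<in> psd" using pr qq \<epsilon> by (simp add: N_def psd_def algebra_simps)
    have qN: "quad v N = quad v M + \<epsilon> * (1 + v\<^sup>2)" for v by (simp add: N_def Mp quad_def algebra_simps)
    have trN: "trace N = trace M + 2 * \<epsilon>" by (simp add: N_def Mp trace_def)
    have tr: "trace M \<ge> 0" using pr by (simp add: Mp trace_def)
    let ?h = "\<lambda>M v. ennreal (w v) * (profile_energy_constant s * riesz a (quad v M))"
    have "?h N v + ennreal (k * c * g * \<epsilon> powr (- a)) * (ennreal (1 / (1 + v\<^sup>2)) * indicator (?V \<epsilon>) v) \<le> ?h M v" for v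
    proof -
      have "?h N v \<le> ?h M v" unfolding qN
        using a psd_quad_nonneg[OF M(1), of v] \<epsilon> v1[of v] by (intro mult_left_mono riesz_antimono) auto
      moreover have "?h N v + ennreal (k * c * g * \<epsilon> powr (- a)) * ennreal (1 / (1 + v\<^sup>2)) \<le> ?h M v" if v: "v \<in> ?V \<epsilon>"
      proof -
        define \<delta> where "\<delta> = \<epsilon> * (1 + v\<^sup>2)"
        have \<delta>: "\<delta> > 0" using \<epsilon> v1[of v] by (simp add: \<delta>_def)
        have sq: "sqrt (1 + v\<^sup>2) > 0" using v1[of v] by simp
        have "(1 + v\<^sup>2) powr (- a) = sqrt (1 + v\<^sup>2) powr (- s)"
          using power2_powr_half[OF sq, of "- s"] v1[of v] by (simp add: a_def)
        then have d: "\<delta> powr (- a) = \<epsilon> powr (- a) * sqrt (1 + v\<^sup>2) powr (- s)"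
          unfolding \<delta>_def using \<epsilon> v1[of v] by (simp add: powr_mult)
        have e: "sqrt (1 + v\<^sup>2) powr (- 2 + s) * sqrt (1 + v\<^sup>2) powr (- s) = 1 / (1 + v\<^sup>2)"
        proof -
          have "h powr (- 2 + s) * h powr (- s) = 1 / h\<^sup>2" if "h > 0" for h
            unfolding powr_add[symmetric] using that by (simp add: powr_minus_divide)
          from this[OF sq] show ?thesis using v1[of v] by (simp only: real_sqrt_pow2 less_imp_le)
        qed
        have "k * c * g * \<epsilon> powr (- a) * (1 / (1 + v\<^sup>2)) = (c * sqrt (1 + v\<^sup>2) powr (- 2 + s)) * (k * (g * \<delta> powr (- a)))"
          unfolding d e[symmetric] by (simp add: mult_ac)
        also have "\<dots> \<le> w v * (k * (g * \<delta> powr (- a)))"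
          using c(2)[of v] k g by (intro mult_right_mono) auto
        finally have "ennreal (k * c * g * \<epsilon> powr (- a)) * ennreal (1 / (1 + v\<^sup>2)) \<le> ennreal (w v) * (ennreal k * ennreal (g * \<delta> powr (- a)))"
          using k c g \<epsilon> w_nonneg[of v] by (simp add: ennreal_mult'[symmetric] ennreal_leI)
        then have "?h N v + ennreal (k * c * g * \<epsilon> powr (- a)) * ennreal (1 / (1 + v\<^sup>2))
          \<le> ennreal (w v) * (ennreal k * riesz a (quad v M + \<delta>)) + ennreal (w v) * (ennreal k * ennreal (g * \<delta> powr (- a)))"
          unfolding qN \<delta>_def[symmetric] k(1) by (rule add_left_mono)
        also have "\<dots> = ennreal (w v) * (ennreal k * (riesz a (quad v M + \<delta>) + ennreal (g * \<delta> powr (- a))))"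
          by (simp add: distrib_left)
        also have "\<dots> \<le> ?h M v"
          unfolding k(1) g_def using v a \<delta> psd_quad_nonneg[OF M(1), of v]
          by (intro mult_left_mono riesz_gap) (auto simp: \<delta>_def)
        finally show ?thesis .
      qed
      ultimately show ?thesis by (cases "v \<in> ?V \<epsilon>") auto
    qed
    then have "(\<integral>\<^sup>+v. ?h N v + ennreal (k * c * g * \<epsilon> powr (- a)) * (ennreal (1 / (1 + v\<^sup>2)) * indicator (?V \<epsilon>) v) \<partial>lborel) \<le> (\<integral>\<^sup>+v. ?h M v \<partial>lborel)"
      by (intro nn_integral_mono)
    also have "(\<integral>\<^sup>+v. ?h N v + ennreal (k * c * g * \<epsilon> powr (- a)) * (ennreal (1 / (1 + v\<^sup>2)) * indicator (?V \<epsilon>) v) \<partial>lborel)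
      = (\<integral>\<^sup>+v. ?h N v \<partial>lborel) + ennreal (k * c * g * \<epsilon> powr (- a)) * ?D \<epsilon>"
      by (simp add: nn_integral_add nn_integral_cmult)
    finally have le: "(\<integral>\<^sup>+v. ?h N v \<partial>lborel) + ennreal (k * c * g * \<epsilon> powr (- a)) * ?D \<epsilon> \<le> (\<integral>\<^sup>+v. ?h M v \<partial>lborel)" .
    have "reduced_energy M \<le> reduced_energy N" by (rule M(2)[OF N])
    then have le2: "(\<integral>\<^sup>+v. ?h M v \<partial>lborel) / 2 + ennreal (trace M) \<le> (\<integral>\<^sup>+v. ?h N v \<partial>lborel) / 2 + ennreal (trace M + 2 * \<epsilon>)"
      unfolding reduced_energy_def trN a_def .
    have "(\<integral>\<^sup>+v. ?h M v \<partial>lborel) < \<infinity>"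
      using fin unfolding reduced_energy_def a_def[symmetric] by (cases "\<integral>\<^sup>+v. ?h M v \<partial>lborel") (auto simp: ennreal_top_divide)
    then obtain i where i: "(\<integral>\<^sup>+v. ?h M v \<partial>lborel) = ennreal i" "i \<ge> 0" by (cases "\<integral>\<^sup>+v. ?h M v \<partial>lborel") auto
    obtain n where n: "(\<integral>\<^sup>+v. ?h N v \<partial>lborel) = ennreal n" "n \<ge> 0"
      using le unfolding i by (cases "\<integral>\<^sup>+v. ?h N v \<partial>lborel") (auto simp: top_unique)
    obtain e where e: "ennreal (k * c * g * \<epsilon> powr (- a)) * ?D \<epsilon> = ennreal e" "e \<ge> 0"
      using le unfolding i by (cases "ennreal (k * c * g * \<epsilon> powr (- a)) * ?D \<epsilon>") (auto simp: top_unique)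
    have "n + e \<le> i" using le i n e by (simp add: ennreal_plus[symmetric] del: ennreal_plus)
    moreover have "i / 2 + trace M \<le> n / 2 + (trace M + 2 * \<epsilon>)"
      using le2 unfolding i n using i n tr \<epsilon> by (simp add: ennreal_divide_numeral ennreal_plus[symmetric] del: ennreal_plus)
    ultimately have "e \<le> 4 * \<epsilon>" by simp
    then show ?thesis unfolding e by (rule ennreal_leI)
  qed
  have lower: "\<exists>K>0. \<forall>\<epsilon>. 0 < \<epsilon> \<longrightarrow> \<epsilon> \<le> 1 \<longrightarrow> ennreal (K * sqrt \<epsilon>) \<le> ?D \<epsilon>"
  proof -
    have I: "ennreal (m * (y - x)) \<le> ?D \<epsilon>" if "x \<le> y" "m \<ge> 0" "\<And>v. v \<in> {x..y} \<Longrightarrow> quad v M \<le> \<epsilon> * (1 + v\<^sup>2) \<and> m \<le> 1 / (1 + v\<^sup>2)" for x y m \<epsilon>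
    proof -
      have "ennreal (m * (y - x)) = (\<integral>\<^sup>+v. ennreal m * indicator {x..y} v \<partial>lborel)"
        using that by (simp add: nn_integral_cmult_indicator ennreal_mult)
      also have "\<dots> \<le> ?D \<epsilon>" by (intro nn_integral_mono) (use that(3) in \<open>auto simp: indicator_def intro!: ennreal_leI\<close>)
      finally show ?thesis .
    qed
    show ?thesis
    proof (cases "r = 0")
      case True
      \<comment> \<open>The degenerate direction is vertical, that is, at infinite slope; the slopes between
        \<open>n\<close> and \<open>2 n\<close> with \<open>n\<^sup>2 = p / \<epsilon>\<close> are close enough to it.\<close>
      then have "q = 0" using qq by simp
      with True have qv: "quad v M = p" for v by (simp add: Mp quad_def)
      have p: "p > 0" using pr ne True \<open>q = 0\<close> Mp by (auto simp: less_le)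
      show ?thesis
      proof (intro exI[of _ "sqrt p / (1 + 4 * p)"] conjI allI impI)
        show "sqrt p / (1 + 4 * p) > 0" using p by simp
        fix \<epsilon> :: real assume \<epsilon>: "0 < \<epsilon>" "\<epsilon> \<le> 1"
        define n where "n = sqrt p / sqrt \<epsilon>"
        have n: "n > 0" "n\<^sup>2 = p / \<epsilon>" using p \<epsilon> by (auto simp: n_def power_divide)
        have x1: "1 / (1 + 4 * n\<^sup>2) * (2 * n - n) = sqrt p * sqrt \<epsilon> / (\<epsilon> + 4 * p)"
        proof -
          have "1 + 4 * n\<^sup>2 = (\<epsilon> + 4 * p) / \<epsilon>" unfolding n using \<epsilon> by (simp add: field_simps)
          moreover have "n = sqrt p * sqrt \<epsilon> / \<epsilon>" unfolding n_def using \<epsilon> by (simp add: field_simps real_div_sqrt)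
          ultimately show ?thesis using \<epsilon> by simp
        qed
        have x2: "sqrt p / (1 + 4 * p) * sqrt \<epsilon> \<le> sqrt p * sqrt \<epsilon> / (\<epsilon> + 4 * p)"
          using p \<epsilon> by (simp add: frac_le)
        have x3: "ennreal (1 / (1 + 4 * n\<^sup>2) * (2 * n - n)) \<le> ?D \<epsilon>"
        proof (rule I)
          fix v assume v: "v \<in> {n..2 * n}"
          have "n\<^sup>2 \<le> v\<^sup>2" by (intro power_mono) (use v n(1) in auto)
          have "v\<^sup>2 \<le> (2 * n)\<^sup>2" by (intro power_mono) (use v n(1) in auto)
          have "p \<le> \<epsilon> * v\<^sup>2" using \<open>n\<^sup>2 \<le> v\<^sup>2\<close> unfolding n(2) using \<epsilon> by (simp add: field_simps)
          moreover have "1 / (1 + 4 * n\<^sup>2) \<le> 1 / (1 + v\<^sup>2)" using \<open>v\<^sup>2 \<le> (2 * n)\<^sup>2\<close> v1[of v] by (intro divide_left_mono) (auto simp: power_mult_distrib intro!: mult_pos_pos add_pos_nonneg)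
          ultimately show "quad v M \<le> \<epsilon> * (1 + v\<^sup>2) \<and> 1 / (1 + 4 * n\<^sup>2) \<le> 1 / (1 + v\<^sup>2)"
            unfolding qv using \<epsilon> by (simp add: algebra_simps)
        qed (use n p \<epsilon> in auto)
        show "ennreal (sqrt p / (1 + 4 * p) * sqrt \<epsilon>) \<le> ?D \<epsilon>"
          by (rule order_trans[OF ennreal_leI[OF x2] x3[unfolded x1]])
      qed
    next
      case False
      then have r: "r > 0" using pr by simp
      \<comment> \<open>The degenerate direction has slope \<open>v0\<close>.\<close>
      define v0 where "v0 = - q / r"
      have qv: "quad v M = r * (v - v0)\<^sup>2" for v
      proof -
        have "r * (v - v0)\<^sup>2 = r * v\<^sup>2 + 2 * q * v + q\<^sup>2 / r" using r by (simp add: v0_def power2_eq_square field_simps)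
        also have "q\<^sup>2 / r = p" unfolding qq using r by simp
        finally show ?thesis by (simp add: Mp quad_def)
      qed
      define B where "B = \<bar>v0\<bar> + 1 / sqrt r"
      show ?thesis
      proof (intro exI[of _ "2 / sqrt r / (1 + B\<^sup>2)"] conjI allI impI)
        show "2 / sqrt r / (1 + B\<^sup>2) > 0" using r v1[of B] by simp
        fix \<epsilon> :: real assume \<epsilon>: "0 < \<epsilon>" "\<epsilon> \<le> 1"
        define d where "d = sqrt \<epsilon> / sqrt r"
        have d: "d > 0" "r * d\<^sup>2 = \<epsilon>" "d \<le> 1 / sqrt r" using r \<epsilon> by (auto simp: d_def power_divide divide_right_mono)
        have "ennreal (1 / (1 + B\<^sup>2) * ((v0 + d) - (v0 - d))) \<le> ?D \<epsilon>"
        proof (rule I)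
          fix v assume "v \<in> {v0 - d..v0 + d}"
          then have vd: "\<bar>v - v0\<bar> \<le> d" by auto
          then have "\<bar>v\<bar> \<le> B" using d(3) unfolding B_def by linarith
          then have "\<bar>v\<bar>\<^sup>2 \<le> B\<^sup>2" by (intro power_mono) auto
          then have "1 / (1 + B\<^sup>2) \<le> 1 / (1 + v\<^sup>2)" using v1[of v] v1[of B] by (intro divide_left_mono) auto
          moreover have "r * (v - v0)\<^sup>2 \<le> r * d\<^sup>2"
            using vd r power_mono[OF vd, of 2] by (intro mult_left_mono) auto
          ultimately show "quad v M \<le> \<epsilon> * (1 + v\<^sup>2) \<and> 1 / (1 + B\<^sup>2) \<le> 1 / (1 + v\<^sup>2)"
            unfolding qv d(2) distrib_left using \<epsilon> mult_nonneg_nonneg[of \<epsilon> "v\<^sup>2"] by (auto intro: order_trans)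
        qed (use d v1[of B] in auto)
        then show "ennreal (2 / sqrt r / (1 + B\<^sup>2) * sqrt \<epsilon>) \<le> ?D \<epsilon>" by (simp add: d_def mult_ac)
      qed
    qed
  qed
  then obtain K where K: "K > 0" "\<And>\<epsilon>. 0 < \<epsilon> \<Longrightarrow> \<epsilon> \<le> 1 \<Longrightarrow> ennreal (K * sqrt \<epsilon>) \<le> ?D \<epsilon>" by blast
  define C where "C = k * c * g * K"
  have C: "C > 0" using k c g K by (simp add: C_def)
  \<comment> \<open>Chosen such that \<open>\<epsilon>\<^sup>1\<^sup>/\<^sup>2\<^sup>+\<^sup>a \<le> C / 8\<close>, hence \<open>4 \<epsilon> < C \<epsilon>\<^sup>1\<^sup>/\<^sup>2\<^sup>-\<^sup>a\<close>.\<close>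
  define \<epsilon> where "\<epsilon> = min 1 ((C / 8) powr (1 / (1 / 2 + a)))"
  have \<epsilon>: "0 < \<epsilon>" "\<epsilon> \<le> 1" using C by (auto simp: \<epsilon>_def)
  have "ennreal (k * c * g * \<epsilon> powr (- a)) * ennreal (K * sqrt \<epsilon>) \<le> ennreal (4 * \<epsilon>)"
    by (rule order_trans[OF mult_left_mono[OF K(2)[OF \<epsilon>]] upper[OF \<epsilon>(1)]]) simp
  then have le: "C * (\<epsilon> powr (- a) * sqrt \<epsilon>) \<le> 4 * \<epsilon>"
    using k c g K \<epsilon> by (simp add: ennreal_mult'[symmetric] C_def mult_ac)
  define y z where "y = \<epsilon> powr (- a) * sqrt \<epsilon>" and "z = \<epsilon> powr (1 / 2 + a)"
  have y: "y > 0" using \<epsilon> by (simp add: y_def)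
  have eyz: "\<epsilon> = y * z"
    unfolding y_def z_def using \<epsilon> by (simp add: powr_half_sqrt[symmetric] powr_add[symmetric])
  have "z \<le> C / 8"
  proof -
    have "z \<le> ((C / 8) powr (1 / (1 / 2 + a))) powr (1 / 2 + a)"
      unfolding z_def using \<epsilon> a by (intro powr_mono2) (auto simp: \<epsilon>_def)
    also have "\<dots> = C / 8" using C a by (simp add: powr_powr)
    finally show ?thesis .
  qed
  then have "y * z \<le> y * (C / 8)" using y by (intro mult_left_mono) auto
  moreover have "C * y \<le> 4 * (y * z)" using le unfolding y_def[symmetric] eyz[symmetric] .
  moreover have "C * y > 0" using C y by simp
  moreover have "y * (C / 8) = C * y / 8" by simp
  ultimately show False by linarith
qed

end

section \<open>Compactly supported measures are determined by their projections\<close>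

text \<open>Moments determine the integrals of these functions because integration is linear; the sums and
  products that generate \<open>real_polynomial_function\<close> do not show this directly.\<close>

inductive plane_monomial_span :: "(real^2 \<Rightarrow> real) \<Rightarrow> bool" where
  monomial: "plane_monomial_span (\<lambda>x. x $ 1 ^ i * x $ 2 ^ j)"
| sum: "plane_monomial_span f \<Longrightarrow> plane_monomial_span g \<Longrightarrow> plane_monomial_span (\<lambda>x. f x + g x)"
| scale: "plane_monomial_span f \<Longrightarrow> plane_monomial_span (\<lambda>x. c * f x)"

lemma plane_monomial_span_mult:
  assumes "plane_monomial_span f" "plane_monomial_span g"
  shows "plane_monomial_span (\<lambda>x. f x * g x)"
  using assms
proof (induction f)
  case (monomial i j)
  from \<open>plane_monomial_span g\<close> show ?case
  proof (induction g)
    case (monomial k l)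
    have "(\<lambda>x::real^2. x $ 1 ^ i * x $ 2 ^ j * (x $ 1 ^ k * x $ 2 ^ l)) = (\<lambda>x. x $ 1 ^ (i + k) * x $ 2 ^ (j + l))"
      by (simp add: power_add mult_ac)
    then show ?case by (simp only: plane_monomial_span.monomial)
  next
    case (sum f g)
    then show ?case by (simp only: distrib_left plane_monomial_span.sum)
  next
    case (scale f c)
    then have "plane_monomial_span (\<lambda>x. c * (x $ 1 ^ i * x $ 2 ^ j * f x))" by (intro plane_monomial_span.scale) auto
    then show ?case by (simp add: mult_ac)
  qed
next
  case (sum f g)
  then show ?case by (simp only: distrib_right plane_monomial_span.sum)
next
  case (scale f c)
  then have "plane_monomial_span (\<lambda>x. c * (f x * g x))" by (intro plane_monomial_span.scale) auto
  then show ?case by (simp add: mult_ac)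
qed

lemma real_polynomial_function_monomial_span:
  fixes f :: "real^2 \<Rightarrow> real"
  assumes "real_polynomial_function f" shows "plane_monomial_span f"
  using assms
proof (induction f)
  case (linear f)
  interpret bounded_linear f by fact
  have "f x = f (axis 1 1) * (x $ 1 ^ 1 * x $ 2 ^ 0) + f (axis 2 1) * (x $ 1 ^ 0 * x $ 2 ^ 1)" for x
  proof -
    have "x = x $ 1 *\<^sub>R axis 1 1 + x $ 2 *\<^sub>R axis 2 1" using vector2_eq_axes[of "x $ 1" "x $ 2"] by simp
    then have "f x = f (x $ 1 *\<^sub>R axis 1 1 + x $ 2 *\<^sub>R axis 2 1)" by simp
    then show ?thesis by (simp add: add scaleR mult.commute)
  qed
  then have "f = (\<lambda>x. f (axis 1 1) * (x $ 1 ^ 1 * x $ 2 ^ 0) + f (axis 2 1) * (x $ 1 ^ 0 * x $ 2 ^ 1))" by blast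
  moreover have "plane_monomial_span \<dots>" by (intro plane_monomial_span.intros)
  ultimately show ?case by (simp only:)
next
  case (const c)
  have "plane_monomial_span (\<lambda>x. c * (x $ 1 ^ 0 * x $ 2 ^ 0))" by (intro plane_monomial_span.intros)
  then show ?case by simp
next
  case (add f g) then show ?case by (intro plane_monomial_span.sum)
next
  case (mult f g) then show ?case by (intro plane_monomial_span_mult)
qed

text \<open>The \<open>n\<close>-th moment of the projection along \<open>v\<close> is a polynomial in \<open>v\<close> whose coefficients are the
  mixed moments of order \<open>n\<close> up to binomial factors. Agreement for infinitely many \<open>v\<close> therefore
  gives agreement of all mixed moments, and polynomials are uniformly dense on the ball that
  carries both measures.\<close>

lemma measure_eq_of_projections:
  fixes \<mu> \<nu> :: "(real^2) measure"
  assumes \<mu>: "prob_space \<mu>" "sets \<mu> = sets borel" "AE x in \<mu>. norm x \<le> K"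
    and \<nu>: "prob_space \<nu>" "sets \<nu> = sets borel" "AE x in \<nu>. norm x \<le> K"
    and proj: "infinite {v. distr \<mu> borel (slope v) = distr \<nu> borel (slope v)}"
  shows "\<mu> = \<nu>"
proof -
  interpret M: prob_space \<mu> by fact
  interpret N: prob_space \<nu> by fact
  have [measurable_cong]: "sets \<mu> = sets borel" "sets \<nu> = sets borel" by fact+
  note int = AE_bounded_integrable[OF \<mu>] AE_bounded_integrable[OF \<nu>]
  define m where "m nn i j = (LINT x|nn. x $ 1 ^ i * x $ 2 ^ j)" for nn :: "(real^2) measure" and i j :: nat
  have cont_mono: "continuous_on UNIV (\<lambda>x::real^2. x $ 1 ^ i * x $ 2 ^ j)" for i j :: nat by (intro continuous_intros)
  have moments: "m \<mu> i j = m \<nu> i j" for i j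
  proof -
    define n where "n = i + j"
    \<comment> \<open>The polynomial in \<open>v\<close> whose values are the differences of the \<open>n\<close>-th moments of the two
      projections.\<close>
    define P where "P = (\<Sum>k\<le>n. monom (real (n choose k) * (m \<mu> (n - k) k - m \<nu> (n - k) k)) k)"
    have expand: "(LINT x|nn. (slope v x) ^ n) = (\<Sum>k\<le>n. real (n choose k) * m nn (n - k) k * v ^ k)"
      if "\<And>i j. integrable nn (\<lambda>x::real^2. x $ 1 ^ i * x $ 2 ^ j)" for nn v
    proof -
      have "(slope v x) ^ n = (\<Sum>k\<le>n. real (n choose k) * v ^ k * (x $ 1 ^ (n - k) * x $ 2 ^ k))" for x
      proof -
        have "(slope v x) ^ n = (v * x $ 2 + x $ 1) ^ n" by (simp add: slope_def add.commute)
        then show ?thesis by (simp add: binomial_ring power_mult_distrib mult_ac)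
      qed
      then have "(LINT x|nn. (slope v x) ^ n) = (LINT x|nn. (\<Sum>k\<le>n. real (n choose k) * v ^ k * (x $ 1 ^ (n - k) * x $ 2 ^ k)))" by simp
      also have "\<dots> = (\<Sum>k\<le>n. LINT x|nn. real (n choose k) * v ^ k * (x $ 1 ^ (n - k) * x $ 2 ^ k))"
        by (intro Bochner_Integration.integral_sum integrable_mult_right that)
      also have "\<dots> = (\<Sum>k\<le>n. real (n choose k) * m nn (n - k) k * v ^ k)" by (simp add: m_def mult_ac)
      finally show ?thesis .
    qed
    have "poly P v = 0" if v: "distr \<mu> borel (slope v) = distr \<nu> borel (slope v)" for v
    proof -
      have "(LINT x|\<mu>. (slope v x) ^ n) = (LINT x|distr \<mu> borel (slope v). x ^ n)" by (subst integral_distr) auto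
      also have "\<dots> = (LINT x|\<nu>. (slope v x) ^ n)" unfolding v by (subst integral_distr) auto
      finally show ?thesis
        unfolding expand[OF int(1)[OF cont_mono]] expand[OF int(2)[OF cont_mono]]
        by (simp add: P_def poly_sum poly_monom sum_subtractf algebra_simps)
    qed
    then have "{v. distr \<mu> borel (slope v) = distr \<nu> borel (slope v)} \<subseteq> {v. poly P v = 0}" by blast
    with proj have "infinite {v. poly P v = 0}" using finite_subset by blast
    then have "P = 0" using poly_roots_finite by blast
    then have "coeff P j = 0" by simp
    moreover have "coeff P j = real (n choose j) * (m \<mu> (n - j) j - m \<nu> (n - j) j)"
      unfolding P_def coeff_sum by (simp add: n_def if_distrib cong: if_cong)
    ultimately show ?thesis by (simp add: n_def)
  qed
  have poly_eq: "(LINT x|\<mu>. f x) = (LINT x|\<nu>. f x) \<and> continuous_on UNIV f" if "plane_monomial_span f" for f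
    using that
  proof induction
    case (monomial i j)
    then show ?case using moments[of i j] cont_mono[of i j] by (simp add: m_def)
  next
    case (sum f g)
    then have "integrable \<mu> f" "integrable \<nu> f" "integrable \<mu> g" "integrable \<nu> g" using int by blast+
    with sum show ?case by (auto intro: continuous_intros)
  next
    case (scale f c)
    then show ?case by (auto intro: continuous_intros)
  qed
  show ?thesis
  proof (rule measure_eqI_continuous[OF \<mu>(1,2) \<nu>(1,2)])
    fix f :: "real^2 \<Rightarrow> real" assume f: "continuous_on UNIV f" "bounded (range f)"
    have "\<bar>(LINT x|\<mu>. f x) - (LINT x|\<nu>. f x)\<bar> \<le> e" if "e > 0" for e
    proof -
      have "e / 2 > 0" using that by simp
      from Stone_Weierstrass_real_polynomial_function[OF compact_cball[of 0 K] continuous_on_subset[OF f(1) subset_UNIV] this]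
      obtain g where g: "real_polynomial_function g" "\<And>x. x \<in> cball 0 K \<Longrightarrow> \<bar>f x - g x\<bar> < e / 2" by blast
      have pg: "(LINT x|\<mu>. g x) = (LINT x|\<nu>. g x)" and cg: "continuous_on UNIV g"
        using poly_eq[OF real_polynomial_function_monomial_span[OF g(1)]] by auto
      have *: "\<bar>(LINT x|nn. f x) - (LINT x|nn. g x)\<bar> \<le> e / 2"
        if l: "prob_space nn" "sets nn = sets borel" "AE x in nn. norm x \<le> K" for nn
      proof -
        interpret L: prob_space nn by fact
        note i = AE_bounded_integrable[OF l f(1)] AE_bounded_integrable[OF l cg]
        have "(LINT x|nn. f x) - (LINT x|nn. g x) = (LINT x|nn. f x - g x)" using i by simp
        also have "\<bar>\<dots>\<bar> \<le> (LINT x|nn. \<bar>f x - g x\<bar>)" by (rule integral_abs_bound)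
        also have "\<dots> \<le> (LINT x|nn. e / 2)"
        proof (rule integral_mono_AE)
          show "AE x in nn. \<bar>f x - g x\<bar> \<le> e / 2" using l(3) by eventually_elim (use g(2) in \<open>auto intro: less_imp_le\<close>)
        qed (use i in auto)
        finally show ?thesis by (simp add: L.prob_space)
      qed
      show ?thesis using *[OF \<mu>] *[OF \<nu>] pg by linarith
    qed
    then have "\<bar>(LINT x|\<mu>. f x) - (LINT x|\<nu>. f x)\<bar> \<le> 0" by (rule field_le_epsilon) simp
    then show "(LINT x|\<mu>. f x) = (LINT x|\<nu>. f x)" by simp
  qed
qed

context slope_mixture
begin

section \<open>The minimizers\<close>

lemma center_measure:
  assumes \<nu>: "prob_space \<nu>" "sets \<nu> = sets borel" and fin: "E \<nu> < \<infinity>"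
  obtains c where "centered (distr \<nu> borel (\<lambda>x. x - c))" "E (distr \<nu> borel (\<lambda>x. x - c)) = E \<nu>"
    "\<nu> = distr (distr \<nu> borel (\<lambda>x. x - c)) borel (\<lambda>x. x + c)"
proof -
  interpret prob_space \<nu> by fact
  have [measurable_cong]: "sets \<nu> = sets borel" by fact
  define c :: "real^2" where "c = vector [LINT x|\<nu>. x $ 1, LINT x|\<nu>. x $ 2]"
  note sm = finite_energy_imp_second_moment[OF \<nu> fin]
  note i1 = second_moment_integrable(1)[OF \<nu> sm]
  have eq: "(norm (x - c))\<^sup>2 = (norm x)\<^sup>2 - 2 * (c $ 1 * x $ 1 + c $ 2 * x $ 2) + (norm c)\<^sup>2" for x :: "real^2"
    unfolding norm_2_square by (simp add: power2_eq_square algebra_simps)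
  have "integrable \<nu> (\<lambda>x. (norm (x - c))\<^sup>2)" unfolding eq using i1 sm by simp
  moreover have "(LINT x|\<nu>. (x - c) $ i) = 0" for i
    using exhaust_2[of i] i1 by (auto simp: c_def prob_space)
  ultimately have "centered (distr \<nu> borel (\<lambda>x. x - c))"
    unfolding centered_def by (auto intro!: prob_space_distr simp: integrable_distr_eq integral_distr)
  moreover have "E (distr \<nu> borel (\<lambda>x. x - c)) = E \<nu>" using energy_translate[OF \<nu>, of "- c"] by simp
  moreover have "\<nu> = distr (distr \<nu> borel (\<lambda>x. x - c)) borel (\<lambda>x. x + c)"
    using distr_id2[of borel \<nu>] \<nu>(2) by (simp add: distr_distr comp_def)
  ultimately show ?thesis by (rule that)
qed

text \<open>The reduced energy of \<open>M\<close> is a lower bound for all energies, after centring, and ellipse laws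
  attain it exactly if their second moments are \<open>M\<close>. A further minimizer, once centred, also has
  second moments \<open>M\<close>, so it has the same projections as the ellipse law for infinitely many
  slopes.\<close>

theorem unique_minimizer_iff_shape:
  assumes M: "M \<in> psd" "\<And>M'. M' \<in> psd \<Longrightarrow> reduced_energy M \<le> reduced_energy M'" and fin: "reduced_energy M < \<infinity>"
    and ex: "shape a0 b0 \<eta>0 = M"
  shows "unique_minimizer E (ellipse_law s a b \<eta>) \<longleftrightarrow> shape a b \<eta> = M"
proof
  have law: "ellipse_law s a b \<eta> \<in> prob_measures" for a b \<eta>
    using prob_space_ellipse_law[OF s] by (simp add: prob_measures_def)
  have lower: "reduced_energy M \<le> E \<nu>" if "\<nu> \<in> prob_measures" for \<nu>
  proof (cases "E \<nu> < \<infinity>")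
    case True
    with that obtain c where c: "centered (distr \<nu> borel (\<lambda>x. x - c))" "E (distr \<nu> borel (\<lambda>x. x - c)) = E \<nu>"
      using center_measure[of \<nu>] unfolding prob_measures_def by blast
    have "reduced_energy M \<le> reduced_energy (second_moments (distr \<nu> borel (\<lambda>x. x - c)))"
      by (rule M(2)[OF psd_second_moments[OF c(1)]])
    also have "\<dots> \<le> E \<nu>" using reduced_energy_le(1)[OF c(1)] c(2) by simp
    finally show ?thesis .
  qed (simp add: not_less top_unique)
  {
    assume "unique_minimizer E (ellipse_law s a b \<eta>)"
    then have "E (ellipse_law s a b \<eta>) \<le> E (ellipse_law s a0 b0 \<eta>0)"
      using law unfolding unique_minimizer_def minimizer_def by blast
    then have le: "reduced_energy (shape a b \<eta>) \<le> reduced_energy M" unfolding energy_ellipse_law ex .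
    have psd: "shape a b \<eta> \<in> psd"
      using psd_second_moments[OF centered_ellipse_law, of a b \<eta>] unfolding second_moments_ellipse_law .
    show "shape a b \<eta> = M"
      by (rule reduced_minimizer_unique[OF M fin psd]) (use le M(2)[OF psd] in auto)
  }
  assume sh: "shape a b \<eta> = M"
  let ?\<mu> = "ellipse_law s a b \<eta>"
  have E\<mu>: "E ?\<mu> = reduced_energy M" unfolding energy_ellipse_law sh ..
  show "unique_minimizer E ?\<mu>"
    unfolding unique_minimizer_def minimizer_def
  proof (intro conjI ballI allI impI)
    show "?\<mu> \<in> prob_measures" by (rule law)
    show "E ?\<mu> \<le> E \<nu>" if "\<nu> \<in> prob_measures" for \<nu> unfolding E\<mu> by (rule lower[OF that])
    fix \<nu> assume min: "\<nu> \<in> prob_measures \<and> (\<forall>\<nu>'\<in>prob_measures. E \<nu> \<le> E \<nu>')"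
    then have \<nu>: "prob_space \<nu>" "sets \<nu> = sets borel" by (auto simp: prob_measures_def)
    have E\<nu>: "E \<nu> = reduced_energy M" using min law lower[of \<nu>] E\<mu> by (metis antisym)
    obtain c where c: "centered (distr \<nu> borel (\<lambda>x. x - c))" "E (distr \<nu> borel (\<lambda>x. x - c)) = E \<nu>"
      "\<nu> = distr (distr \<nu> borel (\<lambda>x. x - c)) borel (\<lambda>x. x + c)"
      using center_measure[OF \<nu>] fin E\<nu> by metis
    define \<nu>' where "\<nu>' = distr \<nu> borel (\<lambda>x. x - c)"
    note c' = c[folded \<nu>'_def]
    have pr: "prob_space \<nu>'" "sets \<nu>' = sets borel" using c'(1) by (auto simp: centered_def)
    have [measurable_cong]: "sets \<nu>' = sets borel" by fact
    have psd: "second_moments \<nu>' \<in> psd" by (rule psd_second_moments[OF c'(1)])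
    have "reduced_energy (second_moments \<nu>') = reduced_energy M"
      using reduced_energy_le(1)[OF c'(1)] M(2)[OF psd] c'(2) E\<nu> by simp
    from reduced_minimizer_unique[OF M fin psd this] have sm: "second_moments \<nu>' = M" .
    have "AE v in lborel. w v > 0 \<longrightarrow> quad v M > 0 \<and> distr \<nu>' borel (slope v) = profile_law s (sqrt (quad v M / profile_variance s))"
      using reduced_energy_le(2)[OF c'(1)] c'(2) E\<nu> fin unfolding sm by simp
    from infinite_support[OF this]
    have inf: "infinite {v. distr \<nu>' borel (slope v) = profile_law s (sqrt (quad v M / profile_variance s))}" (is "infinite ?V")
      by (rule contrapos_nn) (auto elim: finite_subset[rotated])
    have proj: "distr ?\<mu> borel (slope v) = profile_law s (sqrt (quad v M / profile_variance s))" for v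
    proof -
      have "quad v M / profile_variance s = (R2 s)\<^sup>2 * ellipse_width2 a b \<eta> v"
        unfolding sh[symmetric] quad_shape spread_def using profile_variance_pos[OF s(1)] by simp
      then show ?thesis unfolding ellipse_law_projection[OF s] using constants_pos(1)[OF s] by (simp add: real_sqrt_mult)
    qed
    have bound: "AE x in \<nu>'. \<bar>slope v x\<bar> \<le> sqrt (quad v M / profile_variance s)" if "v \<in> ?V" for v
    proof -
      have ve: "distr \<nu>' borel (slope v) = profile_law s (sqrt (quad v M / profile_variance s))" using that by simp
      have "AE t in distr \<nu>' borel (slope v). \<bar>t\<bar> \<le> sqrt (quad v M / profile_variance s)"
        unfolding ve using psd_quad_nonneg[OF M(1), of v] profile_variance_pos[OF s(1)]
        by (intro AE_profile_law) simp
      then show ?thesis by (subst (asm) AE_distr_iff) auto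
    qed
    obtain v1 where v1: "v1 \<in> ?V" using infinite_imp_nonempty[OF inf] by blast
    obtain v2 where v2: "v2 \<in> ?V" "v2 \<noteq> v1"
      using infinite_imp_nonempty[OF infinite_remove[OF inf, of v1]] by blast
    \<comment> \<open>Two strips of different slopes bound the support of the other minimizer, as required by
      \<open>measure_eq_of_projections\<close>.\<close>
    define L where "L v = sqrt (quad v M / profile_variance s)" for v
    define B where "B = (L v1 + L v2) / \<bar>v1 - v2\<bar>"
    define K where "K = max (L v1 + \<bar>v1\<bar> * B + B) ((\<bar>a\<bar> + \<bar>b\<bar>) * \<bar>R2 s\<bar>)"
    have "AE x in \<nu>'. norm x \<le> K"
      using bound[OF v1] bound[OF v2(1)]
    proof eventually_elim
      case (elim x)
      have "(v1 - v2) * x $ 2 = slope v1 x - slope v2 x" by (simp add: slope_def algebra_simps)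
      then have "\<bar>v1 - v2\<bar> * \<bar>x $ 2\<bar> \<le> L v1 + L v2" unfolding abs_mult[symmetric] using elim by (simp add: L_def)
      then have x2: "\<bar>x $ 2\<bar> \<le> B" using v2(2) by (simp add: B_def field_simps)
      have "x $ 1 = slope v1 x - v1 * x $ 2" by (simp add: slope_def)
      then have "\<bar>x $ 1\<bar> \<le> \<bar>slope v1 x\<bar> + \<bar>v1\<bar> * \<bar>x $ 2\<bar>" unfolding abs_mult[symmetric] by linarith
      also have "\<dots> \<le> L v1 + \<bar>v1\<bar> * B" using elim x2 by (intro add_mono mult_left_mono) (auto simp: L_def)
      finally have "\<bar>x $ 1\<bar> + \<bar>x $ 2\<bar> \<le> L v1 + \<bar>v1\<bar> * B + B" using x2 by linarith
      also have "\<dots> \<le> K" unfolding K_def by (rule max.cobounded1)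
      finally have "\<bar>x $ 1\<bar> + \<bar>x $ 2\<bar> \<le> K" .
      then show ?case unfolding norm_2 using sqrt_sum_squares_le_sum_abs[of "x $ 1" "x $ 2"] by linarith
    qed
    moreover have "AE x in ?\<mu>. norm x \<le> K" using AE_ellipse_law[of a b s \<eta>] by eventually_elim (simp add: K_def)
    moreover have "infinite {v. distr \<nu>' borel (slope v) = distr ?\<mu> borel (slope v)}" unfolding proj by (rule inf)
    ultimately have "\<nu>' = ?\<mu>"
      by (intro measure_eq_of_projections[OF pr _ prob_space_ellipse_law[OF s] sets_ellipse_law])
    then show "\<exists>c. \<nu> = distr ?\<mu> borel (\<lambda>x. x + c)" using c'(3) by metis
  qed
qed

text \<open>The two cases are the two possible ranks of the optimal second moment matrix \<open>M\<close>.\<close>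

theorem ellipse_xor_segment:
  obtains (ellipse) M where "M \<in> psd" "reduced_energy M < \<infinity>" "\<And>M'. M' \<in> psd \<Longrightarrow> reduced_energy M \<le> reduced_energy M'" "moment_det M \<noteq> 0"
     "\<exists>!(a, b, \<eta>)\<in>{0<..} \<times> {0<..} \<times> {0..<pi / 2}. (a = b \<longrightarrow> \<eta> = 0) \<and> unique_minimizer E (ellipse_measure s a b \<eta>)"
     "\<not> (\<exists>!(b, \<eta>)\<in>{0<..} \<times> {0..<pi}. unique_minimizer E (segment_measure s b \<eta>))"
   | (segment) M where "M \<in> psd" "reduced_energy M < \<infinity>" "\<And>M'. M' \<in> psd \<Longrightarrow> reduced_energy M \<le> reduced_energy M'" "moment_det M = 0"
     "\<not> (\<exists>!(a, b, \<eta>)\<in>{0<..} \<times> {0<..} \<times> {0..<pi / 2}. (a = b \<longrightarrow> \<eta> = 0) \<and> unique_minimizer E (ellipse_measure s a b \<eta>))"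
     "\<exists>!(b, \<eta>)\<in>{0<..} \<times> {0..<pi}. unique_minimizer E (segment_measure s b \<eta>)"
proof -
  obtain M where M: "M \<in> psd" "reduced_energy M < \<infinity>" "\<And>M'. M' \<in> psd \<Longrightarrow> reduced_energy M \<le> reduced_energy M'"
    using exists_reduced_minimizer by blast
  have "M \<noteq> (0, 0, 0)" using M(2) reduced_energy_zero by auto
  from psd_shape_exists[OF M(1) this] obtain a b \<eta>
    where sh: "0 \<le> a" "0 < b" "0 \<le> \<eta>" "\<eta> < pi" "shape a b \<eta> = M" by blast
  note iff = unique_minimizer_iff_shape[OF M(1,3,2) sh(5)]
  have ell: "unique_minimizer E (ellipse_measure s a b \<eta>) \<longleftrightarrow> shape a b \<eta> = M" if "a > 0" "b > 0" for a b \<eta>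
    using iff ellipse_measure_eq_law[OF that] by simp
  have seg: "unique_minimizer E (segment_measure s b \<eta>) \<longleftrightarrow> shape 0 b \<eta> = M" if "b > 0" for b \<eta>
    using iff segment_measure_eq_law[OF s that] by simp
  show thesis
  proof (cases "a = 0")
    case False
    then have a: "a > 0" using sh(1) by simp
    have det: "moment_det M \<noteq> 0"
      using a sh(2) spread_pos unfolding sh(5)[symmetric] moment_det_shape by simp
    have "\<exists>a b \<eta>. a > 0 \<and> b > 0 \<and> 0 \<le> \<eta> \<and> \<eta> < pi / 2 \<and> (a = b \<longrightarrow> \<eta> = 0) \<and> shape a b \<eta> = M"
    proof (cases "a = b")
      case True
      have "shape a a 0 = shape a a \<eta>"
        by (simp add: shape_def power_mult_distrib distrib_left[symmetric] del: distrib_left_numeral)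
      then show ?thesis using a True sh(5) by (intro exI[of _ a] exI[of _ 0]) auto
    next
      case ab: False
      show ?thesis
      \<comment> \<open>A rotation angle of at least \<open>\<pi>/2\<close> is reduced by exchanging the axes.\<close>
      proof (cases "\<eta> < pi / 2")
        case True
        with a ab sh show ?thesis by blast
      next
        case False
        have "shape b a (\<eta> - pi / 2) = M" using sh(5) shape_swap[of a b \<eta>] by simp
        moreover have "0 \<le> \<eta> - pi / 2" "\<eta> - pi / 2 < pi / 2" using False sh(4) by auto
        ultimately show ?thesis using a ab sh(2) by blast
      qed
    qed
    then obtain a b \<eta> where n: "a > 0" "b > 0" "0 \<le> \<eta>" "\<eta> < pi / 2" "a = b \<longrightarrow> \<eta> = 0" "shape a b \<eta> = M" by blast
    have 1: "\<exists>!(a, b, \<eta>)\<in>{0<..} \<times> {0<..} \<times> {0..<pi / 2}. (a = b \<longrightarrow> \<eta> = 0) \<and> unique_minimizer E (ellipse_measure s a b \<eta>)"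
    proof (rule ex1I[of _ "(a, b, \<eta>)"], goal_cases)
      case 1
      then show ?case using n ell[OF n(1,2)] by simp
    next
      case (2 t)
      obtain a' b' \<eta>' where t: "t = (a', b', \<eta>')" by (cases t)
      from 2 have n': "a' > 0" "b' > 0" "0 \<le> \<eta>'" "\<eta>' < pi / 2" "a' = b' \<longrightarrow> \<eta>' = 0"
        and "unique_minimizer E (ellipse_measure s a' b' \<eta>')" unfolding t by simp_all
      then have "shape a' b' \<eta>' = M" using ell by blast
      then have "shape a' b' \<eta>' = shape a b \<eta>" using n(6) by simp
      from shape_inj[OF this n'(1,2) n(1,2) n'(3,4) n(3,4) n'(5) n(5)] show ?case by (simp add: t)
    qed
    have no: "\<not> unique_minimizer E (segment_measure s b \<eta>)" if "b > 0" for b \<eta>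
      unfolding seg[OF that] using det moment_det_shape[of 0 b \<eta>] by auto
    then have "\<not> (\<exists>!(b, \<eta>)\<in>{0<..} \<times> {0..<pi}. unique_minimizer E (segment_measure s b \<eta>))"
      by (intro notI, elim ex1E) (auto dest: no)
    with 1 det M show thesis by (rule_tac ellipse)
  next
    case True
    have det: "moment_det M = 0" unfolding sh(5)[symmetric] moment_det_shape True by simp
    have 2: "\<exists>!(b, \<eta>)\<in>{0<..} \<times> {0..<pi}. unique_minimizer E (segment_measure s b \<eta>)"
    proof (rule ex1I[of _ "(b, \<eta>)"], goal_cases)
      case 1
      then show ?case using sh True seg[OF sh(2)] by simp
    next
      case (2 t)
      obtain b' \<eta>' where t: "t = (b', \<eta>')" by (cases t)
      from 2 have n': "b' > 0" "0 \<le> \<eta>'" "\<eta>' < pi" and "unique_minimizer E (segment_measure s b' \<eta>')"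
        unfolding t by simp_all
      then have "shape 0 b' \<eta>' = M" using seg by blast
      then have "shape 0 b' \<eta>' = shape 0 b \<eta>" using sh(5) True by simp
      from shape_segment_inj[OF this n'(1) sh(2) n'(2,3) sh(3,4)] show ?case by (simp add: t)
    qed
    have no: "\<not> unique_minimizer E (ellipse_measure s a b \<eta>)" if "a > 0" "b > 0" for a b \<eta>
      unfolding ell[OF that] using det moment_det_shape[of a b \<eta>] spread_pos that by auto
    then have "\<not> (\<exists>!(a, b, \<eta>)\<in>{0<..} \<times> {0<..} \<times> {0..<pi / 2}. (a = b \<longrightarrow> \<eta> = 0) \<and> unique_minimizer E (ellipse_measure s a b \<eta>))"
      by (intro notI, elim ex1E) (auto dest: no)
    with 2 det M show thesis by (rule_tac segment)
  qed
qed

end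

text \<open>The form \<open>slope v\<close> takes the value \<open>1\<close> at \<open>(1, 0)\<close> for every \<open>v\<close>, so the total mass of the
  weight is the value of the kernel at this point.\<close>

lemma slope_mixture_potential:
  assumes s: "0 < s" "s < 1" and cont: "continuous_on UNIV \<Omega>" and pos: "\<And>\<theta>. \<Omega> \<theta> > 0"
    and per: "\<And>\<theta>. \<Omega> (\<theta> + pi) = \<Omega> \<theta>"
    and ang: "angular_fourier s \<Omega> \<Omega>t" and nonneg: "\<And>\<phi>. \<Omega>t \<phi> \<ge> 0"
  shows "slope_mixture s (potential s \<Omega>) (slope_weight s \<Omega>t)"
proof
  have cont': "continuous_on UNIV \<Omega>t" using ang by (auto simp: angular_fourier_def)
  note eq = kernel_eq_slope_mixture[OF s cont pos per ang nonneg]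
  have e0: "vector [1, 0] \<noteq> (0 :: real^2)" by (simp add: vec_eq_iff forall_2)
  have mass: "(\<integral>\<^sup>+v. ennreal (slope_weight s \<Omega>t v) \<partial>lborel) = ennreal (homogeneous_kernel (- s) \<Omega> (vector [1, 0]))"
    unfolding eq[OF e0] by (simp add: slope_def riesz_nonzero)
  have "homogeneous_kernel (- s) \<Omega> (vector [1, 0]) > 0"
    using pos e0 by (simp add: homogeneous_kernel_def)
  then show m: "(\<integral>\<^sup>+v. ennreal (slope_weight s \<Omega>t v) \<partial>lborel) < \<infinity>" "(\<integral>\<^sup>+v. ennreal (slope_weight s \<Omega>t v) \<partial>lborel) \<noteq> 0"
    unfolding mass by auto
  show meas: "slope_weight s \<Omega>t \<in> borel_measurable borel" using cont' by measurable
  show "0 \<le> slope_weight s \<Omega>t v" for v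
    using fourier_constant_pos[OF s] nonneg by (auto simp: slope_weight_def homogeneous_kernel_def)
  show "potential s \<Omega> x = (\<integral>\<^sup>+v. ennreal (slope_weight s \<Omega>t v) * riesz s (slope v x) \<partial>lborel) + ennreal ((norm x)\<^sup>2)" for x
  proof (cases "x = 0")
    case True
    have "(\<integral>\<^sup>+v. ennreal (slope_weight s \<Omega>t v) * riesz s (slope v x) \<partial>lborel) = \<infinity>"
      using m(2) meas by (simp add: True slope_def nn_integral_multc)
    then show ?thesis by (simp add: True potential_def)
  next
    case False
    then show ?thesis using pos[of "polar_angle x"]
      by (simp add: potential_def eq[OF False, symmetric] homogeneous_kernel_def)
  qed
qed (use s in auto)

lemma slope_weight_lower_bound:
  assumes "0 < s" "s < 1" and c: "\<And>\<phi>. c \<le> \<Omega>t \<phi>"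
  shows "fourier_constant s * c * sqrt (1 + v\<^sup>2) powr (- 2 + s) \<le> slope_weight s \<Omega>t v"
proof -
  have "norm (vector [1, v] :: real^2) = sqrt (1 + v\<^sup>2)" "norm (vector [-1, - v] :: real^2) = sqrt (1 + v\<^sup>2)"
    by (simp_all add: norm_2)
  then have "sqrt (1 + v\<^sup>2) powr (- 2 + s) * c \<le> (homogeneous_kernel (- 2 + s) \<Omega>t (vector [1, v]) + homogeneous_kernel (- 2 + s) \<Omega>t (vector [-1, - v])) / 2"
    unfolding homogeneous_kernel_def
    using mult_left_mono[OF c[of "polar_angle (vector [1, v])"], of "sqrt (1 + v\<^sup>2) powr (- 2 + s)"]
      mult_left_mono[OF c[of "polar_angle (vector [-1, - v])"], of "sqrt (1 + v\<^sup>2) powr (- 2 + s)"]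
    by simp
  from mult_left_mono[OF this, of "fourier_constant s"] show ?thesis
    using fourier_constant_pos[OF assms(1,2)] unfolding slope_weight_def by (simp add: mult_ac)
qed

theorem theorem3p1:
  fixes s :: real and \<Omega> \<Omega>t :: "real \<Rightarrow> real"
  assumes "0 < s" and "s < 1"
    and "smooth \<Omega>"
    and "\<And>\<theta>. \<Omega> \<theta> > 0"
    and "\<And>\<theta>. \<Omega> (\<theta> + pi) = \<Omega> \<theta>"
    and "angular_fourier s \<Omega> \<Omega>t"
    and "\<And>\<phi>. \<Omega>t \<phi> \<ge> 0"
  defines "E \<equiv> energy (potential s \<Omega>)"
  defines "item1 \<equiv> (\<exists>!(a, b, \<eta>)\<in>{0<..} \<times> {0<..} \<times> {0..<pi / 2}.
              (a = b \<longrightarrow> \<eta> = 0) \<and> unique_minimizer E (ellipse_measure s a b \<eta>))"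
  defines "item2 \<equiv> (\<exists>!(b, \<eta>)\<in>{0<..} \<times> {0..<pi}. unique_minimizer E (segment_measure s b \<eta>))"
  shows "(item1 \<and> \<not> item2 \<or> \<not> item1 \<and> item2) \<and>
         ((\<exists>c>0. \<forall>\<phi>. \<Omega>t \<phi> \<ge> c) \<longrightarrow> item1)"
proof -
  have "((deriv ^^ 0) \<Omega>) differentiable (at x)" for x
    using assms(3) unfolding smooth_def by blast
  then have cont: "continuous_on UNIV \<Omega>"
    by (auto intro: continuous_at_imp_continuous_on differentiable_imp_continuous_within)
  interpret slope_mixture s "potential s \<Omega>" "slope_weight s \<Omega>t"
    by (rule slope_mixture_potential[OF assms(1,2) cont assms(4-7)])
  show ?thesis
  proof (cases rule: ellipse_xor_segment)
    case (ellipse M)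
    then show ?thesis unfolding item1_def item2_def E_def by blast
  next
    case (segment M)
    have "\<not> (\<exists>c>0. \<forall>\<phi>. \<Omega>t \<phi> \<ge> c)"
    proof
      assume "\<exists>c>0. \<forall>\<phi>. \<Omega>t \<phi> \<ge> c"
      then obtain c where c: "c > 0" "\<And>\<phi>. c \<le> \<Omega>t \<phi>" by blast
      have "fourier_constant s * c > 0" using c(1) fourier_constant_pos[OF assms(1,2)] by simp
      from nondegenerate_of_lower_bound[OF this slope_weight_lower_bound[OF assms(1,2) c(2)] segment(1,3,2)]
      show False using segment(4) by simp
    qed
    with segment show ?thesis unfolding item1_def item2_def E_def by blast
  qed
qed

end
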